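(* Let $(X,\mathcal P)$ be as in the context and let $\mathcal B$ be an $\mathcal O_{X/\mathcal P}$-Lie algebroid which is locally free of finite rank over $\mathcal O_{X/\mathcal P}$. Then the group $\pi_0\mathrm{Pic}_{\mathcal B}(X)$ of isomorphism classes of invertible $\mathcal B$-modules on $X$ satisfies $$\pi_0\mathrm{Pic}_{\mathcal B}(X)\cong H^1(X;\mathcal O^\times_{X/\mathcal P}\xrightarrow{d_{\mathcal B}\log}\Omega^{1,cl}_{\mathcal B}),$$ where the right-hand side is hypercohomology of the two-term complex with $\mathcal O^\times_{X/\mathcal P}$ in degree $0$.
   Context: Setting. $X$ is a $C^\infty$ manifold, $\mathcal T_X$ its sheaf of complex vector fields, $\Omega^\bullet_X$ its complex-valued forms; $\mathcal P\subset\mathcal T_X$ is an integrable complex distribution, i.e. a sub-bundle whose annihilator $\mathcal P^\perp\subset\Omega^1_X$ locally has a frame of exact forms $df_i$ ($f_i$ complex-valued). It is assumed that $\Omega^\bullet_X/(\mathcal P^\perp\wedge\Omega^{\bullet-1}_X)$ with the differential induced by $d$ has zero cohomology sheaves in positive degrees. $\mathcal O_{X/\mathcal P}$ is the sheaf of complex functions killed by $\mathcal P$; $\mathcal T_{X/\mathcal P}$ is the sheaf of sections of $\mathcal T_X/\mathcal P$ invariant under the adjoint action of $\mathcal P$, a sheaf of Lie algebras acting on $\mathcal O_{X/\mathcal P}$ by derivations. Lie algebroids. An $\mathcal O_{X/\mathcal P}$-Lie algebroid is an $\mathcal O_{X/\mathcal P}$-module $\mathcal B$ with a $\mathbb C$-Lie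 bracket and an $\mathcal O_{X/\mathcal P}$-linear anchor $\sigma\colon\mathcal B\to\mathcal T_{X/\mathcal P}$ with $[b_1,fb_2]=\sigma(b_1)(f)b_2+f[b_1,b_2]$. $(\Omega^\bullet_{\mathcal B},d_{\mathcal B})$ is its de Rham (Chevalley–Eilenberg) complex: $\Omega^i_{\mathcal B}=\bigwedge^i\mathcal B^\vee$, $d_{\mathcal B}f(b)=\sigma(b)(f)$; $\Omega^{1,cl}_{\mathcal B}=\ker(d_{\mathcal B}|_{\Omega^1_{\mathcal B}})$; $d_{\mathcal B}\log\colon\mathcal O^\times_{X/\mathcal P}\to\Omega^{1,cl}_{\mathcal B}$, $f\mapsto d_{\mathcal B}f/f$. A $\mathcal B$-module structure on an $\mathcal O_{X/\mathcal P}$-module $\mathcal M$ is an $\mathcal O_{X/\mathcal P}$-linear morphism of Lie algebras $\mathcal B\to\underline{\mathrm{End}}_{\mathbb C}(\mathcal M)$, $b\mapsto(m\mapsto b.m)$, with $b.(fm)=\sigma(b)(f)m+f\,b.m$. An invertible $\mathcal B$-module is a locally free $\mathcal O_{X/\mathcal P}$-module of rank one with a $\mathcal B$-module structure. Invertible $\mathcal B$-modules on $X$ form the Picard category $\mathrm{Pic}_{\mathcal B}(X)$ under $\otimes_{\mathcal O_{X/\mathcal P}}$ with $b.(m\otimes n)=b.m\otimes n+m\otimes b.n$; the group structure on $\pi_0$ is induced by $\otimes$. *)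

theory Defs
  imports "HOL-Analysis.Analysis" "HOL-Algebra.Module" "HOL-Algebra.Product_Groups"
begin

section \<open>Smooth manifolds, complex vector fields and complex forms\<close>

text \<open>
  The model space of dimension \<open>n\<close> is the library topology \<^term>\<open>Euclidean_space n\<close>, whose points are the
  functions \<^typ>\<open>nat \<Rightarrow> real\<close> vanishing from \<open>n\<close> on. A function is of class \<open>C\<^sup>k\<close> on an open set
  iff its iterated partial derivatives up to order \<open>k\<close> exist and are continuous.
\<close>

primrec Ck_on :: "nat \<Rightarrow> nat \<Rightarrow> (nat \<Rightarrow> real) set \<Rightarrow> ((nat \<Rightarrow> real) \<Rightarrow> 'a::real_normed_vector) \<Rightarrow> bool" where
  "Ck_on n 0 S f \<longleftrightarrow> continuous_map (subtopology (Euclidean_space n) S) euclidean f"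
| "Ck_on n (Suc k) S f \<longleftrightarrow>
     continuous_map (subtopology (Euclidean_space n) S) euclidean f \<and>
     (\<forall>i<n. (\<forall>x\<in>S. (\<lambda>t. f (x(i := t))) differentiable (at (x i))) \<and>
            Ck_on n k S (\<lambda>x. vector_derivative (\<lambda>t. f (x(i := t))) (at (x i))))"

definition Cinf_on :: "nat \<Rightarrow> (nat \<Rightarrow> real) set \<Rightarrow> ((nat \<Rightarrow> real) \<Rightarrow> 'a::real_normed_vector) \<Rightarrow> bool" where
  "Cinf_on n S f \<longleftrightarrow> (\<forall>k. Ck_on n k S f)"

record 'x mfd =
  mtop :: "'x topology"
  mdim :: nat
  charts :: "('x set \<times> ('x \<Rightarrow> nat \<Rightarrow> real)) set"

definition smooth_manifold :: "'x mfd \<Rightarrow> bool" where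
  "smooth_manifold M \<longleftrightarrow>
     Hausdorff_space (mtop M) \<and> second_countable (mtop M) \<and>
     (\<Union>(U, \<phi>)\<in>charts M. U) = topspace (mtop M) \<and>
     (\<forall>(U, \<phi>)\<in>charts M. openin (mtop M) U \<and> openin (Euclidean_space (mdim M)) (\<phi> ` U) \<and>
        homeomorphic_map (subtopology (mtop M) U) (subtopology (Euclidean_space (mdim M)) (\<phi> ` U)) \<phi>) \<and>
     (\<forall>(U, \<phi>)\<in>charts M. \<forall>(V, \<psi>)\<in>charts M. \<forall>i<mdim M.
        Cinf_on (mdim M) (\<phi> ` (U \<inter> V)) (\<lambda>y. \<psi> (inv_into U \<phi> y) i))"

type_synonym 'x cfun = "'x \<Rightarrow> complex"
type_synonym 'x tvec = "'x cfun \<Rightarrow> complex"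
type_synonym 'x vfield = "'x \<Rightarrow> 'x tvec"
type_synonym 'x cform = "'x \<Rightarrow> 'x tvec list \<Rightarrow> complex"

definition smooth :: "'x mfd \<Rightarrow> 'x set \<Rightarrow> 'x cfun \<Rightarrow> bool" where
  "smooth M W f \<longleftrightarrow>
     (\<forall>(U, \<phi>)\<in>charts M. Cinf_on (mdim M) (\<phi> ` (U \<inter> W)) (\<lambda>y. f (inv_into U \<phi> y)))"

definition smooth_near :: "'x mfd \<Rightarrow> 'x \<Rightarrow> 'x cfun \<Rightarrow> bool" where
  "smooth_near M p f \<longleftrightarrow> (\<exists>U. openin (mtop M) U \<and> p \<in> U \<and> smooth M U f)"

text \<open>
  Sections over an open set \<open>U\<close> are represented by total functions normalised to a fixed value
  outside \<open>U\<close> (zero for functions, vector fields and forms), so that equality of sections is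
  equality of functions.
\<close>

definition cut :: "'x set \<Rightarrow> 'x cfun \<Rightarrow> 'x cfun" where
  "cut U f = (\<lambda>x. if x \<in> U then f x else 0)"

definition smooth_funs :: "'x mfd \<Rightarrow> 'x set \<Rightarrow> 'x cfun set" where
  "smooth_funs M U = {f. smooth M U f \<and> (\<forall>x. x \<notin> U \<longrightarrow> f x = 0)}"

text \<open>
  The complexified tangent space at \<open>p\<close>: complex-linear derivations at \<open>p\<close> of the algebra of germs
  of smooth complex functions, as functionals that are zero on functions not smooth near \<open>p\<close>.
\<close>

definition tangent :: "'x mfd \<Rightarrow> 'x \<Rightarrow> 'x tvec set" where
  "tangent M p = {D.
     (\<forall>f. \<not> smooth_near M p f \<longrightarrow> D f = 0) \<and>
     (\<forall>f g. smooth_near M p f \<and> smooth_near M p g \<longrightarrow>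
        ((\<exists>U. openin (mtop M) U \<and> p \<in> U \<and> (\<forall>x\<in>U. f x = g x)) \<longrightarrow> D f = D g) \<and>
        D (\<lambda>x. f x + g x) = D f + D g \<and>
        D (\<lambda>x. f x * g x) = f p * D g + g p * D f) \<and>
     (\<forall>f c. smooth_near M p f \<longrightarrow> D (\<lambda>x. c * f x) = c * D f)}"

definition vfields :: "'x mfd \<Rightarrow> 'x set \<Rightarrow> 'x vfield set" where
  "vfields M U = {v.
     (\<forall>p\<in>U. v p \<in> tangent M p) \<and> (\<forall>p. p \<notin> U \<longrightarrow> v p = (\<lambda>_. 0)) \<and>
     (\<forall>W f. openin (mtop M) W \<and> W \<subseteq> U \<and> smooth M W f \<longrightarrow> smooth M W (\<lambda>p. v p f))}"

definition vbracket :: "'x mfd \<Rightarrow> 'x vfield \<Rightarrow> 'x vfield \<Rightarrow> 'x vfield" where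
  "vbracket M v w = (\<lambda>p f. if smooth_near M p f then v p (\<lambda>q. w q f) - w p (\<lambda>q. v q f) else 0)"

definition forms :: "'x mfd \<Rightarrow> nat \<Rightarrow> 'x set \<Rightarrow> 'x cform set" where
  "forms M k U = {\<omega>.
     (\<forall>p vs. \<not> (p \<in> U \<and> length vs = k \<and> set vs \<subseteq> tangent M p) \<longrightarrow> \<omega> p vs = 0) \<and>
     (\<forall>p\<in>U. \<forall>xs ys D E c. length xs + length ys + 1 = k \<and>
        set xs \<union> set ys \<union> {D, E} \<subseteq> tangent M p \<longrightarrow>
        \<omega> p (xs @ (\<lambda>f. c * D f + E f) # ys) = c * \<omega> p (xs @ D # ys) + \<omega> p (xs @ E # ys)) \<and>
     (\<forall>p\<in>U. \<forall>vs. length vs = k \<and> set vs \<subseteq> tangent M p \<and> \<not> distinct vs \<longrightarrow> \<omega> p vs = 0) \<and>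
     (\<forall>W vs. openin (mtop M) W \<and> W \<subseteq> U \<and> length vs = k \<and> set vs \<subseteq> vfields M W \<longrightarrow>
        smooth M W (\<lambda>p. \<omega> p (map (\<lambda>v. v p) vs)))}"

definition omit :: "nat \<Rightarrow> 'a list \<Rightarrow> 'a list" where
  "omit i xs = take i xs @ drop (Suc i) xs"

definition is_ext_d :: "'x mfd \<Rightarrow> 'x set \<Rightarrow> nat \<Rightarrow> 'x cform \<Rightarrow> 'x cform \<Rightarrow> bool" where
  "is_ext_d M U k \<omega> \<eta> \<longleftrightarrow> \<eta> \<in> forms M (Suc k) U \<and>
     (\<forall>W vs. openin (mtop M) W \<and> W \<subseteq> U \<and> length vs = Suc k \<and> set vs \<subseteq> vfields M W \<longrightarrow>
       (\<forall>p\<in>W. \<eta> p (map (\<lambda>v. v p) vs) =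
          (\<Sum>i<Suc k. (-1) ^ i * (vs ! i) p (\<lambda>q. \<omega> q (map (\<lambda>v. v q) (omit i vs)))) +
          (\<Sum>j<Suc k. \<Sum>i<j. (-1) ^ (i + j) *
             \<omega> p (vbracket M (vs ! i) (vs ! j) p # map (\<lambda>v. v p) (omit i (omit j vs))))))"

definition ext_d :: "'x mfd \<Rightarrow> 'x set \<Rightarrow> nat \<Rightarrow> 'x cform \<Rightarrow> 'x cform" where
  "ext_d M U k \<omega> = (THE \<eta>. is_ext_d M U k \<omega> \<eta>)"

text \<open>The exact one-form \<open>df\<close> on \<open>U\<close>.\<close>

definition differential :: "'x mfd \<Rightarrow> 'x set \<Rightarrow> 'x cfun \<Rightarrow> 'x cform" where
  "differential M U f = (\<lambda>p vs. if p \<in> U \<and> length vs = 1 \<and> set vs \<subseteq> tangent M p then hd vs f else 0)"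

text \<open>Exterior product of a one-form with a form of arbitrary degree.\<close>

definition wedge1 :: "'x cform \<Rightarrow> 'x cform \<Rightarrow> 'x cform" where
  "wedge1 \<alpha> \<beta> = (\<lambda>p vs. \<Sum>i<length vs. (-1) ^ i * \<alpha> p [vs ! i] * \<beta> p (omit i vs))"

definition form_cut :: "'x set \<Rightarrow> 'x cform \<Rightarrow> 'x cform" where
  "form_cut U \<omega> = (\<lambda>p vs. if p \<in> U then \<omega> p vs else 0)"


section \<open>Integrable complex distributions\<close>

text \<open>A distribution is given by its fibres \<open>P p\<close> in the complexified tangent spaces.\<close>

type_synonym 'x distrib = "'x \<Rightarrow> 'x tvec set"

definition subbundle :: "'x mfd \<Rightarrow> 'x distrib \<Rightarrow> bool" where
  "subbundle M P \<longleftrightarrow> (\<forall>p\<in>topspace (mtop M). \<exists>U r v. openin (mtop M) U \<and> p \<in> U \<and>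
     (\<forall>i<r. v i \<in> vfields M U) \<and>
     (\<forall>q\<in>U. P q = {\<lambda>f. \<Sum>i<r. c i * v i q f | c :: nat \<Rightarrow> complex. True} \<and>
        (\<forall>c :: nat \<Rightarrow> complex. (\<forall>f. (\<Sum>i<r. c i * v i q f) = 0) \<longrightarrow> (\<forall>i<r. c i = 0))))"

definition P_fields :: "'x mfd \<Rightarrow> 'x distrib \<Rightarrow> 'x set \<Rightarrow> 'x vfield set" where
  "P_fields M P U = {v \<in> vfields M U. \<forall>p\<in>U. v p \<in> P p}"

definition annihilator :: "'x mfd \<Rightarrow> 'x distrib \<Rightarrow> 'x set \<Rightarrow> 'x cform set" where
  "annihilator M P U = {\<alpha> \<in> forms M 1 U. \<forall>p\<in>U. \<forall>v\<in>P p. \<alpha> p [v] = 0}"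

definition integrable_distribution :: "'x mfd \<Rightarrow> 'x distrib \<Rightarrow> bool" where
  "integrable_distribution M P \<longleftrightarrow> subbundle M P \<and>
     (\<forall>p\<in>topspace (mtop M). \<exists>U r f. openin (mtop M) U \<and> p \<in> U \<and>
        (\<forall>i<r. smooth M U (f i) \<and> differential M U (f i) \<in> annihilator M P U) \<and>
        (\<forall>V \<alpha>. openin (mtop M) V \<and> V \<subseteq> U \<and> \<alpha> \<in> annihilator M P V \<longrightarrow>
           (\<exists>!g. g \<in> {..<r::nat} \<rightarrow>\<^sub>E smooth_funs M V \<and>
              \<alpha> = (\<lambda>q vs. \<Sum>i<r. g i q * differential M V (f i) q vs))))"

text \<open>
  Sections over \<open>U\<close> of the degree \<open>k + 1\<close> part of the ideal generated by the annihilator, i.e. of the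
  image sheaf of the exterior product of the annihilator with the sheaf of \<open>k\<close>-forms.
\<close>

definition ann_ideal :: "'x mfd \<Rightarrow> 'x distrib \<Rightarrow> nat \<Rightarrow> 'x set \<Rightarrow> 'x cform set" where
  "ann_ideal M P k U = {\<omega> \<in> forms M (Suc k) U. \<forall>p\<in>U. \<exists>V r \<alpha> \<beta>.
     openin (mtop M) V \<and> p \<in> V \<and> V \<subseteq> U \<and>
     (\<forall>i<r::nat. \<alpha> i \<in> annihilator M P V \<and> \<beta> i \<in> forms M k V) \<and>
     form_cut V \<omega> = (\<lambda>q vs. \<Sum>i<r. wedge1 (\<alpha> i) (\<beta> i) q vs)}"

text \<open>
  Vanishing of the cohomology sheaves in positive degrees of the quotient of the de Rham complex by
  the ideal of the annihilator, in degree \<open>k + 1\<close>: every local form that is closed modulo the ideal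
  is locally exact modulo the ideal.
\<close>

definition acyclic_quotient :: "'x mfd \<Rightarrow> 'x distrib \<Rightarrow> bool" where
  "acyclic_quotient M P \<longleftrightarrow>
     (\<forall>k U \<omega>. openin (mtop M) U \<and> \<omega> \<in> forms M (Suc k) U \<and>
        ext_d M U (Suc k) \<omega> \<in> ann_ideal M P (Suc k) U \<longrightarrow>
        (\<forall>p\<in>U. \<exists>V \<eta>. openin (mtop M) V \<and> p \<in> V \<and> V \<subseteq> U \<and> \<eta> \<in> forms M k V \<and>
           (\<lambda>q vs. form_cut V \<omega> q vs - ext_d M V k \<eta> q vs) \<in> ann_ideal M P k V))"


section \<open>The sheaves of functions and of vector fields transverse to the distribution\<close>

definition OXP :: "'x mfd \<Rightarrow> 'x distrib \<Rightarrow> 'x set \<Rightarrow> 'x cfun ring" where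
  "OXP M P U =
     \<lparr>carrier = {f \<in> smooth_funs M U. \<forall>V v. openin (mtop M) V \<and> V \<subseteq> U \<and> v \<in> P_fields M P V \<longrightarrow>
                   (\<forall>p\<in>V. v p f = 0)},
      monoid.mult = (\<lambda>f g x. f x * g x), monoid.one = cut U (\<lambda>_. 1),
      ring.zero = (\<lambda>_. 0), ring.add = (\<lambda>f g x. f x + g x)\<rparr>"

text \<open>
  Sections over \<open>U\<close> of the quotient of the tangent bundle by \<open>P\<close> are maps \<open>\<tau>\<close> whose value at \<open>p\<close> is
  a coset of \<open>P p\<close> (and empty outside \<open>U\<close>), locally the classes of smooth vector fields.
\<close>

definition qclass :: "'x distrib \<Rightarrow> 'x \<Rightarrow> 'x tvec \<Rightarrow> 'x tvec set" where
  "qclass P p v = {\<lambda>f. v f + w f | w. w \<in> P p}"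

definition lifts :: "'x mfd \<Rightarrow> 'x distrib \<Rightarrow> 'x set \<Rightarrow> ('x \<Rightarrow> 'x tvec set) \<Rightarrow> 'x vfield set" where
  "lifts M P W \<tau> = {v \<in> vfields M W. \<forall>q\<in>W. \<tau> q = qclass P q (v q)}"

definition TXP :: "'x mfd \<Rightarrow> 'x distrib \<Rightarrow> 'x set \<Rightarrow> ('x \<Rightarrow> 'x tvec set) set" where
  "TXP M P U = {\<tau>. (\<forall>p. p \<notin> U \<longrightarrow> \<tau> p = {}) \<and>
     (\<forall>p\<in>U. \<exists>W. openin (mtop M) W \<and> p \<in> W \<and> W \<subseteq> U \<and> lifts M P W \<tau> \<noteq> {}) \<and>
     (\<forall>W v w. openin (mtop M) W \<and> W \<subseteq> U \<and> v \<in> lifts M P W \<tau> \<and> w \<in> P_fields M P W \<longrightarrow>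
        (\<forall>q\<in>W. vbracket M w v q \<in> P q))}"

definition txp_add :: "('x \<Rightarrow> 'x tvec set) \<Rightarrow> ('x \<Rightarrow> 'x tvec set) \<Rightarrow> 'x \<Rightarrow> 'x tvec set" where
  "txp_add \<tau> \<tau>' = (\<lambda>p. {\<lambda>f. v f + w f | v w. v \<in> \<tau> p \<and> w \<in> \<tau>' p})"

definition txp_smult :: "'x distrib \<Rightarrow> 'x cfun \<Rightarrow> ('x \<Rightarrow> 'x tvec set) \<Rightarrow> 'x \<Rightarrow> 'x tvec set" where
  "txp_smult P g \<tau> = (\<lambda>p. \<Union>v\<in>\<tau> p. qclass P p (\<lambda>f. g p * v f))"

definition txp_cut :: "'x set \<Rightarrow> ('x \<Rightarrow> 'x tvec set) \<Rightarrow> 'x \<Rightarrow> 'x tvec set" where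
  "txp_cut V \<tau> = (\<lambda>p. if p \<in> V then \<tau> p else {})"

text \<open>Derivative of a function killed by \<open>P\<close>: the value does not depend on the representative.\<close>

definition txp_apply :: "'x set \<Rightarrow> ('x \<Rightarrow> 'x tvec set) \<Rightarrow> 'x cfun \<Rightarrow> 'x cfun" where
  "txp_apply U \<tau> f = (\<lambda>p. if p \<in> U then (THE c. \<exists>v\<in>\<tau> p. c = v f) else 0)"


section \<open>Sheaves of modules\<close>

definition is_sheaf :: "'x topology \<Rightarrow> ('x set \<Rightarrow> 's set) \<Rightarrow> ('x set \<Rightarrow> 'x set \<Rightarrow> 's \<Rightarrow> 's) \<Rightarrow> bool" where
  "is_sheaf T S r \<longleftrightarrow>
     (\<forall>U V. openin T U \<and> openin T V \<and> V \<subseteq> U \<longrightarrow> r U V \<in> S U \<rightarrow> S V) \<and>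
     (\<forall>U s. openin T U \<and> s \<in> S U \<longrightarrow> r U U s = s) \<and>
     (\<forall>U V W s. openin T U \<and> openin T V \<and> openin T W \<and> W \<subseteq> V \<and> V \<subseteq> U \<and> s \<in> S U \<longrightarrow>
        r V W (r U V s) = r U W s) \<and>
     (\<forall>\<U> s. (\<forall>V\<in>\<U>. openin T V \<and> s V \<in> S V) \<and>
        (\<forall>V\<in>\<U>. \<forall>W\<in>\<U>. r V (V \<inter> W) (s V) = r W (V \<inter> W) (s W)) \<longrightarrow>
        (\<exists>!t. t \<in> S (\<Union>\<U>) \<and> (\<forall>V\<in>\<U>. r (\<Union>\<U>) V t = s V)))"

text \<open>\<open>res L U V\<close> is the restriction from \<open>U\<close> to \<open>V\<close>.\<close>

record ('x, 'm) osheaf =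
  sec :: "'x set \<Rightarrow> ('x cfun, 'm) module"
  res :: "'x set \<Rightarrow> 'x set \<Rightarrow> 'm \<Rightarrow> 'm"

definition omodule :: "'x mfd \<Rightarrow> 'x distrib \<Rightarrow> ('x, 'm, 'z) osheaf_scheme \<Rightarrow> bool" where
  "omodule M P L \<longleftrightarrow>
     is_sheaf (mtop M) (\<lambda>U. carrier (sec L U)) (res L) \<and>
     (\<forall>U. openin (mtop M) U \<longrightarrow> module (OXP M P U) (sec L U)) \<and>
     (\<forall>U V. openin (mtop M) U \<and> openin (mtop M) V \<and> V \<subseteq> U \<longrightarrow>
        (\<forall>m\<in>carrier (sec L U). \<forall>m'\<in>carrier (sec L U).
           res L U V (m \<oplus>\<^bsub>sec L U\<^esub> m') = res L U V m \<oplus>\<^bsub>sec L V\<^esub> res L U V m') \<and>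
        (\<forall>f\<in>carrier (OXP M P U). \<forall>m\<in>carrier (sec L U).
           res L U V (f \<odot>\<^bsub>sec L U\<^esub> m) = cut V f \<odot>\<^bsub>sec L V\<^esub> res L U V m))"

text \<open>Sections \<open>e 0, \<dots>, e (r - 1)\<close> over \<open>U\<close> trivialising the restriction of \<open>L\<close> to \<open>U\<close>.\<close>

definition is_frame :: "'x mfd \<Rightarrow> 'x distrib \<Rightarrow> ('x, 'm, 'z) osheaf_scheme \<Rightarrow> 'x set \<Rightarrow> nat \<Rightarrow> (nat \<Rightarrow> 'm) \<Rightarrow> bool" where
  "is_frame M P L U r e \<longleftrightarrow>
     (\<forall>i<r. e i \<in> carrier (sec L U)) \<and>
     (\<forall>V. openin (mtop M) V \<and> V \<subseteq> U \<longrightarrow> (\<forall>m\<in>carrier (sec L V).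
        \<exists>!c. c \<in> {..<r} \<rightarrow>\<^sub>E carrier (OXP M P V) \<and>
          m = finsum (sec L V) (\<lambda>i. c i \<odot>\<^bsub>sec L V\<^esub> res L U V (e i)) {..<r}))"

definition locally_free_finite_rank :: "'x mfd \<Rightarrow> 'x distrib \<Rightarrow> ('x, 'm, 'z) osheaf_scheme \<Rightarrow> bool" where
  "locally_free_finite_rank M P L \<longleftrightarrow>
     (\<forall>p\<in>topspace (mtop M). \<exists>U r e. openin (mtop M) U \<and> p \<in> U \<and> is_frame M P L U r e)"

definition locally_free_rank_one :: "'x mfd \<Rightarrow> 'x distrib \<Rightarrow> ('x, 'm, 'z) osheaf_scheme \<Rightarrow> bool" where
  "locally_free_rank_one M P L \<longleftrightarrow>
     (\<forall>p\<in>topspace (mtop M). \<exists>U e. openin (mtop M) U \<and> p \<in> U \<and> is_frame M P L U 1 e)"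

definition omodule_hom ::
    "'x mfd \<Rightarrow> 'x distrib \<Rightarrow> ('x, 'm, 'z) osheaf_scheme \<Rightarrow> ('x, 'n, 'w) osheaf_scheme \<Rightarrow> ('x set \<Rightarrow> 'm \<Rightarrow> 'n) \<Rightarrow> bool" where
  "omodule_hom M P L N \<phi> \<longleftrightarrow>
     (\<forall>U. openin (mtop M) U \<longrightarrow>
        \<phi> U \<in> carrier (sec L U) \<rightarrow> carrier (sec N U) \<and>
        (\<forall>m\<in>carrier (sec L U). \<forall>m'\<in>carrier (sec L U).
           \<phi> U (m \<oplus>\<^bsub>sec L U\<^esub> m') = \<phi> U m \<oplus>\<^bsub>sec N U\<^esub> \<phi> U m') \<and>
        (\<forall>f\<in>carrier (OXP M P U). \<forall>m\<in>carrier (sec L U).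
           \<phi> U (f \<odot>\<^bsub>sec L U\<^esub> m) = f \<odot>\<^bsub>sec N U\<^esub> \<phi> U m) \<and>
        (\<forall>V. openin (mtop M) V \<and> V \<subseteq> U \<longrightarrow>
           (\<forall>m\<in>carrier (sec L U). \<phi> V (res L U V m) = res N U V (\<phi> U m))))"

definition omodule_bilinear ::
    "'x mfd \<Rightarrow> 'x distrib \<Rightarrow> ('x, 'k, 'y) osheaf_scheme \<Rightarrow> ('x, 'm, 'z) osheaf_scheme \<Rightarrow> ('x, 'n, 'w) osheaf_scheme
     \<Rightarrow> ('x set \<Rightarrow> 'k \<Rightarrow> 'm \<Rightarrow> 'n) \<Rightarrow> bool" where
  "omodule_bilinear M P K L N \<beta> \<longleftrightarrow>
     (\<forall>U. openin (mtop M) U \<longrightarrow>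
        (\<forall>k\<in>carrier (sec K U). \<forall>l\<in>carrier (sec L U).
           \<beta> U k l \<in> carrier (sec N U) \<and>
           (\<forall>k'\<in>carrier (sec K U). \<beta> U (k \<oplus>\<^bsub>sec K U\<^esub> k') l = \<beta> U k l \<oplus>\<^bsub>sec N U\<^esub> \<beta> U k' l) \<and>
           (\<forall>l'\<in>carrier (sec L U). \<beta> U k (l \<oplus>\<^bsub>sec L U\<^esub> l') = \<beta> U k l \<oplus>\<^bsub>sec N U\<^esub> \<beta> U k l') \<and>
           (\<forall>f\<in>carrier (OXP M P U). \<beta> U (f \<odot>\<^bsub>sec K U\<^esub> k) l = f \<odot>\<^bsub>sec N U\<^esub> \<beta> U k l \<and>
                                      \<beta> U k (f \<odot>\<^bsub>sec L U\<^esub> l) = f \<odot>\<^bsub>sec N U\<^esub> \<beta> U k l) \<and>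
           (\<forall>V. openin (mtop M) V \<and> V \<subseteq> U \<longrightarrow>
              \<beta> V (res K U V k) (res L U V l) = res N U V (\<beta> U k l))))"

text \<open>
  \<open>\<tau>\<close> exhibits \<open>N\<close> as the tensor product of \<open>K\<close> and \<open>L\<close> over the structure sheaf: it is the
  universal bilinear map into sheaves of modules (with sections in the type of those of \<open>N\<close>).
\<close>

definition is_tensor_product ::
    "'x mfd \<Rightarrow> 'x distrib \<Rightarrow> ('x, 'm, 'y) osheaf_scheme \<Rightarrow> ('x, 'm, 'z) osheaf_scheme \<Rightarrow> ('x, 'm, 'w) osheaf_scheme
     \<Rightarrow> ('x set \<Rightarrow> 'm \<Rightarrow> 'm \<Rightarrow> 'm) \<Rightarrow> bool" where
  "is_tensor_product M P K L N \<tau> \<longleftrightarrow>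
     omodule_bilinear M P K L N \<tau> \<and>
     (\<forall>(Q :: ('x, 'm) osheaf) \<beta>. omodule M P Q \<and> omodule_bilinear M P K L Q \<beta> \<longrightarrow>
        (\<exists>h. omodule_hom M P N Q h \<and>
           (\<forall>U k l. openin (mtop M) U \<and> k \<in> carrier (sec K U) \<and> l \<in> carrier (sec L U) \<longrightarrow>
              h U (\<tau> U k l) = \<beta> U k l) \<and>
           (\<forall>h'. omodule_hom M P N Q h' \<and>
              (\<forall>U k l. openin (mtop M) U \<and> k \<in> carrier (sec K U) \<and> l \<in> carrier (sec L U) \<longrightarrow>
                 h' U (\<tau> U k l) = \<beta> U k l) \<longrightarrow>
              (\<forall>U n. openin (mtop M) U \<and> n \<in> carrier (sec N U) \<longrightarrow> h' U n = h U n))))"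


section \<open>Lie algebroids and their modules\<close>

record ('x, 'b) lie_algd = "('x, 'b) osheaf" +
  brk :: "'x set \<Rightarrow> 'b \<Rightarrow> 'b \<Rightarrow> 'b"
  anch :: "'x set \<Rightarrow> 'b \<Rightarrow> 'x \<Rightarrow> 'x tvec set"

text \<open>Multiplication by a complex number, through the constant functions in the structure sheaf.\<close>

definition cscale :: "('x, 'm, 'z) osheaf_scheme \<Rightarrow> 'x set \<Rightarrow> complex \<Rightarrow> 'm \<Rightarrow> 'm" where
  "cscale L U c m = cut U (\<lambda>_. c) \<odot>\<^bsub>sec L U\<^esub> m"

definition lie_algebroid :: "'x mfd \<Rightarrow> 'x distrib \<Rightarrow> ('x, 'b) lie_algd \<Rightarrow> bool" where
  "lie_algebroid M P B \<longleftrightarrow> omodule M P B \<and>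
     (\<forall>U. openin (mtop M) U \<longrightarrow>
        (\<forall>a\<in>carrier (sec B U). \<forall>b\<in>carrier (sec B U).
           brk B U a b \<in> carrier (sec B U) \<and>
           (\<forall>c\<in>carrier (sec B U).
              brk B U (a \<oplus>\<^bsub>sec B U\<^esub> b) c = brk B U a c \<oplus>\<^bsub>sec B U\<^esub> brk B U b c \<and>
              brk B U c (a \<oplus>\<^bsub>sec B U\<^esub> b) = brk B U c a \<oplus>\<^bsub>sec B U\<^esub> brk B U c b \<and>
              brk B U a (brk B U b c) \<oplus>\<^bsub>sec B U\<^esub> brk B U b (brk B U c a) \<oplus>\<^bsub>sec B U\<^esub>
                brk B U c (brk B U a b) = \<zero>\<^bsub>sec B U\<^esub>) \<and>
           (\<forall>z. brk B U (cscale B U z a) b = cscale B U z (brk B U a b) \<and>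
                brk B U a (cscale B U z b) = cscale B U z (brk B U a b)) \<and>
           brk B U a a = \<zero>\<^bsub>sec B U\<^esub> \<and>
           (\<forall>V. openin (mtop M) V \<and> V \<subseteq> U \<longrightarrow>
              brk B V (res B U V a) (res B U V b) = res B U V (brk B U a b)) \<and>
           anch B U (a \<oplus>\<^bsub>sec B U\<^esub> b) = txp_add (anch B U a) (anch B U b) \<and>
           (\<forall>f\<in>carrier (OXP M P U).
              brk B U a (f \<odot>\<^bsub>sec B U\<^esub> b) =
                txp_apply U (anch B U a) f \<odot>\<^bsub>sec B U\<^esub> b \<oplus>\<^bsub>sec B U\<^esub> f \<odot>\<^bsub>sec B U\<^esub> brk B U a b)) \<and>
        (\<forall>b\<in>carrier (sec B U).
           anch B U b \<in> TXP M P U \<and>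
           (\<forall>f\<in>carrier (OXP M P U). anch B U (f \<odot>\<^bsub>sec B U\<^esub> b) = txp_smult P f (anch B U b)) \<and>
           (\<forall>V. openin (mtop M) V \<and> V \<subseteq> U \<longrightarrow> anch B V (res B U V b) = txp_cut V (anch B U b))))"

text \<open>
  A morphism of sheaves from \<open>B\<close> to the sheaf of complex-linear endomorphisms of \<open>L\<close> amounts to
  actions of \<open>B U\<close> on \<open>L U\<close> compatible with restrictions: a section of \<open>B\<close> over \<open>U\<close> acts on
  sections of \<open>L\<close> over a smaller open set through its restriction.
\<close>

record ('x, 'b, 'm) bmod = "('x, 'm) osheaf" +
  act :: "'x set \<Rightarrow> 'b \<Rightarrow> 'm \<Rightarrow> 'm"

definition bmodule :: "'x mfd \<Rightarrow> 'x distrib \<Rightarrow> ('x, 'b) lie_algd \<Rightarrow> ('x, 'b, 'm) bmod \<Rightarrow> bool" where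
  "bmodule M P B L \<longleftrightarrow> omodule M P L \<and>
     (\<forall>U. openin (mtop M) U \<longrightarrow>
        (\<forall>b\<in>carrier (sec B U). \<forall>m\<in>carrier (sec L U).
           act L U b m \<in> carrier (sec L U) \<and>
           (\<forall>m'\<in>carrier (sec L U).
              act L U b (m \<oplus>\<^bsub>sec L U\<^esub> m') = act L U b m \<oplus>\<^bsub>sec L U\<^esub> act L U b m') \<and>
           (\<forall>z. act L U b (cscale L U z m) = cscale L U z (act L U b m)) \<and>
           (\<forall>b'\<in>carrier (sec B U).
              act L U (b \<oplus>\<^bsub>sec B U\<^esub> b') m = act L U b m \<oplus>\<^bsub>sec L U\<^esub> act L U b' m \<and>
              act L U (brk B U b b') m =
                act L U b (act L U b' m) \<ominus>\<^bsub>sec L U\<^esub> act L U b' (act L U b m)) \<and>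
           (\<forall>f\<in>carrier (OXP M P U).
              act L U (f \<odot>\<^bsub>sec B U\<^esub> b) m = f \<odot>\<^bsub>sec L U\<^esub> act L U b m \<and>
              act L U b (f \<odot>\<^bsub>sec L U\<^esub> m) =
                txp_apply U (anch B U b) f \<odot>\<^bsub>sec L U\<^esub> m \<oplus>\<^bsub>sec L U\<^esub> f \<odot>\<^bsub>sec L U\<^esub> act L U b m) \<and>
           (\<forall>V. openin (mtop M) V \<and> V \<subseteq> U \<longrightarrow>
              act L V (res B U V b) (res L U V m) = res L U V (act L U b m))))"

definition invertible_bmodule :: "'x mfd \<Rightarrow> 'x distrib \<Rightarrow> ('x, 'b) lie_algd \<Rightarrow> ('x, 'b, 'm) bmod \<Rightarrow> bool" where
  "invertible_bmodule M P B L \<longleftrightarrow> bmodule M P B L \<and> locally_free_rank_one M P L"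

definition bmodule_isomorphic ::
    "'x mfd \<Rightarrow> 'x distrib \<Rightarrow> ('x, 'b) lie_algd \<Rightarrow> ('x, 'b, 'm) bmod \<Rightarrow> ('x, 'b, 'n) bmod \<Rightarrow> bool" where
  "bmodule_isomorphic M P B L N \<longleftrightarrow> (\<exists>\<phi>. omodule_hom M P L N \<phi> \<and>
     (\<forall>U. openin (mtop M) U \<longrightarrow>
        bij_betw (\<phi> U) (carrier (sec L U)) (carrier (sec N U)) \<and>
        (\<forall>b\<in>carrier (sec B U). \<forall>m\<in>carrier (sec L U). \<phi> U (act L U b m) = act N U b (\<phi> U m))))"

definition bmodule_tensor ::
    "'x mfd \<Rightarrow> 'x distrib \<Rightarrow> ('x, 'b) lie_algd \<Rightarrow> ('x, 'b, 'm) bmod \<Rightarrow> ('x, 'b, 'm) bmod \<Rightarrow> ('x, 'b, 'm) bmod \<Rightarrow> bool" where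
  "bmodule_tensor M P B K L N \<longleftrightarrow> bmodule M P B N \<and>
     (\<exists>\<tau>. is_tensor_product M P K L N \<tau> \<and>
        (\<forall>U. openin (mtop M) U \<longrightarrow>
           (\<forall>b\<in>carrier (sec B U). \<forall>k\<in>carrier (sec K U). \<forall>l\<in>carrier (sec L U).
              act N U b (\<tau> U k l) = \<tau> U (act K U b k) l \<oplus>\<^bsub>sec N U\<^esub> \<tau> U k (act L U b l))))"

text \<open>The structure sheaf with the action through the anchor, the unit of the tensor product.\<close>

definition unit_bmodule :: "'x mfd \<Rightarrow> 'x distrib \<Rightarrow> ('x, 'b) lie_algd \<Rightarrow> ('x, 'b, 'x cfun) bmod" where
  "unit_bmodule M P B =
     \<lparr>sec = (\<lambda>U. \<lparr>carrier = carrier (OXP M P U), monoid.mult = monoid.mult (OXP M P U), monoid.one = \<one>\<^bsub>OXP M P U\<^esub>,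
                 ring.zero = \<zero>\<^bsub>OXP M P U\<^esub>, ring.add = ring.add (OXP M P U), smult = monoid.mult (OXP M P U)\<rparr>),
      res = (\<lambda>U V. cut V),
      act = (\<lambda>U b. txp_apply U (anch B U b))\<rparr>"

text \<open>
  The invertible modules whose sections lie in the type \<open>'m\<close>, up to isomorphism. The type \<open>'m\<close> plays
  the role of a universe. A section of an invertible module is determined by its coefficients in
  chosen trivialisations near the points of \<open>X\<close>, so every invertible module is isomorphic to one
  with sections in \<open>'m\<close> as soon as \<^typ>\<open>'x \<Rightarrow> 'x \<Rightarrow> complex\<close> injects into \<open>'m\<close>.
\<close>

definition iso_class ::
    "'x mfd \<Rightarrow> 'x distrib \<Rightarrow> ('x, 'b) lie_algd \<Rightarrow> ('x, 'b, 'n) bmod \<Rightarrow> ('x, 'b, 'm) bmod set" where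
  "iso_class M P B L = {N. invertible_bmodule M P B N \<and> bmodule_isomorphic M P B L N}"

definition pi0_Pic :: "'x mfd \<Rightarrow> 'x distrib \<Rightarrow> ('x, 'b) lie_algd \<Rightarrow> ('x, 'b, 'm) bmod set monoid" where
  "pi0_Pic M P B =
     \<lparr>carrier = {iso_class M P B L | L :: ('x, 'b, 'm) bmod. invertible_bmodule M P B L},
      monoid.mult = (\<lambda>\<K> \<L>. {N. invertible_bmodule M P B N \<and>
                               (\<exists>K\<in>\<K>. \<exists>L\<in>\<L>. bmodule_tensor M P B K L N)}),
      monoid.one = iso_class M P B (unit_bmodule M P B)\<rparr>"


section \<open>The two-term complex of a Lie algebroid\<close>

text \<open>
  One-forms of \<open>B\<close> over \<open>U\<close> are sections over \<open>U\<close> of the dual sheaf of \<open>B\<close>, i.e. linear morphisms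
  from the restriction of \<open>B\<close> to \<open>U\<close> to the restriction of the structure sheaf; they are families
  indexed by the open subsets of \<open>U\<close>.
\<close>

definition B_forms1 :: "'x mfd \<Rightarrow> 'x distrib \<Rightarrow> ('x, 'b) lie_algd \<Rightarrow> 'x set \<Rightarrow> ('x set \<Rightarrow> 'b \<Rightarrow> 'x cfun) set" where
  "B_forms1 M P B U = {\<alpha>.
     (\<forall>V b. \<not> (openin (mtop M) V \<and> V \<subseteq> U \<and> b \<in> carrier (sec B V)) \<longrightarrow> \<alpha> V b = (\<lambda>_. 0)) \<and>
     (\<forall>V. openin (mtop M) V \<and> V \<subseteq> U \<longrightarrow>
        \<alpha> V \<in> carrier (sec B V) \<rightarrow> carrier (OXP M P V) \<and>
        (\<forall>b\<in>carrier (sec B V). \<forall>b'\<in>carrier (sec B V).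
           \<alpha> V (b \<oplus>\<^bsub>sec B V\<^esub> b') = \<alpha> V b \<oplus>\<^bsub>OXP M P V\<^esub> \<alpha> V b') \<and>
        (\<forall>f\<in>carrier (OXP M P V). \<forall>b\<in>carrier (sec B V).
           \<alpha> V (f \<odot>\<^bsub>sec B V\<^esub> b) = f \<otimes>\<^bsub>OXP M P V\<^esub> \<alpha> V b) \<and>
        (\<forall>W. openin (mtop M) W \<and> W \<subseteq> V \<longrightarrow>
           (\<forall>b\<in>carrier (sec B V). \<alpha> W (res B V W b) = cut W (\<alpha> V b))))}"

text \<open>The Chevalley--Eilenberg differential in degrees zero and one.\<close>

definition dB0 :: "'x mfd \<Rightarrow> ('x, 'b) lie_algd \<Rightarrow> 'x set \<Rightarrow> 'x cfun \<Rightarrow> 'x set \<Rightarrow> 'b \<Rightarrow> 'x cfun" where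
  "dB0 M B U f = (\<lambda>V b. if openin (mtop M) V \<and> V \<subseteq> U \<and> b \<in> carrier (sec B V)
                        then txp_apply V (anch B V b) (cut V f) else (\<lambda>_. 0))"

definition dB1 :: "('x, 'b) lie_algd \<Rightarrow> ('x set \<Rightarrow> 'b \<Rightarrow> 'x cfun) \<Rightarrow> 'x set \<Rightarrow> 'b \<Rightarrow> 'b \<Rightarrow> 'x cfun" where
  "dB1 B \<alpha> V b b' = (\<lambda>p. txp_apply V (anch B V b) (\<alpha> V b') p
                        - txp_apply V (anch B V b') (\<alpha> V b) p - \<alpha> V (brk B V b b') p)"

record ('x, 's) ab_sheaf =
  sgrp :: "'x set \<Rightarrow> 's monoid"
  sres :: "'x set \<Rightarrow> 'x set \<Rightarrow> 's \<Rightarrow> 's"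

definition OXP_units :: "'x mfd \<Rightarrow> 'x distrib \<Rightarrow> ('x, 'x cfun) ab_sheaf" where
  "OXP_units M P = \<lparr>sgrp = (\<lambda>U. units_of (OXP M P U)), sres = (\<lambda>U V. cut V)\<rparr>"

definition B_closed_forms1 ::
    "'x mfd \<Rightarrow> 'x distrib \<Rightarrow> ('x, 'b) lie_algd \<Rightarrow> ('x, 'x set \<Rightarrow> 'b \<Rightarrow> 'x cfun) ab_sheaf" where
  "B_closed_forms1 M P B =
     \<lparr>sgrp = (\<lambda>U. \<lparr>carrier = {\<alpha> \<in> B_forms1 M P B U. \<forall>V. openin (mtop M) V \<and> V \<subseteq> U \<longrightarrow>
                      (\<forall>b\<in>carrier (sec B V). \<forall>b'\<in>carrier (sec B V). dB1 B \<alpha> V b b' = (\<lambda>_. 0))},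
                  monoid.mult = (\<lambda>\<alpha> \<beta> V b p. \<alpha> V b p + \<beta> V b p),
                  monoid.one = (\<lambda>_ _ _. 0)\<rparr>),
      sres = (\<lambda>U V \<alpha> W. if W \<subseteq> V then \<alpha> W else (\<lambda>_ _. 0))\<rparr>"

definition dB_log :: "'x mfd \<Rightarrow> ('x, 'b) lie_algd \<Rightarrow> 'x set \<Rightarrow> 'x cfun \<Rightarrow> 'x set \<Rightarrow> 'b \<Rightarrow> 'x cfun" where
  "dB_log M B U f = (\<lambda>V b p. dB0 M B U f V b p / f p)"


section \<open>Hypercohomology through Godement resolutions\<close>

text \<open>
  Groups are written multiplicatively. The hypercohomology of a complex of sheaves is the
  cohomology of the global sections of the total complex of its Godement resolutions, which are
  built here up to the degree needed for the first hypercohomology of a two-term complex.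
\<close>

definition germ :: "'x topology \<Rightarrow> ('x, 's) ab_sheaf \<Rightarrow> 'x \<Rightarrow> 'x set \<Rightarrow> 's \<Rightarrow> ('x set \<times> 's) set" where
  "germ T F p U s = {(V, t). openin T V \<and> p \<in> V \<and> t \<in> carrier (sgrp F V) \<and>
     (\<exists>W. openin T W \<and> p \<in> W \<and> W \<subseteq> U \<inter> V \<and> sres F U W s = sres F V W t)}"

definition stalk :: "'x topology \<Rightarrow> ('x, 's) ab_sheaf \<Rightarrow> 'x \<Rightarrow> ('x set \<times> 's) set monoid" where
  "stalk T F p =
     \<lparr>carrier = {germ T F p U s | U s. openin T U \<and> p \<in> U \<and> s \<in> carrier (sgrp F U)},
      monoid.mult = (\<lambda>\<sigma> \<tau>. \<Union>(U, s)\<in>\<sigma>. \<Union>(V, t)\<in>\<tau>.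
         germ T F p (U \<inter> V) (sres F U (U \<inter> V) s \<otimes>\<^bsub>sgrp F (U \<inter> V)\<^esub> sres F V (U \<inter> V) t)),
      monoid.one = germ T F p (topspace T) \<one>\<^bsub>sgrp F (topspace T)\<^esub>\<rparr>"

definition stalk_map ::
    "'x topology \<Rightarrow> ('x, 't) ab_sheaf \<Rightarrow> ('x set \<Rightarrow> 's \<Rightarrow> 't) \<Rightarrow> 'x \<Rightarrow> ('x set \<times> 's) set \<Rightarrow> ('x set \<times> 't) set" where
  "stalk_map T G \<phi> p \<sigma> = (\<Union>(U, s)\<in>\<sigma>. germ T G p U (\<phi> U s))"

text \<open>The sheaf of discontinuous sections, with its unit and its functoriality.\<close>

definition godement :: "'x topology \<Rightarrow> ('x, 's) ab_sheaf \<Rightarrow> ('x, 'x \<Rightarrow> ('x set \<times> 's) set) ab_sheaf" where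
  "godement T F = \<lparr>sgrp = (\<lambda>U. product_group U (stalk T F)), sres = (\<lambda>U V s. restrict s V)\<rparr>"

definition godement_unit :: "'x topology \<Rightarrow> ('x, 's) ab_sheaf \<Rightarrow> 'x set \<Rightarrow> 's \<Rightarrow> 'x \<Rightarrow> ('x set \<times> 's) set" where
  "godement_unit T F U s = (\<lambda>p\<in>U. germ T F p U s)"

definition godement_map ::
    "'x topology \<Rightarrow> ('x, 't) ab_sheaf \<Rightarrow> ('x set \<Rightarrow> 's \<Rightarrow> 't) \<Rightarrow> 'x set
     \<Rightarrow> ('x \<Rightarrow> ('x set \<times> 's) set) \<Rightarrow> 'x \<Rightarrow> ('x set \<times> 't) set" where
  "godement_map T G \<phi> U s = (\<lambda>p\<in>U. stalk_map T G \<phi> p (s p))"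

text \<open>
  The cokernel presheaf of \<open>\<phi> : F \<rightarrow> G\<close>. It is only used through its stalks, which are those of the
  cokernel sheaf. \<open>coker_map\<close> is the map to the cokernel of \<open>\<phi>\<close> induced by a map \<open>\<psi>\<close> to \<open>G\<close>.
\<close>

definition coker :: "('x, 's) ab_sheaf \<Rightarrow> ('x, 't) ab_sheaf \<Rightarrow> ('x set \<Rightarrow> 's \<Rightarrow> 't) \<Rightarrow> ('x, 't set) ab_sheaf" where
  "coker F G \<phi> =
     \<lparr>sgrp = (\<lambda>U. sgrp G U Mod (\<phi> U ` carrier (sgrp F U))),
      sres = (\<lambda>U V A. (\<phi> V ` carrier (sgrp F V)) <#>\<^bsub>sgrp G V\<^esub> (sres G U V ` A))\<rparr>"

definition coker_proj :: "('x, 's) ab_sheaf \<Rightarrow> ('x, 't) ab_sheaf \<Rightarrow> ('x set \<Rightarrow> 's \<Rightarrow> 't) \<Rightarrow> 'x set \<Rightarrow> 't \<Rightarrow> 't set" where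
  "coker_proj F G \<phi> U t = (\<phi> U ` carrier (sgrp F U)) #>\<^bsub>sgrp G U\<^esub> t"

definition coker_map ::
    "('x, 's) ab_sheaf \<Rightarrow> ('x, 't) ab_sheaf \<Rightarrow> ('x set \<Rightarrow> 's \<Rightarrow> 't) \<Rightarrow> ('x set \<Rightarrow> 'u \<Rightarrow> 't)
     \<Rightarrow> 'x set \<Rightarrow> 'u set \<Rightarrow> 't set" where
  "coker_map F G \<phi> \<psi> U A = (\<phi> U ` carrier (sgrp F U)) <#>\<^bsub>sgrp G U\<^esub> (\<psi> U ` A)"

text \<open>One step of the resolution: from \<open>\<phi> : F \<rightarrow> G\<close> to \<open>G \<rightarrow> godement (coker \<phi>)\<close>.\<close>

definition gd_step ::
    "'x topology \<Rightarrow> ('x, 's) ab_sheaf \<Rightarrow> ('x, 't) ab_sheaf \<Rightarrow> ('x set \<Rightarrow> 's \<Rightarrow> 't)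
     \<Rightarrow> ('x, 'x \<Rightarrow> ('x set \<times> 't set) set) ab_sheaf" where
  "gd_step T F G \<phi> = godement T (coker F G \<phi>)"

definition gd_step_d ::
    "'x topology \<Rightarrow> ('x, 's) ab_sheaf \<Rightarrow> ('x, 't) ab_sheaf \<Rightarrow> ('x set \<Rightarrow> 's \<Rightarrow> 't)
     \<Rightarrow> 'x set \<Rightarrow> 't \<Rightarrow> 'x \<Rightarrow> ('x set \<times> 't set) set" where
  "gd_step_d T F G \<phi> U t = godement_unit T (coker F G \<phi>) U (coker_proj F G \<phi> U t)"

text \<open>The Godement resolution \<open>F \<rightarrow> gd0 \<rightarrow> gd1 \<rightarrow> gd2\<close>.\<close>

abbreviation "gd0 T F \<equiv> godement T F"
abbreviation "gd1 T F \<equiv> gd_step T F (gd0 T F) (godement_unit T F)"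
abbreviation "gd_d0 T F \<equiv> gd_step_d T F (gd0 T F) (godement_unit T F)"
abbreviation "gd2 T F \<equiv> gd_step T (gd0 T F) (gd1 T F) (gd_d0 T F)"
abbreviation "gd_d1 T F \<equiv> gd_step_d T (gd0 T F) (gd1 T F) (gd_d0 T F)"

text \<open>The maps induced on the resolutions by a morphism \<open>d : F \<rightarrow> G\<close>.\<close>

abbreviation "gd_map0 T G d \<equiv> godement_map T G d"
abbreviation "gd_map1 T G d \<equiv>
  godement_map T (coker G (gd0 T G) (godement_unit T G))
    (coker_map G (gd0 T G) (godement_unit T G) (gd_map0 T G d))"

text \<open>
  First hypercohomology of the complex \<open>d : F \<rightarrow> G\<close> with \<open>F\<close> in degree zero; the total complex is
  \<open>gd0 F \<rightarrow> gd1 F \<times> gd0 G \<rightarrow> gd2 F \<times> gd1 G\<close> with differentials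
  \<open>u \<mapsto> (\<delta> u, d u)\<close> and \<open>(a, w) \<mapsto> (\<delta> a, d a / \<delta> w)\<close>.
\<close>

definition hyper_H1 where
  "hyper_H1 T F G d =
     (let X = topspace T;
          T0 = sgrp (gd0 T F) X;
          T1 = sgrp (gd1 T F) X \<times>\<times> sgrp (gd0 T G) X;
          T2 = sgrp (gd2 T F) X \<times>\<times> sgrp (gd1 T G) X;
          D0 = (\<lambda>u. (gd_d0 T F X u, gd_map0 T G d X u));
          D1 = (\<lambda>(a, w). (gd_d1 T F X a,
                  gd_map1 T G d X a \<otimes>\<^bsub>sgrp (gd1 T G) X\<^esub> inv\<^bsub>sgrp (gd1 T G) X\<^esub> gd_d0 T G X w))
      in T1\<lparr>carrier := kernel T1 T2 D1\<rparr> Mod (D0 ` carrier T0))"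

end

theory Submission
  imports Defs
begin

text \<open>
  A class in the hypercohomology group is represented by a cocycle \<open>(a, w)\<close> of the total complex
  of the Godement resolutions. Locally \<open>a\<close> is the coboundary of a family \<open>u\<close> of germs of units, and
  then \<open>w\<close> is \<open>d log u\<close> corrected by a closed one-form \<open>\<alpha>\<close>; these local trivialisations are unique up
  to \<open>(u, \<alpha>) \<mapsto> (h u, \<alpha> - d log h)\<close> for units \<open>h\<close>. Taking values of germs turns \<open>u\<close> into a nowhere
  vanishing function \<open>\<gamma>\<close>, and the functions \<open>s\<close> for which all \<open>\<gamma> s\<close> are sections of the structure sheaf
  form an invertible module with generator \<open>1 / \<gamma>\<close> and connection form \<open>\<alpha>\<close>, so that the tensor product
  becomes the multiplication of functions. A module isomorphic to the unit has a global flat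
  generator, which exhibits its cocycle as a coboundary. Conversely, the ratios and the connection
  forms of local generators of an invertible module make up a cocycle. That \<open>d log h\<close> is closed
  needs that the anchor respects brackets, which follows from the Jacobi identity.
\<close>

section \<open>Godement resolutions\<close>

text \<open>The Godement resolution starts with discontinuous sections, and this shapes both
  directions. A local 0-cochain assigns to each point a germ of a unit, hence a nonzero number, so
  the module of a cocycle can be cut out of the sheaf of all functions and no abstract bundle has to
  be glued. Conversely, an invertible module yields 0-cochains from generators chosen separately at
  every point, without any continuity in the point. Cokernels enter only through their stalks, so
  the groundwork is done for presheaves. Sign convention: multiplying \<open>\<gamma>\<close> by
  \<open>h\<close> divides the generator \<open>1 / \<gamma>\<close> by \<open>h\<close>, which
  subtracts \<open>d log h\<close> from its connection form. Modules cut out in this way have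
  functions on the space as sections, while isomorphism classes are formed in a prescribed universe;
  they are therefore transported along an injection. The tensor product of classes is never analysed
  on its own: its group laws are inherited from the cocycles.\<close>

locale ab_presheaf =
  fixes T :: "'x topology" and F :: "('x, 's) ab_sheaf"
  assumes grp: "openin T U \<Longrightarrow> comm_group (sgrp F U)"
    and res_hom: "\<lbrakk>openin T U; openin T V; V \<subseteq> U\<rbrakk> \<Longrightarrow> sres F U V \<in> hom (sgrp F U) (sgrp F V)"
    and res_id: "\<lbrakk>openin T U; s \<in> carrier (sgrp F U)\<rbrakk> \<Longrightarrow> sres F U U s = s"
    and res_res: "\<lbrakk>openin T U; openin T V; openin T W; W \<subseteq> V; V \<subseteq> U; s \<in> carrier (sgrp F U)\<rbrakk>
      \<Longrightarrow> sres F V W (sres F U V s) = sres F U W s"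
begin

lemma group: "openin T U \<Longrightarrow> group (sgrp F U)"
  using grp comm_group.axioms(2) by blast

lemma res_closed: "\<lbrakk>openin T U; openin T V; V \<subseteq> U; s \<in> carrier (sgrp F U)\<rbrakk> \<Longrightarrow> sres F U V s \<in> carrier (sgrp F V)"
  using res_hom hom_in_carrier by fastforce

lemma res_mult: "\<lbrakk>openin T U; openin T V; V \<subseteq> U; s \<in> carrier (sgrp F U); t \<in> carrier (sgrp F U)\<rbrakk>
   \<Longrightarrow> sres F U V (s \<otimes>\<^bsub>sgrp F U\<^esub> t) = sres F U V s \<otimes>\<^bsub>sgrp F V\<^esub> sres F U V t"
  using res_hom hom_mult by fastforce

lemma res_one: "\<lbrakk>openin T U; openin T V; V \<subseteq> U\<rbrakk> \<Longrightarrow> sres F U V \<one>\<^bsub>sgrp F U\<^esub> = \<one>\<^bsub>sgrp F V\<^esub>"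
  using res_hom hom_one group by blast

lemma mult_closed: "\<lbrakk>openin T U; s \<in> carrier (sgrp F U); t \<in> carrier (sgrp F U)\<rbrakk>
   \<Longrightarrow> s \<otimes>\<^bsub>sgrp F U\<^esub> t \<in> carrier (sgrp F U)"
  by (meson group group.is_monoid monoid.m_closed)

lemma one_closed: "openin T U \<Longrightarrow> \<one>\<^bsub>sgrp F U\<^esub> \<in> carrier (sgrp F U)"
  by (meson group group.is_monoid monoid.one_closed)

lemma inv_closed: "\<lbrakk>openin T U; s \<in> carrier (sgrp F U)\<rbrakk> \<Longrightarrow> inv\<^bsub>sgrp F U\<^esub> s \<in> carrier (sgrp F U)"
  by (simp add: group)

section \<open>Germs and stalks of a presheaf of abelian groups\<close>

lemma germ_eq_iff:
  assumes s: "openin T U" "p \<in> U" "s \<in> carrier (sgrp F U)" and t: "openin T V" "p \<in> V" "t \<in> carrier (sgrp F V)"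
  shows "germ T F p U s = germ T F p V t \<longleftrightarrow>
     (\<exists>W. openin T W \<and> p \<in> W \<and> W \<subseteq> U \<inter> V \<and> sres F U W s = sres F V W t)" (is "_ \<longleftrightarrow> ?R")
proof
  assume *: "germ T F p U s = germ T F p V t"
  \<comment> \<open>A germ is the set of all its representatives, so equality of germs yields
    membership of one pair, which is the existence of a common neighbourhood.\<close>
  have "(V, t) \<in> germ T F p V t"
    using t by (auto simp: germ_def)
  then have "(V, t) \<in> germ T F p U s" by (simp add: *)
  then show ?R by (auto simp: germ_def)
next
  assume ?R
  then obtain W where W: "openin T W" "p \<in> W" "W \<subseteq> U" "W \<subseteq> V" "sres F U W s = sres F V W t" by auto
  \<comment> \<open>One inclusion is shown for arbitrary data because the situation is symmetric in
    the two pairs. It is transitivity: shrink to the intersection of both witnessing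
    neighbourhoods.\<close>
  have *: "germ T F p U s \<subseteq> germ T F p V t"
    if s: "openin T U" "p \<in> U" "s \<in> carrier (sgrp F U)" and t: "openin T V" "p \<in> V" "t \<in> carrier (sgrp F V)"
      and W: "openin T W" "p \<in> W" "W \<subseteq> U" "W \<subseteq> V" "sres F U W s = sres F V W t" for U V s t W
  proof
    fix z assume "z \<in> germ T F p U s"
    then obtain A a B where z: "z = (A, a)" "openin T A" "p \<in> A" "a \<in> carrier (sgrp F A)"
      and B: "openin T B" "p \<in> B" "B \<subseteq> U" "B \<subseteq> A" "sres F U B s = sres F A B a"
      unfolding germ_def by auto
    have WB: "openin T (W \<inter> B)" using W B by auto
    have "sres F V (W \<inter> B) t = sres F W (W \<inter> B) (sres F V W t)" using res_res[of V W "W \<inter> B" t] W t WB by simp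
    also have "\<dots> = sres F U (W \<inter> B) s" using res_res[of U W "W \<inter> B" s] W s WB by simp
    also have "\<dots> = sres F B (W \<inter> B) (sres F U B s)" using res_res[of U B "W \<inter> B" s] B s WB by simp
    also have "\<dots> = sres F A (W \<inter> B) a" using res_res[of A B "W \<inter> B" a] B z WB by simp
    finally show "z \<in> germ T F p V t"
      unfolding germ_def using z W B WB by blast
  qed
  show "germ T F p U s = germ T F p V t"
    using *[OF s t W] *[OF t s W(1,2,4,3) W(5)[symmetric]] by auto
qed

lemma germ_self: "\<lbrakk>openin T U; p \<in> U; s \<in> carrier (sgrp F U)\<rbrakk> \<Longrightarrow> (U, s) \<in> germ T F p U s"
  by (auto simp: germ_def)

lemma germ_memD:
  assumes "(V, t) \<in> germ T F p U s" "openin T U" "p \<in> U" "s \<in> carrier (sgrp F U)"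
  shows "openin T V \<and> p \<in> V \<and> t \<in> carrier (sgrp F V) \<and> germ T F p V t = germ T F p U s"
proof -
  have *: "openin T V" "p \<in> V" "t \<in> carrier (sgrp F V)"
    "\<exists>W. openin T W \<and> p \<in> W \<and> W \<subseteq> U \<inter> V \<and> sres F U W s = sres F V W t"
    using assms(1) by (auto simp: germ_def)
  with germ_eq_iff[OF assms(2-4) *(1-3)] show ?thesis by simp
qed

lemma germ_res:
  assumes "openin T U" "openin T V" "p \<in> V" "V \<subseteq> U" "s \<in> carrier (sgrp F U)"
  shows "germ T F p V (sres F U V s) = germ T F p U s"
proof -
  have "sres F V V (sres F U V s) = sres F U V s" using assms by (simp add: res_id res_closed)
  then show ?thesis
    using germ_eq_iff[of V p "sres F U V s" U s] assms res_closed by blast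
qed

lemma stalk_carrier: "carrier (stalk T F p) = {germ T F p U s | U s. openin T U \<and> p \<in> U \<and> s \<in> carrier (sgrp F U)}"
  by (simp add: stalk_def)

lemma germ_closed: "\<lbrakk>openin T U; p \<in> U; s \<in> carrier (sgrp F U)\<rbrakk> \<Longrightarrow> germ T F p U s \<in> carrier (stalk T F p)"
  by (auto simp: stalk_carrier)

lemma stalkE:
  assumes "\<sigma> \<in> carrier (stalk T F p)"
  obtains U s where "openin T U" "p \<in> U" "s \<in> carrier (sgrp F U)" "\<sigma> = germ T F p U s"
  using assms by (auto simp: stalk_carrier)

text \<open>Products and images of germs are defined as unions over all representatives. If every
  representative contributes the same set, the union is that set; a germ contains at least one pair,
  so the union is not over nothing.\<close>

lemma UN_germ:
  assumes "openin T U" "p \<in> U" "s \<in> carrier (sgrp F U)"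
    and "\<And>V t. \<lbrakk>openin T V; p \<in> V; t \<in> carrier (sgrp F V); germ T F p V t = germ T F p U s\<rbrakk> \<Longrightarrow> f V t = c"
  shows "(\<Union>(V, t)\<in>germ T F p U s. f V t) = c"
proof -
  have "f V t = c" if "(V, t) \<in> germ T F p U s" for V t
    using germ_memD[OF that assms(1-3)] assms(4) by blast
  then show ?thesis using germ_self[OF assms(1-3)] by fastforce
qed

text \<open>The right-hand side depends on the two germs only: other representatives agree with the
  given ones on neighbourhoods \<open>A\<close> and \<open>B\<close> of \<open>p\<close>, so the
  products agree on \<open>A \<inter> B\<close>. Hence the union in the definition of the stalk
  collapses.\<close>

lemma stalk_mult_germ:
  assumes s: "openin T U" "p \<in> U" "s \<in> carrier (sgrp F U)" and t: "openin T V" "p \<in> V" "t \<in> carrier (sgrp F V)"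
  shows "germ T F p U s \<otimes>\<^bsub>stalk T F p\<^esub> germ T F p V t =
         germ T F p (U \<inter> V) (sres F U (U \<inter> V) s \<otimes>\<^bsub>sgrp F (U \<inter> V)\<^esub> sres F V (U \<inter> V) t)"
proof -
  have "germ T F p (U' \<inter> V') (sres F U' (U' \<inter> V') s' \<otimes>\<^bsub>sgrp F (U' \<inter> V')\<^esub> sres F V' (U' \<inter> V') t') =
        germ T F p (U \<inter> V) (sres F U (U \<inter> V) s \<otimes>\<^bsub>sgrp F (U \<inter> V)\<^esub> sres F V (U \<inter> V) t)" (is "germ T F p _ ?a = germ T F p _ ?b")
    if s': "openin T U'" "p \<in> U'" "s' \<in> carrier (sgrp F U')" "germ T F p U' s' = germ T F p U s"
     and t': "openin T V'" "p \<in> V'" "t' \<in> carrier (sgrp F V')" "germ T F p V' t' = germ T F p V t" for U' V' s' t'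
  proof -
    obtain A where A: "openin T A" "p \<in> A" "A \<subseteq> U'" "A \<subseteq> U" "sres F U' A s' = sres F U A s"
      using s'(4) germ_eq_iff[OF s'(1-3) s] by auto
    obtain B where B: "openin T B" "p \<in> B" "B \<subseteq> V'" "B \<subseteq> V" "sres F V' B t' = sres F V B t"
      using t'(4) germ_eq_iff[OF t'(1-3) t] by auto
    have AB: "openin T (A \<inter> B)" "openin T (U' \<inter> V')" "openin T (U \<inter> V)" using A B s t s' t' by auto
    have 1: "sres F U' (A \<inter> B) s' = sres F U (A \<inter> B) s"
      using res_res[of U' A "A \<inter> B" s'] res_res[of U A "A \<inter> B" s] A s s' AB by simp
    have 2: "sres F V' (A \<inter> B) t' = sres F V (A \<inter> B) t"
      using res_res[of V' B "A \<inter> B" t'] res_res[of V B "A \<inter> B" t] B t t' AB by simp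
    have "sres F (U' \<inter> V') (A \<inter> B) ?a = sres F U' (A \<inter> B) s' \<otimes>\<^bsub>sgrp F (A \<inter> B)\<^esub> sres F V' (A \<inter> B) t'"
      using A B s' t' AB by (subst res_mult) (auto simp: res_closed intro!: arg_cong2[where f="mult _"] res_res)
    also have "\<dots> = sres F (U \<inter> V) (A \<inter> B) ?b"
      unfolding 1 2 using A B s t AB
      by (subst res_mult) (auto simp: res_closed intro!: arg_cong2[where f="mult _"] res_res[symmetric])
    finally have e: "sres F (U' \<inter> V') (A \<inter> B) ?a = sres F (U \<inter> V) (A \<inter> B) ?b" .
    have "?a \<in> carrier (sgrp F (U' \<inter> V'))" "?b \<in> carrier (sgrp F (U \<inter> V))"
      using s t s' t' AB by (auto intro!: mult_closed res_closed)
    then show ?thesis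
      using germ_eq_iff[of "U' \<inter> V'" p ?a "U \<inter> V" ?b] e A B s s' t t' AB
      by (smt (verit) Int_iff Int_mono le_inf_iff inf_mono)
  qed
  then show ?thesis
    unfolding stalk_def monoid.simps
    using s t by (intro UN_germ) blast+
qed

lemma stalk_mult_same:
  assumes "openin T U" "p \<in> U" "s \<in> carrier (sgrp F U)" "t \<in> carrier (sgrp F U)"
  shows "germ T F p U s \<otimes>\<^bsub>stalk T F p\<^esub> germ T F p U t = germ T F p U (s \<otimes>\<^bsub>sgrp F U\<^esub> t)"
  using stalk_mult_germ[of U p s U t] assms by (simp add: res_id)

lemma stalk_one:
  assumes "openin T U" "p \<in> U"
  shows "\<one>\<^bsub>stalk T F p\<^esub> = germ T F p U \<one>\<^bsub>sgrp F U\<^esub>"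
proof -
  have "U \<subseteq> topspace T" using assms openin_subset by blast
  then show ?thesis
    using germ_res[of "topspace T" U p "\<one>\<^bsub>sgrp F (topspace T)\<^esub>"] assms
    by (simp add: stalk_def res_one one_closed)
qed

text \<open>Turns computations with two germs into computations in one group of sections.\<close>

lemma stalk_common:
  assumes "\<sigma> \<in> carrier (stalk T F p)" "\<tau> \<in> carrier (stalk T F p)"
  obtains U s t where "openin T U" "p \<in> U" "s \<in> carrier (sgrp F U)" "t \<in> carrier (sgrp F U)"
    "\<sigma> = germ T F p U s" "\<tau> = germ T F p U t"
proof -
  obtain U s where s: "openin T U" "p \<in> U" "s \<in> carrier (sgrp F U)" "\<sigma> = germ T F p U s"
    using assms stalkE by metis
  obtain V t where t: "openin T V" "p \<in> V" "t \<in> carrier (sgrp F V)" "\<tau> = germ T F p V t"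
    using assms stalkE by metis
  have o: "openin T (U \<inter> V)" using s t by auto
  show thesis
    by (rule that[of "U \<inter> V" "sres F U (U \<inter> V) s" "sres F V (U \<inter> V) t"])
       (use s t o in \<open>auto simp: germ_res res_closed\<close>)
qed

lemma stalk_comm_group: "p \<in> topspace T \<Longrightarrow> comm_group (stalk T F p)"
proof (rule comm_groupI)
  assume p: "p \<in> topspace T"
  show "\<one>\<^bsub>stalk T F p\<^esub> \<in> carrier (stalk T F p)"
    using p by (simp add: stalk_one[of "topspace T"] germ_closed one_closed)
  fix x assume x: "x \<in> carrier (stalk T F p)"
  then obtain U s where s: "openin T U" "p \<in> U" "s \<in> carrier (sgrp F U)" "x = germ T F p U s"
    using stalkE by metis
  show "\<one>\<^bsub>stalk T F p\<^esub> \<otimes>\<^bsub>stalk T F p\<^esub> x = x"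
    using s group by (simp add: stalk_one[of U] stalk_mult_same one_closed group.is_monoid monoid.l_one)
  show "\<exists>y\<in>carrier (stalk T F p). y \<otimes>\<^bsub>stalk T F p\<^esub> x = \<one>\<^bsub>stalk T F p\<^esub>"
    using s group by (intro bexI[of _ "germ T F p U (inv\<^bsub>sgrp F U\<^esub> s)"])
      (auto simp: stalk_one[of U] stalk_mult_same group.l_inv germ_closed)
  fix y assume y: "y \<in> carrier (stalk T F p)"
  obtain U s t where st: "openin T U" "p \<in> U" "s \<in> carrier (sgrp F U)" "t \<in> carrier (sgrp F U)"
    "x = germ T F p U s" "y = germ T F p U t" using stalk_common[OF x y] .
  show "x \<otimes>\<^bsub>stalk T F p\<^esub> y \<in> carrier (stalk T F p)"
    using st by (simp add: stalk_mult_same germ_closed mult_closed)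
  show "x \<otimes>\<^bsub>stalk T F p\<^esub> y = y \<otimes>\<^bsub>stalk T F p\<^esub> x"
    using st grp[of U] by (simp add: stalk_mult_same comm_monoid.m_comm[OF comm_group.axioms(1)])
  fix z assume z: "z \<in> carrier (stalk T F p)"
  obtain V c where c: "openin T V" "p \<in> V" "c \<in> carrier (sgrp F V)" "z = germ T F p V c"
    using z stalkE by metis
  have o: "openin T (U \<inter> V)" using st c by auto
  define s' t' c' where "s' = sres F U (U \<inter> V) s" and "t' = sres F U (U \<inter> V) t" and "c' = sres F V (U \<inter> V) c"
  have *: "s' \<in> carrier (sgrp F (U \<inter> V))" "t' \<in> carrier (sgrp F (U \<inter> V))" "c' \<in> carrier (sgrp F (U \<inter> V))"
    "x = germ T F p (U \<inter> V) s'" "y = germ T F p (U \<inter> V) t'" "z = germ T F p (U \<inter> V) c'"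
    using st c o by (auto simp: s'_def t'_def c'_def germ_res res_closed)
  show "x \<otimes>\<^bsub>stalk T F p\<^esub> y \<otimes>\<^bsub>stalk T F p\<^esub> z = x \<otimes>\<^bsub>stalk T F p\<^esub> (y \<otimes>\<^bsub>stalk T F p\<^esub> z)"
    using * o st c group[OF o] by (simp add: stalk_mult_same mult_closed group.is_monoid monoid.m_assoc)
qed

lemma stalk_group: "p \<in> topspace T \<Longrightarrow> group (stalk T F p)"
  using stalk_comm_group comm_group.axioms(2) by blast

lemma godement_carrier: "carrier (sgrp (godement T F) U) = (\<Pi>\<^sub>E p\<in>U. carrier (stalk T F p))"
  by (simp add: godement_def)

lemma godement_presheaf: "ab_presheaf T (godement T F)"
proof (rule ab_presheaf.intro)
  fix U assume U: "openin T U"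
  then have sub: "U \<subseteq> topspace T" by (rule openin_subset)
  have g: "group (sgrp (godement T F) U)"
    using sub stalk_group by (auto simp: godement_def intro!: product_group)
  show "comm_group (sgrp (godement T F) U)"
  proof (rule group.group_comm_groupI[OF g])
    fix x y assume "x \<in> carrier (sgrp (godement T F) U)" "y \<in> carrier (sgrp (godement T F) U)"
    then show "x \<otimes>\<^bsub>sgrp (godement T F) U\<^esub> y = y \<otimes>\<^bsub>sgrp (godement T F) U\<^esub> x"
      using sub stalk_comm_group
      by (simp add: godement_def PiE_iff subset_iff comm_monoid.m_comm[OF comm_group.axioms(1)] cong: restrict_cong)
  qed
qed (auto simp: godement_def hom_def PiE_iff restrict_def fun_eq_iff extensional_def)

end

section \<open>Morphisms of presheaves and the induced maps on stalks\<close>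

locale ab_presheaf_hom = F: ab_presheaf T F + G: ab_presheaf T G
  for T :: "'x topology" and F :: "('x, 's) ab_sheaf" and G :: "('x, 't) ab_sheaf" +
  fixes \<phi> :: "'x set \<Rightarrow> 's \<Rightarrow> 't"
  assumes map_hom: "openin T U \<Longrightarrow> \<phi> U \<in> hom (sgrp F U) (sgrp G U)"
    and map_res: "\<lbrakk>openin T U; openin T V; V \<subseteq> U; s \<in> carrier (sgrp F U)\<rbrakk>
      \<Longrightarrow> \<phi> V (sres F U V s) = sres G U V (\<phi> U s)"
begin

lemma map_closed: "\<lbrakk>openin T U; s \<in> carrier (sgrp F U)\<rbrakk> \<Longrightarrow> \<phi> U s \<in> carrier (sgrp G U)"
  using map_hom hom_in_carrier by fastforce

lemma map_mult: "\<lbrakk>openin T U; s \<in> carrier (sgrp F U); t \<in> carrier (sgrp F U)\<rbrakk>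
   \<Longrightarrow> \<phi> U (s \<otimes>\<^bsub>sgrp F U\<^esub> t) = \<phi> U s \<otimes>\<^bsub>sgrp G U\<^esub> \<phi> U t"
  using map_hom hom_mult by fastforce

lemma map_one: "openin T U \<Longrightarrow> \<phi> U \<one>\<^bsub>sgrp F U\<^esub> = \<one>\<^bsub>sgrp G U\<^esub>"
  using map_hom hom_one F.group G.group by blast

lemma map_inv: "\<lbrakk>openin T U; s \<in> carrier (sgrp F U)\<rbrakk> \<Longrightarrow> \<phi> U (inv\<^bsub>sgrp F U\<^esub> s) = inv\<^bsub>sgrp G U\<^esub> \<phi> U s"
  using group_hom.hom_inv[of "sgrp F U" "sgrp G U" "\<phi> U"] F.group G.group map_hom
  by (simp add: group_hom_def group_hom_axioms_def)

text \<open>Representatives with a common restriction have images with a common restriction, since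
  the map commutes with restriction; so the union in \<open>stalk_map\<close> takes only one
  value.\<close>

lemma stalk_map_germ:
  assumes "openin T U" "p \<in> U" "s \<in> carrier (sgrp F U)"
  shows "stalk_map T G \<phi> p (germ T F p U s) = germ T G p U (\<phi> U s)"
  unfolding stalk_map_def
proof (rule F.UN_germ[OF assms])
  fix V t assume t: "openin T V" "p \<in> V" "t \<in> carrier (sgrp F V)" "germ T F p V t = germ T F p U s"
  then obtain W where W: "openin T W" "p \<in> W" "W \<subseteq> V" "W \<subseteq> U" "sres F V W t = sres F U W s"
    using F.germ_eq_iff[OF t(1-3) assms] by auto
  then have "sres G V W (\<phi> V t) = sres G U W (\<phi> U s)"
    using map_res[of V W t] map_res[of U W s] t assms by simp
  then show "germ T G p V (\<phi> V t) = germ T G p U (\<phi> U s)"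
    using W t assms G.germ_eq_iff[of V p "\<phi> V t" U "\<phi> U s"] map_closed by auto
qed

lemma stalk_map_closed: "\<sigma> \<in> carrier (stalk T F p) \<Longrightarrow> stalk_map T G \<phi> p \<sigma> \<in> carrier (stalk T G p)"
  by (erule F.stalkE) (simp add: stalk_map_germ G.germ_closed map_closed)

lemma stalk_map_mult:
  assumes "\<sigma> \<in> carrier (stalk T F p)" "\<tau> \<in> carrier (stalk T F p)"
  shows "stalk_map T G \<phi> p (\<sigma> \<otimes>\<^bsub>stalk T F p\<^esub> \<tau>) = stalk_map T G \<phi> p \<sigma> \<otimes>\<^bsub>stalk T G p\<^esub> stalk_map T G \<phi> p \<tau>"
  using F.stalk_common[OF assms]
  by (metis F.stalk_mult_same G.stalk_mult_same F.mult_closed map_closed map_mult stalk_map_germ)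

lemma godement_map_hom: "ab_presheaf_hom T (godement T F) (godement T G) (godement_map T G \<phi>)"
proof -
  interpret GF: ab_presheaf T "godement T F" by (rule F.godement_presheaf)
  interpret GG: ab_presheaf T "godement T G" by (rule G.godement_presheaf)
  show ?thesis
  proof
    show "godement_map T G \<phi> U \<in> hom (sgrp (godement T F) U) (sgrp (godement T G) U)" if "openin T U" for U
      by (rule homI)
         (auto simp: godement_def godement_map_def PiE_iff stalk_map_closed stalk_map_mult intro!: restrict_ext)
  qed (auto simp: godement_def godement_map_def subset_iff restrict_def fun_eq_iff)
qed

end

context ab_presheaf
begin

lemma godement_unit_hom: "ab_presheaf_hom T F (godement T F) (godement_unit T F)"
proof -
  interpret GF: ab_presheaf T "godement T F" by (rule godement_presheaf)
  show ?thesis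
  proof
    show "godement_unit T F U \<in> hom (sgrp F U) (sgrp (godement T F) U)" if "openin T U" for U
      using that by (intro homI) (auto simp: godement_def godement_unit_def germ_closed stalk_mult_same intro!: restrict_ext)
  next
    fix U V s assume a: "openin T U" "openin T V" "V \<subseteq> U" "s \<in> carrier (sgrp F U)"
    have "germ T F p V (sres F U V s) = germ T F p U s" if "p \<in> V" for p using germ_res a that by blast
    with a show "godement_unit T F V (sres F U V s) = sres (godement T F) U V (godement_unit T F U s)"
      by (auto simp: godement_def godement_unit_def restrict_def fun_eq_iff)
  qed
qed

end

section \<open>Cokernel presheaves and one step of the resolution\<close>

context ab_presheaf_hom
begin

lemma image_subgroup: "openin T U \<Longrightarrow> subgroup (\<phi> U ` carrier (sgrp F U)) (sgrp G U)"
  by (intro group_hom.img_is_subgroup)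
     (simp add: group_hom_def group_hom_axioms_def F.group G.group map_hom)

lemma image_normal: "openin T U \<Longrightarrow> (\<phi> U ` carrier (sgrp F U)) \<lhd> sgrp G U"
  by (simp add: G.grp comm_group.normal_iff_subgroup image_subgroup)

lemma coker_carrierE:
  assumes "A \<in> carrier (sgrp (coker F G \<phi>) U)"
  obtains t where "t \<in> carrier (sgrp G U)" "A = coker_proj F G \<phi> U t"
  using assms by (auto simp: coker_def coker_proj_def carrier_FactGroup)

lemma coker_proj_closed: "t \<in> carrier (sgrp G U) \<Longrightarrow> coker_proj F G \<phi> U t \<in> carrier (sgrp (coker F G \<phi>) U)"
  by (auto simp: coker_def coker_proj_def carrier_FactGroup)

lemma coker_proj_mult:
  assumes "openin T U" "s \<in> carrier (sgrp G U)" "t \<in> carrier (sgrp G U)"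
  shows "coker_proj F G \<phi> U s \<otimes>\<^bsub>sgrp (coker F G \<phi>) U\<^esub> coker_proj F G \<phi> U t = coker_proj F G \<phi> U (s \<otimes>\<^bsub>sgrp G U\<^esub> t)"
  using normal.rcos_sum[OF image_normal] assms by (simp add: coker_def coker_proj_def)

lemma coker_proj_eq_iff:
  assumes "openin T U" "s \<in> carrier (sgrp G U)" "t \<in> carrier (sgrp G U)"
  shows "coker_proj F G \<phi> U s = coker_proj F G \<phi> U t \<longleftrightarrow> (\<exists>r\<in>carrier (sgrp F U). s = \<phi> U r \<otimes>\<^bsub>sgrp G U\<^esub> t)"
    (is "?L \<longleftrightarrow> ?R")
proof
  assume ?L
  then have "s \<in> (\<phi> U ` carrier (sgrp F U)) #>\<^bsub>sgrp G U\<^esub> t"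
    using group.rcos_self[OF G.group[OF assms(1)] assms(2) image_subgroup[OF assms(1)]] by (simp add: coker_proj_def)
  then show ?R by (auto simp: r_coset_def)
next
  assume ?R
  then have "s \<in> (\<phi> U ` carrier (sgrp F U)) #>\<^bsub>sgrp G U\<^esub> t" by (auto simp: r_coset_def)
  then show ?L
    using group.repr_independence[OF G.group[OF assms(1)] _ assms(3) image_subgroup[OF assms(1)]] by (simp add: coker_proj_def)
qed

text \<open>Both the restriction maps of \<open>coker\<close> and \<open>coker_map\<close> multiply
  the image of a coset by a subgroup \<open>N\<close>. As \<open>h\<close> carries the old subgroup
  into \<open>N\<close>, the product is a single coset; this makes both of them computable on
  representatives.\<close>

lemma set_mult_image_coset:
  assumes H: "group H" and h: "h \<in> hom (sgrp G U) H" and N: "subgroup N H" and U: "openin T U"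
    and sub: "h ` \<phi> U ` carrier (sgrp F U) \<subseteq> N" and t: "t \<in> carrier (sgrp G U)"
  shows "N <#>\<^bsub>H\<^esub> (h ` ((\<phi> U ` carrier (sgrp F U)) #>\<^bsub>sgrp G U\<^esub> t)) = N #>\<^bsub>H\<^esub> h t"
proof -
  interpret H: group H by (rule H)
  interpret N: subgroup N H by (rule N)
  have ht: "h t \<in> carrier H" using h t hom_in_carrier by fastforce
  have "h ((\<phi> U r) \<otimes>\<^bsub>sgrp G U\<^esub> t) = h (\<phi> U r) \<otimes>\<^bsub>H\<^esub> h t" if "r \<in> carrier (sgrp F U)" for r
    using h hom_mult map_closed that U t by fastforce
  then have 1: "h ` ((\<phi> U ` carrier (sgrp F U)) #>\<^bsub>sgrp G U\<^esub> t) = (\<lambda>n. n \<otimes>\<^bsub>H\<^esub> h t) ` h ` \<phi> U ` carrier (sgrp F U)"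
    unfolding r_coset_def image_image by (auto simp: image_iff)
  \<comment> \<open>The image contains the unit, so the coset of \<open>t\<close> contains
    \<open>t\<close> itself; this gives the second inclusion.\<close>
  have one: "\<one>\<^bsub>H\<^esub> \<in> h ` \<phi> U ` carrier (sgrp F U)"
    using map_one[OF U] F.one_closed[OF U] hom_one[OF h G.group[OF U] H] by (metis image_eqI)
  show ?thesis
  proof
    show "N <#>\<^bsub>H\<^esub> (h ` ((\<phi> U ` carrier (sgrp F U)) #>\<^bsub>sgrp G U\<^esub> t)) \<subseteq> N #>\<^bsub>H\<^esub> h t"
      unfolding 1 using sub ht by (force simp: set_mult_def r_coset_def H.m_assoc[symmetric])
    show "N #>\<^bsub>H\<^esub> h t \<subseteq> N <#>\<^bsub>H\<^esub> (h ` ((\<phi> U ` carrier (sgrp F U)) #>\<^bsub>sgrp G U\<^esub> t))"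
      unfolding 1 using one ht H.l_one by (force simp: set_mult_def r_coset_def)
  qed
qed

lemma coker_proj_res:
  assumes "openin T U" "openin T V" "V \<subseteq> U" "t \<in> carrier (sgrp G U)"
  shows "sres (coker F G \<phi>) U V (coker_proj F G \<phi> U t) = coker_proj F G \<phi> V (sres G U V t)"
proof -
  have "sres G U V ` \<phi> U ` carrier (sgrp F U) \<subseteq> \<phi> V ` carrier (sgrp F V)"
    using assms by (auto simp flip: map_res intro!: imageI F.res_closed)
  then show ?thesis
    using set_mult_image_coset[of "sgrp G V" "sres G U V" U "\<phi> V ` carrier (sgrp F V)" t] assms
    by (simp add: coker_def coker_proj_def G.group G.res_hom image_subgroup)
qed

lemma coker_presheaf: "ab_presheaf T (coker F G \<phi>)"
proof (rule ab_presheaf.intro)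
  show "comm_group (sgrp (coker F G \<phi>) U)" if "openin T U" for U
    using comm_group.abelian_FactGroup[OF G.grp image_subgroup] that by (simp add: coker_def)
next
  fix U V assume *: "openin T U" "openin T V" "V \<subseteq> U"
  show "sres (coker F G \<phi>) U V \<in> hom (sgrp (coker F G \<phi>) U) (sgrp (coker F G \<phi>) V)"
  proof (rule homI)
    fix A assume "A \<in> carrier (sgrp (coker F G \<phi>) U)"
    then show "sres (coker F G \<phi>) U V A \<in> carrier (sgrp (coker F G \<phi>) V)"
      by (elim coker_carrierE) (use * in \<open>simp add: coker_proj_res coker_proj_closed G.res_closed\<close>)
    fix B assume "B \<in> carrier (sgrp (coker F G \<phi>) U)"
    with \<open>A \<in> _\<close> show "sres (coker F G \<phi>) U V (A \<otimes>\<^bsub>sgrp (coker F G \<phi>) U\<^esub> B) =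
        sres (coker F G \<phi>) U V A \<otimes>\<^bsub>sgrp (coker F G \<phi>) V\<^esub> sres (coker F G \<phi>) U V B"
      by (elim coker_carrierE) (use * in \<open>simp add: coker_proj_res coker_proj_mult G.res_closed G.mult_closed G.res_mult\<close>)
  qed
next
  fix U A assume *: "openin T U" "A \<in> carrier (sgrp (coker F G \<phi>) U)"
  then show "sres (coker F G \<phi>) U U A = A"
    by (elim coker_carrierE) (simp add: coker_proj_res G.res_id)
next
  fix U V W A assume *: "openin T U" "openin T V" "openin T W" "W \<subseteq> V" "V \<subseteq> U" "A \<in> carrier (sgrp (coker F G \<phi>) U)"
  then show "sres (coker F G \<phi>) V W (sres (coker F G \<phi>) U V A) = sres (coker F G \<phi>) U W A"
    by (elim coker_carrierE) (auto simp: coker_proj_res G.res_closed G.res_res)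
qed

lemma coker_proj_hom: "ab_presheaf_hom T G (coker F G \<phi>) (coker_proj F G \<phi>)"
proof -
  interpret C: ab_presheaf T "coker F G \<phi>" by (rule coker_presheaf)
  show ?thesis
    by unfold_locales (auto intro!: homI simp: coker_proj_closed coker_proj_mult coker_proj_res)
qed

lemma gd_step_presheaf: "ab_presheaf T (gd_step T F G \<phi>)"
  unfolding gd_step_def by (rule ab_presheaf.godement_presheaf[OF coker_presheaf])

lemma gd_step_d_hom: "ab_presheaf_hom T G (gd_step T F G \<phi>) (gd_step_d T F G \<phi>)"
proof -
  interpret S: ab_presheaf T "gd_step T F G \<phi>" by (rule gd_step_presheaf)
  interpret P: ab_presheaf_hom T G "coker F G \<phi>" "coker_proj F G \<phi>" by (rule coker_proj_hom)
  interpret N: ab_presheaf_hom T "coker F G \<phi>" "gd_step T F G \<phi>" "godement_unit T (coker F G \<phi>)"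
    unfolding gd_step_def by (rule P.G.godement_unit_hom)
  show ?thesis
    by unfold_locales
       (auto intro!: homI simp: gd_step_d_def N.map_closed P.map_closed P.map_mult N.map_mult P.map_res N.map_res)
qed

text \<open>The differential passes to the cokernel and then takes germs, so what it forgets is a
  local contribution from \<open>\<phi>\<close>. Exactness of the resolution enters the later
  arguments in this form.\<close>

lemma gd_step_d_eq_iff:
  assumes U: "openin T U" and s: "s \<in> carrier (sgrp G U)" and t: "t \<in> carrier (sgrp G U)"
  shows "gd_step_d T F G \<phi> U s = gd_step_d T F G \<phi> U t \<longleftrightarrow>
    (\<forall>p\<in>U. \<exists>W. openin T W \<and> p \<in> W \<and> W \<subseteq> U \<and>
       (\<exists>r\<in>carrier (sgrp F W). sres G U W s = \<phi> W r \<otimes>\<^bsub>sgrp G W\<^esub> sres G U W t))"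
proof -
  interpret P: ab_presheaf_hom T G "coker F G \<phi>" "coker_proj F G \<phi>" by (rule coker_proj_hom)
  have "gd_step_d T F G \<phi> U s = gd_step_d T F G \<phi> U t \<longleftrightarrow>
    (\<forall>p\<in>U. germ T (coker F G \<phi>) p U (coker_proj F G \<phi> U s) = germ T (coker F G \<phi>) p U (coker_proj F G \<phi> U t))"
    by (auto simp: gd_step_d_def godement_unit_def fun_eq_iff restrict_def)
  also have "\<dots> \<longleftrightarrow> (\<forall>p\<in>U. \<exists>W. openin T W \<and> p \<in> W \<and> W \<subseteq> U \<and>
      coker_proj F G \<phi> W (sres G U W s) = coker_proj F G \<phi> W (sres G U W t))"
    using U s t by (auto simp: P.G.germ_eq_iff coker_proj_closed coker_proj_res cong: conj_cong)
  also have "\<dots> \<longleftrightarrow> (\<forall>p\<in>U. \<exists>W. openin T W \<and> p \<in> W \<and> W \<subseteq> U \<and>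
       (\<exists>r\<in>carrier (sgrp F W). sres G U W s = \<phi> W r \<otimes>\<^bsub>sgrp G W\<^esub> sres G U W t))"
    using U s t by (simp add: coker_proj_eq_iff G.res_closed cong: conj_cong)
  finally show ?thesis .
qed

lemma gd_step_d_eq_one_iff:
  assumes U: "openin T U" and s: "s \<in> carrier (sgrp G U)"
  shows "gd_step_d T F G \<phi> U s = \<one>\<^bsub>sgrp (gd_step T F G \<phi>) U\<^esub> \<longleftrightarrow>
    (\<forall>p\<in>U. \<exists>W. openin T W \<and> p \<in> W \<and> W \<subseteq> U \<and> (\<exists>r\<in>carrier (sgrp F W). sres G U W s = \<phi> W r))"
proof -
  interpret D: ab_presheaf_hom T G "gd_step T F G \<phi>" "gd_step_d T F G \<phi>" by (rule gd_step_d_hom)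
  have *: "\<phi> W r \<otimes>\<^bsub>sgrp G W\<^esub> sres G U W \<one>\<^bsub>sgrp G U\<^esub> = \<phi> W r" if "openin T W" "W \<subseteq> U" "r \<in> carrier (sgrp F W)" for W r
    using that U by (simp add: G.res_one map_closed G.group group.is_monoid monoid.r_one)
  show ?thesis
    using gd_step_d_eq_iff[OF U s G.one_closed[OF U]] D.map_one[OF U] *
    by (metis (no_types, lifting))
qed

end

section \<open>Functoriality of a resolution step\<close>

locale ab_presheaf_square =
  f: ab_presheaf_hom T F F1 \<phi> + g: ab_presheaf_hom T G G1 \<phi>' +
  d: ab_presheaf_hom T F G d + e: ab_presheaf_hom T F1 G1 e
  for T :: "'x topology" and F :: "('x, 's) ab_sheaf" and F1 :: "('x, 's1) ab_sheaf"
    and G :: "('x, 't) ab_sheaf" and G1 :: "('x, 't1) ab_sheaf" and \<phi> \<phi>' d e +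
  assumes square: "\<lbrakk>openin T U; s \<in> carrier (sgrp F U)\<rbrakk> \<Longrightarrow> e U (\<phi> U s) = \<phi>' U (d U s)"
begin

lemma coker_map_proj:
  assumes "openin T U" "t \<in> carrier (sgrp F1 U)"
  shows "coker_map G G1 \<phi>' e U (coker_proj F F1 \<phi> U t) = coker_proj G G1 \<phi>' U (e U t)"
  unfolding coker_map_def coker_proj_def
  by (rule f.set_mult_image_coset)
     (use assms in \<open>auto simp: g.G.group e.map_hom g.image_subgroup square intro!: imageI d.map_closed\<close>)

lemma coker_map_hom:
  "ab_presheaf_hom T (coker F F1 \<phi>) (coker G G1 \<phi>') (coker_map G G1 \<phi>' e)"
proof -
  interpret C: ab_presheaf T "coker F F1 \<phi>" by (rule f.coker_presheaf)
  interpret C': ab_presheaf T "coker G G1 \<phi>'" by (rule g.coker_presheaf)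
  show ?thesis
  proof
    fix U assume U: "openin T U"
    show "coker_map G G1 \<phi>' e U \<in> hom (sgrp (coker F F1 \<phi>) U) (sgrp (coker G G1 \<phi>') U)"
    proof (rule homI)
      fix A assume "A \<in> carrier (sgrp (coker F F1 \<phi>) U)"
      then show "coker_map G G1 \<phi>' e U A \<in> carrier (sgrp (coker G G1 \<phi>') U)"
        by (elim f.coker_carrierE) (use U in \<open>simp add: coker_map_proj g.coker_proj_closed e.map_closed\<close>)
      fix B assume "B \<in> carrier (sgrp (coker F F1 \<phi>) U)"
      with \<open>A \<in> _\<close> show "coker_map G G1 \<phi>' e U (A \<otimes>\<^bsub>sgrp (coker F F1 \<phi>) U\<^esub> B) =
          coker_map G G1 \<phi>' e U A \<otimes>\<^bsub>sgrp (coker G G1 \<phi>') U\<^esub> coker_map G G1 \<phi>' e U B"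
        by (elim f.coker_carrierE)
           (use U in \<open>simp add: coker_map_proj f.coker_proj_mult g.coker_proj_mult e.map_closed e.map_mult f.G.mult_closed\<close>)
    qed
  next
    fix U V A assume *: "openin T U" "openin T V" "V \<subseteq> U" "A \<in> carrier (sgrp (coker F F1 \<phi>) U)"
    then show "coker_map G G1 \<phi>' e V (sres (coker F F1 \<phi>) U V A) = sres (coker G G1 \<phi>') U V (coker_map G G1 \<phi>' e U A)"
      by (elim f.coker_carrierE)
         (simp add: coker_map_proj f.coker_proj_res g.coker_proj_res e.map_closed e.map_res f.G.res_closed)
  qed
qed

text \<open>Both sides are families of germs of one class in the cokernel of \<open>\<phi>'\<close>.
  This naturality allows the differential of the two-term complex to be moved past the differential
  of the resolution.\<close>

lemma gd_map_step_d:
  assumes U: "openin T U" and t: "t \<in> carrier (sgrp F1 U)"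
  shows "godement_map T (coker G G1 \<phi>') (coker_map G G1 \<phi>' e) U (gd_step_d T F F1 \<phi> U t) =
         gd_step_d T G G1 \<phi>' U (e U t)"
proof -
  interpret C: ab_presheaf_hom T "coker F F1 \<phi>" "coker G G1 \<phi>'" "coker_map G G1 \<phi>' e" by (rule coker_map_hom)
  show ?thesis
    using assms
    by (auto simp: godement_map_def gd_step_d_def godement_unit_def C.stalk_map_germ f.coker_proj_closed coker_map_proj
        intro!: restrict_ext)
qed

lemma gd_map_hom:
  "ab_presheaf_hom T (gd_step T F F1 \<phi>) (gd_step T G G1 \<phi>')
     (godement_map T (coker G G1 \<phi>') (coker_map G G1 \<phi>' e))"
  unfolding gd_step_def by (rule ab_presheaf_hom.godement_map_hom[OF coker_map_hom])

end

context ab_presheaf_hom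
begin

lemma godement_map_unit:
  "\<lbrakk>openin T U; s \<in> carrier (sgrp F U)\<rbrakk> \<Longrightarrow> godement_map T G \<phi> U (godement_unit T F U s) = godement_unit T G U (\<phi> U s)"
  by (auto simp: godement_map_def godement_unit_def stalk_map_germ intro!: restrict_ext)

lemma godement_square:
  "ab_presheaf_square T F (gd0 T F) G (gd0 T G) (godement_unit T F) (godement_unit T G) \<phi> (gd_map0 T G \<phi>)"
proof -
  interpret u: ab_presheaf_hom T F "gd0 T F" "godement_unit T F" by (rule F.godement_unit_hom)
  interpret u': ab_presheaf_hom T G "gd0 T G" "godement_unit T G" by (rule G.godement_unit_hom)
  interpret m: ab_presheaf_hom T "gd0 T F" "gd0 T G" "gd_map0 T G \<phi>" by (rule godement_map_hom)
  show ?thesis by unfold_locales (simp add: godement_map_unit)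
qed

end

section \<open>First hypercohomology of a two-term complex\<close>

definition hyper_T1 where
  "hyper_T1 T F G = sgrp (gd1 T F) (topspace T) \<times>\<times> sgrp (gd0 T G) (topspace T)"

definition hyper_T2 where
  "hyper_T2 T F G = sgrp (gd2 T F) (topspace T) \<times>\<times> sgrp (gd1 T G) (topspace T)"

definition hyper_D0 where
  "hyper_D0 T F G d = (\<lambda>u. (gd_d0 T F (topspace T) u, gd_map0 T G d (topspace T) u))"

definition hyper_D1 where
  "hyper_D1 T F G d = (\<lambda>(a, w). (gd_d1 T F (topspace T) a,
     gd_map1 T G d (topspace T) a \<otimes>\<^bsub>sgrp (gd1 T G) (topspace T)\<^esub>
       inv\<^bsub>sgrp (gd1 T G) (topspace T)\<^esub> gd_d0 T G (topspace T) w))"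

definition hyper_Z where
  "hyper_Z T F G d = kernel (hyper_T1 T F G) (hyper_T2 T F G) (hyper_D1 T F G d)"

lemma hyper_H1_eq:
  "hyper_H1 T F G d = (hyper_T1 T F G)\<lparr>carrier := hyper_Z T F G d\<rparr> Mod
     (hyper_D0 T F G d ` carrier (sgrp (gd0 T F) (topspace T)))"
  by (simp add: hyper_H1_def hyper_T1_def hyper_T2_def hyper_D0_def hyper_D1_def hyper_Z_def Let_def)

text \<open>Over \<open>V\<close> the cocycle is the coboundary of \<open>u\<close> up to the
  contribution of a section \<alpha> of the second sheaf. That such pairs exist near every point is
  what being a cocycle amounts to, see \<open>hyper_Z_iff\<close>.\<close>

definition local_trivialisation ::
    "'x topology \<Rightarrow> ('x, 's) ab_sheaf \<Rightarrow> ('x, 't) ab_sheaf \<Rightarrow> ('x set \<Rightarrow> 's \<Rightarrow> 't) \<Rightarrow>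
     ('x \<Rightarrow> ('x set \<times> ('x \<Rightarrow> ('x set \<times> 's) set) set) set) \<times> ('x \<Rightarrow> ('x set \<times> 't) set) \<Rightarrow>
     'x set \<Rightarrow> ('x \<Rightarrow> ('x set \<times> 's) set) \<Rightarrow> 't \<Rightarrow> bool" where
  "local_trivialisation T F G d z V u \<alpha> \<longleftrightarrow> openin T V \<and> u \<in> carrier (sgrp (gd0 T F) V) \<and> \<alpha> \<in> carrier (sgrp G V) \<and>
     gd_d0 T F V u = restrict (fst z) V \<and>
     restrict (snd z) V = gd_map0 T G d V u \<otimes>\<^bsub>sgrp (gd0 T G) V\<^esub> godement_unit T G V \<alpha>"

context ab_presheaf_hom
begin

interpretation F0: ab_presheaf_hom T F "gd0 T F" "godement_unit T F" by (rule F.godement_unit_hom)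
interpretation G0: ab_presheaf_hom T G "gd0 T G" "godement_unit T G" by (rule G.godement_unit_hom)
interpretation F1: ab_presheaf_hom T "gd0 T F" "gd1 T F" "gd_d0 T F" by (rule F0.gd_step_d_hom)
interpretation G1: ab_presheaf_hom T "gd0 T G" "gd1 T G" "gd_d0 T G" by (rule G0.gd_step_d_hom)
interpretation F2: ab_presheaf_hom T "gd1 T F" "gd2 T F" "gd_d1 T F" by (rule F1.gd_step_d_hom)
interpretation m0: ab_presheaf_hom T "gd0 T F" "gd0 T G" "gd_map0 T G \<phi>" by (rule godement_map_hom)
interpretation sq: ab_presheaf_square T F "gd0 T F" G "gd0 T G" "godement_unit T F" "godement_unit T G" \<phi> "gd_map0 T G \<phi>"
  by (rule godement_square)
interpretation m1: ab_presheaf_hom T "gd1 T F" "gd1 T G" "gd_map1 T G \<phi>" by (rule sq.gd_map_hom)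

lemma gd_map1_d0: "\<lbrakk>openin T U; u \<in> carrier (sgrp (gd0 T F) U)\<rbrakk> \<Longrightarrow>
  gd_map1 T G \<phi> U (gd_d0 T F U u) = gd_d0 T G U (gd_map0 T G \<phi> U u)"
  by (rule sq.gd_map_step_d)

lemma hyper_T1_group: "group (hyper_T1 T F G)"
  unfolding hyper_T1_def by (intro DirProd_group F1.G.group G0.G.group openin_topspace)

lemma hyper_T2_group: "group (hyper_T2 T F G)"
  unfolding hyper_T2_def by (intro DirProd_group F2.G.group G1.G.group openin_topspace)

lemma hyper_D1_hom: "hyper_D1 T F G \<phi> \<in> hom (hyper_T1 T F G) (hyper_T2 T F G)"
proof (rule homI)
  let ?X = "topspace T"
  fix x assume "x \<in> carrier (hyper_T1 T F G)"
  then obtain a w where x: "x = (a, w)" "a \<in> carrier (sgrp (gd1 T F) ?X)" "w \<in> carrier (sgrp (gd0 T G) ?X)"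
    by (auto simp: hyper_T1_def)
  then show "hyper_D1 T F G \<phi> x \<in> carrier (hyper_T2 T F G)"
    by (auto simp: hyper_D1_def hyper_T2_def intro!: F2.map_closed G1.G.mult_closed m1.map_closed G1.G.inv_closed G1.map_closed)
  fix y assume "y \<in> carrier (hyper_T1 T F G)"
  then obtain b v where y: "y = (b, v)" "b \<in> carrier (sgrp (gd1 T F) ?X)" "v \<in> carrier (sgrp (gd0 T G) ?X)"
    by (auto simp: hyper_T1_def)
  interpret A: comm_group "sgrp (gd1 T G) ?X" by (rule G1.G.grp) simp
  have c: "gd_map1 T G \<phi> ?X a \<in> carrier (sgrp (gd1 T G) ?X)" "gd_map1 T G \<phi> ?X b \<in> carrier (sgrp (gd1 T G) ?X)"
    "gd_d0 T G ?X w \<in> carrier (sgrp (gd1 T G) ?X)" "gd_d0 T G ?X v \<in> carrier (sgrp (gd1 T G) ?X)"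
    using x y by (auto intro!: m1.map_closed G1.map_closed)
  show "hyper_D1 T F G \<phi> (x \<otimes>\<^bsub>hyper_T1 T F G\<^esub> y) = hyper_D1 T F G \<phi> x \<otimes>\<^bsub>hyper_T2 T F G\<^esub> hyper_D1 T F G \<phi> y"
    using x y c
    by (simp add: hyper_D1_def hyper_T1_def hyper_T2_def F2.map_mult m1.map_mult G1.map_mult A.inv_mult A.m_ac)
qed

lemma hyper_Z_subgroup: "subgroup (hyper_Z T F G \<phi>) (hyper_T1 T F G)"
  unfolding hyper_Z_def
  by (rule group_hom.subgroup_kernel) (simp add: group_hom_def group_hom_axioms_def hyper_T1_group hyper_T2_group hyper_D1_hom)

lemma hyper_Z_group: "group ((hyper_T1 T F G)\<lparr>carrier := hyper_Z T F G \<phi>\<rparr>)"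
  by (rule subgroup.subgroup_is_group[OF hyper_Z_subgroup hyper_T1_group])

lemma gd_restrict: "sres (gd0 T F) U V u = restrict u V" "sres (gd0 T G) U V w = restrict w V"
    "sres (gd1 T F) U V a = restrict a V"
  by (simp_all add: godement_def gd_step_def)

text \<open>Exactness is used twice. Closedness of \<open>a\<close> gives \<open>u\<close> locally
  with coboundary \<open>a\<close>; then \<open>w\<close> and the image of \<open>u\<close> have the
  same coboundary, so they differ locally by a section \<alpha>. Conversely both cocycle conditions
  are local.\<close>

lemma hyper_Z_iff:
  "(a, w) \<in> hyper_Z T F G \<phi> \<longleftrightarrow>
     a \<in> carrier (sgrp (gd1 T F) (topspace T)) \<and> w \<in> carrier (sgrp (gd0 T G) (topspace T)) \<and>
     (\<forall>p\<in>topspace T. \<exists>V u \<alpha>. p \<in> V \<and> local_trivialisation T F G \<phi> (a, w) V u \<alpha>)" (is "?L \<longleftrightarrow> ?R")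
proof (cases "a \<in> carrier (sgrp (gd1 T F) (topspace T)) \<and> w \<in> carrier (sgrp (gd0 T G) (topspace T))")
  case False
  then show ?thesis by (auto simp: hyper_Z_def kernel_def hyper_T1_def)
next
  case True
  let ?X = "topspace T"
  have a: "a \<in> carrier (sgrp (gd1 T F) ?X)" and w: "w \<in> carrier (sgrp (gd0 T G) ?X)" using True by auto
  interpret A: group "sgrp (gd1 T G) ?X" by (rule G1.G.group) simp
  have "?L \<longleftrightarrow> gd_d1 T F ?X a = \<one>\<^bsub>sgrp (gd2 T F) ?X\<^esub> \<and> gd_map1 T G \<phi> ?X a = gd_d0 T G ?X w"
    using True m1.map_closed[OF _ a] G1.map_closed[OF _ w]
    by (auto simp: hyper_Z_def kernel_def hyper_T1_def hyper_T2_def hyper_D1_def A.inv_solve_right')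
  also have "\<dots> \<longleftrightarrow> (\<forall>p\<in>?X. \<exists>V. openin T V \<and> p \<in> V \<and> (\<exists>u\<in>carrier (sgrp (gd0 T F) V).
       restrict a V = gd_d0 T F V u)) \<and> gd_map1 T G \<phi> ?X a = gd_d0 T G ?X w" (is "_ \<longleftrightarrow> ?M \<and> ?E")
    unfolding F1.gd_step_d_eq_one_iff[OF openin_topspace a] gd_restrict using openin_subset by blast
  also have "\<dots> \<longleftrightarrow> (\<forall>p\<in>?X. \<exists>V u \<alpha>. p \<in> V \<and> local_trivialisation T F G \<phi> (a, w) V u \<alpha>)" (is "_ \<longleftrightarrow> ?N")
  proof
    assume "?M \<and> ?E"
    then have M: ?M and E: ?E by auto
    show ?N
    proof
      fix p assume "p \<in> ?X"
      then obtain V u where V: "openin T V" "p \<in> V" and u: "u \<in> carrier (sgrp (gd0 T F) V)" "restrict a V = gd_d0 T F V u"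
        using M by blast
      have VX: "V \<subseteq> ?X" using V openin_subset by blast
      \<comment> \<open>By naturality the second cocycle condition says over \<open>V\<close> that
        \<open>w\<close> and the image of \<open>u\<close> have the same coboundary.\<close>
      have "gd_d0 T G V (restrict w V) = sres (gd1 T G) ?X V (gd_d0 T G ?X w)"
        using G1.map_res[of ?X V w] V VX w by (simp add: gd_restrict)
      also have "\<dots> = gd_map1 T G \<phi> V (restrict a V)"
        using m1.map_res[of ?X V a] V VX a by (simp add: gd_restrict E)
      also have "\<dots> = gd_d0 T G V (gd_map0 T G \<phi> V u)"
        using gd_map1_d0 V u by simp
      finally have e: "gd_d0 T G V (restrict w V) = gd_d0 T G V (gd_map0 T G \<phi> V u)" .
      have wV: "restrict w V \<in> carrier (sgrp (gd0 T G) V)"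
        using G0.G.res_closed[of ?X V w] V VX w by (simp add: gd_restrict)
      obtain W r where W: "openin T W" "p \<in> W" "W \<subseteq> V" "r \<in> carrier (sgrp G W)"
        and r: "restrict (restrict w V) W = godement_unit T G W r \<otimes>\<^bsub>sgrp (gd0 T G) W\<^esub> restrict (gd_map0 T G \<phi> V u) W"
        using e G0.gd_step_d_eq_iff[OF V(1) wV m0.map_closed[OF V(1) u(1)]] V by (auto simp: gd_restrict)
      interpret B: comm_group "sgrp (gd0 T G) W" by (rule G0.G.grp) (rule W)
      have "restrict w W = restrict (restrict w V) W" using W by (simp add: restrict_restrict Int_absorb1)
      also have "\<dots> = gd_map0 T G \<phi> W (restrict u W) \<otimes>\<^bsub>sgrp (gd0 T G) W\<^esub> godement_unit T G W r"
        using r m0.map_res[of V W u] V W u B.m_comm G0.map_closed[of W r] m0.map_closed[of W "sres (gd0 T F) V W u"]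
          F0.G.res_closed[of V W u]
        by (simp add: gd_restrict)
      finally have 1: "restrict w W = gd_map0 T G \<phi> W (restrict u W) \<otimes>\<^bsub>sgrp (gd0 T G) W\<^esub> godement_unit T G W r" .
      have 2: "gd_d0 T F W (restrict u W) = restrict a W"
        using F1.map_res[of V W u] V W u by (auto simp: gd_restrict restrict_def fun_eq_iff simp flip: u(2))
      have "local_trivialisation T F G \<phi> (a, w) W (restrict u W) r"
        using 1 2 W F0.G.res_closed[of V W u] V u by (simp add: local_trivialisation_def gd_restrict)
      with W show "\<exists>V u \<alpha>. p \<in> V \<and> local_trivialisation T F G \<phi> (a, w) V u \<alpha>" by blast
    qed
  next
    assume N: ?N
    then have M: ?M unfolding local_trivialisation_def fst_conv snd_conv by metis
    have "gd_map1 T G \<phi> ?X a p = gd_d0 T G ?X w p" if p: "p \<in> ?X" for p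
    proof -
      obtain V u \<alpha> where V: "openin T V" "p \<in> V" and u: "u \<in> carrier (sgrp (gd0 T F) V)" "\<alpha> \<in> carrier (sgrp G V)"
        and a': "gd_d0 T F V u = restrict a V"
        and w': "restrict w V = gd_map0 T G \<phi> V u \<otimes>\<^bsub>sgrp (gd0 T G) V\<^esub> godement_unit T G V \<alpha>"
        using N p unfolding local_trivialisation_def fst_conv snd_conv by blast
      have VX: "V \<subseteq> ?X" using V openin_subset by blast
      interpret B: group "sgrp (gd1 T G) V" by (rule G1.G.group) (rule V)
      \<comment> \<open>A family of germs of one section has trivial coboundary, so \<alpha> is
        invisible to the second cocycle condition.\<close>
      have "gd_d0 T G V (godement_unit T G V \<alpha>) = \<one>\<^bsub>sgrp (gd1 T G) V\<^esub>"
        using G0.gd_step_d_eq_one_iff[OF V(1) G0.map_closed[OF V(1) u(2)]] V u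
          G0.G.res_id[OF V(1) G0.map_closed[OF V(1) u(2)]] G.res_id[OF V(1) u(2)]
        by (meson G0.map_res order_refl)
      then have "gd_d0 T G V (restrict w V) = gd_d0 T G V (gd_map0 T G \<phi> V u)"
        unfolding w' using V u by (simp add: G1.map_mult m0.map_closed G0.map_closed G1.map_closed)
      also have "\<dots> = gd_map1 T G \<phi> V (restrict a V)"
        using gd_map1_d0 V u by (simp flip: a')
      finally have "sres (gd1 T G) ?X V (gd_d0 T G ?X w) = sres (gd1 T G) ?X V (gd_map1 T G \<phi> ?X a)"
        using G1.map_res[of ?X V w] m1.map_res[of ?X V a] V VX a w by (simp add: gd_restrict)
      then have "restrict (gd_d0 T G ?X w) V p = restrict (gd_map1 T G \<phi> ?X a) V p"
        by (simp add: gd_step_def godement_def)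
      then show ?thesis using V by simp
    qed
    then have "gd_map1 T G \<phi> ?X a = gd_d0 T G ?X w"
      using m1.map_closed[OF _ a] G1.map_closed[OF _ w]
      by (intro PiE_ext[of _ ?X]) (auto simp: gd_step_def godement_def)
    with M show "?M \<and> ?E" by blast
  qed
  finally show ?thesis using True by simp
qed

lemma local_trivialisation_res:
  assumes "local_trivialisation T F G \<phi> z V u \<alpha>" "openin T W" "W \<subseteq> V"
  shows "local_trivialisation T F G \<phi> z W (restrict u W) (sres G V W \<alpha>)"
proof -
  have V: "openin T V" and u: "u \<in> carrier (sgrp (gd0 T F) V)" "\<alpha> \<in> carrier (sgrp G V)"
    and a: "gd_d0 T F V u = restrict (fst z) V"
    and w: "restrict (snd z) V = gd_map0 T G \<phi> V u \<otimes>\<^bsub>sgrp (gd0 T G) V\<^esub> godement_unit T G V \<alpha>"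
    using assms by (auto simp: local_trivialisation_def)
  have "gd_d0 T F W (restrict u W) = restrict (restrict (fst z) V) W"
    using F1.map_res[of V W u] V assms u a by (simp add: gd_restrict)
  moreover have "restrict (restrict (snd z) V) W = gd_map0 T G \<phi> W (restrict u W) \<otimes>\<^bsub>sgrp (gd0 T G) W\<^esub> godement_unit T G W (sres G V W \<alpha>)"
    unfolding w using m0.map_res[of V W u] G0.map_res[of V W \<alpha>] V assms u
      G0.G.res_mult[of V W "gd_map0 T G \<phi> V u" "godement_unit T G V \<alpha>"]
    by (simp add: gd_restrict m0.map_closed G0.map_closed)
  moreover have "V \<inter> W = W" using assms by blast
  ultimately show ?thesis
    using assms(2,3) V u F0.G.res_closed[of V W u] G.res_closed[of V W \<alpha>]
    by (simp add: local_trivialisation_def gd_restrict restrict_restrict)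
qed

lemma local_trivialisation_mult:
  assumes "local_trivialisation T F G \<phi> z V u \<alpha>" "local_trivialisation T F G \<phi> z' V u' \<alpha>'"
  shows "local_trivialisation T F G \<phi> (z \<otimes>\<^bsub>hyper_T1 T F G\<^esub> z') V
    (u \<otimes>\<^bsub>sgrp (gd0 T F) V\<^esub> u') (\<alpha> \<otimes>\<^bsub>sgrp G V\<^esub> \<alpha>')"
proof -
  have V: "openin T V" and u: "u \<in> carrier (sgrp (gd0 T F) V)" "\<alpha> \<in> carrier (sgrp G V)"
    and u': "u' \<in> carrier (sgrp (gd0 T F) V)" "\<alpha>' \<in> carrier (sgrp G V)"
    using assms by (auto simp: local_trivialisation_def)
  have VX: "V \<subseteq> topspace T" using V openin_subset by blast
  obtain a w a' w' where z: "z = (a, w)" "z' = (a', w')" by (metis surj_pair)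
  have m: "restrict (a \<otimes>\<^bsub>sgrp (gd1 T F) (topspace T)\<^esub> a') V = restrict a V \<otimes>\<^bsub>sgrp (gd1 T F) V\<^esub> restrict a' V"
    "restrict (w \<otimes>\<^bsub>sgrp (gd0 T G) (topspace T)\<^esub> w') V = restrict w V \<otimes>\<^bsub>sgrp (gd0 T G) V\<^esub> restrict w' V"
    using VX by (auto simp: gd_step_def godement_def restrict_def fun_eq_iff)
  interpret B: comm_group "sgrp (gd0 T G) V" by (rule G0.G.grp) (rule V)
  show ?thesis
    using assms V u u'
    by (simp add: local_trivialisation_def z hyper_T1_def m F0.G.mult_closed G.mult_closed F1.map_mult m0.map_mult
        m0.map_closed G0.map_closed G0.map_mult B.m_ac)
qed

text \<open>Equal coboundaries make the cochains differ near \<open>p\<close> by a section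
  \<open>h\<close>. In the stalk at \<open>p\<close> the common value of the second component then
  forces the relation between \<alpha>, \<open>\<alpha>'\<close> and \<open>h\<close>; as an
  equality of germs it persists on a smaller \<open>W\<close>.\<close>

lemma local_trivialisation_compare:
  assumes "local_trivialisation T F G \<phi> z V u \<alpha>" "local_trivialisation T F G \<phi> z V u' \<alpha>'" and p: "p \<in> V"
  obtains W h where "openin T W" "p \<in> W" "W \<subseteq> V" "h \<in> carrier (sgrp F W)"
    "\<And>q. q \<in> W \<Longrightarrow> u' q = germ T F q W h \<otimes>\<^bsub>stalk T F q\<^esub> u q"
    "sres G V W \<alpha> = sres G V W \<alpha>' \<otimes>\<^bsub>sgrp G W\<^esub> \<phi> W h"
proof -
  have V: "openin T V" and u: "u \<in> carrier (sgrp (gd0 T F) V)" "\<alpha> \<in> carrier (sgrp G V)"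
    and u': "u' \<in> carrier (sgrp (gd0 T F) V)" "\<alpha>' \<in> carrier (sgrp G V)"
    using assms by (auto simp: local_trivialisation_def)
  have "gd_d0 T F V u' = gd_d0 T F V u" using assms by (simp add: local_trivialisation_def)
  then obtain W0 h0 where W0: "openin T W0" "p \<in> W0" "W0 \<subseteq> V" and h0: "h0 \<in> carrier (sgrp F W0)"
    and h0': "restrict u' W0 = godement_unit T F W0 h0 \<otimes>\<^bsub>sgrp (gd0 T F) W0\<^esub> restrict u W0"
    using F0.gd_step_d_eq_iff[OF V u'(1) u(1)] p by (auto simp: gd_restrict)
  have hu: "u' q = germ T F q W0 h0 \<otimes>\<^bsub>stalk T F q\<^esub> u q" if "q \<in> W0" for q
    using fun_cong[OF h0', of q] that by (simp add: godement_def godement_unit_def)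
  have pX: "p \<in> topspace T" using W0 openin_subset by blast
  interpret S: comm_group "stalk T G p" by (rule G.stalk_comm_group) (rule pX)
  have up: "u p \<in> carrier (stalk T F p)" "u' p \<in> carrier (stalk T F p)"
    using u u' p by (auto simp: F.godement_carrier)
  have gc: "germ T F p W0 h0 \<in> carrier (stalk T F p)" using W0 h0 by (simp add: F.germ_closed)
  have "snd z p = stalk_map T G \<phi> p (u p) \<otimes>\<^bsub>stalk T G p\<^esub> germ T G p V \<alpha>"
    if "local_trivialisation T F G \<phi> z V u \<alpha>" for u \<alpha>
  proof -
    have "restrict (snd z) V p = (gd_map0 T G \<phi> V u \<otimes>\<^bsub>sgrp (gd0 T G) V\<^esub> godement_unit T G V \<alpha>) p"
      using that by (simp add: local_trivialisation_def)
    then show ?thesis using p by (simp add: godement_def godement_map_def godement_unit_def)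
  qed
  from this[OF assms(1)] this[OF assms(2)]
  have "stalk_map T G \<phi> p (u p) \<otimes>\<^bsub>stalk T G p\<^esub> germ T G p V \<alpha> = stalk_map T G \<phi> p (u' p) \<otimes>\<^bsub>stalk T G p\<^esub> germ T G p V \<alpha>'"
    by simp
  also have "stalk_map T G \<phi> p (u' p) = germ T G p W0 (\<phi> W0 h0) \<otimes>\<^bsub>stalk T G p\<^esub> stalk_map T G \<phi> p (u p)"
    using hu[OF W0(2)] stalk_map_mult[OF gc up(1)] stalk_map_germ W0 h0 by simp
  finally have e: "stalk_map T G \<phi> p (u p) \<otimes>\<^bsub>stalk T G p\<^esub> germ T G p V \<alpha> =
     germ T G p W0 (\<phi> W0 h0) \<otimes>\<^bsub>stalk T G p\<^esub> stalk_map T G \<phi> p (u p) \<otimes>\<^bsub>stalk T G p\<^esub> germ T G p V \<alpha>'" .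
  have c: "stalk_map T G \<phi> p (u p) \<in> carrier (stalk T G p)" "germ T G p W0 (\<phi> W0 h0) \<in> carrier (stalk T G p)"
    "germ T G p V \<alpha> \<in> carrier (stalk T G p)" "germ T G p V \<alpha>' \<in> carrier (stalk T G p)"
    using up W0 h0 V p u u' by (auto simp: stalk_map_closed G.germ_closed map_closed)
  \<comment> \<open>Reordering in the commutative stalk puts the image of \<open>u p\<close> in
    front on both sides, where it can be cancelled.\<close>
  then have "stalk_map T G \<phi> p (u p) \<otimes>\<^bsub>stalk T G p\<^esub> germ T G p V \<alpha> =
      stalk_map T G \<phi> p (u p) \<otimes>\<^bsub>stalk T G p\<^esub> (germ T G p V \<alpha>' \<otimes>\<^bsub>stalk T G p\<^esub> germ T G p W0 (\<phi> W0 h0))"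
    using e by (simp add: S.m_ac)
  with c have "germ T G p V \<alpha> = germ T G p V \<alpha>' \<otimes>\<^bsub>stalk T G p\<^esub> germ T G p W0 (\<phi> W0 h0)"
    by simp
  also have "\<dots> = germ T G p W0 (sres G V W0 \<alpha>' \<otimes>\<^bsub>sgrp G W0\<^esub> \<phi> W0 h0)"
    using G.germ_res[OF V W0(1,2,3) u'(2)] W0 V u' h0 G.stalk_mult_same[of W0 p "sres G V W0 \<alpha>'" "\<phi> W0 h0"]
    by (simp add: G.res_closed map_closed)
  finally obtain W where W: "openin T W" "p \<in> W" "W \<subseteq> V" "W \<subseteq> W0"
    and r: "sres G V W \<alpha> = sres G W0 W (sres G V W0 \<alpha>' \<otimes>\<^bsub>sgrp G W0\<^esub> \<phi> W0 h0)"
    using G.germ_eq_iff[OF V p u(2) W0(1,2), of "sres G V W0 \<alpha>' \<otimes>\<^bsub>sgrp G W0\<^esub> \<phi> W0 h0"] W0 V u' h0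
    by (auto simp: G.mult_closed G.res_closed map_closed)
  show thesis
  proof (rule that[of W "sres F W0 W h0"])
    show "u' q = germ T F q W (sres F W0 W h0) \<otimes>\<^bsub>stalk T F q\<^esub> u q" if "q \<in> W" for q
      using hu[of q] F.germ_res[of W0 W q h0] W W0 h0 that by auto
    show "sres G V W \<alpha> = sres G V W \<alpha>' \<otimes>\<^bsub>sgrp G W\<^esub> \<phi> W (sres F W0 W h0)"
      unfolding r using W W0 V h0 u' by (simp add: G.res_mult G.res_closed map_closed map_res G.res_res)
  qed (use W W0 h0 F.res_closed in auto)
qed

lemma gd_d0_change:
  assumes V: "openin T V" and h: "h \<in> carrier (sgrp F V)" and u: "u \<in> carrier (sgrp (gd0 T F) V)"
  shows "gd_d0 T F V (godement_unit T F V h \<otimes>\<^bsub>sgrp (gd0 T F) V\<^esub> u) = gd_d0 T F V u"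
proof -
  note hu = F0.G.mult_closed[OF V F0.map_closed[OF V h] u]
  have "sres (gd0 T F) V V (godement_unit T F V h \<otimes>\<^bsub>sgrp (gd0 T F) V\<^esub> u) =
      godement_unit T F V h \<otimes>\<^bsub>sgrp (gd0 T F) V\<^esub> sres (gd0 T F) V V u"
    unfolding F0.G.res_id[OF V hu] F0.G.res_id[OF V u] ..
  then show ?thesis
    unfolding F0.gd_step_d_eq_iff[OF V hu u] using V h by (intro ballI exI[of _ V] conjI bexI[of _ h]) auto
qed

text \<open>The section \<open>h\<close> enters the second component twice with opposite signs,
  through the new cochain and through the corrected form. An \<open>h\<close> whose image is
  \<alpha> therefore removes \<alpha> altogether; this is how flat generators lead to
  coboundaries.\<close>

lemma local_trivialisation_change:
  assumes lt: "local_trivialisation T F G \<phi> z V u \<alpha>" and h: "h \<in> carrier (sgrp F V)"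
  shows "local_trivialisation T F G \<phi> z V (godement_unit T F V h \<otimes>\<^bsub>sgrp (gd0 T F) V\<^esub> u) (\<alpha> \<otimes>\<^bsub>sgrp G V\<^esub> inv\<^bsub>sgrp G V\<^esub> \<phi> V h)"
proof -
  have V: "openin T V" and u: "u \<in> carrier (sgrp (gd0 T F) V)" and \<alpha>: "\<alpha> \<in> carrier (sgrp G V)"
    using lt by (auto simp: local_trivialisation_def)
  interpret A: comm_group "sgrp (gd0 T G) V" by (rule G0.G.grp[OF V])
  note \<phi>h = map_closed[OF V h] and i = G.inv_closed[OF V map_closed[OF V h]]
  note c = G0.map_closed[OF V \<alpha>] m0.map_closed[OF V u] G0.map_closed[OF V \<phi>h]
  have "gd_map0 T G \<phi> V (godement_unit T F V h \<otimes>\<^bsub>sgrp (gd0 T F) V\<^esub> u) =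
      godement_unit T G V (\<phi> V h) \<otimes>\<^bsub>sgrp (gd0 T G) V\<^esub> gd_map0 T G \<phi> V u"
    unfolding m0.map_mult[OF V F0.map_closed[OF V h] u] godement_map_unit[OF V h] ..
  moreover have "godement_unit T G V (\<alpha> \<otimes>\<^bsub>sgrp G V\<^esub> inv\<^bsub>sgrp G V\<^esub> \<phi> V h) =
      godement_unit T G V \<alpha> \<otimes>\<^bsub>sgrp (gd0 T G) V\<^esub> inv\<^bsub>sgrp (gd0 T G) V\<^esub> godement_unit T G V (\<phi> V h)"
    unfolding G0.map_mult[OF V \<alpha> i] G0.map_inv[OF V \<phi>h] ..
  moreover have "g \<otimes>\<^bsub>sgrp (gd0 T G) V\<^esub> m \<otimes>\<^bsub>sgrp (gd0 T G) V\<^esub> (a \<otimes>\<^bsub>sgrp (gd0 T G) V\<^esub> inv\<^bsub>sgrp (gd0 T G) V\<^esub> g) =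
      m \<otimes>\<^bsub>sgrp (gd0 T G) V\<^esub> a"
    if "g \<in> carrier (sgrp (gd0 T G) V)" "m \<in> carrier (sgrp (gd0 T G) V)" "a \<in> carrier (sgrp (gd0 T G) V)" for g m a
  proof -
    define i where "i = inv\<^bsub>sgrp (gd0 T G) V\<^esub> g"
    have i: "i \<in> carrier (sgrp (gd0 T G) V)" "g \<otimes>\<^bsub>sgrp (gd0 T G) V\<^esub> i = \<one>\<^bsub>sgrp (gd0 T G) V\<^esub>"
      using that by (simp_all add: i_def)
    have "g \<otimes>\<^bsub>sgrp (gd0 T G) V\<^esub> m \<otimes>\<^bsub>sgrp (gd0 T G) V\<^esub> (a \<otimes>\<^bsub>sgrp (gd0 T G) V\<^esub> inv\<^bsub>sgrp (gd0 T G) V\<^esub> g) =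
       (m \<otimes>\<^bsub>sgrp (gd0 T G) V\<^esub> a) \<otimes>\<^bsub>sgrp (gd0 T G) V\<^esub> (g \<otimes>\<^bsub>sgrp (gd0 T G) V\<^esub> i)"
      unfolding i_def[symmetric] using that i(1) by (simp add: A.m_ac)
    also have "\<dots> = m \<otimes>\<^bsub>sgrp (gd0 T G) V\<^esub> a" using that i(2) by simp
    finally show ?thesis .
  qed
  ultimately show ?thesis
    using lt V u \<alpha> h c F0.G.mult_closed[OF V F0.map_closed[OF V h] u] G.mult_closed[OF V \<alpha> i]
    by (simp add: local_trivialisation_def gd_d0_change)
qed

lemma unit_one_right:
  assumes "openin T V" "x \<in> carrier (sgrp (gd0 T G) V)"
  shows "x \<otimes>\<^bsub>sgrp (gd0 T G) V\<^esub> godement_unit T G V \<one>\<^bsub>sgrp G V\<^esub> = x"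
  using assms by (simp add: G0.map_one G0.G.group group.is_monoid monoid.r_one)

text \<open>Cochains of the resolution are functions on the space and may be compared at each point,
  where one of the trivialisations by the same global \<open>v\<close> is available.\<close>

lemma hyper_D0_eqI:
  assumes z: "z \<in> hyper_Z T F G \<phi>" and v: "v \<in> carrier (sgrp (gd0 T F) (topspace T))"
    and lt: "\<And>p. p \<in> topspace T \<Longrightarrow> \<exists>V. p \<in> V \<and> local_trivialisation T F G \<phi> z V (restrict v V) \<one>\<^bsub>sgrp G V\<^esub>"
  shows "z = hyper_D0 T F G \<phi> v"
proof -
  let ?X = "topspace T"
  have zc: "fst z \<in> carrier (sgrp (gd1 T F) ?X)" "snd z \<in> carrier (sgrp (gd0 T G) ?X)"
    using z hyper_Z_iff[of "fst z" "snd z"] by auto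
  have eq: "fst z p = gd_d0 T F ?X v p \<and> snd z p = gd_map0 T G \<phi> ?X v p" if p: "p \<in> ?X" for p
  proof -
    obtain V where V: "p \<in> V" and l: "local_trivialisation T F G \<phi> z V (restrict v V) \<one>\<^bsub>sgrp G V\<^esub>" using lt[OF p] by blast
    have o: "openin T V" using l by (simp add: local_trivialisation_def)
    then have VX: "V \<subseteq> ?X" by (rule openin_subset)
    have vV: "restrict v V \<in> carrier (sgrp (gd0 T F) V)" using l by (simp add: local_trivialisation_def)
    have "restrict (gd_d0 T F ?X v) V = restrict (fst z) V"
      using F1.map_res[OF openin_topspace o VX v] l by (simp add: gd_restrict local_trivialisation_def)
    moreover have "restrict (gd_map0 T G \<phi> ?X v) V = restrict (snd z) V"
      using m0.map_res[OF openin_topspace o VX v] l unit_one_right[OF o m0.map_closed[OF o vV]]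
      by (simp add: gd_restrict local_trivialisation_def)
    ultimately show ?thesis using V by (metis restrict_apply')
  qed
  have "fst z = gd_d0 T F ?X v"
    by (rule PiE_ext[of _ ?X "\<lambda>p. carrier (stalk T (coker F (gd0 T F) (godement_unit T F)) p)"])
       (use zc(1) F1.map_closed[OF openin_topspace v] eq in \<open>auto simp: gd_step_def godement_def\<close>)
  moreover have "snd z = gd_map0 T G \<phi> ?X v"
    by (rule PiE_ext[of _ ?X "\<lambda>p. carrier (stalk T G p)"])
       (use zc(2) m0.map_closed[OF openin_topspace v] eq in \<open>auto simp: godement_def\<close>)
  ultimately show ?thesis by (simp add: hyper_D0_def prod_eq_iff)
qed

lemma hyper_D0_trivialisation:
  assumes v: "v \<in> carrier (sgrp (gd0 T F) (topspace T))"
  shows "local_trivialisation T F G \<phi> (hyper_D0 T F G \<phi> v) (topspace T) v \<one>\<^bsub>sgrp G (topspace T)\<^esub>"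
    and "hyper_D0 T F G \<phi> v \<in> hyper_Z T F G \<phi>"
proof -
  let ?X = "topspace T"
  note c = F1.map_closed[OF openin_topspace v] m0.map_closed[OF openin_topspace v]
  have "restrict (gd_d0 T F ?X v) ?X = gd_d0 T F ?X v" "restrict (gd_map0 T G \<phi> ?X v) ?X = gd_map0 T G \<phi> ?X v"
    using F1.G.res_id[OF openin_topspace c(1)] G0.G.res_id[OF openin_topspace c(2)] by (simp_all add: gd_restrict)
  then show l: "local_trivialisation T F G \<phi> (hyper_D0 T F G \<phi> v) ?X v \<one>\<^bsub>sgrp G ?X\<^esub>"
    using v c by (simp add: local_trivialisation_def hyper_D0_def unit_one_right G.one_closed)
  then show "hyper_D0 T F G \<phi> v \<in> hyper_Z T F G \<phi>"
    using c unfolding hyper_D0_def hyper_Z_iff by blast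
qed

text \<open>A cochain of the Godement resolution may be prescribed point by point: \<open>z\<close>
  takes at \<open>q\<close> the value that the data chosen for \<open>q\<close> have there.
  Compatibility ensures that the data chosen for \<open>p\<close> give these values throughout
  \<open>V p\<close>.\<close>

lemma hyper_Z_family:
  assumes V: "\<And>p. p \<in> topspace T \<Longrightarrow> openin T (V p) \<and> p \<in> V p \<and> u p \<in> carrier (sgrp (gd0 T F) (V p)) \<and> \<alpha> p \<in> carrier (sgrp G (V p))"
    and comp: "\<And>p q. \<lbrakk>p \<in> topspace T; q \<in> V p\<rbrakk> \<Longrightarrow> \<exists>r\<in>carrier (sgrp F (V p \<inter> V q)).
        restrict (u p) (V p \<inter> V q) = godement_unit T F (V p \<inter> V q) r \<otimes>\<^bsub>sgrp (gd0 T F) (V p \<inter> V q)\<^esub> restrict (u q) (V p \<inter> V q) \<and>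
        sres G (V q) (V p \<inter> V q) (\<alpha> q) = sres G (V p) (V p \<inter> V q) (\<alpha> p) \<otimes>\<^bsub>sgrp G (V p \<inter> V q)\<^esub> \<phi> (V p \<inter> V q) r"
  obtains z where "z \<in> hyper_Z T F G \<phi>" "\<And>p. p \<in> topspace T \<Longrightarrow> local_trivialisation T F G \<phi> z (V p) (u p) (\<alpha> p)"
proof -
  let ?X = "topspace T"
  define b where "b p = gd_map0 T G \<phi> (V p) (u p) \<otimes>\<^bsub>sgrp (gd0 T G) (V p)\<^esub> godement_unit T G (V p) (\<alpha> p)" for p
  define z where "z = ((\<lambda>q\<in>?X. gd_d0 T F (V q) (u q) q), (\<lambda>q\<in>?X. b q q))"
  have b: "b p \<in> carrier (sgrp (gd0 T G) (V p))" if "p \<in> ?X" for p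
    unfolding b_def using V[OF that] by (intro G0.G.mult_closed m0.map_closed G0.map_closed) auto
  \<comment> \<open>The data for \<open>p\<close> and for \<open>q\<close> differ on the overlap by
    \<open>r\<close>, whose coboundary is trivial and whose image in the second sheaf cancels
    against the change of \<alpha>.\<close>
  have eq: "gd_d0 T F (V p) (u p) q = gd_d0 T F (V q) (u q) q \<and> b p q = b q q" if p: "p \<in> ?X" and q: "q \<in> V p" for p q
  proof -
    have qX: "q \<in> ?X" using V[OF p] q openin_subset by blast
    define W where "W = V p \<inter> V q"
    have W: "openin T W" "W \<subseteq> V p" "W \<subseteq> V q" "q \<in> W" using V[OF p] V[OF qX] q by (auto simp: W_def)
    note o = V[OF p, THEN conjunct1] V[OF qX, THEN conjunct1]
    have up: "u p \<in> carrier (sgrp (gd0 T F) (V p))" "\<alpha> p \<in> carrier (sgrp G (V p))" using V[OF p] by auto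
    have uq: "u q \<in> carrier (sgrp (gd0 T F) (V q))" "\<alpha> q \<in> carrier (sgrp G (V q))" using V[OF qX] by auto
    obtain r where r: "r \<in> carrier (sgrp F W)"
      and ru: "restrict (u p) W = godement_unit T F W r \<otimes>\<^bsub>sgrp (gd0 T F) W\<^esub> restrict (u q) W"
      and r\<alpha>: "sres G (V q) W (\<alpha> q) = sres G (V p) W (\<alpha> p) \<otimes>\<^bsub>sgrp G W\<^esub> \<phi> W r"
      using comp[OF p q] unfolding W_def by blast
    have uqW: "restrict (u q) W \<in> carrier (sgrp (gd0 T F) W)"
      using F0.G.res_closed[OF o(2) W(1,3) uq(1)] by (simp add: gd_restrict)
    have upW: "restrict (u p) W \<in> carrier (sgrp (gd0 T F) W)"
      using F0.G.res_closed[OF o(1) W(1,2) up(1)] by (simp add: gd_restrict)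
    have "restrict (gd_d0 T F (V p) (u p)) W = restrict (gd_d0 T F (V q) (u q)) W"
      using F1.map_res[OF o(1) W(1,2) up(1)] F1.map_res[OF o(2) W(1,3) uq(1)] gd_d0_change[OF W(1) r uqW] ru
      by (simp add: gd_restrict)
    then have 1: "gd_d0 T F (V p) (u p) q = gd_d0 T F (V q) (u q) q" using W(4) by (metis restrict_apply')
    interpret A: comm_group "sgrp (gd0 T G) W" by (rule G0.G.grp[OF W(1)])
    have bW: "restrict (b p) W = gd_map0 T G \<phi> W (restrict (u p) W) \<otimes>\<^bsub>sgrp (gd0 T G) W\<^esub> godement_unit T G W (sres G (V p) W (\<alpha> p))"
      if "p \<in> ?X" "W \<subseteq> V p" for p
    proof -
      have *: "openin T (V p)" "u p \<in> carrier (sgrp (gd0 T F) (V p))" "\<alpha> p \<in> carrier (sgrp G (V p))" using V[OF that(1)] by auto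
      show ?thesis
        unfolding b_def
        using G0.G.res_mult[OF *(1) W(1) that(2) m0.map_closed[OF *(1,2)] G0.map_closed[OF *(1,3)]]
          m0.map_res[OF *(1) W(1) that(2) *(2)] G0.map_res[OF *(1) W(1) that(2) *(3)] by (simp add: gd_restrict)
    qed
    note c = G0.map_closed[OF W(1) map_closed[OF W(1) r]] m0.map_closed[OF W(1) uqW]
      G0.map_closed[OF W(1) G.res_closed[OF o(1) W(1,2) up(2)]]
    have "restrict (b p) W = restrict (b q) W"
      unfolding bW[OF p W(2)] bW[OF qX W(3)] ru r\<alpha> m0.map_mult[OF W(1) F0.map_closed[OF W(1) r] uqW] godement_map_unit[OF W(1) r]
        G0.map_mult[OF W(1) G.res_closed[OF o(1) W(1,2) up(2)] map_closed[OF W(1) r]]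
      using c by (simp add: A.m_ac)
    then have "b p q = b q q" using W(4) by (metis restrict_apply')
    with 1 show ?thesis by simp
  qed
  have lt: "local_trivialisation T F G \<phi> z (V p) (u p) (\<alpha> p)" if p: "p \<in> ?X" for p
  proof -
    have Vp: "openin T (V p)" "u p \<in> carrier (sgrp (gd0 T F) (V p))" "\<alpha> p \<in> carrier (sgrp G (V p))" using V[OF p] by auto
    have sub: "V p \<subseteq> ?X" using Vp openin_subset by blast
    have "gd_d0 T F (V p) (u p) = restrict (fst z) (V p)"
    proof
      fix q show "gd_d0 T F (V p) (u p) q = restrict (fst z) (V p) q"
        using eq[OF p, of q] sub F1.map_closed[OF Vp(1,2)]
        by (cases "q \<in> V p") (auto simp: z_def gd_step_def godement_def PiE_iff extensional_def)
    qed
    moreover have "restrict (snd z) (V p) = b p"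
    proof
      fix q show "restrict (snd z) (V p) q = b p q"
        using eq[OF p, of q] sub b[OF p] by (cases "q \<in> V p") (auto simp: z_def godement_def PiE_iff extensional_def)
    qed
    ultimately show ?thesis using Vp by (simp add: local_trivialisation_def b_def)
  qed
  have "gd_d0 T F (V q) (u q) q \<in> carrier (stalk T (coker F (gd0 T F) (godement_unit T F)) q)" if "q \<in> ?X" for q
    using F1.map_closed[of "V q" "u q"] V[OF that] by (auto simp: gd_step_def godement_def)
  then have "fst z \<in> carrier (sgrp (gd1 T F) ?X)" by (auto simp: z_def gd_step_def godement_def)
  moreover have "snd z \<in> carrier (sgrp (gd0 T G) ?X)" using b V by (fastforce simp: z_def godement_def)
  ultimately have "(fst z, snd z) \<in> hyper_Z T F G \<phi>"
    unfolding hyper_Z_iff using lt V by (auto simp: z_def)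
  then show thesis using that lt by simp
qed

lemma hyper_D0_one: "hyper_D0 T F G \<phi> \<one>\<^bsub>sgrp (gd0 T F) (topspace T)\<^esub> = \<one>\<^bsub>hyper_T1 T F G\<^esub>"
proof -
  interpret F0: ab_presheaf_hom T F "gd0 T F" "godement_unit T F" by (rule F.godement_unit_hom)
  interpret F1: ab_presheaf_hom T "gd0 T F" "gd1 T F" "gd_d0 T F" by (rule F0.gd_step_d_hom)
  interpret m0: ab_presheaf_hom T "gd0 T F" "gd0 T G" "gd_map0 T G \<phi>" by (rule godement_map_hom)
  show ?thesis by (simp add: hyper_D0_def hyper_T1_def F1.map_one m0.map_one)
qed

end

section \<open>Locality of smoothness and tangent vectors\<close>

text \<open>A partial derivative sees the values on a line through \<open>x\<close>. This line stays
  in the open set for parameters near \<open>x i\<close>, and it stays in the model space because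
  only a coordinate below \<open>n\<close> is moved.\<close>

lemma Euclidean_update_nhd:
  assumes S: "openin (Euclidean_space n) S" and x: "x \<in> S" and i: "i < n"
  shows "\<exists>N. open N \<and> x i \<in> N \<and> (\<forall>t\<in>N. x(i := t) \<in> S)"
proof -
  obtain A where A: "open A" "S = A \<inter> topspace (Euclidean_space n)"
    using S by (auto simp: Euclidean_space_def openin_subtopology euclidean_product_topology)
  have "continuous_on UNIV (\<lambda>t. x(i := t))"
  proof (rule continuous_on_coordinatewise_then_product)
    show "continuous_on UNIV (\<lambda>t. (x(i := t)) j)" for j by (cases "j = i") auto
  qed
  then have "open ((\<lambda>t. x(i := t)) -` A)"
    using A(1) by (simp add: continuous_on_open_vimage)
  moreover have "x(i := t) \<in> topspace (Euclidean_space n)" for t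
    using x A i by (auto simp: topspace_Euclidean_space)
  ultimately show ?thesis
    using x A by (intro exI[of _ "(\<lambda>t. x(i := t)) -` A"]) auto
qed

text \<open>The partial derivatives in \<open>Ck_on\<close> are taken along full lines and do not
  refer to the set; only the continuity requirements become weaker.\<close>

lemma Ck_on_subset:
  assumes "Ck_on n k S f" "S' \<subseteq> S" shows "Ck_on n k S' f"
  using assms by (induction k arbitrary: f) (auto intro: continuous_map_from_subtopology_mono)

text \<open>Openness is essential: the derivative of \<open>g\<close> at a point of \<open>S\<close>
  involves nearby values on a line, and the two functions are known to agree only inside
  \<open>S\<close>.\<close>

lemma Ck_on_cong:
  assumes "Ck_on n k S f" "openin (Euclidean_space n) S" "\<And>x. x \<in> S \<Longrightarrow> f x = g x"
  shows "Ck_on n k S g"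
  using assms(1,3)
proof (induction k arbitrary: f g)
  case 0
  then show ?case by (auto elim!: continuous_map_eq)
next
  case (Suc k)
  have d: "((\<lambda>t. g (x(i := t))) has_vector_derivative D) (at (x i))"
    if "((\<lambda>t. f (x(i := t))) has_vector_derivative D) (at (x i))" "x \<in> S" "i < n" for x i D
  proof -
    obtain N where "open N" "x i \<in> N" "\<forall>t\<in>N. x(i := t) \<in> S"
      using Euclidean_update_nhd[OF assms(2) \<open>x \<in> S\<close> \<open>i < n\<close>] by blast
    then show ?thesis
      using has_vector_derivative_transform_within_open[OF that(1), of N "\<lambda>t. g (x(i := t))"] Suc.prems(2) by auto
  qed
  have c: "continuous_map (subtopology (Euclidean_space n) S) euclidean g"
    using Suc.prems by (auto elim!: continuous_map_eq)
  have "(\<lambda>t. g (x(i := t))) differentiable at (x i) \<and>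
      vector_derivative (\<lambda>t. f (x(i := t))) (at (x i)) = vector_derivative (\<lambda>t. g (x(i := t))) (at (x i))"
    if "x \<in> S" "i < n" for x i
  proof -
    have "((\<lambda>t. f (x(i := t))) has_vector_derivative vector_derivative (\<lambda>t. f (x(i := t))) (at (x i))) (at (x i))"
      using Suc.prems(1) that by (simp add: vector_derivative_works[symmetric])
    from d[OF this that] show ?thesis
      by (auto simp: vector_derivative_at intro: differentiableI_vector)
  qed
  note e = this
  have "Ck_on n k S (\<lambda>x. vector_derivative (\<lambda>t. g (x(i := t))) (at (x i)))" if "i < n" for i
    by (rule Suc.IH[of "\<lambda>x. vector_derivative (\<lambda>t. f (x(i := t))) (at (x i))"])
       (use Suc.prems(1) e that in \<open>simp_all del: fun_upd_apply\<close>)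
  with c e show ?case by simp
qed

lemma continuous_map_local:
  assumes X: "openin X S" and f: "\<And>x. x \<in> S \<Longrightarrow> \<exists>S'. openin X S' \<and> x \<in> S' \<and> S' \<subseteq> S \<and> continuous_map (subtopology X S') Y f"
  shows "continuous_map (subtopology X S) Y f"
proof (rule pasting_lemma[where I = "{S'. openin X S' \<and> S' \<subseteq> S \<and> continuous_map (subtopology X S') Y f}"
      and T = id and f = "\<lambda>_. f"])
  fix i assume i: "i \<in> {S'. openin X S' \<and> S' \<subseteq> S \<and> continuous_map (subtopology X S') Y f}"
  show "openin (subtopology X S) (id i)" using i X by (simp add: openin_open_subtopology)
  show "continuous_map (subtopology (subtopology X S) (id i)) Y f"
    using i by (simp add: subtopology_subtopology Int_absorb1)
next
  fix x assume "x \<in> topspace (subtopology X S)"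
  then have "x \<in> S" by simp
  from f[OF this] show "\<exists>j. j \<in> {S'. openin X S' \<and> S' \<subseteq> S \<and> continuous_map (subtopology X S') Y f} \<and> x \<in> id j \<and> f x = f x"
    by auto
qed simp

text \<open>Derivatives do not depend on the set, so at every order only continuity has to be pasted
  together.\<close>

lemma Ck_on_local:
  assumes "openin (Euclidean_space n) S"
    and "\<And>x. x \<in> S \<Longrightarrow> \<exists>S'. openin (Euclidean_space n) S' \<and> x \<in> S' \<and> S' \<subseteq> S \<and> Ck_on n k S' f"
  shows "Ck_on n k S f"
  using assms(2)
proof (induction k arbitrary: f)
  case 0
  then show ?case by (simp add: continuous_map_local[OF assms(1)])
next
  case (Suc k)
  have "continuous_map (subtopology (Euclidean_space n) S) euclidean f"
  proof (rule continuous_map_local[OF assms(1)])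
    fix x assume "x \<in> S"
    from Suc.prems[OF this] show "\<exists>S'. openin (Euclidean_space n) S' \<and> x \<in> S' \<and> S' \<subseteq> S \<and>
        continuous_map (subtopology (Euclidean_space n) S') euclidean f" by auto
  qed
  moreover have "(\<lambda>t. f (x(i := t))) differentiable at (x i)" if "x \<in> S" "i < n" for x i
    using Suc.prems[OF that(1)] that(2) by auto
  moreover have "Ck_on n k S (\<lambda>x. vector_derivative (\<lambda>t. f (x(i := t))) (at (x i)))" if "i < n" for i
  proof (rule Suc.IH)
    fix x assume "x \<in> S"
    from Suc.prems[OF this] that show "\<exists>S'. openin (Euclidean_space n) S' \<and> x \<in> S' \<and> S' \<subseteq> S \<and>
        Ck_on n k S' (\<lambda>x. vector_derivative (\<lambda>t. f (x(i := t))) (at (x i)))" by auto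
  qed
  ultimately show ?case by simp
qed

lemma Ck_on_const: "Ck_on n k S (\<lambda>_. c)"
  by (induction k arbitrary: c) auto

text \<open>Restriction of vector fields: a section over \<open>W\<close> is normalised to the zero
  functional outside \<open>W\<close>, so restricting changes the representing function.\<close>

definition vf_cut :: "'x set \<Rightarrow> 'x vfield \<Rightarrow> 'x vfield" where
  "vf_cut W v = (\<lambda>p. if p \<in> W then v p else (\<lambda>_. 0))"

section \<open>Smooth functions, tangent vectors and vector fields on a manifold\<close>

context
  fixes M :: "'x mfd"
  assumes man: "smooth_manifold M"
begin

lemma chartD:
  assumes "(U, \<phi>) \<in> charts M"
  shows "openin (mtop M) U" "inj_on \<phi> U" "openin (mtop M) W \<Longrightarrow> openin (Euclidean_space (mdim M)) (\<phi> ` (U \<inter> W))"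
proof -
  have *: "openin (mtop M) U" "openin (Euclidean_space (mdim M)) (\<phi> ` U)"
    "homeomorphic_map (subtopology (mtop M) U) (subtopology (Euclidean_space (mdim M)) (\<phi> ` U)) \<phi>"
    using man assms by (auto simp: smooth_manifold_def)
  show "openin (mtop M) U" by (rule *)
  have "topspace (subtopology (mtop M) U) = U"
    using openin_subset[OF *(1)] by auto
  then show "inj_on \<phi> U" using homeomorphic_imp_injective_map[OF *(3)] by simp
  assume "openin (mtop M) W"
  then have "openin (subtopology (mtop M) U) (U \<inter> W)" using *(1) by (simp add: openin_open_subtopology openin_Int)
  then have "openin (subtopology (Euclidean_space (mdim M)) (\<phi> ` U)) (\<phi> ` (U \<inter> W))"
    using homeomorphic_map_openness_eq[OF *(3)] by blast
  then show "openin (Euclidean_space (mdim M)) (\<phi> ` (U \<inter> W))"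
    using *(2) by (simp add: openin_open_subtopology)
qed

lemma smooth_subset: "\<lbrakk>smooth M W f; V \<subseteq> W\<rbrakk> \<Longrightarrow> smooth M V f"
  unfolding smooth_def Cinf_on_def by (fast elim: Ck_on_subset)

lemma smooth_cong:
  assumes "smooth M W f" "openin (mtop M) W" "\<And>x. x \<in> W \<Longrightarrow> f x = g x"
  shows "smooth M W g"
  unfolding smooth_def Cinf_on_def
proof (intro ballI, clarify)
  fix U \<phi> k assume c: "(U, \<phi>) \<in> charts M"
  have "Ck_on (mdim M) k (\<phi> ` (U \<inter> W)) (\<lambda>y. f (inv_into U \<phi> y))"
    using assms(1) c by (auto simp: smooth_def Cinf_on_def)
  then show "Ck_on (mdim M) k (\<phi> ` (U \<inter> W)) (\<lambda>y. g (inv_into U \<phi> y))"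
  proof (rule Ck_on_cong)
    show "openin (Euclidean_space (mdim M)) (\<phi> ` (U \<inter> W))" using chartD[OF c] assms(2) by blast
    fix y assume "y \<in> \<phi> ` (U \<inter> W)"
    then have "inv_into U \<phi> y \<in> W" using chartD(2)[OF c] by auto
    then show "f (inv_into U \<phi> y) = g (inv_into U \<phi> y)" by (rule assms(3))
  qed
qed

lemma smooth_local:
  assumes W: "openin (mtop M) W"
    and "\<And>p. p \<in> W \<Longrightarrow> \<exists>V. openin (mtop M) V \<and> p \<in> V \<and> V \<subseteq> W \<and> smooth M V f"
  shows "smooth M W f"
  unfolding smooth_def Cinf_on_def
proof (intro ballI, clarify)
  fix U \<phi> k assume c: "(U, \<phi>) \<in> charts M"
  show "Ck_on (mdim M) k (\<phi> ` (U \<inter> W)) (\<lambda>y. f (inv_into U \<phi> y))"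
  proof (rule Ck_on_local)
    show "openin (Euclidean_space (mdim M)) (\<phi> ` (U \<inter> W))" using chartD[OF c] W by blast
    fix y assume "y \<in> \<phi> ` (U \<inter> W)"
    then obtain p where p: "p \<in> U" "p \<in> W" "y = \<phi> p" by auto
    then obtain V where V: "openin (mtop M) V" "p \<in> V" "V \<subseteq> W" "smooth M V f" using assms by blast
    show "\<exists>S'. openin (Euclidean_space (mdim M)) S' \<and> y \<in> S' \<and> S' \<subseteq> \<phi> ` (U \<inter> W) \<and>
        Ck_on (mdim M) k S' (\<lambda>y. f (inv_into U \<phi> y))"
      using V p c chartD(3)[OF c V(1)]
      by (intro exI[of _ "\<phi> ` (U \<inter> V)"]) (auto simp: smooth_def Cinf_on_def)
  qed
qed

lemma smooth_const: "smooth M W (\<lambda>_. c)"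
  by (simp add: smooth_def Cinf_on_def Ck_on_const)

lemma smooth_cut_iff: "\<lbrakk>openin (mtop M) W; W \<subseteq> V\<rbrakk> \<Longrightarrow> smooth M W (cut V f) \<longleftrightarrow> smooth M W f"
  using smooth_cong[of W f "cut V f"] smooth_cong[of W "cut V f" f] by (auto simp: cut_def subset_iff)

lemma smooth_nearI: "\<lbrakk>smooth M U f; openin (mtop M) U; p \<in> U\<rbrakk> \<Longrightarrow> smooth_near M p f"
  by (auto simp: smooth_near_def)

lemma smooth_near_const: "p \<in> topspace (mtop M) \<Longrightarrow> smooth_near M p (\<lambda>_. c)"
  using smooth_const smooth_nearI by blast

text \<open>Tangent vectors depend on germs, and smoothness near \<open>p\<close> passes from
  \<open>f\<close> to \<open>g\<close>. This permits functions to be exchanged with their cut-off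
  versions.\<close>

lemma tangent_cong:
  assumes "D \<in> tangent M p" "smooth M U f" "openin (mtop M) U" "p \<in> U" "\<And>x. x \<in> U \<Longrightarrow> f x = g x"
  shows "D f = D g"
proof -
  have "smooth_near M p f" "smooth_near M p g"
    using smooth_nearI smooth_cong[OF assms(2,3,5)] assms by blast+
  then show ?thesis using assms unfolding tangent_def mem_Collect_eq by blast
qed

lemma tangent_add: "\<lbrakk>D \<in> tangent M p; smooth_near M p f; smooth_near M p g\<rbrakk> \<Longrightarrow> D (\<lambda>x. f x + g x) = D f + D g"
  and tangent_mult: "\<lbrakk>D \<in> tangent M p; smooth_near M p f; smooth_near M p g\<rbrakk> \<Longrightarrow> D (\<lambda>x. f x * g x) = f p * D g + g p * D f"
  and tangent_scale: "\<lbrakk>D \<in> tangent M p; smooth_near M p f\<rbrakk> \<Longrightarrow> D (\<lambda>x. c * f x) = c * D f"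
  unfolding tangent_def by blast+

lemma tangent_const:
  assumes "D \<in> tangent M p" "p \<in> topspace (mtop M)" shows "D (\<lambda>_. c) = 0"
proof -
  \<comment> \<open>The Leibniz rule for \<open>1 = 1 * 1\<close> gives
    \<open>D 1 = 2 * D 1\<close>.\<close>
  have "D (\<lambda>x. 1 * 1) = 1 * D (\<lambda>_. 1) + 1 * D (\<lambda>_. 1)"
    by (rule tangent_mult) (use assms smooth_near_const in auto)
  then have "D (\<lambda>_. 1) = 0" by simp
  then show ?thesis using tangent_scale[OF assms(1) smooth_near_const[OF assms(2)], of c 1] by simp
qed

lemma vf_cut_vfields:
  assumes v: "v \<in> vfields M U" and W: "openin (mtop M) W" "W \<subseteq> U"
  shows "vf_cut W v \<in> vfields M W"
  unfolding vfields_def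
proof (intro CollectI conjI allI impI ballI)
  fix V f assume V: "openin (mtop M) V \<and> V \<subseteq> W \<and> smooth M V f"
  then have "smooth M V (\<lambda>p. v p f)" using v W unfolding vfields_def by blast
  then show "smooth M V (\<lambda>p. vf_cut W v p f)"
    using V by (elim smooth_cong) (auto simp: vf_cut_def)
qed (use v W in \<open>auto simp: vfields_def vf_cut_def\<close>)

lemma vf_cut_P_fields:
  "\<lbrakk>v \<in> P_fields M P U; openin (mtop M) W; W \<subseteq> U\<rbrakk> \<Longrightarrow> vf_cut W v \<in> P_fields M P W"
  using vf_cut_vfields by (auto simp: P_fields_def vf_cut_def)

lemma vf_cut_lifts:
  "\<lbrakk>v \<in> lifts M P U \<tau>; openin (mtop M) W; W \<subseteq> U\<rbrakk> \<Longrightarrow> vf_cut W v \<in> lifts M P W \<tau>"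
  using vf_cut_vfields by (auto simp: lifts_def vf_cut_def)

end

section \<open>The structure sheaf and sheaves of modules\<close>

locale lie_algebroid_space =
  fixes M :: "'x mfd" and P :: "'x distrib" and B :: "('x, 'b) lie_algd"
  assumes man: "smooth_manifold M"
    and sub: "subbundle M P"
    and algd: "lie_algebroid M P B"
    and free: "locally_free_finite_rank M P B"
begin

abbreviation "op U \<equiv> openin (mtop M) U"
abbreviation "OX U \<equiv> carrier (OXP M P U)"

lemma OXP_simps [simp]:
  "f \<otimes>\<^bsub>OXP M P U\<^esub> g = (\<lambda>x. f x * g x)" "f \<oplus>\<^bsub>OXP M P U\<^esub> g = (\<lambda>x. f x + g x)"
  "\<one>\<^bsub>OXP M P U\<^esub> = cut U (\<lambda>_. 1)" "\<zero>\<^bsub>OXP M P U\<^esub> = (\<lambda>_. 0)"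
  by (simp_all add: OXP_def)

lemma OX_iff: "f \<in> OX U \<longleftrightarrow> smooth M U f \<and> (\<forall>x. x \<notin> U \<longrightarrow> f x = 0) \<and>
    (\<forall>V v. op V \<and> V \<subseteq> U \<and> v \<in> P_fields M P V \<longrightarrow> (\<forall>p\<in>V. v p f = 0))"
  by (auto simp: OXP_def smooth_funs_def)

text \<open>That the sections of \<open>B\<close> form modules includes that their scalars form a
  commutative ring, so closure of the structure sheaf under sums and products is read off from the
  hypothesis on \<open>B\<close>.\<close>

lemma OX_cring: "op U \<Longrightarrow> cring (OXP M P U)"
  using algd by (simp add: lie_algebroid_def omodule_def module_def)

lemma OX_off: "\<lbrakk>f \<in> OX U; x \<notin> U\<rbrakk> \<Longrightarrow> f x = 0"
  by (simp add: OX_iff)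

lemma cut_OX_eq: "f \<in> OX U \<Longrightarrow> cut U f = f"
  by (auto simp: cut_def OX_off)

lemma cut_cut [simp]: "cut V (cut U f) = cut (U \<inter> V) f"
  by (auto simp: cut_def)

lemma cut_zero [simp]: "cut U (\<lambda>_. 0) = (\<lambda>_. 0)"
  by (auto simp: cut_def)

lemma OX_smooth_near: "\<lbrakk>f \<in> OX U; op U; p \<in> U\<rbrakk> \<Longrightarrow> smooth_near M p f"
  using OX_iff smooth_nearI[OF man] by blast

lemma OX_cut:
  assumes f: "f \<in> OX U" and V: "op V" "V \<subseteq> U"
  shows "cut V f \<in> OX V"
  unfolding OX_iff
proof (intro conjI allI impI ballI)
  show "smooth M V (cut V f)"
    using smooth_cut_iff[OF man V(1) subset_refl] smooth_subset[OF man _ V(2)] f by (auto simp: OX_iff)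
  fix W v p assume W: "op W \<and> W \<subseteq> V \<and> v \<in> P_fields M P W" and p: "p \<in> W"
  then have "v p f = 0" using f V unfolding OX_iff by blast
  moreover have "v p f = v p (cut V f)"
  proof (rule tangent_cong[OF man, of "v p" p W])
    show "v p \<in> tangent M p" using W p by (auto simp: P_fields_def vfields_def)
    show "smooth M W f" using f W V smooth_subset[OF man, of U f W] unfolding OX_iff by blast
  qed (use W p in \<open>auto simp: cut_def\<close>)
  ultimately show "v p (cut V f) = 0" by simp
qed (simp add: cut_def)

text \<open>Smoothness is local, and whether a field of \<open>P\<close> kills the function at a
  point is tested after restricting the field to a small neighbourhood.\<close>

lemma OX_local:
  assumes U: "op U" and off: "\<And>x. x \<notin> U \<Longrightarrow> f x = 0"
    and loc: "\<And>p. p \<in> U \<Longrightarrow> \<exists>V. op V \<and> p \<in> V \<and> V \<subseteq> U \<and> cut V f \<in> OX V"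
  shows "f \<in> OX U"
  unfolding OX_iff
proof (intro conjI allI impI ballI)
  have smV: "smooth M V f" if "op V" "V \<subseteq> U" "cut V f \<in> OX V" for V
    using that smooth_cut_iff[OF man, of V V f] by (simp add: OX_iff)
  show "smooth M U f"
    using loc smV by (intro smooth_local[OF man U]) metis
  fix W v p assume W: "op W \<and> W \<subseteq> U \<and> v \<in> P_fields M P W" and p: "p \<in> W"
  obtain V where V: "op V" "p \<in> V" "V \<subseteq> U" "cut V f \<in> OX V" using loc W p by blast
  have VW: "op (V \<inter> W)" using V W by blast
  have "vf_cut (V \<inter> W) v \<in> P_fields M P (V \<inter> W)"
    using vf_cut_P_fields[OF man _ VW] W by blast
  moreover have "p \<in> V \<inter> W" using V p by blast
  ultimately have "vf_cut (V \<inter> W) v p (cut V f) = 0"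
    using V(4) VW unfolding OX_iff by blast
  then have "v p (cut V f) = 0" using V p by (simp add: vf_cut_def)
  moreover have "v p f = v p (cut V f)"
  proof (rule tangent_cong[OF man, of "v p" p V])
    show "v p \<in> tangent M p" using W p by (auto simp: P_fields_def vfields_def)
    show "smooth M V f" by (rule smV) (use V in auto)
  qed (use V p in \<open>auto simp: cut_def\<close>)
  ultimately show "v p f = 0" by simp
qed (rule off)

lemma OX_const: "op U \<Longrightarrow> cut U (\<lambda>_. c) \<in> OX U"
  unfolding OX_iff
proof (intro conjI allI impI ballI)
  assume U: "op U"
  show "smooth M U (cut U (\<lambda>_. c))"
    using smooth_cut_iff[OF man U subset_refl] smooth_const[OF man] by blast
  fix W v p assume W: "op W \<and> W \<subseteq> U \<and> v \<in> P_fields M P W" and p: "p \<in> W"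
  then have v: "v p \<in> tangent M p" by (auto simp: P_fields_def vfields_def)
  have "v p (\<lambda>_. c) = v p (cut U (\<lambda>_. c))"
    by (rule tangent_cong[OF man v smooth_const[OF man], of W]) (use W p in \<open>auto simp: cut_def\<close>)
  moreover have "v p (\<lambda>_. c) = 0"
    using tangent_const[OF man v] W p openin_subset by blast
  ultimately show "v p (cut U (\<lambda>_. c)) = 0" by simp
qed (simp add: cut_def)

lemma OX_zero: "op U \<Longrightarrow> (\<lambda>_. 0) \<in> OX U"
  using OX_const[of U 0] by simp

lemma OX_add: "\<lbrakk>op U; f \<in> OX U; g \<in> OX U\<rbrakk> \<Longrightarrow> (\<lambda>x. f x + g x) \<in> OX U"
  using ring.ring_simprules(1)[OF cring.axioms(1)[OF OX_cring], of U f g] by simp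

lemma OX_mult: "\<lbrakk>op U; f \<in> OX U; g \<in> OX U\<rbrakk> \<Longrightarrow> (\<lambda>x. f x * g x) \<in> OX U"
  using monoid.m_closed[OF ring.is_monoid[OF cring.axioms(1)[OF OX_cring]], of U f g] by simp

lemma OX_scale:
  assumes "op U" "f \<in> OX U" shows "(\<lambda>x. c * f x) \<in> OX U"
proof -
  have "(\<lambda>x. cut U (\<lambda>_. c) x * f x) = (\<lambda>x. c * f x)" using assms by (auto simp: cut_def OX_off)
  then show ?thesis using OX_mult[OF assms(1) OX_const[OF assms(1)] assms(2), of c] by simp
qed

lemma OX_minus: "\<lbrakk>op U; f \<in> OX U\<rbrakk> \<Longrightarrow> (\<lambda>x. - f x) \<in> OX U"
  using OX_scale[of U f "-1"] by simp

lemma OX_diff: "\<lbrakk>op U; f \<in> OX U; g \<in> OX U\<rbrakk> \<Longrightarrow> (\<lambda>x. f x - g x) \<in> OX U"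
  using OX_add[of U f "\<lambda>x. - g x"] OX_minus[of U g] by simp

lemma OX_a_inv: "\<lbrakk>op U; f \<in> OX U\<rbrakk> \<Longrightarrow> \<ominus>\<^bsub>OXP M P U\<^esub> f = (\<lambda>x. - f x)"
  by (rule abelian_group.minus_equality[OF ring.is_abelian_group[OF cring.axioms(1)[OF OX_cring]]])
     (auto simp: OX_minus)

text \<open>Membership in the structure sheaf speaks of vector fields in \<open>P\<close> over open
  sets. A single vector of \<open>P p\<close> is a constant combination of the values at
  \<open>p\<close> of local frame fields, and these are such vector fields.\<close>

lemma P_kills:
  assumes w: "w \<in> P p" and p: "p \<in> U" and U: "op U" and f: "f \<in> OX U"
  shows "w f = 0"
proof -
  have pX: "p \<in> topspace (mtop M)" using p U openin_subset by blast
  obtain V r v where V: "op V" "p \<in> V" and v': "\<forall>i<r. v i \<in> vfields M V"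
    and PV': "\<forall>q\<in>V. P q = {\<lambda>f. \<Sum>i<r. c i * v i q f | c :: nat \<Rightarrow> complex. True}"
    using bspec[OF sub[unfolded subbundle_def] pX] by blast
  note v = v'[rule_format] and PV = bspec[OF PV']
  obtain c :: "nat \<Rightarrow> complex" where c: "w = (\<lambda>f. \<Sum>i<r. c i * v i p f)"
    using w PV[OF V(2)] by auto
  have "v i p f = 0" if i: "i < r" for i
  proof -
    have "v i q \<in> P q" if "q \<in> V" for q
    proof -
      have "v i q = (\<lambda>f. \<Sum>j<r. (if j = i then 1 else 0) * v j q f)"
        using i by (simp add: if_distrib[of "\<lambda>x. x * _"] cong: if_cong)
      then show ?thesis unfolding PV[OF that] by (intro CollectI exI[of _ "\<lambda>j. if j = i then 1 else 0"] conjI TrueI)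
    qed
    then have "v i \<in> P_fields M P V" using v[OF i] by (simp add: P_fields_def)
    then have "vf_cut (U \<inter> V) (v i) \<in> P_fields M P (U \<inter> V)"
      using vf_cut_P_fields[OF man, of "v i" P V "U \<inter> V"] U V by auto
    then have "vf_cut (U \<inter> V) (v i) p f = 0"
      using f U V p unfolding OX_iff by blast
    then show ?thesis using p V by (simp add: vf_cut_def)
  qed
  then show ?thesis by (simp add: c)
qed

lemma zero_in_P:
  assumes "p \<in> topspace (mtop M)" shows "(\<lambda>_. 0) \<in> P p"
proof -
  obtain V r and v :: "nat \<Rightarrow> 'x vfield"
    where V: "p \<in> V" "\<forall>q\<in>V. P q = {\<lambda>f. \<Sum>i<r. c i * v i q f | c :: nat \<Rightarrow> complex. True}"
    using bspec[OF sub[unfolded subbundle_def] assms] by blast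
  show ?thesis
    unfolding bspec[OF V(2,1)] by (intro CollectI exI[of _ "\<lambda>_. 0"] conjI TrueI) simp
qed

subsection \<open>Derivatives along the anchor\<close>

lemma lift_ex:
  assumes "\<tau> \<in> TXP M P U" "p \<in> U"
  obtains W v where "op W" "p \<in> W" "W \<subseteq> U" "v \<in> lifts M P W \<tau>"
proof -
  have "\<forall>p\<in>U. \<exists>W. op W \<and> p \<in> W \<and> W \<subseteq> U \<and> lifts M P W \<tau> \<noteq> {}"
    using assms(1) unfolding TXP_def mem_Collect_eq by (elim conjE)
  with assms(2) that show thesis by blast
qed

text \<open>Representatives of a class differ by vectors of \<open>P p\<close>, which kill
  \<open>f\<close>, so the description in \<open>txp_apply\<close> has exactly one value.\<close>

lemma txp_apply_eq:
  assumes "\<tau> \<in> TXP M P U" "op U" "f \<in> OX U" "p \<in> U" "v \<in> \<tau> p"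
  shows "txp_apply U \<tau> f p = v f"
proof -
  obtain W u where W: "op W" "p \<in> W" "W \<subseteq> U" "u \<in> lifts M P W \<tau>" using lift_ex assms by blast
  then have "\<tau> p = qclass P p (u p)" by (simp add: lifts_def)
  then have e: "v' f = u p f" if "v' \<in> \<tau> p" for v'
    using that P_kills[OF _ assms(4,2,3)] by (auto simp: qclass_def)
  have "(THE c. \<exists>v\<in>\<tau> p. c = v f) = v f"
  proof (rule the_equality)
    show "\<exists>w\<in>\<tau> p. v f = w f" using assms(5) by blast
    fix c assume "\<exists>w\<in>\<tau> p. c = w f"
    then show "c = v f" using e e[OF assms(5)] by auto
  qed
  then show ?thesis using assms(4) by (simp add: txp_apply_def)
qed

lemma txp_tangent:
  assumes "\<tau> \<in> TXP M P U" "op U" "p \<in> U"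
  obtains v where "v \<in> \<tau> p" "v \<in> tangent M p"
proof -
  obtain W u where W: "op W" "p \<in> W" "W \<subseteq> U" "u \<in> lifts M P W \<tau>" using lift_ex assms by blast
  have "u p \<in> qclass P p (u p)"
    using zero_in_P[of p] openin_subset[OF assms(2)] assms(3) by (force simp: qclass_def)
  moreover have "u p \<in> tangent M p" "\<tau> p = qclass P p (u p)" using W by (auto simp: lifts_def vfields_def)
  ultimately show thesis using that by simp
qed

lemma txp_lift_eq:
  assumes "\<tau> \<in> TXP M P U" "op U" "f \<in> OX U" "v \<in> lifts M P W \<tau>" "W \<subseteq> U" "p \<in> W"
  shows "txp_apply U \<tau> f p = v p f"
proof (rule txp_apply_eq[OF assms(1-3)])
  have "p \<in> topspace (mtop M)" using assms openin_subset by blast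
  then have "v p \<in> qclass P p (v p)"
    using zero_in_P[of p] by (force simp: qclass_def)
  then show "v p \<in> \<tau> p" using assms by (simp add: lifts_def)
qed (use assms in auto)

text \<open>For \<open>w\<close> in \<open>P\<close> and a lift \<open>v\<close> of
  \<open>\<tau>\<close> one has \<open>w (v f) = [w, v] f + v (w f)\<close>. The bracket lies in
  \<open>P\<close> by invariance of \<open>\<tau>\<close> and so kills \<open>f\<close>, and
  \<open>w f\<close> vanishes.\<close>

lemma txp_apply_closed:
  assumes \<tau>: "\<tau> \<in> TXP M P U" and U: "op U" and f: "f \<in> OX U"
  shows "txp_apply U \<tau> f \<in> OX U"
  unfolding OX_iff
proof (intro conjI allI impI ballI)
  have sm: "smooth M W (\<lambda>q. v q f)" "smooth M W (txp_apply U \<tau> f)"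
    if "op W" "W \<subseteq> U" "v \<in> lifts M P W \<tau>" for W v
  proof -
    have "smooth M W f" using f that smooth_subset[OF man] by (auto simp: OX_iff)
    then show 1: "smooth M W (\<lambda>q. v q f)" using that by (auto simp: lifts_def vfields_def)
    show "smooth M W (txp_apply U \<tau> f)"
      by (rule smooth_cong[OF man 1]) (use that in \<open>auto simp: txp_lift_eq[OF \<tau> U f]\<close>)
  qed
  show "smooth M U (txp_apply U \<tau> f)"
  proof (rule smooth_local[OF man U])
    fix p assume "p \<in> U"
    then obtain W v where "op W" "p \<in> W" "W \<subseteq> U" "v \<in> lifts M P W \<tau>" using lift_ex[OF \<tau>] by blast
    with sm show "\<exists>V. op V \<and> p \<in> V \<and> V \<subseteq> U \<and> smooth M V (txp_apply U \<tau> f)" by blast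
  qed
  fix V w p assume V: "op V \<and> V \<subseteq> U \<and> w \<in> P_fields M P V" and p: "p \<in> V"
  then obtain W0 v0 where W0: "op W0" "p \<in> W0" "W0 \<subseteq> U" "v0 \<in> lifts M P W0 \<tau>" using lift_ex[OF \<tau>, of p] by blast
  \<comment> \<open>The invariance condition compares a lift and a field of \<open>P\<close> over
    one open set, so both are restricted to \<open>W\<close>.\<close>
  define W v w' where "W = V \<inter> W0" and "v = vf_cut W v0" and "w' = vf_cut W w"
  have W: "op W" "W \<subseteq> U" "p \<in> W" using V W0 p by (auto simp: W_def)
  have v: "v \<in> lifts M P W \<tau>" unfolding v_def
    by (rule vf_cut_lifts[OF man W0(4) W(1)]) (simp add: W_def)
  have w': "w' \<in> P_fields M P W" unfolding w'_def
    by (rule vf_cut_P_fields[OF man, of w P V]) (use V W in \<open>auto simp: W_def\<close>)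
  have "\<forall>W v w. op W \<and> W \<subseteq> U \<and> v \<in> lifts M P W \<tau> \<and> w \<in> P_fields M P W \<longrightarrow> (\<forall>q\<in>W. vbracket M w v q \<in> P q)"
    using \<tau> unfolding TXP_def mem_Collect_eq by (elim conjE)
  then have "vbracket M w' v p \<in> P p" using W v w' by simp
  then have "vbracket M w' v p f = 0" using P_kills U W f by blast
  moreover have "smooth_near M p f" using OX_smooth_near[OF f U] W by blast
  ultimately have 1: "w' p (\<lambda>q. v q f) = v p (\<lambda>q. w' q f)" by (simp add: vbracket_def)
  \<comment> \<open>This is wanted for all \<open>q\<close>, also outside \<open>W\<close>: then the
    function differentiated by \<open>v\<close> is the constant zero and
    \<open>tangent_const\<close> applies.\<close>
  have "w' q f = 0" for q
  proof (cases "q \<in> W")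
    case True
    then show ?thesis using f W w' unfolding OX_iff by blast
  qed (use w' in \<open>auto simp: P_fields_def vfields_def\<close>)
  moreover have "v p \<in> tangent M p" "w' p \<in> tangent M p" using v w' W by (auto simp: lifts_def vfields_def P_fields_def)
  moreover have "p \<in> topspace (mtop M)" using W U openin_subset by blast
  ultimately have "w' p (\<lambda>q. v q f) = 0" using 1 tangent_const[OF man] by simp
  moreover have "w' p (\<lambda>q. v q f) = w' p (txp_apply U \<tau> f)"
    by (rule tangent_cong[OF man \<open>w' p \<in> _\<close> sm(1)[OF W(1,2) v] W(1,3)]) (use txp_lift_eq[OF \<tau> U f v W(2)] in simp)
  ultimately show "w p (txp_apply U \<tau> f) = 0"
    using W by (simp add: w'_def vf_cut_def)
qed (simp add: txp_apply_def)

abbreviation "BB U \<equiv> carrier (sec B U)"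
abbreviation "DD U b \<equiv> txp_apply U (anch B U b)"

lemma anch_TXP: "\<lbrakk>op U; b \<in> BB U\<rbrakk> \<Longrightarrow> anch B U b \<in> TXP M P U"
  using algd by (simp add: lie_algebroid_def)

lemma DD_closed: "\<lbrakk>op U; b \<in> BB U; f \<in> OX U\<rbrakk> \<Longrightarrow> DD U b f \<in> OX U"
  by (simp add: txp_apply_closed anch_TXP)

lemma DD_off: "x \<notin> U \<Longrightarrow> DD U b f x = 0"
  by (simp add: txp_apply_def)

text \<open>At each point the derivative along \<open>b\<close> is evaluation of a tangent vector
  representing the anchor, so the rules for \<open>DD\<close> can be read off pointwise.\<close>

lemma DD_tangent:
  assumes "op U" "b \<in> BB U" "p \<in> U"
  obtains v where "v \<in> tangent M p" "v \<in> anch B U b p" "\<And>f. f \<in> OX U \<Longrightarrow> DD U b f p = v f"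
  using txp_tangent[OF anch_TXP[OF assms(1,2)] assms(1,3)] txp_apply_eq[OF anch_TXP[OF assms(1,2)] assms(1)] assms(3)
  by metis

lemma DD_add: assumes "op U" "b \<in> BB U" "f \<in> OX U" "g \<in> OX U"
  shows "DD U b (\<lambda>x. f x + g x) = (\<lambda>x. DD U b f x + DD U b g x)"
proof
  fix p show "DD U b (\<lambda>x. f x + g x) p = DD U b f p + DD U b g p"
  proof (cases "p \<in> U")
    case True
    obtain v where v: "v \<in> tangent M p" "\<And>f. f \<in> OX U \<Longrightarrow> DD U b f p = v f"
      using DD_tangent[OF assms(1,2) True] by metis
    show ?thesis using assms True OX_add tangent_add[OF man v(1)] OX_smooth_near by (simp add: v(2))
  qed (simp add: DD_off)
qed

lemma DD_mult: assumes "op U" "b \<in> BB U" "f \<in> OX U" "g \<in> OX U"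
  shows "DD U b (\<lambda>x. f x * g x) = (\<lambda>x. f x * DD U b g x + g x * DD U b f x)"
proof
  fix p show "DD U b (\<lambda>x. f x * g x) p = f p * DD U b g p + g p * DD U b f p"
  proof (cases "p \<in> U")
    case True
    obtain v where v: "v \<in> tangent M p" "\<And>f. f \<in> OX U \<Longrightarrow> DD U b f p = v f"
      using DD_tangent[OF assms(1,2) True] by metis
    show ?thesis using assms True OX_mult tangent_mult[OF man v(1)] OX_smooth_near by (simp add: v(2))
  qed (simp add: DD_off)
qed

lemma DD_const: assumes "op U" "b \<in> BB U" shows "DD U b (cut U (\<lambda>_. c)) = (\<lambda>_. 0)"
proof
  fix p show "DD U b (cut U (\<lambda>_. c)) p = 0"
  proof (cases "p \<in> U")
    case True
    obtain v where v: "v \<in> tangent M p" "\<And>f. f \<in> OX U \<Longrightarrow> DD U b f p = v f"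
      using DD_tangent[OF assms(1,2) True] by metis
    have "v (\<lambda>_. c) = v (cut U (\<lambda>_. c))"
      by (rule tangent_cong[OF man v(1) smooth_const[OF man] assms(1) True]) (simp add: cut_def)
    moreover have "v (\<lambda>_. c) = 0" using tangent_const[OF man v(1)] openin_subset[OF assms(1)] True by blast
    ultimately show ?thesis using v(2) OX_const[OF assms(1)] by simp
  qed (simp add: DD_off)
qed

lemma BB_res: "\<lbrakk>op U; op V; V \<subseteq> U; b \<in> BB U\<rbrakk> \<Longrightarrow> res B U V b \<in> BB V"
  using algd by (auto simp: lie_algebroid_def omodule_def is_sheaf_def)

lemma DD_cut:
  assumes "op U" "op V" "V \<subseteq> U" "b \<in> BB U" "f \<in> OX U"
  shows "DD V (res B U V b) (cut V f) = cut V (DD U b f)"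
proof
  fix p show "DD V (res B U V b) (cut V f) p = cut V (DD U b f) p"
  proof (cases "p \<in> V")
    case True
    then have p: "p \<in> U" using assms by blast
    have r: "anch B V (res B U V b) = txp_cut V (anch B U b)"
      using algd assms by (simp add: lie_algebroid_def)
    obtain v where v: "v \<in> tangent M p" "v \<in> anch B U b p" "\<And>f. f \<in> OX U \<Longrightarrow> DD U b f p = v f"
      using DD_tangent[OF assms(1,4) p] by metis
    have "v \<in> anch B V (res B U V b) p" using True v by (simp add: r txp_cut_def)
    then have "DD V (res B U V b) (cut V f) p = v (cut V f)"
      using txp_apply_eq[OF anch_TXP] BB_res OX_cut assms True by meson
    also have "\<dots> = v f"
      by (rule tangent_cong[OF man v(1), of V f, symmetric])
         (use True assms smooth_subset[OF man, of U f V] in \<open>auto simp: cut_def OX_iff\<close>)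
    finally show ?thesis using v(3)[OF assms(5)] True by (simp add: cut_def)
  qed (simp add: DD_off cut_def)
qed

lemma BB_module: "op U \<Longrightarrow> module (OXP M P U) (sec B U)"
  using algd by (simp add: lie_algebroid_def omodule_def)

lemma BB_add: "\<lbrakk>op U; a \<in> BB U; b \<in> BB U\<rbrakk> \<Longrightarrow> a \<oplus>\<^bsub>sec B U\<^esub> b \<in> BB U"
  by (rule abelian_groupE(1)[OF module.axioms(2)[OF BB_module]])

lemma BB_smult: "\<lbrakk>op U; f \<in> OX U; b \<in> BB U\<rbrakk> \<Longrightarrow> f \<odot>\<^bsub>sec B U\<^esub> b \<in> BB U"
  by (rule module.smult_closed[OF BB_module])

lemma DD_badd:
  assumes "op U" "a \<in> BB U" "b \<in> BB U" "f \<in> OX U"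
  shows "DD U (a \<oplus>\<^bsub>sec B U\<^esub> b) f = (\<lambda>x. DD U a f x + DD U b f x)"
proof
  fix p show "DD U (a \<oplus>\<^bsub>sec B U\<^esub> b) f p = DD U a f p + DD U b f p"
  proof (cases "p \<in> U")
    case True
    obtain v where v: "v \<in> anch B U a p" "\<And>f. f \<in> OX U \<Longrightarrow> DD U a f p = v f"
      using DD_tangent[OF assms(1,2) True] by metis
    obtain w where w: "w \<in> anch B U b p" "\<And>f. f \<in> OX U \<Longrightarrow> DD U b f p = w f"
      using DD_tangent[OF assms(1,3) True] by metis
    have "anch B U (a \<oplus>\<^bsub>sec B U\<^esub> b) = txp_add (anch B U a) (anch B U b)"
      using algd assms by (simp add: lie_algebroid_def)
    then have "(\<lambda>f. v f + w f) \<in> anch B U (a \<oplus>\<^bsub>sec B U\<^esub> b) p" using v w by (auto simp: txp_add_def)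
    then show ?thesis
      using txp_apply_eq[OF anch_TXP[OF assms(1) BB_add[OF assms(1-3)]] assms(1,4) True] v w assms by simp
  qed (simp add: DD_off)
qed

lemma DD_bsmult:
  assumes "op U" "g \<in> OX U" "b \<in> BB U" "f \<in> OX U"
  shows "DD U (g \<odot>\<^bsub>sec B U\<^esub> b) f = (\<lambda>x. g x * DD U b f x)"
proof
  fix p show "DD U (g \<odot>\<^bsub>sec B U\<^esub> b) f p = g p * DD U b f p"
  proof (cases "p \<in> U")
    case True
    then have pX: "p \<in> topspace (mtop M)" using assms openin_subset by blast
    obtain v where v: "v \<in> anch B U b p" "\<And>f. f \<in> OX U \<Longrightarrow> DD U b f p = v f"
      using DD_tangent[OF assms(1,3) True] by metis
    have "anch B U (g \<odot>\<^bsub>sec B U\<^esub> b) = txp_smult P g (anch B U b)"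
      using algd assms by (simp add: lie_algebroid_def)
    then have "(\<lambda>f. g p * v f) \<in> anch B U (g \<odot>\<^bsub>sec B U\<^esub> b) p"
      using v zero_in_P[OF pX] by (force simp: txp_smult_def qclass_def)
    then show ?thesis
      using txp_apply_eq[OF anch_TXP[OF assms(1) BB_smult[OF assms(1-3)]] assms(1,4) True] v assms by simp
  qed (simp add: DD_off)
qed

subsection \<open>Sheaves of modules\<close>

lemma om_module: "\<lbrakk>omodule M P L; op U\<rbrakk> \<Longrightarrow> module (OXP M P U) (sec L U)"
  by (simp add: omodule_def)

lemma om_group: "\<lbrakk>omodule M P L; op U\<rbrakk> \<Longrightarrow> abelian_group (sec L U)"
  using om_module module.axioms(2) by blast

lemma om_add: "\<lbrakk>omodule M P L; op U; a \<in> carrier (sec L U); b \<in> carrier (sec L U)\<rbrakk> \<Longrightarrow> a \<oplus>\<^bsub>sec L U\<^esub> b \<in> carrier (sec L U)"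
  by (rule abelian_groupE(1)[OF om_group])

lemma om_smult: "\<lbrakk>omodule M P L; op U; f \<in> OX U; b \<in> carrier (sec L U)\<rbrakk> \<Longrightarrow> f \<odot>\<^bsub>sec L U\<^esub> b \<in> carrier (sec L U)"
  by (rule module.smult_closed[OF om_module])

lemma om_smult_assoc: "\<lbrakk>omodule M P L; op U; f \<in> OX U; g \<in> OX U; b \<in> carrier (sec L U)\<rbrakk>
    \<Longrightarrow> f \<odot>\<^bsub>sec L U\<^esub> (g \<odot>\<^bsub>sec L U\<^esub> b) = (\<lambda>x. f x * g x) \<odot>\<^bsub>sec L U\<^esub> b"
  using module.smult_assoc1[OF om_module, of L U f g b] by simp

lemma om_smult_ldistr: "\<lbrakk>omodule M P L; op U; f \<in> OX U; g \<in> OX U; b \<in> carrier (sec L U)\<rbrakk>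
    \<Longrightarrow> (\<lambda>x. f x + g x) \<odot>\<^bsub>sec L U\<^esub> b = f \<odot>\<^bsub>sec L U\<^esub> b \<oplus>\<^bsub>sec L U\<^esub> g \<odot>\<^bsub>sec L U\<^esub> b"
  using module.smult_l_distr[OF om_module, of L U f g b] by simp

lemma om_smult_rdistr: "\<lbrakk>omodule M P L; op U; f \<in> OX U; a \<in> carrier (sec L U); b \<in> carrier (sec L U)\<rbrakk>
    \<Longrightarrow> f \<odot>\<^bsub>sec L U\<^esub> (a \<oplus>\<^bsub>sec L U\<^esub> b) = f \<odot>\<^bsub>sec L U\<^esub> a \<oplus>\<^bsub>sec L U\<^esub> f \<odot>\<^bsub>sec L U\<^esub> b"
  by (rule module.smult_r_distr[OF om_module])

lemma om_smult_one: "\<lbrakk>omodule M P L; op U; b \<in> carrier (sec L U)\<rbrakk> \<Longrightarrow> cut U (\<lambda>_. 1) \<odot>\<^bsub>sec L U\<^esub> b = b"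
  using module.smult_one[OF om_module, of L U b] by simp

lemma om_smult_zero: "\<lbrakk>omodule M P L; op U; b \<in> carrier (sec L U)\<rbrakk> \<Longrightarrow> (\<lambda>_. 0) \<odot>\<^bsub>sec L U\<^esub> b = \<zero>\<^bsub>sec L U\<^esub>"
  using module.smult_l_null[OF om_module, of L U b] by simp

lemma om_smult_minus:
  "\<lbrakk>omodule M P L; op U; f \<in> OX U; b \<in> carrier (sec L U)\<rbrakk> \<Longrightarrow> (\<lambda>x. - f x) \<odot>\<^bsub>sec L U\<^esub> b = \<ominus>\<^bsub>sec L U\<^esub> (f \<odot>\<^bsub>sec L U\<^esub> b)"
  using module.smult_l_minus[OF om_module, of L U f b] by (simp add: OX_a_inv)

lemma om_res: "\<lbrakk>omodule M P L; op U; op V; V \<subseteq> U; m \<in> carrier (sec L U)\<rbrakk> \<Longrightarrow> res L U V m \<in> carrier (sec L V)"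
  by (auto simp: omodule_def is_sheaf_def)

lemma om_res_id: "\<lbrakk>omodule M P L; op U; m \<in> carrier (sec L U)\<rbrakk> \<Longrightarrow> res L U U m = m"
  by (auto simp: omodule_def is_sheaf_def)

lemma om_res_res: "\<lbrakk>omodule M P L; op U; op V; op W; W \<subseteq> V; V \<subseteq> U; m \<in> carrier (sec L U)\<rbrakk>
    \<Longrightarrow> res L V W (res L U V m) = res L U W m"
  unfolding omodule_def is_sheaf_def by meson

lemma om_res_add: "\<lbrakk>omodule M P L; op U; op V; V \<subseteq> U; a \<in> carrier (sec L U); b \<in> carrier (sec L U)\<rbrakk>
    \<Longrightarrow> res L U V (a \<oplus>\<^bsub>sec L U\<^esub> b) = res L U V a \<oplus>\<^bsub>sec L V\<^esub> res L U V b"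
  by (simp add: omodule_def)

lemma om_res_smult: "\<lbrakk>omodule M P L; op U; op V; V \<subseteq> U; f \<in> OX U; b \<in> carrier (sec L U)\<rbrakk>
    \<Longrightarrow> res L U V (f \<odot>\<^bsub>sec L U\<^esub> b) = cut V f \<odot>\<^bsub>sec L V\<^esub> res L U V b"
  by (simp add: omodule_def)

lemma om_glue1:
  assumes "omodule M P L" "\<And>V. V \<in> \<U> \<Longrightarrow> op V" "\<And>V. V \<in> \<U> \<Longrightarrow> s V \<in> carrier (sec L V)"
    and "\<And>V W. \<lbrakk>V \<in> \<U>; W \<in> \<U>\<rbrakk> \<Longrightarrow> res L V (V \<inter> W) (s V) = res L W (V \<inter> W) (s W)"
  shows "\<exists>!t. t \<in> carrier (sec L (\<Union>\<U>)) \<and> (\<forall>V\<in>\<U>. res L (\<Union>\<U>) V t = s V)"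
proof -
  have "\<forall>\<U> s. (\<forall>V\<in>\<U>. op V \<and> s V \<in> carrier (sec L V)) \<and>
        (\<forall>V\<in>\<U>. \<forall>W\<in>\<U>. res L V (V \<inter> W) (s V) = res L W (V \<inter> W) (s W)) \<longrightarrow>
        (\<exists>!t. t \<in> carrier (sec L (\<Union>\<U>)) \<and> (\<forall>V\<in>\<U>. res L (\<Union>\<U>) V t = s V))"
    using assms(1) unfolding omodule_def is_sheaf_def by (elim conjE)
  note H = this
  show ?thesis by (rule mp[OF spec[OF spec[OF H, of \<U>], of s]]) (intro conjI ballI assms(2-4))
qed

text \<open>Uniqueness in the sheaf axiom, applied to the cover by all open sets on which the two
  restrictions coincide.\<close>

lemma om_sep:
  assumes L: "omodule M P L" and U: "op U" and st: "s \<in> carrier (sec L U)" "t \<in> carrier (sec L U)"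
    and loc: "\<And>p. p \<in> U \<Longrightarrow> \<exists>V. op V \<and> p \<in> V \<and> V \<subseteq> U \<and> res L U V s = res L U V t"
  shows "s = t"
proof -
  define \<U> where "\<U> = {V. op V \<and> V \<subseteq> U \<and> res L U V s = res L U V t}"
  have un: "\<Union>\<U> = U" using loc by (auto simp: \<U>_def)
  have "\<exists>!x. x \<in> carrier (sec L (\<Union>\<U>)) \<and> (\<forall>V\<in>\<U>. res L (\<Union>\<U>) V x = res L U V s)"
  proof (rule om_glue1[OF L])
    show "op V" if "V \<in> \<U>" for V using that by (simp add: \<U>_def)
    show "res L U V s \<in> carrier (sec L V)" if "V \<in> \<U>" for V
      using that by (intro om_res[OF L U]) (auto simp: \<U>_def st)
    show "res L V (V \<inter> W) (res L U V s) = res L W (V \<inter> W) (res L U W s)" if "V \<in> \<U>" "W \<in> \<U>" for V W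
    proof -
      have "op V" "op W" "op (V \<inter> W)" "V \<subseteq> U" "W \<subseteq> U" using that by (auto simp: \<U>_def)
      then show ?thesis
        using om_res_res[OF L U, of V "V \<inter> W" s] om_res_res[OF L U, of W "V \<inter> W" s] st by auto
    qed
  qed
  moreover have "\<forall>V\<in>\<U>. res L U V t = res L U V s" by (auto simp: \<U>_def)
  ultimately show ?thesis using st unfolding un by blast
qed

text \<open>The sheaf axiom indexes sections by open sets, whereas here several indices may share
  one open set. Compatibility of two such indices says that their sections are equal, so
  \<open>c\<close> may pick one index for each open set.\<close>

lemma om_glue:
  assumes L: "omodule M P L" and U: "op U"
    and V: "\<And>i. i \<in> I \<Longrightarrow> op (V i)" "\<And>i. i \<in> I \<Longrightarrow> V i \<subseteq> U" "U \<subseteq> (\<Union>i\<in>I. V i)"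
    and s: "\<And>i. i \<in> I \<Longrightarrow> s i \<in> carrier (sec L (V i))"
    and comp: "\<And>i j. \<lbrakk>i \<in> I; j \<in> I\<rbrakk> \<Longrightarrow> res L (V i) (V i \<inter> V j) (s i) = res L (V j) (V i \<inter> V j) (s j)"
  shows "\<exists>t\<in>carrier (sec L U). \<forall>i\<in>I. res L U (V i) t = s i"
proof -
  define c where "c W = (SOME i. i \<in> I \<and> V i = W)" for W
  have c: "c W \<in> I \<and> V (c W) = W" if "W \<in> V ` I" for W
    unfolding c_def by (rule someI_ex) (use that in auto)
  have ceq: "s (c (V i)) = s i" if "i \<in> I" for i
  proof -
    have c': "c (V i) \<in> I" "V (c (V i)) = V i" using c that by blast+
    have "s (c (V i)) \<in> carrier (sec L (V i))" using s[OF c'(1)] c'(2) by simp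
    moreover have "res L (V i) (V i) (s (c (V i))) = res L (V i) (V i) (s i)"
      using comp[OF c'(1) that] c'(2) by simp
    ultimately show ?thesis using om_res_id[OF L V(1)[OF that]] s[OF that] by simp
  qed
  have un: "\<Union>(V ` I) = U" using V by auto
  have "\<exists>!t. t \<in> carrier (sec L (\<Union>(V ` I))) \<and> (\<forall>W\<in>V ` I. res L (\<Union>(V ` I)) W t = s (c W))"
  proof (rule om_glue1[OF L])
    show "op W" if "W \<in> V ` I" for W using that V by auto
    show "s (c W) \<in> carrier (sec L W)" if "W \<in> V ` I" for W using c[OF that] s by force
    show "res L W1 (W1 \<inter> W2) (s (c W1)) = res L W2 (W1 \<inter> W2) (s (c W2))" if "W1 \<in> V ` I" "W2 \<in> V ` I" for W1 W2
      using comp[of "c W1" "c W2"] c[OF that(1)] c[OF that(2)] by simp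
  qed
  then obtain t where "t \<in> carrier (sec L U)" "\<And>i. i \<in> I \<Longrightarrow> res L U (V i) t = s (c (V i))"
    unfolding un by blast
  then show ?thesis using ceq by auto
qed

section \<open>Generators of rank one modules and coefficients with respect to them\<close>

definition generator :: "('x, 'm, 'z) osheaf_scheme \<Rightarrow> 'x set \<Rightarrow> 'm \<Rightarrow> bool" where
  "generator L U e \<longleftrightarrow> e \<in> carrier (sec L U) \<and>
     (\<forall>V. op V \<and> V \<subseteq> U \<longrightarrow> (\<forall>m\<in>carrier (sec L V). \<exists>!f. f \<in> OX V \<and> m = f \<odot>\<^bsub>sec L V\<^esub> res L U V e))"

text \<open>The coefficients of a frame of length one are functions on a singleton index set;
  passing to their single value frees the later arguments from extensional function spaces.\<close>

lemma frame_one: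
  assumes L: "omodule M P L" and U: "op U"
  shows "is_frame M P L U 1 e \<longleftrightarrow> generator L U (e 0)"
proof (cases "e 0 \<in> carrier (sec L U)")
  case True
  have "(\<exists>!c. c \<in> {..<1::nat} \<rightarrow>\<^sub>E OX V \<and> m = finsum (sec L V) (\<lambda>i. c i \<odot>\<^bsub>sec L V\<^esub> res L U V (e i)) {..<1}) \<longleftrightarrow>
        (\<exists>!f. f \<in> OX V \<and> m = f \<odot>\<^bsub>sec L V\<^esub> res L U V (e 0))" (is "?A \<longleftrightarrow> ?B")
    if V: "op V" "V \<subseteq> U" and m: "m \<in> carrier (sec L V)" for V m
  proof -
    interpret G: abelian_group "sec L V" by (rule om_group[OF L V(1)])
    have set1: "{..<1::nat} = {0}" by auto
    have fs: "finsum (sec L V) (\<lambda>i. c i \<odot>\<^bsub>sec L V\<^esub> res L U V (e i)) {0} = c 0 \<odot>\<^bsub>sec L V\<^esub> res L U V (e 0)"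
      if "c 0 \<in> OX V" for c :: "nat \<Rightarrow> 'x cfun"
      using that True V om_smult[OF L V(1)] om_res[OF L U V] by (subst G.finsum_insert) auto
    have c: "c \<in> {0::nat} \<rightarrow>\<^sub>E OX V \<longleftrightarrow> c 0 \<in> OX V \<and> c = (\<lambda>i\<in>{0}. c 0)" for c
      by (auto simp: PiE_iff extensional_def restrict_def fun_eq_iff)
    show ?thesis
      unfolding set1
    proof
      assume "\<exists>!c. c \<in> {0::nat} \<rightarrow>\<^sub>E OX V \<and> m = finsum (sec L V) (\<lambda>i. c i \<odot>\<^bsub>sec L V\<^esub> res L U V (e i)) {0}" (is "\<exists>!c. ?Q c")
      then obtain d where d: "?Q d" and du': "\<forall>c. ?Q c \<longrightarrow> c = d"
        unfolding Ex1_def by (rule exE) (elim conjE, rule that, intro conjI)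
      note du = du'[rule_format]
      have d0: "d 0 \<in> OX V" using d by auto
      have Q: "?Q (\<lambda>i\<in>{0}. f)" if f: "f \<in> OX V \<and> m = f \<odot>\<^bsub>sec L V\<^esub> res L U V (e 0)" for f
      proof -
        define d where "d = (\<lambda>i\<in>{0::nat}. f)"
        have "d 0 = f" by (simp add: d_def)
        moreover have "d \<in> {0} \<rightarrow>\<^sub>E OX V" using f by (simp add: d_def)
        ultimately have "?Q d" using f fs[of d] by simp
        then show ?thesis by (simp only: d_def)
      qed
      show ?B
      proof (rule ex1I[of _ "d 0"])
        show "d 0 \<in> OX V \<and> m = d 0 \<odot>\<^bsub>sec L V\<^esub> res L U V (e 0)" using d d0 fs[of d, OF d0] by simp
        fix f assume f: "f \<in> OX V \<and> m = f \<odot>\<^bsub>sec L V\<^esub> res L U V (e 0)"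
        have "(\<lambda>i\<in>{0}. f) = d" by (rule du) (rule Q[OF f])
        then show "f = d 0" by auto
      qed
    next
      assume ?B
      then obtain f where f: "f \<in> OX V" "m = f \<odot>\<^bsub>sec L V\<^esub> res L U V (e 0)"
        and fu: "\<And>g. g \<in> OX V \<Longrightarrow> m = g \<odot>\<^bsub>sec L V\<^esub> res L U V (e 0) \<Longrightarrow> g = f" by blast
      show "\<exists>!c. c \<in> {0::nat} \<rightarrow>\<^sub>E OX V \<and> m = finsum (sec L V) (\<lambda>i. c i \<odot>\<^bsub>sec L V\<^esub> res L U V (e i)) {0}" (is "\<exists>!c. ?Q c")
      proof (rule ex1I[of _ "\<lambda>i\<in>{0}. f"])
        define d where "d = (\<lambda>i\<in>{0::nat}. f)"
        have "d 0 = f" by (simp add: d_def)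
        moreover have "d \<in> {0} \<rightarrow>\<^sub>E OX V" using f by (simp add: d_def)
        ultimately have "?Q d" using f fs[of d] by simp
        then show "?Q (\<lambda>i\<in>{0}. f)" by (simp only: d_def)
        fix d assume d: "?Q d"
        then have d0: "d 0 \<in> OX V" by auto
        then have "d 0 = f" using d fs[of d, OF d0] fu by simp
        moreover have "d = (\<lambda>i\<in>{0}. d 0)" using d c[of d] by blast
        ultimately show "d = (\<lambda>i\<in>{0}. f)" by simp
      qed
    qed
  qed
  then show ?thesis using True by (auto simp: is_frame_def generator_def)
next
  case False
  then show ?thesis by (auto simp: is_frame_def generator_def)
qed

lemma rank_one_iff:
  assumes "omodule M P L"
  shows "locally_free_rank_one M P L \<longleftrightarrow> (\<forall>p\<in>topspace (mtop M). \<exists>U e. op U \<and> p \<in> U \<and> generator L U e)"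
proof -
  have "(\<exists>e. op U \<and> p \<in> U \<and> is_frame M P L U 1 e) \<longleftrightarrow> (\<exists>e. op U \<and> p \<in> U \<and> generator L U e)" for U p
  proof
    assume "\<exists>e. op U \<and> p \<in> U \<and> generator L U e"
    then obtain e where "op U" "p \<in> U" "generator L U e" by blast
    then have "is_frame M P L U 1 (\<lambda>_. e)" using frame_one[OF assms, of U "\<lambda>_. e"] by simp
    with \<open>op U\<close> \<open>p \<in> U\<close> show "\<exists>e. op U \<and> p \<in> U \<and> is_frame M P L U 1 e" by blast
  qed (use frame_one[OF assms] in blast)
  then show ?thesis by (simp add: locally_free_rank_one_def)
qed

lemma generator_closed: "generator L U e \<Longrightarrow> e \<in> carrier (sec L U)"
  by (simp add: generator_def)

lemma generator_res:
  assumes L: "omodule M P L" and U: "op U" "op V" "V \<subseteq> U" and e: "generator L U e"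
  shows "generator L V (res L U V e)"
  unfolding generator_def
proof (intro conjI allI impI ballI)
  fix W m assume W: "op W \<and> W \<subseteq> V" and m: "m \<in> carrier (sec L W)"
  then have "op W" "W \<subseteq> U" using U by auto
  then have "\<exists>!f. f \<in> OX W \<and> m = f \<odot>\<^bsub>sec L W\<^esub> res L U W e"
    using e m by (simp add: generator_def)
  then show "\<exists>!f. f \<in> OX W \<and> m = f \<odot>\<^bsub>sec L W\<^esub> res L V W (res L U V e)"
    using om_res_res[OF L U(1,2) _ _ U(3) generator_closed[OF e], of W] W by simp
qed (rule om_res[OF L U generator_closed[OF e]])

definition coef :: "('x, 'm, 'z) osheaf_scheme \<Rightarrow> 'x set \<Rightarrow> 'm \<Rightarrow> 'm \<Rightarrow> 'x cfun" where
  "coef L U e m = (THE f. f \<in> OX U \<and> m = f \<odot>\<^bsub>sec L U\<^esub> e)"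

lemma generator_ex1:
  assumes L: "omodule M P L" and U: "op U" and e: "generator L U e" and m: "m \<in> carrier (sec L U)"
  shows "\<exists>!f. f \<in> OX U \<and> m = f \<odot>\<^bsub>sec L U\<^esub> e"
proof -
  have "\<exists>!f. f \<in> OX U \<and> m = f \<odot>\<^bsub>sec L U\<^esub> res L U U e" using e U m unfolding generator_def by blast
  then show ?thesis using om_res_id[OF L U generator_closed[OF e]] by simp
qed

lemma coef:
  assumes "omodule M P L" "op U" "generator L U e" "m \<in> carrier (sec L U)"
  shows coef_closed: "coef L U e m \<in> OX U" and coef_smult: "coef L U e m \<odot>\<^bsub>sec L U\<^esub> e = m"
  using theI'[OF generator_ex1[OF assms]] by (auto simp: coef_def)

lemma generator_unique:
  assumes "omodule M P L" "op U" "generator L U e" "f \<in> OX U" "g \<in> OX U" "f \<odot>\<^bsub>sec L U\<^esub> e = g \<odot>\<^bsub>sec L U\<^esub> e"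
  shows "f = g"
  using generator_ex1[OF assms(1-3), of "f \<odot>\<^bsub>sec L U\<^esub> e"] om_smult[OF assms(1,2,4) generator_closed[OF assms(3)]]
    assms(4-6) by blast

lemma coef_eq:
  assumes "omodule M P L" "op U" "generator L U e" "f \<in> OX U"
  shows "coef L U e (f \<odot>\<^bsub>sec L U\<^esub> e) = f"
  using generator_unique[OF assms(1-3)] coef[OF assms(1-3)] om_smult[OF assms(1,2,4) generator_closed[OF assms(3)]] assms(4)
  by blast

lemma coef_res:
  assumes L: "omodule M P L" and U: "op U" "op V" "V \<subseteq> U" and e: "generator L U e" and m: "m \<in> carrier (sec L U)"
  shows "coef L V (res L U V e) (res L U V m) = cut V (coef L U e m)"
proof -
  have "res L U V m = cut V (coef L U e m) \<odot>\<^bsub>sec L V\<^esub> res L U V e"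
    using om_res_smult[OF L U coef_closed[OF L U(1) e m] generator_closed[OF e]] coef_smult[OF L U(1) e m] by simp
  then show ?thesis
    using coef_eq[OF L U(2) generator_res[OF L U e] OX_cut[OF coef_closed[OF L U(1) e m] U(2,3)]] by simp
qed

subsection \<open>The anchor respects brackets\<close>

lemma B_om: "omodule M P B"
  using algd by (simp add: lie_algebroid_def)

lemma brk_closed: "\<lbrakk>op U; a \<in> BB U; b \<in> BB U\<rbrakk> \<Longrightarrow> brk B U a b \<in> BB U"
  and brk_ladd: "\<lbrakk>op U; a \<in> BB U; b \<in> BB U; c \<in> BB U\<rbrakk> \<Longrightarrow> brk B U (a \<oplus>\<^bsub>sec B U\<^esub> b) c = brk B U a c \<oplus>\<^bsub>sec B U\<^esub> brk B U b c"
  and brk_radd: "\<lbrakk>op U; a \<in> BB U; b \<in> BB U; c \<in> BB U\<rbrakk> \<Longrightarrow> brk B U c (a \<oplus>\<^bsub>sec B U\<^esub> b) = brk B U c a \<oplus>\<^bsub>sec B U\<^esub> brk B U c b"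
  and brk_jacobi: "\<lbrakk>op U; a \<in> BB U; b \<in> BB U; c \<in> BB U\<rbrakk> \<Longrightarrow>
     brk B U a (brk B U b c) \<oplus>\<^bsub>sec B U\<^esub> brk B U b (brk B U c a) \<oplus>\<^bsub>sec B U\<^esub> brk B U c (brk B U a b) = \<zero>\<^bsub>sec B U\<^esub>"
  and brk_self: "\<lbrakk>op U; a \<in> BB U\<rbrakk> \<Longrightarrow> brk B U a a = \<zero>\<^bsub>sec B U\<^esub>"
  and brk_res: "\<lbrakk>op U; op V; V \<subseteq> U; a \<in> BB U; b \<in> BB U\<rbrakk> \<Longrightarrow> brk B V (res B U V a) (res B U V b) = res B U V (brk B U a b)"
  and brk_smult: "\<lbrakk>op U; a \<in> BB U; b \<in> BB U; f \<in> OX U\<rbrakk> \<Longrightarrow>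
     brk B U a (f \<odot>\<^bsub>sec B U\<^esub> b) = DD U a f \<odot>\<^bsub>sec B U\<^esub> b \<oplus>\<^bsub>sec B U\<^esub> f \<odot>\<^bsub>sec B U\<^esub> brk B U a b"
  using algd by (simp_all add: lie_algebroid_def)

lemma brk_anti:
  assumes U: "op U" and ab: "a \<in> BB U" "b \<in> BB U"
  shows "brk B U b a = \<ominus>\<^bsub>sec B U\<^esub> brk B U a b"
proof -
  interpret G: abelian_group "sec B U" by (rule om_group[OF B_om U])
  have "brk B U (a \<oplus>\<^bsub>sec B U\<^esub> b) (a \<oplus>\<^bsub>sec B U\<^esub> b) = \<zero>\<^bsub>sec B U\<^esub>" using brk_self U ab by simp
  then have "brk B U b a \<oplus>\<^bsub>sec B U\<^esub> brk B U a b = \<zero>\<^bsub>sec B U\<^esub>"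
    unfolding brk_ladd[OF U ab BB_add[OF U ab]] brk_radd[OF U ab ab(1)] brk_radd[OF U ab ab(2)]
    using U ab by (simp add: brk_self brk_closed G.a_comm)
  then show ?thesis using U ab by (metis G.minus_equality brk_closed)
qed

lemma brk_minus:
  assumes U: "op U" and ab: "a \<in> BB U" "b \<in> BB U"
  shows "brk B U a (\<ominus>\<^bsub>sec B U\<^esub> b) = \<ominus>\<^bsub>sec B U\<^esub> brk B U a b"
proof -
  interpret G: abelian_group "sec B U" by (rule om_group[OF B_om U])
  have z: "brk B U a \<zero>\<^bsub>sec B U\<^esub> = \<zero>\<^bsub>sec B U\<^esub>"
    using brk_radd[OF U G.zero_closed G.zero_closed ab(1)] brk_closed[OF U ab(1) G.zero_closed]
    by (metis G.add.l_cancel_one' G.l_zero G.zero_closed)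
  have "brk B U a (\<ominus>\<^bsub>sec B U\<^esub> b) \<oplus>\<^bsub>sec B U\<^esub> brk B U a b = brk B U a (\<ominus>\<^bsub>sec B U\<^esub> b \<oplus>\<^bsub>sec B U\<^esub> b)"
    using brk_radd[OF U _ _ ab(1)] ab by simp
  also have "\<dots> = \<zero>\<^bsub>sec B U\<^esub>" using ab z by (simp add: G.l_neg)
  finally show ?thesis using U ab by (metis G.minus_equality G.a_inv_closed brk_closed)
qed

text \<open>Compare the Jacobi identities for \<open>(a, b, c)\<close> and for \<open>(a, b, f c)\<close>.\<close>

lemma brk_anchor_smult:
  assumes U: "op U" and a: "a \<in> BB U" and b: "b \<in> BB U" and c: "c \<in> BB U" and f: "f \<in> OX U"
  shows "DD U (brk B U a b) f \<odot>\<^bsub>sec B U\<^esub> c = (\<lambda>x. DD U a (DD U b f) x - DD U b (DD U a f) x) \<odot>\<^bsub>sec B U\<^esub> c"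
proof -
  interpret Md: module "OXP M P U" "sec B U" by (rule om_module[OF B_om U])
  let ?p = "\<lambda>x y. x \<oplus>\<^bsub>sec B U\<^esub> y" and ?n = "\<lambda>x. \<ominus>\<^bsub>sec B U\<^esub> x" and ?s = "\<lambda>g y. g \<odot>\<^bsub>sec B U\<^esub> y" and ?b = "brk B U"
  note cl = brk_closed[OF U] DD_closed[OF U] om_smult[OF B_om U] om_add[OF B_om U] f a b c OX_diff[OF U]
  \<comment> \<open>The terms of the Leibniz expansions. The mixed terms \<open>q\<close> and
    \<open>r\<close> occur on both sides and cancel; \<open>p\<close> and \<open>p'\<close> carry
    the second derivatives of \<open>f\<close>, and \<open>u\<close> the derivative along the
    bracket.\<close>
  define p p' q r s s' u v where "p = ?s (DD U a (DD U b f)) c" and "p' = ?s (DD U b (DD U a f)) c"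
    and "q = ?s (DD U b f) (?b a c)" and "r = ?s (DD U a f) (?b b c)"
    and "s = ?s f (?b a (?b b c))" and "s' = ?s f (?b b (?b a c))"
    and "u = ?s (DD U (?b a b) f) c" and "v = ?s f (?b (?b a b) c)"
  have C: "p \<in> BB U" "p' \<in> BB U" "q \<in> BB U" "r \<in> BB U" "s \<in> BB U" "s' \<in> BB U" "u \<in> BB U" "v \<in> BB U"
    unfolding p_def p'_def q_def r_def s_def s'_def u_def v_def by (intro cl)+
  have solve: "x = ?p y z" if "?p (?p x (?n y)) (?n z) = \<zero>\<^bsub>sec B U\<^esub>" "x \<in> BB U" "y \<in> BB U" "z \<in> BB U" for x y z
  proof -
    have "?p x (?n (?p y z)) = \<zero>\<^bsub>sec B U\<^esub>" using that by (simp add: Md.minus_add Md.a_assoc)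
    then have "x = ?n (?n (?p y z))" using that Md.minus_equality[of x "?n (?p y z)"] by simp
    then show ?thesis using that by simp
  qed
  have 1: "?b a (?b b (?s f c)) = ?p (?p p q) (?p r s)"
    unfolding p_def q_def r_def s_def using cl by (simp add: brk_smult[OF U] brk_radd[OF U] del: OXP_simps)
  have 2: "?b b (?b (?s f c) a) = ?n (?p (?p p' r) (?p q s'))"
  proof -
    have "?b (?s f c) a = ?n (?b a (?s f c))" by (rule brk_anti[OF U a om_smult[OF B_om U f c]])
    then show ?thesis
      unfolding p'_def q_def r_def s'_def using cl
      by (simp add: brk_minus[OF U] brk_smult[OF U] brk_radd[OF U])
  qed
  have 3: "?b (?s f c) (?b a b) = ?n (?p u v)"
    using brk_anti[OF U, of "?b a b" "?s f c"] brk_smult[OF U, of "?b a b" c f] cl unfolding u_def v_def by simp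
  have J: "?p (?p p q) (?p r s) = ?p (?p (?p p' r) (?p q s')) (?p u v)"
    using brk_jacobi[OF U a b om_smult[OF B_om U f c]] C unfolding 1 2 3 by (intro solve) simp_all
  \<comment> \<open>The identity for \<open>(a, b, c)\<close>, multiplied by \<open>f\<close>,
    accounts for \<open>s\<close>, \<open>s'\<close> and \<open>v\<close>, the terms in which
    \<open>f\<close> is not differentiated.\<close>
  have "?p (?p (?b a (?b b c)) (?n (?b b (?b a c)))) (?n (?b (?b a b) c)) = \<zero>\<^bsub>sec B U\<^esub>"
  proof -
    have "?b b (?b c a) = ?n (?b b (?b a c))" using cl by (simp add: brk_anti[OF U a c] brk_minus[OF U])
    moreover have "?b c (?b a b) = ?n (?b (?b a b) c)" using cl brk_anti[OF U, of "?b a b" c] by simp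
    ultimately show ?thesis using brk_jacobi[OF U a b c] by simp
  qed
  from solve[OF this] have "?b a (?b b c) = ?p (?b b (?b a c)) (?b (?b a b) c)" using cl by simp
  then have "s = ?p s' v" unfolding s_def s'_def v_def using cl by (simp add: om_smult_rdistr[OF B_om U])
  with J have "?p p (?p (?p q r) (?p s' v)) = ?p (?p p' u) (?p (?p q r) (?p s' v))"
    using C by (simp add: Md.a_ac)
  then have "p = ?p p' u" using C by (metis Md.add.right_cancel Md.a_closed)
  then have "?p p (?n p') = ?p u (?p p' (?n p'))" using C by (simp add: Md.a_comm[of p' u] Md.a_assoc)
  then have "u = ?p p (?n p')" using C by (simp add: Md.r_neg)
  also have "\<dots> = ?s (\<lambda>x. DD U a (DD U b f) x + - DD U b (DD U a f) x) c"
    unfolding p_def p'_def using cl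
    by (subst om_smult_ldistr[OF B_om U]) (simp_all add: om_smult_minus[OF B_om U] OX_minus[OF U])
  finally show ?thesis by (simp add: u_def)
qed

lemma is_frameD:
  assumes "is_frame M P L U r e" "op V" "V \<subseteq> U" "m \<in> carrier (sec L V)"
  shows "\<exists>!c. c \<in> {..<r} \<rightarrow>\<^sub>E OX V \<and> m = finsum (sec L V) (\<lambda>i. c i \<odot>\<^bsub>sec L V\<^esub> res L U V (e i)) {..<r}"
proof -
  have "\<forall>V. op V \<and> V \<subseteq> U \<longrightarrow> (\<forall>m\<in>carrier (sec L V). \<exists>!c. c \<in> {..<r} \<rightarrow>\<^sub>E OX V \<and>
      m = finsum (sec L V) (\<lambda>i. c i \<odot>\<^bsub>sec L V\<^esub> res L U V (e i)) {..<r})"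
    using assms(1) unfolding is_frame_def by (elim conjE)
  then show ?thesis using assms(2-4) by simp
qed

text \<open>Uniqueness of coordinates: the coordinate vectors with first entry \<open>f\<close> or
  \<open>g\<close> and zeros elsewhere represent the same section.\<close>

lemma frame_cancel:
  assumes U: "op U" and e: "is_frame M P B U0 r e" and U0: "op U0" "U \<subseteq> U0" and r: "0 < r"
    and f: "f \<in> OX U" "g \<in> OX U" "f \<odot>\<^bsub>sec B U\<^esub> res B U0 U (e 0) = g \<odot>\<^bsub>sec B U\<^esub> res B U0 U (e 0)"
  shows "f = g"
proof -
  interpret Md: module "OXP M P U" "sec B U" by (rule om_module[OF B_om U])
  have ec: "res B U0 U (e i) \<in> BB U" if "i < r" for i
    using e that om_res[OF B_om U0(1) U U0(2)] by (simp add: is_frame_def)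
  define c where "c h = (\<lambda>i\<in>{..<r}. if i = 0 then h else (\<lambda>_. 0))" for h :: "'x cfun"
  have s: "finsum (sec B U) (\<lambda>i. c h i \<odot>\<^bsub>sec B U\<^esub> res B U0 U (e i)) {..<r} = h \<odot>\<^bsub>sec B U\<^esub> res B U0 U (e 0)"
    if "h \<in> OX U" for h
  proof -
    have "finsum (sec B U) (\<lambda>i. c h i \<odot>\<^bsub>sec B U\<^esub> res B U0 U (e i)) {..<r} =
       finsum (sec B U) (\<lambda>i. if 0 = i then h \<odot>\<^bsub>sec B U\<^esub> res B U0 U (e i) else \<zero>\<^bsub>sec B U\<^esub>) {..<r}"
      by (rule Md.finsum_cong') (use that ec in \<open>auto simp: c_def om_smult_zero[OF B_om U] om_smult[OF B_om U]\<close>)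
    also have "\<dots> = h \<odot>\<^bsub>sec B U\<^esub> res B U0 U (e 0)"
      by (rule Md.finsum_singleton) (use that r ec in \<open>auto simp: om_smult[OF B_om U]\<close>)
    finally show ?thesis .
  qed
  have "f \<odot>\<^bsub>sec B U\<^esub> res B U0 U (e 0) \<in> BB U" using om_smult[OF B_om U f(1) ec[OF r]] .
  then obtain d where d: "\<forall>c. c \<in> {..<r} \<rightarrow>\<^sub>E OX U \<and> f \<odot>\<^bsub>sec B U\<^esub> res B U0 U (e 0) =
      finsum (sec B U) (\<lambda>i. c i \<odot>\<^bsub>sec B U\<^esub> res B U0 U (e i)) {..<r} \<longrightarrow> c = d"
    using is_frameD[OF e U U0(2)] unfolding Ex1_def by blast
  moreover have "c h \<in> {..<r} \<rightarrow>\<^sub>E OX U" if "h \<in> OX U" for h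
    using that OX_zero[OF U] by (auto simp: c_def)
  ultimately have "c f = d" "c g = d" using s f by simp_all
  then have "c f = c g" by simp
  then have "c f 0 = c g 0" by simp
  then show ?thesis using r by (simp add: c_def)
qed

text \<open>\<open>brk_anchor_smult\<close> gives the identity only after multiplication with a
  section of \<open>B\<close>; near each point a basis section of a frame can be cancelled. In rank
  zero there is none, but then all sections of \<open>B\<close> vanish, and with them all
  derivatives.\<close>

lemma DD_brk:
  assumes U: "op U" and a: "a \<in> BB U" and b: "b \<in> BB U" and f: "f \<in> OX U"
  shows "DD U (brk B U a b) f = (\<lambda>x. DD U a (DD U b f) x - DD U b (DD U a f) x)"
proof
  fix x show "DD U (brk B U a b) f x = DD U a (DD U b f) x - DD U b (DD U a f) x"
  proof (cases "x \<in> U")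
    case True
    then have "x \<in> topspace (mtop M)" using openin_subset[OF U] by blast
    then obtain U0 r e where U0: "op U0" "x \<in> U0" and e: "is_frame M P B U0 r e"
      using free unfolding locally_free_finite_rank_def by blast
    define W where "W = U \<inter> U0"
    have W: "op W" "W \<subseteq> U" "W \<subseteq> U0" "x \<in> W" using U U0 True by (auto simp: W_def)
    define a' b' f' where "a' = res B U W a" and "b' = res B U W b" and "f' = cut W f"
    have a': "a' \<in> BB W" and b': "b' \<in> BB W" and f': "f' \<in> OX W"
      unfolding a'_def b'_def f'_def using BB_res[OF U W(1,2)] OX_cut[OF f W(1,2)] a b by auto
    have l: "DD U (brk B U a b) f x = DD W (brk B W a' b') f' x"
      unfolding a'_def b'_def f'_def brk_res[OF U W(1,2) a b] DD_cut[OF U W(1,2) brk_closed[OF U a b] f]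
      using W by (simp add: cut_def)
    have r1: "DD U a (DD U b f) x = DD W a' (DD W b' f') x"
      unfolding a'_def b'_def f'_def DD_cut[OF U W(1,2) b f] DD_cut[OF U W(1,2) a DD_closed[OF U b f]]
      using W by (simp add: cut_def)
    have r2: "DD U b (DD U a f) x = DD W b' (DD W a' f') x"
      unfolding a'_def b'_def f'_def DD_cut[OF U W(1,2) a f] DD_cut[OF U W(1,2) b DD_closed[OF U a f]]
      using W by (simp add: cut_def)
    show ?thesis
    proof (cases "r = 0")
      case True
      have z: "d = \<zero>\<^bsub>sec B W\<^esub>" if d: "d \<in> BB W" for d
      proof -
        interpret G: abelian_group "sec B W" by (rule om_group[OF B_om W(1)])
        have "\<exists>c. d = finsum (sec B W) (\<lambda>i. c i \<odot>\<^bsub>sec B W\<^esub> res B U0 W (e i)) {..<r}"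
          using is_frameD[OF e W(1,3) d] by blast
        then show ?thesis using True by simp
      qed
      have D0: "DD W d g = (\<lambda>_. 0)" if d: "d \<in> BB W" and g: "g \<in> OX W" for d g
        using DD_bsmult[OF W(1) OX_zero[OF W(1)] d g] om_smult_zero[OF B_om W(1) d] z[OF d] by simp
      have "brk B W a' b' \<in> BB W" using brk_closed[OF W(1) a' b'] .
      then show ?thesis unfolding l r1 r2
        using D0[OF _ f'] D0[OF a' DD_closed[OF W(1) b' f']] D0[OF b' DD_closed[OF W(1) a' f']] by simp
    next
      case False
      then have r: "0 < r" by simp
      have c: "res B U0 W (e 0) \<in> BB W"
        using e r om_res[OF B_om U0(1) W(1,3)] by (simp add: is_frame_def)
      have "DD W (brk B W a' b') f' = (\<lambda>x. DD W a' (DD W b' f') x - DD W b' (DD W a' f') x)"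
        by (rule frame_cancel[OF W(1) e U0(1) W(3) r _ _ brk_anchor_smult[OF W(1) a' b' c f']])
           (intro DD_closed[OF W(1)] brk_closed[OF W(1)] OX_diff[OF W(1)] a' b' f')+
      then show ?thesis unfolding l r1 r2 by simp
    qed
  qed (simp add: DD_off)
qed

subsection \<open>Units and closed one-forms\<close>

text \<open>The one of the ring is constant on \<open>U\<close> and zero outside, where sections
  vanish. Since \<open>inverse 0 = 0\<close>, the pointwise inverse has the right normalisation, so
  it is the ring inverse if there is one.\<close>

lemma OX_unit_iff:
  assumes U: "op U"
  shows "h \<in> Units (OXP M P U) \<longleftrightarrow> h \<in> OX U \<and> (\<forall>x\<in>U. h x \<noteq> 0) \<and> (\<lambda>x. inverse (h x)) \<in> OX U" (is "_ \<longleftrightarrow> ?R")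
proof
  assume "h \<in> Units (OXP M P U)"
  then obtain g where h: "h \<in> OX U" and g: "g \<in> OX U" "(\<lambda>x. g x * h x) = cut U (\<lambda>_. 1)"
    by (auto simp: Units_def)
  have e: "g x * h x = (if x \<in> U then 1 else 0)" for x
    using fun_cong[OF g(2), of x] by (simp add: cut_def)
  have "g x = inverse (h x)" for x
  proof (cases "x \<in> U")
    case True
    then show ?thesis using e[of x] by (simp add: inverse_unique mult.commute)
  next
    case False
    then show ?thesis using h g by (simp add: OX_off)
  qed
  then have "g = (\<lambda>x. inverse (h x))" by blast
  moreover have "\<forall>x\<in>U. h x \<noteq> 0" using e by (metis mult_zero_right zero_neq_one)
  ultimately show ?R using h g by auto
next
  assume R: ?R
  have "(\<lambda>x. inverse (h x) * h x) = cut U (\<lambda>_. 1)" "(\<lambda>x. h x * inverse (h x)) = cut U (\<lambda>_. 1)"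
    using R by (auto simp: cut_def OX_off fun_eq_iff)
  then show "h \<in> Units (OXP M P U)"
    using R unfolding Units_def by auto
qed

section \<open>The two presheaves of the complex: units and closed one-forms\<close>

abbreviation "FF \<equiv> OXP_units M P"
abbreviation "GG \<equiv> B_closed_forms1 M P B"
abbreviation "Fx U \<equiv> carrier (sgrp FF U)"
abbreviation "Gx U \<equiv> carrier (sgrp GG U)"

lemma FF_simps [simp]:
  "f \<otimes>\<^bsub>sgrp FF U\<^esub> g = (\<lambda>x. f x * g x)" "\<one>\<^bsub>sgrp FF U\<^esub> = cut U (\<lambda>_. 1)" "sres FF U V = cut V"
  by (simp_all add: OXP_units_def units_of_mult units_of_one)

lemma GG_simps [simp]:
  "\<alpha> \<otimes>\<^bsub>sgrp GG U\<^esub> \<beta> = (\<lambda>V b p. \<alpha> V b p + \<beta> V b p)" "\<one>\<^bsub>sgrp GG U\<^esub> = (\<lambda>_ _ _. 0)"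
  "sres GG U V \<alpha> = (\<lambda>W. if W \<subseteq> V then \<alpha> W else (\<lambda>_ _. 0))"
  by (simp_all add: B_closed_forms1_def)

lemma Fx_iff: "op U \<Longrightarrow> h \<in> Fx U \<longleftrightarrow> h \<in> OX U \<and> (\<forall>x\<in>U. h x \<noteq> 0) \<and> (\<lambda>x. inverse (h x)) \<in> OX U"
  by (simp add: OXP_units_def units_of_carrier OX_unit_iff)

lemma FF_presheaf: "ab_presheaf (mtop M) FF"
proof (rule ab_presheaf.intro)
  show "comm_group (sgrp FF U)" if "op U" for U
    using comm_monoid.units_comm_group[OF cring.axioms(2)[OF OX_cring[OF that]]] by (simp add: OXP_units_def)
next
  fix U V assume UV: "op U" "op V" "V \<subseteq> U"
  have "cut V h \<in> Fx V" if "h \<in> Fx U" for h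
  proof -
    have "(\<lambda>x. inverse (cut V h x)) = cut V (\<lambda>x. inverse (h x))" by (auto simp: cut_def)
    then show ?thesis
      using that UV OX_cut[of h U V] OX_cut[of "\<lambda>x. inverse (h x)" U V] by (auto simp: Fx_iff cut_def)
  qed
  then show "sres FF U V \<in> hom (sgrp FF U) (sgrp FF V)"
    by (intro homI) (auto simp: cut_def)
next
  fix U h assume "op U" "h \<in> Fx U"
  then show "sres FF U U h = h" by (simp add: Fx_iff cut_OX_eq)
next
  fix U V W :: "'x set" and h assume "W \<subseteq> V" "V \<subseteq> U"
  then show "sres FF V W (sres FF U V h) = sres FF U W h" by (simp add: Int_absorb1)
qed

text \<open>Linearity, compatibility with restriction and closedness in one condition, closedness
  being solved for the value on a bracket. The normalisation to zero outside the domain is kept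
  apart and recombined in \<open>Gx_iff\<close>.\<close>

definition lin_form :: "'x set \<Rightarrow> ('x set \<Rightarrow> 'b \<Rightarrow> 'x cfun) \<Rightarrow> bool" where
  "lin_form U \<alpha> \<longleftrightarrow> (\<forall>V. op V \<and> V \<subseteq> U \<longrightarrow>
     (\<forall>b\<in>BB V. \<alpha> V b \<in> OX V \<and>
        (\<forall>b'\<in>BB V. \<alpha> V (b \<oplus>\<^bsub>sec B V\<^esub> b') = (\<lambda>x. \<alpha> V b x + \<alpha> V b' x) \<and>
           \<alpha> V (brk B V b b') = (\<lambda>x. DD V b (\<alpha> V b') x - DD V b' (\<alpha> V b) x)) \<and>
        (\<forall>f\<in>OX V. \<alpha> V (f \<odot>\<^bsub>sec B V\<^esub> b) = (\<lambda>x. f x * \<alpha> V b x)) \<and>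
        (\<forall>W. op W \<and> W \<subseteq> V \<longrightarrow> \<alpha> W (res B V W b) = cut W (\<alpha> V b))))"

lemma Gx_iff:
  "\<alpha> \<in> Gx U \<longleftrightarrow> (\<forall>V b. \<not> (op V \<and> V \<subseteq> U \<and> b \<in> BB V) \<longrightarrow> \<alpha> V b = (\<lambda>_. 0)) \<and> lin_form U \<alpha>"
proof -
  have c: "dB1 B \<alpha> V b b' = (\<lambda>_. 0) \<longleftrightarrow> \<alpha> V (brk B V b b') = (\<lambda>x. DD V b (\<alpha> V b') x - DD V b' (\<alpha> V b) x)" for V b b'
    unfolding dB1_def fun_eq_iff by (auto simp: algebra_simps)
  have e: "((\<alpha> V \<in> BB V \<rightarrow> OX V \<and>
        (\<forall>b\<in>BB V. \<forall>b'\<in>BB V. \<alpha> V (b \<oplus>\<^bsub>sec B V\<^esub> b') = \<alpha> V b \<oplus>\<^bsub>OXP M P V\<^esub> \<alpha> V b') \<and>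
        (\<forall>f\<in>OX V. \<forall>b\<in>BB V. \<alpha> V (f \<odot>\<^bsub>sec B V\<^esub> b) = f \<otimes>\<^bsub>OXP M P V\<^esub> \<alpha> V b) \<and>
        (\<forall>W. op W \<and> W \<subseteq> V \<longrightarrow> (\<forall>b\<in>BB V. \<alpha> W (res B V W b) = cut W (\<alpha> V b)))) \<and>
        (\<forall>b\<in>BB V. \<forall>b'\<in>BB V. dB1 B \<alpha> V b b' = (\<lambda>_. 0))) \<longleftrightarrow>
     (\<forall>b\<in>BB V. \<alpha> V b \<in> OX V \<and>
        (\<forall>b'\<in>BB V. \<alpha> V (b \<oplus>\<^bsub>sec B V\<^esub> b') = (\<lambda>x. \<alpha> V b x + \<alpha> V b' x) \<and>
           \<alpha> V (brk B V b b') = (\<lambda>x. DD V b (\<alpha> V b') x - DD V b' (\<alpha> V b) x)) \<and>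
        (\<forall>f\<in>OX V. \<alpha> V (f \<odot>\<^bsub>sec B V\<^esub> b) = (\<lambda>x. f x * \<alpha> V b x)) \<and>
        (\<forall>W. op W \<and> W \<subseteq> V \<longrightarrow> \<alpha> W (res B V W b) = cut W (\<alpha> V b)))" (is "?R V \<and> ?C V \<longleftrightarrow> ?S V") for V
    unfolding c OXP_simps Pi_iff
    by (rule iffI, elim conjE, (intro ballI conjI allI impI; (elim conjE)?; simp), intro ballI conjI allI impI, simp_all)
  have "\<alpha> \<in> Gx U \<longleftrightarrow> ((\<forall>V b. \<not> (op V \<and> V \<subseteq> U \<and> b \<in> BB V) \<longrightarrow> \<alpha> V b = (\<lambda>_. 0)) \<and>
     (\<forall>V. op V \<and> V \<subseteq> U \<longrightarrow> ?R V)) \<and> (\<forall>V. op V \<and> V \<subseteq> U \<longrightarrow> ?C V)"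
    unfolding B_closed_forms1_def B_forms1_def by simp
  also have "\<dots> \<longleftrightarrow> (\<forall>V b. \<not> (op V \<and> V \<subseteq> U \<and> b \<in> BB V) \<longrightarrow> \<alpha> V b = (\<lambda>_. 0)) \<and>
     (\<forall>V. op V \<and> V \<subseteq> U \<longrightarrow> ?R V \<and> ?C V)"
    by (simp only: imp_conjR all_conj_distrib conj_assoc)
  finally show ?thesis unfolding e lin_form_def .
qed

lemma
  assumes "lin_form U \<alpha>" "op V" "V \<subseteq> U" "b \<in> BB V"
  shows lin_form_closed: "\<alpha> V b \<in> OX V"
    and lin_form_add: "b' \<in> BB V \<Longrightarrow> \<alpha> V (b \<oplus>\<^bsub>sec B V\<^esub> b') = (\<lambda>x. \<alpha> V b x + \<alpha> V b' x)"
    and lin_form_brk: "b' \<in> BB V \<Longrightarrow> \<alpha> V (brk B V b b') = (\<lambda>x. DD V b (\<alpha> V b') x - DD V b' (\<alpha> V b) x)"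
    and lin_form_smult: "f \<in> OX V \<Longrightarrow> \<alpha> V (f \<odot>\<^bsub>sec B V\<^esub> b) = (\<lambda>x. f x * \<alpha> V b x)"
    and lin_form_res: "\<lbrakk>op W; W \<subseteq> V\<rbrakk> \<Longrightarrow> \<alpha> W (res B V W b) = cut W (\<alpha> V b)"
proof -
  have *: "\<alpha> V b \<in> OX V \<and>
        (\<forall>b'\<in>BB V. \<alpha> V (b \<oplus>\<^bsub>sec B V\<^esub> b') = (\<lambda>x. \<alpha> V b x + \<alpha> V b' x) \<and>
           \<alpha> V (brk B V b b') = (\<lambda>x. DD V b (\<alpha> V b') x - DD V b' (\<alpha> V b) x)) \<and>
        (\<forall>f\<in>OX V. \<alpha> V (f \<odot>\<^bsub>sec B V\<^esub> b) = (\<lambda>x. f x * \<alpha> V b x)) \<and>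
        (\<forall>W. op W \<and> W \<subseteq> V \<longrightarrow> \<alpha> W (res B V W b) = cut W (\<alpha> V b))"
    using assms unfolding lin_form_def by simp
  from * show "\<alpha> V b \<in> OX V" by simp
  from * show "b' \<in> BB V \<Longrightarrow> \<alpha> V (b \<oplus>\<^bsub>sec B V\<^esub> b') = (\<lambda>x. \<alpha> V b x + \<alpha> V b' x)" by simp
  from * show "b' \<in> BB V \<Longrightarrow> \<alpha> V (brk B V b b') = (\<lambda>x. DD V b (\<alpha> V b') x - DD V b' (\<alpha> V b) x)" by simp
  from * show "f \<in> OX V \<Longrightarrow> \<alpha> V (f \<odot>\<^bsub>sec B V\<^esub> b) = (\<lambda>x. f x * \<alpha> V b x)" by simp
  from * show "\<lbrakk>op W; W \<subseteq> V\<rbrakk> \<Longrightarrow> \<alpha> W (res B V W b) = cut W (\<alpha> V b)" by simp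
qed

lemma Gx_form: "\<alpha> \<in> Gx U \<Longrightarrow> lin_form U \<alpha>"
  by (simp add: Gx_iff)

lemma Gx_supp: "\<alpha> \<in> Gx U \<Longrightarrow> \<not> (op V \<and> V \<subseteq> U \<and> b \<in> BB V) \<Longrightarrow> \<alpha> V b = (\<lambda>_. 0)"
  by (simp only: Gx_iff) blast

lemma DD_minus: assumes "op U" "b \<in> BB U" "f \<in> OX U"
  shows "DD U b (\<lambda>x. - f x) = (\<lambda>x. - DD U b f x)"
proof -
  have "(\<lambda>x. f x + - f x) = cut U (\<lambda>_. 0)" by auto
  then have "DD U b (\<lambda>x. f x + - f x) = (\<lambda>_. 0)" using DD_const[OF assms(1,2), of 0] by simp
  then have "(\<lambda>x. DD U b f x + DD U b (\<lambda>x. - f x) x) = (\<lambda>_. 0)"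
    using DD_add[OF assms OX_minus[OF assms(1,3)]] by simp
  then show ?thesis by (auto simp: fun_eq_iff add_eq_0_iff)
qed

lemma DD_zero: "op U \<Longrightarrow> b \<in> BB U \<Longrightarrow> DD U b (\<lambda>_. 0) = (\<lambda>_. 0)"
  using DD_const[of U b 0] by simp

lemma lin_form_plus:
  assumes "lin_form U \<alpha>" "lin_form U \<beta>"
  shows "lin_form U (\<lambda>V b p. \<alpha> V b p + \<beta> V b p)"
proof -
  note * = lin_form_closed lin_form_add lin_form_brk lin_form_smult lin_form_res
  show ?thesis
    unfolding lin_form_def
  proof (intro allI impI ballI conjI)
    fix V b assume V: "op V \<and> V \<subseteq> U" and b: "b \<in> BB V"
    then have V1: "op V" and V2: "V \<subseteq> U" by auto
    note A = *[OF assms(1) V1 V2] and C = *[OF assms(2) V1 V2]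
    show "(\<lambda>p. \<alpha> V b p + \<beta> V b p) \<in> OX V" using A(1)[OF b] C(1)[OF b] by (rule OX_add[OF V1])
    { fix b' assume b': "b' \<in> BB V"
      show "(\<lambda>p. \<alpha> V (b \<oplus>\<^bsub>sec B V\<^esub> b') p + \<beta> V (b \<oplus>\<^bsub>sec B V\<^esub> b') p) = (\<lambda>x. \<alpha> V b x + \<beta> V b x + (\<alpha> V b' x + \<beta> V b' x))"
        using A(2)[OF b b'] C(2)[OF b b'] by (simp add: algebra_simps)
      show "(\<lambda>p. \<alpha> V (brk B V b b') p + \<beta> V (brk B V b b') p) =
         (\<lambda>x. DD V b (\<lambda>p. \<alpha> V b' p + \<beta> V b' p) x - DD V b' (\<lambda>p. \<alpha> V b p + \<beta> V b p) x)"
        using A(3)[OF b b'] C(3)[OF b b'] DD_add[OF V1 b A(1)[OF b'] C(1)[OF b']] DD_add[OF V1 b' A(1)[OF b] C(1)[OF b]]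
        by (simp add: algebra_simps) }
    { fix f assume f: "f \<in> OX V"
      show "(\<lambda>p. \<alpha> V (f \<odot>\<^bsub>sec B V\<^esub> b) p + \<beta> V (f \<odot>\<^bsub>sec B V\<^esub> b) p) = (\<lambda>x. f x * (\<alpha> V b x + \<beta> V b x))"
        using A(4)[OF b f] C(4)[OF b f] by (simp add: algebra_simps) }
    { fix W assume W: "op W \<and> W \<subseteq> V"
      show "(\<lambda>p. \<alpha> W (res B V W b) p + \<beta> W (res B V W b) p) = cut W (\<lambda>p. \<alpha> V b p + \<beta> V b p)"
        using A(5)[OF b] C(5)[OF b] W by (auto simp: cut_def) }
  qed
qed

lemma lin_form_uminus:
  assumes "lin_form U \<alpha>"
  shows "lin_form U (\<lambda>V b p. - \<alpha> V b p)"
proof -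
  note * = lin_form_closed lin_form_add lin_form_brk lin_form_smult lin_form_res
  show ?thesis
    unfolding lin_form_def
  proof (intro allI impI ballI conjI)
    fix V b assume V: "op V \<and> V \<subseteq> U" and b: "b \<in> BB V"
    then have V1: "op V" and V2: "V \<subseteq> U" by auto
    note A = *[OF assms(1) V1 V2]
    show "(\<lambda>p. - \<alpha> V b p) \<in> OX V" using A(1)[OF b] by (rule OX_minus[OF V1])
    { fix b' assume b': "b' \<in> BB V"
      show "(\<lambda>p. - \<alpha> V (b \<oplus>\<^bsub>sec B V\<^esub> b') p) = (\<lambda>x. - \<alpha> V b x + - \<alpha> V b' x)"
        using A(2)[OF b b'] by (simp add: algebra_simps)
      show "(\<lambda>p. - \<alpha> V (brk B V b b') p) = (\<lambda>x. DD V b (\<lambda>p. - \<alpha> V b' p) x - DD V b' (\<lambda>p. - \<alpha> V b p) x)"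
        using A(3)[OF b b'] DD_minus[OF V1 b A(1)[OF b']] DD_minus[OF V1 b' A(1)[OF b]]
        by (simp add: algebra_simps) }
    { fix f assume f: "f \<in> OX V"
      show "(\<lambda>p. - \<alpha> V (f \<odot>\<^bsub>sec B V\<^esub> b) p) = (\<lambda>x. f x * - \<alpha> V b x)"
        using A(4)[OF b f] by (simp add: algebra_simps) }
    { fix W assume W: "op W \<and> W \<subseteq> V"
      show "(\<lambda>p. - \<alpha> W (res B V W b) p) = cut W (\<lambda>p. - \<alpha> V b p)"
        using A(5)[OF b] W by (auto simp: cut_def) }
  qed
qed

lemma lin_form_zero: "lin_form U (\<lambda>_ _ _. 0)"
  by (auto simp: lin_form_def OX_zero DD_zero)

lemma lin_form_restrict:
  assumes "lin_form U \<alpha>" "V \<subseteq> U"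
  shows "lin_form V (\<lambda>W. if W \<subseteq> V then \<alpha> W else (\<lambda>_ _. 0))"
proof -
  note * = lin_form_closed lin_form_add lin_form_brk lin_form_smult lin_form_res
  show ?thesis
    unfolding lin_form_def
  proof (intro allI impI, elim conjE)
    fix W assume W: "op W" "W \<subseteq> V"
    then have W2: "W \<subseteq> U" using assms(2) by blast
    have "W' \<subseteq> V" if "W' \<subseteq> W" for W' using that W by blast
    then show "\<forall>b\<in>BB W. (if W \<subseteq> V then \<alpha> W else (\<lambda>_ _. 0)) b \<in> OX W \<and>
        (\<forall>b'\<in>BB W. (if W \<subseteq> V then \<alpha> W else (\<lambda>_ _. 0)) (b \<oplus>\<^bsub>sec B W\<^esub> b') =
             (\<lambda>x. (if W \<subseteq> V then \<alpha> W else (\<lambda>_ _. 0)) b x + (if W \<subseteq> V then \<alpha> W else (\<lambda>_ _. 0)) b' x) \<and>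
           (if W \<subseteq> V then \<alpha> W else (\<lambda>_ _. 0)) (brk B W b b') =
             (\<lambda>x. DD W b ((if W \<subseteq> V then \<alpha> W else (\<lambda>_ _. 0)) b') x - DD W b' ((if W \<subseteq> V then \<alpha> W else (\<lambda>_ _. 0)) b) x)) \<and>
        (\<forall>f\<in>OX W. (if W \<subseteq> V then \<alpha> W else (\<lambda>_ _. 0)) (f \<odot>\<^bsub>sec B W\<^esub> b) = (\<lambda>x. f x * (if W \<subseteq> V then \<alpha> W else (\<lambda>_ _. 0)) b x)) \<and>
        (\<forall>W'. op W' \<and> W' \<subseteq> W \<longrightarrow> (if W' \<subseteq> V then \<alpha> W' else (\<lambda>_ _. 0)) (res B W W' b) = cut W' ((if W \<subseteq> V then \<alpha> W else (\<lambda>_ _. 0)) b))"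
      using *[OF assms(1) W(1) W2] W by (intro ballI conjI allI impI) simp_all
  qed
qed

lemma Gx_mult: "\<alpha> \<in> Gx U \<Longrightarrow> \<beta> \<in> Gx U \<Longrightarrow> (\<lambda>V b p. \<alpha> V b p + \<beta> V b p) \<in> Gx U"
  unfolding Gx_iff by (intro conjI lin_form_plus) auto

lemma Gx_uminus: "\<alpha> \<in> Gx U \<Longrightarrow> (\<lambda>V b p. - \<alpha> V b p) \<in> Gx U"
  unfolding Gx_iff by (intro conjI lin_form_uminus) auto

lemma Gx_zero: "(\<lambda>_ _ _. 0) \<in> Gx U"
  unfolding Gx_iff by (intro conjI lin_form_zero) auto

lemma Gx_restrict: "\<lbrakk>\<alpha> \<in> Gx U; V \<subseteq> U\<rbrakk> \<Longrightarrow> (\<lambda>W. if W \<subseteq> V then \<alpha> W else (\<lambda>_ _. 0)) \<in> Gx V"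
  unfolding Gx_iff by (intro conjI lin_form_restrict) auto

lemma GG_presheaf: "ab_presheaf (mtop M) GG"
proof (rule ab_presheaf.intro)
  show "comm_group (sgrp GG U)" if "op U" for U
  proof (rule comm_groupI)
    fix \<alpha> assume "\<alpha> \<in> Gx U"
    then show "\<exists>\<beta>\<in>Gx U. \<beta> \<otimes>\<^bsub>sgrp GG U\<^esub> \<alpha> = \<one>\<^bsub>sgrp GG U\<^esub>"
      by (intro bexI[OF _ Gx_uminus]) simp_all
  qed (simp_all add: Gx_mult Gx_zero algebra_simps)
next
  fix U V :: "'x set" assume "V \<subseteq> U"
  then show "sres GG U V \<in> hom (sgrp GG U) (sgrp GG V)"
    by (intro homI) (simp_all add: Gx_restrict fun_eq_iff)
next
  fix U \<alpha> assume "\<alpha> \<in> Gx U"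
  then show "sres GG U U \<alpha> = \<alpha>" using Gx_supp[of \<alpha> U] by (auto simp: fun_eq_iff)
next
  fix U V W :: "'x set" and \<alpha> assume "W \<subseteq> V" "V \<subseteq> U"
  then show "sres GG V W (sres GG U V \<alpha>) = sres GG U W \<alpha>" by (auto simp: fun_eq_iff)
qed

section \<open>The logarithmic differential as a morphism of presheaves\<close>

abbreviation "dlog \<equiv> dB_log M B"

text \<open>Differentiate \<open>h * inverse h = 1\<close>, an identity with a constant function on
  \<open>U\<close>.\<close>

lemma Fx_inv_DD:
  assumes U: "op U" and b: "b \<in> BB U" and h: "h \<in> Fx U"
  shows "DD U b (\<lambda>x. inverse (h x)) = (\<lambda>x. - (inverse (h x) * inverse (h x) * DD U b h x))"
proof
  fix x
  have h': "h \<in> OX U" "(\<lambda>x. inverse (h x)) \<in> OX U" "\<forall>x\<in>U. h x \<noteq> 0" using h U by (auto simp: Fx_iff)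
  have "(\<lambda>x. h x * inverse (h x)) = cut U (\<lambda>_. 1)" using h' by (auto simp: cut_def OX_off fun_eq_iff)
  then have "h x * DD U b (\<lambda>x. inverse (h x)) x + inverse (h x) * DD U b h x = 0"
    using fun_cong[OF DD_mult[OF U b h'(1,2)], of x] fun_cong[OF DD_const[OF U b, of 1], of x] by simp
  then have "h x * DD U b (\<lambda>x. inverse (h x)) x = - (inverse (h x) * DD U b h x)"
    by (simp add: add_eq_0_iff2)
  then show "DD U b (\<lambda>x. inverse (h x)) x = - (inverse (h x) * inverse (h x) * DD U b h x)"
  proof (cases "x \<in> U")
    case True
    then have "inverse (h x) * (h x * DD U b (\<lambda>x. inverse (h x)) x) = DD U b (\<lambda>x. inverse (h x)) x" using h' by simp
    then show ?thesis using \<open>h x * _ = _\<close> by (simp add: mult.assoc)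
  qed (simp add: DD_off)
qed

text \<open>Cutting \<open>h\<close> to \<open>V\<close> makes both factors sections over
  \<open>V\<close>; outside \<open>V\<close> both sides vanish together with the derivative.\<close>

lemma dlog_eq: "\<lbrakk>op V; V \<subseteq> U; b \<in> BB V\<rbrakk> \<Longrightarrow> dlog U h V b = (\<lambda>x. inverse (cut V h x) * DD V b (cut V h) x)"
  by (auto simp: dB_log_def dB0_def cut_def DD_off divide_inverse fun_eq_iff)

text \<open>By \<open>DD_brk\<close> the derivative along a bracket is the commutator of the
  derivatives. The terms that arise from differentiating \<open>inverse k\<close> are symmetric in
  \<open>b\<close> and \<open>b'\<close> and cancel, which is closedness.\<close>

lemma dlog_closed:
  assumes U: "op U" and h: "h \<in> Fx U"
  shows "dlog U h \<in> Gx U"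
  unfolding Gx_iff lin_form_def
proof (intro conjI allI impI ballI)
  fix V b assume "\<not> (op V \<and> V \<subseteq> U \<and> b \<in> BB V)"
  then show "dlog U h V b = (\<lambda>_. 0)" by (auto simp: dB_log_def dB0_def)
next
  fix V b assume V: "op V \<and> V \<subseteq> U" and b: "b \<in> BB V"
  then have V1: "op V" and V2: "V \<subseteq> U" by auto
  define k where "k = cut V h"
  have k: "k \<in> Fx V" unfolding k_def using ab_presheaf.res_closed[OF FF_presheaf U V1 V2 h] by simp
  then have k1: "k \<in> OX V" and k2: "(\<lambda>x. inverse (k x)) \<in> OX V" by (auto simp: Fx_iff[OF V1])
  have e: "dlog U h V b = (\<lambda>x. inverse (k x) * DD V b k x)" if "b \<in> BB V" for b
    using dlog_eq[OF V1 V2 that] by (simp add: k_def)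
  show "dlog U h V b \<in> OX V" unfolding e[OF b] by (rule OX_mult[OF V1 k2 DD_closed[OF V1 b k1]])
  { fix b' assume b': "b' \<in> BB V"
    show "dlog U h V (b \<oplus>\<^bsub>sec B V\<^esub> b') = (\<lambda>x. dlog U h V b x + dlog U h V b' x)"
      unfolding e[OF b] e[OF b'] e[OF BB_add[OF V1 b b']] DD_badd[OF V1 b b' k1] by (simp add: algebra_simps)
    show "dlog U h V (brk B V b b') = (\<lambda>x. DD V b (dlog U h V b') x - DD V b' (dlog U h V b) x)"
      unfolding e[OF b] e[OF b'] e[OF brk_closed[OF V1 b b']] DD_brk[OF V1 b b' k1]
        DD_mult[OF V1 b k2 DD_closed[OF V1 b' k1]] DD_mult[OF V1 b' k2 DD_closed[OF V1 b k1]]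
        Fx_inv_DD[OF V1 b k] Fx_inv_DD[OF V1 b' k] by (simp add: algebra_simps) }
  { fix f assume f: "f \<in> OX V"
    show "dlog U h V (f \<odot>\<^bsub>sec B V\<^esub> b) = (\<lambda>x. f x * dlog U h V b x)"
      unfolding e[OF b] e[OF BB_smult[OF V1 f b]] DD_bsmult[OF V1 f b k1] by (simp add: algebra_simps) }
  { fix W assume W: "op W \<and> W \<subseteq> V"
    then have "cut W h = cut W k" by (auto simp: k_def cut_def fun_eq_iff)
    then show "dlog U h W (res B V W b) = cut W (dlog U h V b)"
      using dlog_eq[of W U "res B V W b" h] W V2 BB_res[OF V1 _ _ b, of W] DD_cut[OF V1 _ _ b k1, of W]
      unfolding e[OF b] by (auto simp: cut_def) }
qed

lemma dlog_mult:
  assumes U: "op U" and h: "h \<in> Fx U" and k: "k \<in> Fx U"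
  shows "dlog U (\<lambda>x. h x * k x) = (\<lambda>V b p. dlog U h V b p + dlog U k V b p)"
proof (intro ext)
  fix V b x
  show "dlog U (\<lambda>x. h x * k x) V b x = dlog U h V b x + dlog U k V b x"
  proof (cases "op V \<and> V \<subseteq> U \<and> b \<in> BB V \<and> x \<in> V")
    case True
    have h': "cut V h \<in> OX V" "cut V k \<in> OX V" "h x \<noteq> 0" "k x \<noteq> 0"
      using h k U True OX_cut by (auto simp: Fx_iff[OF U])
    have "cut V (\<lambda>x. h x * k x) = (\<lambda>x. cut V h x * cut V k x)" by (auto simp: cut_def)
    then have "DD V b (cut V (\<lambda>x. h x * k x)) x = h x * DD V b (cut V k) x + k x * DD V b (cut V h) x"
      using True DD_mult[of V b "cut V h" "cut V k"] h' by (simp add: cut_def)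
    then show ?thesis using True h' by (simp add: dlog_eq) (simp add: cut_def field_simps)
  next
    case False
    then show ?thesis by (auto simp: dB_log_def dB0_def DD_off)
  qed
qed

lemma dlog_hom: "ab_presheaf_hom (mtop M) FF GG dlog"
proof -
  interpret F: ab_presheaf "mtop M" FF by (rule FF_presheaf)
  interpret G: ab_presheaf "mtop M" GG by (rule GG_presheaf)
  show ?thesis
  proof
    show "dlog U \<in> hom (sgrp FF U) (sgrp GG U)" if "op U" for U
      by (rule homI) (simp_all add: dlog_closed[OF that] dlog_mult[OF that])
  next
    fix U V h assume UV: "op U" "op V" "V \<subseteq> U"
    show "dlog V (sres FF U V h) = sres GG U V (dlog U h)"
    proof (intro ext)
      fix W b x
      show "dlog V (sres FF U V h) W b x = sres GG U V (dlog U h) W b x"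
      proof (cases "op W \<and> W \<subseteq> V \<and> b \<in> BB W")
        case True
        then have "W \<subseteq> U" "V \<inter> W = W" using UV by auto
        then show ?thesis using True by (simp add: dlog_eq)
      qed (auto simp: dB_log_def dB0_def)
    qed
  qed
qed

end

section \<open>The module of an atlas\<close>

context lie_algebroid_space
begin

text \<open>
  A chart \<open>(V, \<gamma>, \<alpha>)\<close> describes a generator \<open>1 / \<gamma>\<close> over \<open>V\<close> of a submodule of the sheaf of all
  complex functions, where \<open>\<gamma>\<close> need not be continuous, with connection form \<open>\<alpha>\<close>.
\<close>

definition atlas :: "('x set \<times> 'x cfun \<times> ('x set \<Rightarrow> 'b \<Rightarrow> 'x cfun)) set \<Rightarrow> bool" where
  "atlas A \<longleftrightarrow> (\<forall>(V, \<gamma>, \<alpha>)\<in>A. op V \<and> (\<forall>x\<in>V. \<gamma> x \<noteq> 0) \<and> \<alpha> \<in> Gx V) \<and>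
     (\<forall>p\<in>topspace (mtop M). \<exists>(V, \<gamma>, \<alpha>)\<in>A. p \<in> V) \<and>
     (\<forall>(V, \<gamma>, \<alpha>)\<in>A. \<forall>(V', \<gamma>', \<alpha>')\<in>A. \<forall>p\<in>V \<inter> V'. \<exists>W h. op W \<and> p \<in> W \<and> W \<subseteq> V \<inter> V' \<and> h \<in> Fx W \<and>
        (\<forall>x\<in>W. \<gamma>' x = h x * \<gamma> x) \<and>
        (\<forall>W' b. op W' \<and> W' \<subseteq> W \<and> b \<in> BB W' \<longrightarrow> \<alpha> W' b = (\<lambda>x. \<alpha>' W' b x + dlog W h W' b x)))"

definition L_sec :: "('x set \<times> 'x cfun \<times> ('x set \<Rightarrow> 'b \<Rightarrow> 'x cfun)) set \<Rightarrow> 'x set \<Rightarrow> 'x cfun set" where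
  "L_sec A U = {s. (\<forall>x. x \<notin> U \<longrightarrow> s x = 0) \<and> (\<forall>(V, \<gamma>, \<alpha>)\<in>A. cut (U \<inter> V) (\<lambda>x. \<gamma> x * s x) \<in> OX (U \<inter> V))}"

text \<open>In the coordinate \<open>\<gamma> * s\<close> the action is the derivative along
  \<open>b\<close> plus multiplication by the connection form; dividing by \<open>\<gamma>\<close>
  returns from the coordinate to the function.\<close>

definition chart_act :: "'x cfun \<Rightarrow> ('x set \<Rightarrow> 'b \<Rightarrow> 'x cfun) \<Rightarrow> 'x set \<Rightarrow> 'b \<Rightarrow> 'x cfun \<Rightarrow> 'x cfun" where
  "chart_act \<gamma> \<alpha> W b s = (\<lambda>x. (DD W b (cut W (\<lambda>x. \<gamma> x * s x)) x + \<alpha> W b x * (\<gamma> x * s x)) / \<gamma> x)"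

text \<open>Sections are functions, so the action can be given by its values, with a chart picked
  anew at every point; \<open>L_act_eq\<close> shows that the choice does not matter.\<close>

definition L_act :: "('x set \<times> 'x cfun \<times> ('x set \<Rightarrow> 'b \<Rightarrow> 'x cfun)) set \<Rightarrow> 'x set \<Rightarrow> 'b \<Rightarrow> 'x cfun \<Rightarrow> 'x cfun" where
  "L_act A U b s = (\<lambda>x. if x \<in> U then
     (case SOME c. c \<in> A \<and> x \<in> fst c of (V, \<gamma>, \<alpha>) \<Rightarrow> chart_act \<gamma> \<alpha> (U \<inter> V) (res B U (U \<inter> V) b) s x) else 0)"

definition L_mod :: "('x set \<times> 'x cfun \<times> ('x set \<Rightarrow> 'b \<Rightarrow> 'x cfun)) set \<Rightarrow> ('x, 'b, 'x cfun) bmod" where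
  "L_mod A = \<lparr>sec = (\<lambda>U. \<lparr>carrier = L_sec A U, monoid.mult = (\<lambda>f g x. f x * g x), monoid.one = (\<lambda>_. 0),
      ring.zero = (\<lambda>_. 0), ring.add = (\<lambda>f g x. f x + g x), smult = (\<lambda>f s x. f x * s x)\<rparr>),
    res = (\<lambda>U V. cut V), act = L_act A\<rparr>"

lemma L_mod_simps [simp]:
  "carrier (sec (L_mod A) U) = L_sec A U" "\<zero>\<^bsub>sec (L_mod A) U\<^esub> = (\<lambda>_. 0)"
  "s \<oplus>\<^bsub>sec (L_mod A) U\<^esub> t = (\<lambda>x. s x + t x)" "f \<odot>\<^bsub>sec (L_mod A) U\<^esub> s = (\<lambda>x. f x * s x)"
  "res (L_mod A) U V = cut V" "act (L_mod A) = L_act A"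
  by (simp_all add: L_mod_def)

end

section \<open>Sections and action of the module of an atlas\<close>

locale atlas_space = lie_algebroid_space M P B
  for M :: "'x mfd" and P :: "'x distrib" and B :: "('x, 'b) lie_algd" +
  fixes A :: "('x set \<times> 'x cfun \<times> ('x set \<Rightarrow> 'b \<Rightarrow> 'x cfun)) set"
  assumes atl: "atlas A"
begin

lemma chart:
  assumes "(V, \<gamma>, \<alpha>) \<in> A"
  shows chart_op: "op V" and chart_nz: "x \<in> V \<Longrightarrow> \<gamma> x \<noteq> 0" and chart_form: "\<alpha> \<in> Gx V"
  using atl assms by (auto simp: atlas_def)

lemma chart_ex:
  assumes "op U" "p \<in> U"
  obtains V \<gamma> \<alpha> where "(V, \<gamma>, \<alpha>) \<in> A" "p \<in> V"
proof -
  have "\<forall>p\<in>topspace (mtop M). \<exists>(V, \<gamma>, \<alpha>)\<in>A. p \<in> V" using atl unfolding atlas_def by (elim conjE)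
  moreover have "p \<in> topspace (mtop M)" using assms openin_subset by blast
  ultimately show thesis using that by fastforce
qed

lemma chart_compat:
  assumes "(V, \<gamma>, \<alpha>) \<in> A" "(V', \<gamma>', \<alpha>') \<in> A" "p \<in> V" "p \<in> V'"
  obtains W h where "op W" "p \<in> W" "W \<subseteq> V" "W \<subseteq> V'" "h \<in> Fx W" "\<And>x. x \<in> W \<Longrightarrow> \<gamma>' x = h x * \<gamma> x"
    "\<And>W' b. \<lbrakk>op W'; W' \<subseteq> W; b \<in> BB W'\<rbrakk> \<Longrightarrow> \<alpha> W' b = (\<lambda>x. \<alpha>' W' b x + dlog W h W' b x)"
proof -
  have "\<forall>(V, \<gamma>, \<alpha>)\<in>A. \<forall>(V', \<gamma>', \<alpha>')\<in>A. \<forall>p\<in>V \<inter> V'. \<exists>W h. op W \<and> p \<in> W \<and> W \<subseteq> V \<inter> V' \<and> h \<in> Fx W \<and>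
        (\<forall>x\<in>W. \<gamma>' x = h x * \<gamma> x) \<and>
        (\<forall>W' b. op W' \<and> W' \<subseteq> W \<and> b \<in> BB W' \<longrightarrow> \<alpha> W' b = (\<lambda>x. \<alpha>' W' b x + dlog W h W' b x))"
    using atl unfolding atlas_def by (elim conjE)
  from bspec[OF bspec[OF bspec[OF this assms(1), unfolded prod.case] assms(2), unfolded prod.case] IntI[OF assms(3,4)]]
  obtain W h where *: "op W \<and> p \<in> W \<and> W \<subseteq> V \<inter> V' \<and> h \<in> Fx W \<and> (\<forall>x\<in>W. \<gamma>' x = h x * \<gamma> x) \<and>
    (\<forall>W' b. op W' \<and> W' \<subseteq> W \<and> b \<in> BB W' \<longrightarrow> \<alpha> W' b = (\<lambda>x. \<alpha>' W' b x + dlog W h W' b x))"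
    by (elim exE)
  show thesis by (rule that[of W h]) (use * in auto)
qed

lemma L_sec_off: "s \<in> L_sec A U \<Longrightarrow> x \<notin> U \<Longrightarrow> s x = 0"
  by (auto simp: L_sec_def)

lemma L_sec_chart:
  assumes "s \<in> L_sec A U" "(V, \<gamma>, \<alpha>) \<in> A" "op U" "op W" "W \<subseteq> U" "W \<subseteq> V"
  shows "cut W (\<lambda>x. \<gamma> x * s x) \<in> OX W"
proof -
  have "cut (U \<inter> V) (\<lambda>x. \<gamma> x * s x) \<in> OX (U \<inter> V)" using assms by (auto simp: L_sec_def)
  moreover have "U \<inter> V \<inter> W = W" "W \<subseteq> U \<inter> V" using assms by auto
  ultimately show ?thesis using OX_cut[of _ "U \<inter> V" W] assms(4) by fastforce
qed

text \<open>In another chart the coordinate is multiplied near each point by a section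
  \<open>h\<close>, and membership in the structure sheaf is local; so one chart around each point
  suffices.\<close>

lemma L_secI:
  assumes U: "op U" and off: "\<And>x. x \<notin> U \<Longrightarrow> s x = 0"
    and loc: "\<And>p. p \<in> U \<Longrightarrow> \<exists>V \<gamma> \<alpha> W. (V, \<gamma>, \<alpha>) \<in> A \<and> op W \<and> p \<in> W \<and> W \<subseteq> U \<inter> V \<and> cut W (\<lambda>x. \<gamma> x * s x) \<in> OX W"
  shows "s \<in> L_sec A U"
proof -
  have "cut (U \<inter> V') (\<lambda>x. \<gamma>' x * s x) \<in> OX (U \<inter> V')" if c': "(V', \<gamma>', \<alpha>') \<in> A" for V' \<gamma>' \<alpha>'
  proof (rule OX_local)
    show "op (U \<inter> V')" using U chart_op[OF c'] by blast
    fix p assume p: "p \<in> U \<inter> V'"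
    then obtain V \<gamma> \<alpha> W where c: "(V, \<gamma>, \<alpha>) \<in> A" and W: "op W" "p \<in> W" "W \<subseteq> U \<inter> V" "cut W (\<lambda>x. \<gamma> x * s x) \<in> OX W"
      using loc by blast
    obtain W' h where W': "op W'" "p \<in> W'" "W' \<subseteq> V" "W' \<subseteq> V'" "h \<in> Fx W'" "\<And>x. x \<in> W' \<Longrightarrow> \<gamma>' x = h x * \<gamma> x"
      by (rule chart_compat[OF c c', of p]) (use W p in auto)
    define W2 where "W2 = W \<inter> W'"
    have W2: "op W2" "p \<in> W2" "W2 \<subseteq> W" "W2 \<subseteq> W'" "W2 \<subseteq> U \<inter> V'" using W W' by (auto simp: W2_def)
    have "(\<lambda>x. cut W2 h x * cut W2 (cut W (\<lambda>x. \<gamma> x * s x)) x) \<in> OX W2"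
      using W W' W2 by (intro OX_mult OX_cut[of h W' W2] OX_cut[of _ W W2]) (auto simp: Fx_iff)
    moreover have "(\<lambda>x. cut W2 h x * cut W2 (cut W (\<lambda>x. \<gamma> x * s x)) x) = cut W2 (cut (U \<inter> V') (\<lambda>x. \<gamma>' x * s x))"
      using W2 W'(6) by (auto simp: cut_def fun_eq_iff)
    ultimately show "\<exists>V. op V \<and> p \<in> V \<and> V \<subseteq> U \<inter> V' \<and> cut V (cut (U \<inter> V') (\<lambda>x. \<gamma>' x * s x)) \<in> OX V"
      using W2 by auto
  qed (auto simp: cut_def)
  with off show ?thesis by (auto simp: L_sec_def)
qed

lemma chart_act_res:
  assumes c: "(V, \<gamma>, \<alpha>) \<in> A" and U: "op U" and W: "op W" "W \<subseteq> U" "W \<subseteq> V" and W': "op W'" "W' \<subseteq> W"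
    and b: "b \<in> BB W" and s: "s \<in> L_sec A U" and x: "x \<in> W'"
  shows "chart_act \<gamma> \<alpha> W' (res B W W' b) s x = chart_act \<gamma> \<alpha> W b s x"
proof -
  have e: "cut W' (\<lambda>x. \<gamma> x * s x) = cut W' (cut W (\<lambda>x. \<gamma> x * s x))" using W' by (auto simp: cut_def fun_eq_iff)
  show ?thesis
    unfolding chart_act_def e DD_cut[OF W(1) W' b L_sec_chart[OF s c U W]]
      lin_form_res[OF Gx_form[OF chart_form[OF c]] W(1,3) b W']
    using x by (simp add: cut_def)
qed

text \<open>Passing from \<open>\<gamma>\<close> to \<open>h * \<gamma>\<close> adds the logarithmic
  derivative of \<open>h\<close> to the derivative term and subtracts it from the connection form,
  so the value of the action stays the same.\<close>

lemma L_act_eq: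
  assumes c: "(V, \<gamma>, \<alpha>) \<in> A" and U: "op U" and W: "op W" "W \<subseteq> U" "W \<subseteq> V" and b: "b \<in> BB U"
    and s: "s \<in> L_sec A U" and x: "x \<in> W"
  shows "L_act A U b s x = chart_act \<gamma> \<alpha> W (res B U W b) s x"
proof -
  define c' where "c' = (SOME c. c \<in> A \<and> x \<in> fst c)"
  have "c' \<in> A \<and> x \<in> fst c'" unfolding c'_def by (rule someI_ex) (use c x W in force)
  then obtain V' \<gamma>' \<alpha>' where c': "c' = (V', \<gamma>', \<alpha>')" "(V', \<gamma>', \<alpha>') \<in> A" "x \<in> V'" by (cases c') auto
  have UV': "op (U \<inter> V')" using U chart_op[OF c'(2)] by blast
  have l: "L_act A U b s x = chart_act \<gamma>' \<alpha>' (U \<inter> V') (res B U (U \<inter> V') b) s x"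
    using x W unfolding L_act_def c'_def[symmetric] c'(1) by auto
  obtain W0 h where W0: "op W0" "x \<in> W0" "W0 \<subseteq> V" "W0 \<subseteq> V'" "h \<in> Fx W0" "\<And>x. x \<in> W0 \<Longrightarrow> \<gamma>' x = h x * \<gamma> x"
    "\<And>W' b. \<lbrakk>op W'; W' \<subseteq> W0; b \<in> BB W'\<rbrakk> \<Longrightarrow> \<alpha> W' b = (\<lambda>x. \<alpha>' W' b x + dlog W0 h W' b x)"
    by (rule chart_compat[OF c c'(2), of x]) (use W x c' in auto)
  \<comment> \<open>A neighbourhood of \<open>x\<close> inside both charts on which the transition
    function \<open>h\<close> is available; both values are computed there.\<close>
  define W1 where "W1 = W \<inter> W0"
  have W1: "op W1" "W1 \<subseteq> W" "W1 \<subseteq> W0" "W1 \<subseteq> U" "W1 \<subseteq> V" "W1 \<subseteq> V'" "W1 \<subseteq> U \<inter> V'" "x \<in> W1"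
    using W W0 x by (auto simp: W1_def)
  define b1 where "b1 = res B U W1 b"
  have b1: "b1 \<in> BB W1" unfolding b1_def by (rule BB_res[OF U W1(1,4) b])
  define g where "g = cut W1 (\<lambda>x. \<gamma> x * s x)"
  have g: "g \<in> OX W1" unfolding g_def by (rule L_sec_chart[OF s c U W1(1,4,5)])
  define k where "k = cut W1 h"
  have k: "k \<in> OX W1" unfolding k_def using W0 W1 OX_cut[of h W0 W1] by (auto simp: Fx_iff)
  have hx: "h x \<noteq> 0" using W0 W1 by (auto simp: Fx_iff)
  have gx: "\<gamma> x \<noteq> 0" using chart_nz[OF c] x W by blast
  have e: "cut W1 (\<lambda>x. \<gamma>' x * s x) = (\<lambda>x. k x * g x)"
    using W0(6) W1 by (auto simp: k_def g_def cut_def fun_eq_iff)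
  have a: "\<alpha> W1 b1 x = \<alpha>' W1 b1 x + DD W1 b1 k x / h x"
    using W0(7)[OF W1(1,3) b1] dlog_eq[OF W1(1,3) b1, of h] W1(8) by (simp add: k_def cut_def divide_inverse)
  have "chart_act \<gamma>' \<alpha>' W1 b1 s x = chart_act \<gamma> \<alpha> W1 b1 s x"
    unfolding chart_act_def e DD_mult[OF W1(1) b1 k g] g_def[symmetric] a W0(6)[OF W0(2)]
    using hx gx W1(8) by (simp add: g_def[THEN fun_cong] k_def[THEN fun_cong] cut_def) (simp add: field_simps)
  moreover have "chart_act \<gamma> \<alpha> W1 b1 s x = chart_act \<gamma> \<alpha> W (res B U W b) s x"
    using chart_act_res[OF c U W W1(1,2) BB_res[OF U W(1,2) b] s W1(8)] om_res_res[OF B_om U W(1) W1(1,2) W(2) b]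
    by (simp add: b1_def)
  moreover have "chart_act \<gamma>' \<alpha>' W1 b1 s x = chart_act \<gamma>' \<alpha>' (U \<inter> V') (res B U (U \<inter> V') b) s x"
    using chart_act_res[OF c'(2) U UV' _ _ W1(1,7) BB_res[OF U UV' _ b] s W1(8)] om_res_res[OF B_om U UV' W1(1,7) _ b]
    by (simp add: b1_def)
  ultimately show ?thesis using l by simp
qed

text \<open>Multiplying by \<open>\<gamma>\<close> clears the denominator and leaves an identity in
  the structure sheaf. Combined with \<open>L_sec_eqI\<close>, it reduces the algebraic laws of the
  action to calculations with \<open>DD\<close> in one chart.\<close>

lemma L_act_chart:
  assumes c: "(V, \<gamma>, \<alpha>) \<in> A" and U: "op U" and W: "op W" "W \<subseteq> U" "W \<subseteq> V" and b: "b \<in> BB U" and s: "s \<in> L_sec A U"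
  shows "cut W (\<lambda>x. \<gamma> x * L_act A U b s x) =
    (\<lambda>x. DD W (res B U W b) (cut W (\<lambda>x. \<gamma> x * s x)) x + \<alpha> W (res B U W b) x * cut W (\<lambda>x. \<gamma> x * s x) x)"
proof
  fix x show "cut W (\<lambda>x. \<gamma> x * L_act A U b s x) x =
    DD W (res B U W b) (cut W (\<lambda>x. \<gamma> x * s x)) x + \<alpha> W (res B U W b) x * cut W (\<lambda>x. \<gamma> x * s x) x"
  proof (cases "x \<in> W")
    case True
    then have "\<gamma> x \<noteq> 0" using chart_nz[OF c] W by blast
    then show ?thesis using True L_act_eq[OF c U W b s True] by (simp add: chart_act_def cut_def)
  qed (simp add: cut_def DD_off)
qed

lemma L_act_closed:
  assumes U: "op U" and b: "b \<in> BB U" and s: "s \<in> L_sec A U"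
  shows "L_act A U b s \<in> L_sec A U"
proof -
  have "cut (U \<inter> V) (\<lambda>x. \<gamma> x * L_act A U b s x) \<in> OX (U \<inter> V)" if c: "(V, \<gamma>, \<alpha>) \<in> A" for V \<gamma> \<alpha>
  proof -
    have W: "op (U \<inter> V)" "U \<inter> V \<subseteq> U" "U \<inter> V \<subseteq> V" using U chart_op[OF c] by auto
    note b' = BB_res[OF U W(1,2) b] and g = L_sec_chart[OF s c U W]
    show ?thesis
      unfolding L_act_chart[OF c U W b s]
      by (intro OX_add OX_mult DD_closed W(1) b' g lin_form_closed[OF Gx_form[OF chart_form[OF c]] W(1,3) b'])
  qed
  then show ?thesis by (auto simp: L_sec_def L_act_def)
qed

lemma L_sec_eqI:
  assumes U: "op U" and off: "\<And>x. x \<notin> U \<Longrightarrow> s x = t x"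
    and eq: "\<And>V \<gamma> \<alpha>. \<lbrakk>(V, \<gamma>, \<alpha>) \<in> A; op (U \<inter> V)\<rbrakk> \<Longrightarrow> cut (U \<inter> V) (\<lambda>x. \<gamma> x * s x) = cut (U \<inter> V) (\<lambda>x. \<gamma> x * t x)"
  shows "s = t"
proof
  fix x show "s x = t x"
  proof (cases "x \<in> U")
    case True
    then obtain V \<gamma> \<alpha> where c: "(V, \<gamma>, \<alpha>) \<in> A" "x \<in> V" using chart_ex[OF U] by blast
    moreover have "op (U \<inter> V)" using U chart_op[OF c(1)] by blast
    ultimately have "\<gamma> x * s x = \<gamma> x * t x" using fun_cong[OF eq, of V \<gamma> \<alpha> x] True by (simp add: cut_def)
    then show ?thesis using chart_nz[OF c] by simp
  qed (rule off)
qed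

lemma L_sec_zero: "op U \<Longrightarrow> (\<lambda>_. 0) \<in> L_sec A U"
  using chart_op OX_zero by (auto simp: L_sec_def openin_Int)

lemma L_sec_add:
  assumes U: "op U" and s: "s \<in> L_sec A U" and t: "t \<in> L_sec A U"
  shows "(\<lambda>x. s x + t x) \<in> L_sec A U"
proof -
  have "cut (U \<inter> V) (\<lambda>x. \<gamma> x * (s x + t x)) \<in> OX (U \<inter> V)" if c: "(V, \<gamma>, \<alpha>) \<in> A" for V \<gamma> \<alpha>
  proof -
    have W: "op (U \<inter> V)" "U \<inter> V \<subseteq> U" "U \<inter> V \<subseteq> V" using U chart_op[OF c] by auto
    have "cut (U \<inter> V) (\<lambda>x. \<gamma> x * (s x + t x)) = (\<lambda>x. cut (U \<inter> V) (\<lambda>x. \<gamma> x * s x) x + cut (U \<inter> V) (\<lambda>x. \<gamma> x * t x) x)"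
      by (auto simp: cut_def algebra_simps)
    then show ?thesis using OX_add[OF W(1) L_sec_chart[OF s c U W] L_sec_chart[OF t c U W]] by simp
  qed
  then show ?thesis using s t by (auto simp: L_sec_def)
qed

lemma L_sec_smult:
  assumes U: "op U" and f: "f \<in> OX U" and s: "s \<in> L_sec A U"
  shows "(\<lambda>x. f x * s x) \<in> L_sec A U"
proof -
  have "cut (U \<inter> V) (\<lambda>x. \<gamma> x * (f x * s x)) \<in> OX (U \<inter> V)" if c: "(V, \<gamma>, \<alpha>) \<in> A" for V \<gamma> \<alpha>
  proof -
    have W: "op (U \<inter> V)" "U \<inter> V \<subseteq> U" "U \<inter> V \<subseteq> V" using U chart_op[OF c] by auto
    have "cut (U \<inter> V) (\<lambda>x. \<gamma> x * (f x * s x)) = (\<lambda>x. cut (U \<inter> V) f x * cut (U \<inter> V) (\<lambda>x. \<gamma> x * s x) x)"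
      by (auto simp: cut_def algebra_simps)
    then show ?thesis using OX_mult[OF W(1) OX_cut[OF f W(1,2)] L_sec_chart[OF s c U W]] by simp
  qed
  then show ?thesis using s by (auto simp: L_sec_def)
qed

lemma L_sec_minus:
  assumes U: "op U" and s: "s \<in> L_sec A U" shows "(\<lambda>x. - s x) \<in> L_sec A U"
proof -
  have "(\<lambda>x. cut U (\<lambda>_. - 1) x * s x) = (\<lambda>x. - s x)" using L_sec_off[OF s] by (auto simp: cut_def fun_eq_iff)
  then show ?thesis using L_sec_smult[OF U OX_const[OF U, of "- 1"] s] by simp
qed

lemma L_sec_cut:
  assumes U: "op U" "op V" "V \<subseteq> U" and s: "s \<in> L_sec A U"
  shows "cut V s \<in> L_sec A V"
proof -
  have "cut (V \<inter> V') (\<lambda>x. \<gamma> x * cut V s x) \<in> OX (V \<inter> V')" if c: "(V', \<gamma>, \<alpha>) \<in> A" for V' \<gamma> \<alpha>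
  proof -
    have W: "op (V \<inter> V')" "V \<inter> V' \<subseteq> U" "V \<inter> V' \<subseteq> V'" using U chart_op[OF c] by auto
    have "cut (V \<inter> V') (\<lambda>x. \<gamma> x * cut V s x) = cut (V \<inter> V') (\<lambda>x. \<gamma> x * s x)" by (auto simp: cut_def)
    then show ?thesis using L_sec_chart[OF s c U(1) W] by simp
  qed
  then show ?thesis by (auto simp: L_sec_def cut_def)
qed

lemma L_sheaf: "is_sheaf (mtop M) (L_sec A) (\<lambda>U V. cut V)"
  unfolding is_sheaf_def
proof (intro conjI allI impI, goal_cases)
  case (1 U V)
  then show ?case using L_sec_cut by blast
next
  case (2 U s)
  then show ?case using L_sec_off by (auto simp: cut_def)
next
  case (3 U V W s)
  then show ?case by (simp add: Int_absorb1)
next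
  case (4 \<U> s)
  \<comment> \<open>Gluing is pointwise because sections are functions; compatibility makes the
    value independent of the chosen member of the cover.\<close>
  define t where "t = (\<lambda>x. if x \<in> \<Union>\<U> then s (SOME V. V \<in> \<U> \<and> x \<in> V) x else 0)"
  have t: "t x = s V x" if "V \<in> \<U>" "x \<in> V" for V x
  proof -
    define V' where "V' = (SOME V. V \<in> \<U> \<and> x \<in> V)"
    have V': "V' \<in> \<U> \<and> x \<in> V'" unfolding V'_def by (rule someI_ex) (use that in blast)
    have "cut (V \<inter> V') (s V) x = cut (V \<inter> V') (s V') x" using 4 that V' by metis
    then have "s V' x = s V x" using that V' by (simp add: cut_def)
    then show ?thesis using that unfolding t_def V'_def[symmetric] by auto
  qed
  have o: "op (\<Union>\<U>)" using 4 by blast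
  have tc: "cut V t = s V" if "V \<in> \<U>" for V
  proof -
    have "s V x = 0" if "x \<notin> V" for x using L_sec_off 4 \<open>V \<in> \<U>\<close> that by blast
    then show ?thesis using t[OF that] by (auto simp: cut_def)
  qed
  show ?case
  proof (rule ex1I[of _ t])
    have "t \<in> L_sec A (\<Union>\<U>)"
    proof (rule L_secI[OF o])
      fix p assume "p \<in> \<Union>\<U>"
      then obtain V where V: "V \<in> \<U>" "p \<in> V" by blast
      then have Vo: "op V" and sV: "s V \<in> L_sec A V" using 4 by auto
      obtain V' \<gamma> \<alpha> where c: "(V', \<gamma>, \<alpha>) \<in> A" "p \<in> V'" using chart_ex[OF Vo V(2)] by blast
      have W: "op (V \<inter> V')" "V \<inter> V' \<subseteq> V" "V \<inter> V' \<subseteq> V'" using Vo chart_op[OF c(1)] by auto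
      have "cut (V \<inter> V') (\<lambda>x. \<gamma> x * t x) = cut (V \<inter> V') (\<lambda>x. \<gamma> x * s V x)"
        using t[OF V(1)] by (auto simp: cut_def)
      then have "cut (V \<inter> V') (\<lambda>x. \<gamma> x * t x) \<in> OX (V \<inter> V')" using L_sec_chart[OF sV c(1) Vo W] by simp
      then show "\<exists>V' \<gamma> \<alpha> W. (V', \<gamma>, \<alpha>) \<in> A \<and> op W \<and> p \<in> W \<and> W \<subseteq> \<Union>\<U> \<inter> V' \<and> cut W (\<lambda>x. \<gamma> x * t x) \<in> OX W"
        using c V W by (intro exI[of _ V'] exI[of _ \<gamma>] exI[of _ \<alpha>] exI[of _ "V \<inter> V'"]) auto
    qed (simp add: t_def)
    then show "t \<in> L_sec A (\<Union>\<U>) \<and> (\<forall>V\<in>\<U>. cut V t = s V)" using tc by blast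
    fix t' assume t': "t' \<in> L_sec A (\<Union>\<U>) \<and> (\<forall>V\<in>\<U>. cut V t' = s V)"
    show "t' = t"
    proof
      fix x show "t' x = t x"
      proof (cases "x \<in> \<Union>\<U>")
        case True
        then obtain V where V: "V \<in> \<U>" "x \<in> V" by blast
        then have "cut V t' x = s V x" using t' by metis
        then show ?thesis using t[OF V] V by (simp add: cut_def)
      next
        case False
        then show ?thesis using t' L_sec_off by (auto simp: t_def)
      qed
    qed
  qed
qed

lemma L_module:
  assumes U: "op U" shows "module (OXP M P U) (sec (L_mod A) U)"
proof (rule moduleI)
  show "cring (OXP M P U)" by (rule OX_cring[OF U])
  show "abelian_group (sec (L_mod A) U)"
  proof (rule abelian_groupI)
    fix s assume "s \<in> carrier (sec (L_mod A) U)"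
    then show "\<exists>t\<in>carrier (sec (L_mod A) U). t \<oplus>\<^bsub>sec (L_mod A) U\<^esub> s = \<zero>\<^bsub>sec (L_mod A) U\<^esub>"
      using L_sec_minus[OF U] by (intro bexI[of _ "\<lambda>x. - s x"]) auto
  qed (auto simp: L_sec_add[OF U] L_sec_zero[OF U] algebra_simps)
qed (auto simp: L_sec_smult[OF U] L_sec_off cut_def fun_eq_iff algebra_simps)

lemma L_omodule: "omodule M P (L_mod A)"
proof -
  have "res (L_mod A) = (\<lambda>U V. cut V)" by (simp add: L_mod_def)
  then show ?thesis
    unfolding omodule_def \<open>res (L_mod A) = _\<close> using L_sheaf L_module by (auto simp: cut_def fun_eq_iff)
qed

lemma L_a_minus:
  assumes U: "op U" and s: "s \<in> L_sec A U" and t: "t \<in> L_sec A U"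
  shows "s \<ominus>\<^bsub>sec (L_mod A) U\<^esub> t = (\<lambda>x. s x - t x)"
proof -
  have "\<ominus>\<^bsub>sec (L_mod A) U\<^esub> t = (\<lambda>x. - t x)"
    by (rule abelian_group.minus_equality[OF om_group[OF L_omodule U]]) (simp_all add: t L_sec_minus[OF U])
  then show ?thesis by (simp add: a_minus_def)
qed

lemma L_act_off: "x \<notin> U \<Longrightarrow> L_act A U b s x = 0"
  by (simp add: L_act_def)

lemma L_act_add:
  assumes U: "op U" and b: "b \<in> BB U" and s: "s \<in> L_sec A U" and t: "t \<in> L_sec A U"
  shows "L_act A U b (\<lambda>x. s x + t x) = (\<lambda>x. L_act A U b s x + L_act A U b t x)"
proof (rule L_sec_eqI[OF U])
  fix V \<gamma> \<alpha> assume c: "(V, \<gamma>, \<alpha>) \<in> A" and W: "op (U \<inter> V)"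
  have e: "cut (U \<inter> V) (\<lambda>x. \<gamma> x * (s x + t x)) = (\<lambda>x. cut (U \<inter> V) (\<lambda>x. \<gamma> x * s x) x + cut (U \<inter> V) (\<lambda>x. \<gamma> x * t x) x)"
    for s t :: "'x cfun" by (auto simp: cut_def algebra_simps)
  show "cut (U \<inter> V) (\<lambda>x. \<gamma> x * L_act A U b (\<lambda>x. s x + t x) x) = cut (U \<inter> V) (\<lambda>x. \<gamma> x * (L_act A U b s x + L_act A U b t x))"
    unfolding e L_act_chart[OF c U W Int_lower1 Int_lower2 b s] L_act_chart[OF c U W Int_lower1 Int_lower2 b t]
      L_act_chart[OF c U W Int_lower1 Int_lower2 b L_sec_add[OF U s t]]
      DD_add[OF W BB_res[OF U W Int_lower1 b] L_sec_chart[OF s c U W Int_lower1 Int_lower2] L_sec_chart[OF t c U W Int_lower1 Int_lower2]]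
    by (simp add: algebra_simps)
qed (simp add: L_act_off)

lemma L_act_leibniz:
  assumes U: "op U" and b: "b \<in> BB U" and f: "f \<in> OX U" and s: "s \<in> L_sec A U"
  shows "L_act A U b (\<lambda>x. f x * s x) = (\<lambda>x. DD U b f x * s x + f x * L_act A U b s x)"
proof (rule L_sec_eqI[OF U])
  fix V \<gamma> \<alpha> assume c: "(V, \<gamma>, \<alpha>) \<in> A" and W: "op (U \<inter> V)"
  have e1: "cut (U \<inter> V) (\<lambda>x. \<gamma> x * (f x * s x)) = (\<lambda>x. cut (U \<inter> V) f x * cut (U \<inter> V) (\<lambda>x. \<gamma> x * s x) x)"
    by (auto simp: cut_def algebra_simps)
  have e2: "cut (U \<inter> V) (\<lambda>x. \<gamma> x * (DD U b f x * s x + f x * L_act A U b s x)) =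
     (\<lambda>x. cut (U \<inter> V) (DD U b f) x * cut (U \<inter> V) (\<lambda>x. \<gamma> x * s x) x + cut (U \<inter> V) f x * cut (U \<inter> V) (\<lambda>x. \<gamma> x * L_act A U b s x) x)"
    by (auto simp: cut_def algebra_simps)
  show "cut (U \<inter> V) (\<lambda>x. \<gamma> x * L_act A U b (\<lambda>x. f x * s x) x) =
     cut (U \<inter> V) (\<lambda>x. \<gamma> x * (DD U b f x * s x + f x * L_act A U b s x))"
    unfolding e2 L_act_chart[OF c U W Int_lower1 Int_lower2 b s]
      L_act_chart[OF c U W Int_lower1 Int_lower2 b L_sec_smult[OF U f s]] e1
      DD_mult[OF W BB_res[OF U W Int_lower1 b] OX_cut[OF f W Int_lower1] L_sec_chart[OF s c U W Int_lower1 Int_lower2]]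
      DD_cut[OF U W Int_lower1 b f]
    by (simp add: algebra_simps)
qed (auto simp: L_act_off DD_off L_sec_off[OF s])

lemma L_act_badd:
  assumes U: "op U" and b: "b \<in> BB U" and b': "b' \<in> BB U" and s: "s \<in> L_sec A U"
  shows "L_act A U (b \<oplus>\<^bsub>sec B U\<^esub> b') s = (\<lambda>x. L_act A U b s x + L_act A U b' s x)"
proof (rule L_sec_eqI[OF U])
  fix V \<gamma> \<alpha> assume c: "(V, \<gamma>, \<alpha>) \<in> A" and W: "op (U \<inter> V)"
  note r = BB_res[OF U W Int_lower1 b] BB_res[OF U W Int_lower1 b']
  have e: "cut (U \<inter> V) (\<lambda>x. \<gamma> x * (s x + t x)) = (\<lambda>x. cut (U \<inter> V) (\<lambda>x. \<gamma> x * s x) x + cut (U \<inter> V) (\<lambda>x. \<gamma> x * t x) x)"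
    for s t :: "'x cfun" by (auto simp: cut_def algebra_simps)
  show "cut (U \<inter> V) (\<lambda>x. \<gamma> x * L_act A U (b \<oplus>\<^bsub>sec B U\<^esub> b') s x) = cut (U \<inter> V) (\<lambda>x. \<gamma> x * (L_act A U b s x + L_act A U b' s x))"
    unfolding e L_act_chart[OF c U W Int_lower1 Int_lower2 b s] L_act_chart[OF c U W Int_lower1 Int_lower2 b' s]
      L_act_chart[OF c U W Int_lower1 Int_lower2 BB_add[OF U b b'] s] om_res_add[OF B_om U W Int_lower1 b b']
      DD_badd[OF W r L_sec_chart[OF s c U W Int_lower1 Int_lower2]]
      lin_form_add[OF Gx_form[OF chart_form[OF c]] W Int_lower2 r]
    by (simp add: algebra_simps)
qed (simp add: L_act_off)

lemma L_act_bsmult: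
  assumes U: "op U" and b: "b \<in> BB U" and f: "f \<in> OX U" and s: "s \<in> L_sec A U"
  shows "L_act A U (f \<odot>\<^bsub>sec B U\<^esub> b) s = (\<lambda>x. f x * L_act A U b s x)"
proof (rule L_sec_eqI[OF U])
  fix V \<gamma> \<alpha> assume c: "(V, \<gamma>, \<alpha>) \<in> A" and W: "op (U \<inter> V)"
  note r = BB_res[OF U W Int_lower1 b]
  have e: "cut (U \<inter> V) (\<lambda>x. \<gamma> x * (f x * L_act A U b s x)) = (\<lambda>x. cut (U \<inter> V) f x * cut (U \<inter> V) (\<lambda>x. \<gamma> x * L_act A U b s x) x)"
    by (auto simp: cut_def algebra_simps)
  show "cut (U \<inter> V) (\<lambda>x. \<gamma> x * L_act A U (f \<odot>\<^bsub>sec B U\<^esub> b) s x) = cut (U \<inter> V) (\<lambda>x. \<gamma> x * (f x * L_act A U b s x))"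
    unfolding e L_act_chart[OF c U W Int_lower1 Int_lower2 b s]
      L_act_chart[OF c U W Int_lower1 Int_lower2 BB_smult[OF U f b] s] om_res_smult[OF B_om U W Int_lower1 f b]
      DD_bsmult[OF W OX_cut[OF f W Int_lower1] r L_sec_chart[OF s c U W Int_lower1 Int_lower2]]
      lin_form_smult[OF Gx_form[OF chart_form[OF c]] W Int_lower2 r OX_cut[OF f W Int_lower1]]
    by (simp add: algebra_simps)
qed (auto simp: L_act_off OX_off[OF f])

text \<open>Flatness of the connection. In a chart the commutator of two actions consists of the
  commutator of derivatives, treated by \<open>DD_brk\<close>, and of derivatives of the connection
  form, which closedness turns into its value on the bracket; the remaining products are
  symmetric.\<close>

lemma L_act_brk:
  assumes U: "op U" and b: "b \<in> BB U" and b': "b' \<in> BB U" and s: "s \<in> L_sec A U"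
  shows "L_act A U (brk B U b b') s = (\<lambda>x. L_act A U b (L_act A U b' s) x - L_act A U b' (L_act A U b s) x)"
proof (rule L_sec_eqI[OF U])
  fix V \<gamma> \<alpha> assume c: "(V, \<gamma>, \<alpha>) \<in> A" and W: "op (U \<inter> V)"
  note r = BB_res[OF U W Int_lower1 b] and r' = BB_res[OF U W Int_lower1 b']
  note g = L_sec_chart[OF s c U W Int_lower1 Int_lower2]
  note \<alpha> = Gx_form[OF chart_form[OF c]]
  note a = lin_form_closed[OF \<alpha> W Int_lower2 r] and a' = lin_form_closed[OF \<alpha> W Int_lower2 r']
  have e: "cut (U \<inter> V) (\<lambda>x. \<gamma> x * (s x - t x)) = (\<lambda>x. cut (U \<inter> V) (\<lambda>x. \<gamma> x * s x) x - cut (U \<inter> V) (\<lambda>x. \<gamma> x * t x) x)"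
    for s t :: "'x cfun" by (auto simp: cut_def algebra_simps)
  show "cut (U \<inter> V) (\<lambda>x. \<gamma> x * L_act A U (brk B U b b') s x) =
     cut (U \<inter> V) (\<lambda>x. \<gamma> x * (L_act A U b (L_act A U b' s) x - L_act A U b' (L_act A U b s) x))"
    unfolding e L_act_chart[OF c U W Int_lower1 Int_lower2 b L_act_closed[OF U b' s]]
      L_act_chart[OF c U W Int_lower1 Int_lower2 b' L_act_closed[OF U b s]]
      L_act_chart[OF c U W Int_lower1 Int_lower2 b s] L_act_chart[OF c U W Int_lower1 Int_lower2 b' s]
      L_act_chart[OF c U W Int_lower1 Int_lower2 brk_closed[OF U b b'] s]
      brk_res[OF U W Int_lower1 b b', symmetric]
      DD_brk[OF W r r' g] lin_form_brk[OF \<alpha> W Int_lower2 r r']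
      DD_add[OF W r DD_closed[OF W r' g] OX_mult[OF W a' g]] DD_add[OF W r' DD_closed[OF W r g] OX_mult[OF W a g]]
      DD_mult[OF W r a' g] DD_mult[OF W r' a g]
    by (simp add: algebra_simps)
qed (simp add: L_act_off)

lemma L_act_res:
  assumes U: "op U" "op V" "V \<subseteq> U" and b: "b \<in> BB U" and s: "s \<in> L_sec A U"
  shows "L_act A V (res B U V b) (cut V s) = cut V (L_act A U b s)"
proof
  fix x show "L_act A V (res B U V b) (cut V s) x = cut V (L_act A U b s) x"
  proof (cases "x \<in> V")
    case True
    then obtain V' \<gamma> \<alpha> where c: "(V', \<gamma>, \<alpha>) \<in> A" "x \<in> V'" using chart_ex[OF U(2)] by blast
    define W where "W = V \<inter> V'"
    have W: "op W" "W \<subseteq> U" "W \<subseteq> V" "W \<subseteq> V'" "x \<in> W" using U chart_op[OF c(1)] True c(2) by (auto simp: W_def)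
    have e: "cut W (\<lambda>x. \<gamma> x * cut V s x) = cut W (\<lambda>x. \<gamma> x * s x)" using W by (auto simp: cut_def fun_eq_iff)
    have "L_act A V (res B U V b) (cut V s) x = chart_act \<gamma> \<alpha> W (res B V W (res B U V b)) (cut V s) x"
      by (rule L_act_eq[OF c(1) U(2) W(1,3,4) BB_res[OF U b] L_sec_cut[OF U s] W(5)])
    also have "\<dots> = chart_act \<gamma> \<alpha> W (res B U W b) s x"
      unfolding om_res_res[OF B_om U(1,2) W(1,3) U(3) b] chart_act_def e using True by (simp add: cut_def)
    also have "\<dots> = L_act A U b s x" by (rule L_act_eq[OF c(1) U(1) W(1,2,4) b s W(5), symmetric])
    finally show ?thesis using True by (simp add: cut_def)
  qed (simp add: L_act_off cut_def)
qed

lemma L_bmodule: "bmodule M P B (L_mod A)"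
proof -
  have cs: "L_act A U b (\<lambda>x. cut U (\<lambda>_. z) x * s x) = (\<lambda>x. cut U (\<lambda>_. z) x * L_act A U b s x)"
    if "op U" "b \<in> BB U" "s \<in> L_sec A U" for U b s z
    using L_act_leibniz[OF that(1,2) OX_const[OF that(1)] that(3), of z] DD_const[OF that(1,2)] by simp
  show ?thesis
    unfolding bmodule_def
    using L_omodule
    by (auto simp: L_act_closed L_act_add cscale_def cs L_act_badd L_act_brk L_a_minus L_act_bsmult L_act_leibniz L_act_res)
qed

definition chart_gen :: "'x set \<Rightarrow> 'x cfun \<Rightarrow> 'x cfun" where
  "chart_gen V \<gamma> = cut V (\<lambda>x. 1 / \<gamma> x)"

lemma chart_gen_mem:
  assumes c: "(V, \<gamma>, \<alpha>) \<in> A"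
  shows "chart_gen V \<gamma> \<in> L_sec A V"
proof (rule L_secI[OF chart_op[OF c]])
  fix p assume p: "p \<in> V"
  have "cut V (\<lambda>x. \<gamma> x * chart_gen V \<gamma> x) = cut V (\<lambda>_. 1)"
    using chart_nz[OF c] by (auto simp: cut_def chart_gen_def)
  then show "\<exists>V' \<gamma>' \<alpha> W. (V', \<gamma>', \<alpha>) \<in> A \<and> op W \<and> p \<in> W \<and> W \<subseteq> V \<inter> V' \<and> cut W (\<lambda>x. \<gamma>' x * chart_gen V \<gamma> x) \<in> OX W"
    using c p chart_op[OF c] OX_const[OF chart_op[OF c], of 1]
    by (intro exI[of _ V] exI[of _ \<gamma>] exI[of _ \<alpha>] exI[of _ V]) auto
qed (simp add: chart_gen_def cut_def)

text \<open>The coefficient of \<open>s\<close> with respect to \<open>1 / \<gamma>\<close> is the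
  coordinate \<open>\<gamma> * s\<close>, which belongs to the structure sheaf by definition of
  \<open>L_sec\<close>.\<close>

lemma chart_generator:
  assumes c: "(V, \<gamma>, \<alpha>) \<in> A"
  shows "generator (L_mod A) V (chart_gen V \<gamma>)"
  unfolding generator_def L_mod_simps
proof (intro conjI allI impI ballI chart_gen_mem[OF c], elim conjE)
  fix W s assume W: "op W" "W \<subseteq> V" and s: "s \<in> L_sec A W"
  have f: "cut W (\<lambda>x. \<gamma> x * s x) \<in> OX W" by (rule L_sec_chart[OF s c W(1,1) subset_refl W(2)])
  have nz: "\<gamma> x \<noteq> 0" if "x \<in> W" for x using chart_nz[OF c] W that by blast
  show "\<exists>!f. f \<in> OX W \<and> s = (\<lambda>x. f x * cut W (chart_gen V \<gamma>) x)"
  proof (rule ex1I[of _ "cut W (\<lambda>x. \<gamma> x * s x)"])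
    have "s x = cut W (\<lambda>x. \<gamma> x * s x) x * cut W (chart_gen V \<gamma>) x" for x
      using nz[of x] W L_sec_off[OF s, of x] by (auto simp: cut_def chart_gen_def)
    then show "cut W (\<lambda>x. \<gamma> x * s x) \<in> OX W \<and> s = (\<lambda>x. cut W (\<lambda>x. \<gamma> x * s x) x * cut W (chart_gen V \<gamma>) x)"
      using f by blast
    fix g assume g: "g \<in> OX W \<and> s = (\<lambda>x. g x * cut W (chart_gen V \<gamma>) x)"
    show "g = cut W (\<lambda>x. \<gamma> x * s x)"
    proof
      fix x show "g x = cut W (\<lambda>x. \<gamma> x * s x) x"
      proof (cases "x \<in> W")
        case True
        have "s x = g x * cut W (chart_gen V \<gamma>) x" using g by metis
        then show ?thesis using True nz[OF True] W by (auto simp: cut_def chart_gen_def)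
      qed (use g in \<open>auto simp: OX_off cut_def\<close>)
    qed
  qed
qed

lemma L_invertible: "invertible_bmodule M P B (L_mod A)"
proof -
  have "\<exists>U e. op U \<and> p \<in> U \<and> generator (L_mod A) U e" if "p \<in> topspace (mtop M)" for p
    using chart_ex[OF openin_topspace that] chart_generator chart_op by metis
  then show ?thesis
    using L_bmodule rank_one_iff[OF L_omodule] by (simp add: invertible_bmodule_def)
qed

end

section \<open>Isomorphisms of modules\<close>

context lie_algebroid_space
begin

lemma bm_om: "bmodule M P B L \<Longrightarrow> omodule M P L"
  by (simp add: bmodule_def)

lemma
  assumes "bmodule M P B L" "op U" "b \<in> BB U" "m \<in> carrier (sec L U)"
  shows bm_act: "act L U b m \<in> carrier (sec L U)"
    and bm_add: "m' \<in> carrier (sec L U) \<Longrightarrow> act L U b (m \<oplus>\<^bsub>sec L U\<^esub> m') = act L U b m \<oplus>\<^bsub>sec L U\<^esub> act L U b m'"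
    and bm_badd: "b' \<in> BB U \<Longrightarrow> act L U (b \<oplus>\<^bsub>sec B U\<^esub> b') m = act L U b m \<oplus>\<^bsub>sec L U\<^esub> act L U b' m"
    and bm_brk: "b' \<in> BB U \<Longrightarrow> act L U (brk B U b b') m = act L U b (act L U b' m) \<ominus>\<^bsub>sec L U\<^esub> act L U b' (act L U b m)"
    and bm_bsmult: "f \<in> OX U \<Longrightarrow> act L U (f \<odot>\<^bsub>sec B U\<^esub> b) m = f \<odot>\<^bsub>sec L U\<^esub> act L U b m"
    and bm_leibniz: "f \<in> OX U \<Longrightarrow> act L U b (f \<odot>\<^bsub>sec L U\<^esub> m) = DD U b f \<odot>\<^bsub>sec L U\<^esub> m \<oplus>\<^bsub>sec L U\<^esub> f \<odot>\<^bsub>sec L U\<^esub> act L U b m"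
    and bm_res: "\<lbrakk>op V; V \<subseteq> U\<rbrakk> \<Longrightarrow> act L V (res B U V b) (res L U V m) = res L U V (act L U b m)"
  using assms by (simp_all add: bmodule_def)

text \<open>Multiplication by a complex number is multiplication by a constant section, whose
  derivative vanishes; so the Leibniz rule already contains complex linearity.\<close>

lemma bm_cscale:
  assumes "omodule M P L" "op U" "b \<in> BB U" "m \<in> carrier (sec L U)" "act L U b m \<in> carrier (sec L U)"
    and "\<And>f. f \<in> OX U \<Longrightarrow> act L U b (f \<odot>\<^bsub>sec L U\<^esub> m) = DD U b f \<odot>\<^bsub>sec L U\<^esub> m \<oplus>\<^bsub>sec L U\<^esub> f \<odot>\<^bsub>sec L U\<^esub> act L U b m"
  shows "act L U b (cscale L U z m) = cscale L U z (act L U b m)"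
proof -
  interpret G: abelian_group "sec L U" by (rule om_group[OF assms(1,2)])
  show ?thesis
    using assms(6)[OF OX_const[OF assms(2), of z]] om_smult[OF assms(1,2) OX_const[OF assms(2), of z] assms(5)]
    by (simp add: cscale_def DD_const[OF assms(2,3)] om_smult_zero[OF assms(1,2,4)])
qed

text \<open>Isomorphisms with the map as a parameter, so that composites and inverses can be named;
  all conditions are gathered open set by open set.\<close>

definition bm_iso :: "('x, 'b, 'm) bmod \<Rightarrow> ('x, 'b, 'n) bmod \<Rightarrow> ('x set \<Rightarrow> 'm \<Rightarrow> 'n) \<Rightarrow> bool" where
  "bm_iso L N \<phi> \<longleftrightarrow> (\<forall>U. op U \<longrightarrow> bij_betw (\<phi> U) (carrier (sec L U)) (carrier (sec N U)) \<and>
     (\<forall>m\<in>carrier (sec L U).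
        (\<forall>m'\<in>carrier (sec L U). \<phi> U (m \<oplus>\<^bsub>sec L U\<^esub> m') = \<phi> U m \<oplus>\<^bsub>sec N U\<^esub> \<phi> U m') \<and>
        (\<forall>f\<in>OX U. \<phi> U (f \<odot>\<^bsub>sec L U\<^esub> m) = f \<odot>\<^bsub>sec N U\<^esub> \<phi> U m) \<and>
        (\<forall>V. op V \<and> V \<subseteq> U \<longrightarrow> \<phi> V (res L U V m) = res N U V (\<phi> U m)) \<and>
        (\<forall>b\<in>BB U. \<phi> U (act L U b m) = act N U b (\<phi> U m))))"

lemma bmodule_isomorphic_iff: "bmodule_isomorphic M P B L N \<longleftrightarrow> (\<exists>\<phi>. bm_iso L N \<phi>)"
proof -
  have "(omodule_hom M P L N \<phi> \<and> (\<forall>U. op U \<longrightarrow> bij_betw (\<phi> U) (carrier (sec L U)) (carrier (sec N U)) \<and>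
        (\<forall>b\<in>BB U. \<forall>m\<in>carrier (sec L U). \<phi> U (act L U b m) = act N U b (\<phi> U m)))) \<longleftrightarrow> bm_iso L N \<phi>" for \<phi>
  proof
    assume "omodule_hom M P L N \<phi> \<and> (\<forall>U. op U \<longrightarrow> bij_betw (\<phi> U) (carrier (sec L U)) (carrier (sec N U)) \<and>
        (\<forall>b\<in>BB U. \<forall>m\<in>carrier (sec L U). \<phi> U (act L U b m) = act N U b (\<phi> U m)))"
    then show "bm_iso L N \<phi>"
      unfolding bm_iso_def omodule_hom_def by (elim conjE) (intro allI impI conjI ballI; simp)
  next
    assume a: "bm_iso L N \<phi>"
    have "\<phi> U m \<in> carrier (sec N U)" if "op U" "m \<in> carrier (sec L U)" for U m
      by (rule bij_betw_apply[OF _ that(2)]) (use that a in \<open>simp add: bm_iso_def\<close>)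
    with a show "omodule_hom M P L N \<phi> \<and> (\<forall>U. op U \<longrightarrow> bij_betw (\<phi> U) (carrier (sec L U)) (carrier (sec N U)) \<and>
        (\<forall>b\<in>BB U. \<forall>m\<in>carrier (sec L U). \<phi> U (act L U b m) = act N U b (\<phi> U m)))"
      unfolding bm_iso_def omodule_hom_def by (intro allI impI conjI ballI funcsetI; simp)
  qed
  then show ?thesis by (simp add: bmodule_isomorphic_def)
qed

lemma
  assumes "bm_iso L N \<phi>" "op U"
  shows bm_iso_bij: "bij_betw (\<phi> U) (carrier (sec L U)) (carrier (sec N U))"
    and bm_iso_closed: "m \<in> carrier (sec L U) \<Longrightarrow> \<phi> U m \<in> carrier (sec N U)"
    and bm_iso_add: "\<lbrakk>m \<in> carrier (sec L U); m' \<in> carrier (sec L U)\<rbrakk> \<Longrightarrow> \<phi> U (m \<oplus>\<^bsub>sec L U\<^esub> m') = \<phi> U m \<oplus>\<^bsub>sec N U\<^esub> \<phi> U m'"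
    and bm_iso_smult: "\<lbrakk>m \<in> carrier (sec L U); f \<in> OX U\<rbrakk> \<Longrightarrow> \<phi> U (f \<odot>\<^bsub>sec L U\<^esub> m) = f \<odot>\<^bsub>sec N U\<^esub> \<phi> U m"
    and bm_iso_res: "\<lbrakk>m \<in> carrier (sec L U); op V; V \<subseteq> U\<rbrakk> \<Longrightarrow> \<phi> V (res L U V m) = res N U V (\<phi> U m)"
    and bm_iso_act: "\<lbrakk>m \<in> carrier (sec L U); b \<in> BB U\<rbrakk> \<Longrightarrow> \<phi> U (act L U b m) = act N U b (\<phi> U m)"
  using assms bij_betw_apply unfolding bm_iso_def by simp_all fast

lemma bm_iso_trans:
  assumes "bm_iso L N \<phi>" "bm_iso N K \<psi>"
  shows "bm_iso L K (\<lambda>U m. \<psi> U (\<phi> U m))"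
  unfolding bm_iso_def
proof (intro allI impI conjI ballI, goal_cases)
  case (1 U)
  then show ?case
    using bij_betw_trans[OF bm_iso_bij[OF assms(1)] bm_iso_bij[OF assms(2)], of U] by (simp add: comp_def)
qed (simp_all add: bm_iso_add[OF assms(1)] bm_iso_add[OF assms(2)] bm_iso_smult[OF assms(1)] bm_iso_smult[OF assms(2)]
      bm_iso_res[OF assms(1)] bm_iso_res[OF assms(2)] bm_iso_act[OF assms(1)] bm_iso_act[OF assms(2)]
      bm_iso_closed[OF assms(1)])

lemma bm_iso_sym:
  assumes L: "bmodule M P B L" and \<phi>: "bm_iso L N \<phi>"
  shows "bm_iso N L (\<lambda>U. inv_into (carrier (sec L U)) (\<phi> U))"
proof -
  note om = bm_om[OF L]
  have inv: "inv_into (carrier (sec L U)) (\<phi> U) (\<phi> U m) = m" if "op U" "m \<in> carrier (sec L U)" for U m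
    using bm_iso_bij[OF \<phi> that(1)] that(2) by (meson bij_betw_inv_into_left)
  have ex: "\<exists>m\<in>carrier (sec L U). n = \<phi> U m" if "op U" "n \<in> carrier (sec N U)" for U n
    using bm_iso_bij[OF \<phi> that(1)] that(2) by (auto simp: bij_betw_def)
  show ?thesis
    unfolding bm_iso_def
  proof (intro allI impI conjI ballI, goal_cases)
    case (1 U)
    then show ?case using bij_betw_inv_into[OF bm_iso_bij[OF \<phi>]] by blast
  next
    case (2 U n n')
    obtain m m' where m: "m \<in> carrier (sec L U)" "n = \<phi> U m" "m' \<in> carrier (sec L U)" "n' = \<phi> U m'"
      using ex[OF 2(1,2)] ex[OF 2(1,3)] by blast
    then show ?case
      using inv[OF 2(1) om_add[OF om 2(1) m(1,3)]] by (simp add: inv[OF 2(1)] bm_iso_add[OF \<phi> 2(1)])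
  next
    case (3 U n f)
    obtain m where m: "m \<in> carrier (sec L U)" "n = \<phi> U m" using ex[OF 3(1,2)] by blast
    then show ?case
      using inv[OF 3(1) om_smult[OF om 3(1,3) m(1)]] 3 by (simp add: inv[OF 3(1)] bm_iso_smult[OF \<phi> 3(1)])
  next
    case (4 U n V)
    obtain m where m: "m \<in> carrier (sec L U)" "n = \<phi> U m" using ex[OF 4(1,2)] by blast
    have V: "op V" "V \<subseteq> U" using 4 by auto
    show ?case
      using m inv[OF V(1) om_res[OF om 4(1) V m(1)]] bm_iso_res[OF \<phi> 4(1) m(1) V] by (simp add: inv[OF 4(1)])
  next
    case (5 U n b)
    obtain m where m: "m \<in> carrier (sec L U)" "n = \<phi> U m" using ex[OF 5(1,2)] by blast
    then show ?case
      using inv[OF 5(1) bm_act[OF L 5(1,3) m(1)]] 5 by (simp add: inv[OF 5(1)] bm_iso_act[OF \<phi> 5(1)])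
  qed
qed

lemma iso_trans: "\<lbrakk>bmodule_isomorphic M P B L N; bmodule_isomorphic M P B N K\<rbrakk> \<Longrightarrow> bmodule_isomorphic M P B L K"
  using bm_iso_trans unfolding bmodule_isomorphic_iff by blast

lemma iso_sym: "\<lbrakk>bmodule M P B L; bmodule_isomorphic M P B L N\<rbrakk> \<Longrightarrow> bmodule_isomorphic M P B N L"
  using bm_iso_sym unfolding bmodule_isomorphic_iff by blast

text \<open>By linearity and injectivity a section and its image have the same coefficients, over
  every smaller open set.\<close>

lemma generator_iso:
  assumes L: "bmodule M P B L" and \<phi>: "bm_iso L N \<phi>" and U: "op U" and e: "generator L U e"
  shows "generator N U (\<phi> U e)"
  unfolding generator_def
proof (intro conjI allI impI ballI, goal_cases)
  case 1
  then show ?case using bm_iso_closed[OF \<phi> U generator_closed[OF e]] .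
next
  case (2 V n)
  then have V: "op V" "V \<subseteq> U" by auto
  note om = bm_om[OF L]
  obtain m where m: "m \<in> carrier (sec L V)" "n = \<phi> V m"
    using bm_iso_bij[OF \<phi> V(1)] 2(2) by (auto simp: bij_betw_def)
  note eV = generator_res[OF om U V e]
  have eq: "f \<odot>\<^bsub>sec N V\<^esub> res N U V (\<phi> U e) = \<phi> V (f \<odot>\<^bsub>sec L V\<^esub> res L U V e)" if "f \<in> OX V" for f
    using bm_iso_smult[OF \<phi> V(1) generator_closed[OF eV] that] bm_iso_res[OF \<phi> U generator_closed[OF e] V] by simp
  have inj: "inj_on (\<phi> V) (carrier (sec L V))" using bm_iso_bij[OF \<phi> V(1)] by (simp add: bij_betw_def)
  have "n = f \<odot>\<^bsub>sec N V\<^esub> res N U V (\<phi> U e) \<longleftrightarrow> m = f \<odot>\<^bsub>sec L V\<^esub> res L U V e" if "f \<in> OX V" for f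
    unfolding m(2) eq[OF that]
    using inj_on_eq_iff[OF inj m(1) om_smult[OF om V(1) that generator_closed[OF eV]]] .
  then show ?case using generator_ex1[OF om V(1) eV m(1)] by (metis (no_types, lifting))
qed

lemma invertible_iso:
  assumes L: "invertible_bmodule M P B L" and iso: "bmodule_isomorphic M P B L N" and N: "bmodule M P B N"
  shows "invertible_bmodule M P B N"
proof -
  obtain \<phi> where \<phi>: "bm_iso L N \<phi>" using iso by (auto simp: bmodule_isomorphic_iff)
  have Lb: "bmodule M P B L" using L by (simp add: invertible_bmodule_def)
  have L1: "locally_free_rank_one M P L" using L by (simp add: invertible_bmodule_def)
  have "\<exists>U e. op U \<and> p \<in> U \<and> generator N U e" if p: "p \<in> topspace (mtop M)" for p
  proof -
    obtain U e where "op U" "p \<in> U" "generator L U e"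
      using bspec[OF iffD1[OF rank_one_iff[OF bm_om[OF Lb]] L1] p] by blast
    then show ?thesis using generator_iso[OF Lb \<phi>] by blast
  qed
  then show ?thesis using N rank_one_iff[OF bm_om[OF N]] by (simp add: invertible_bmodule_def)
qed

subsection \<open>Transport along an injection\<close>

text \<open>Modules of atlases have sections of type \<open>'x cfun\<close>, whereas isomorphism
  classes collect modules with sections in the universe \<open>'m\<close>. The structure is carried
  over along an injection between the two types.\<close>

definition bm_transport :: "('m \<Rightarrow> 'n) \<Rightarrow> ('x, 'b, 'm) bmod \<Rightarrow> ('x, 'b, 'n) bmod" where
  "bm_transport \<iota> L = \<lparr>sec = (\<lambda>U. \<lparr>carrier = \<iota> ` carrier (sec L U), monoid.mult = (\<lambda>a _. a), monoid.one = \<iota> \<zero>\<^bsub>sec L U\<^esub>,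
      ring.zero = \<iota> \<zero>\<^bsub>sec L U\<^esub>, ring.add = (\<lambda>a b. \<iota> (inv_into UNIV \<iota> a \<oplus>\<^bsub>sec L U\<^esub> inv_into UNIV \<iota> b)),
      smult = (\<lambda>f a. \<iota> (f \<odot>\<^bsub>sec L U\<^esub> inv_into UNIV \<iota> a))\<rparr>),
    res = (\<lambda>U V a. \<iota> (res L U V (inv_into UNIV \<iota> a))), act = (\<lambda>U b a. \<iota> (act L U b (inv_into UNIV \<iota> a)))\<rparr>"

lemma bm_transport:
  assumes \<iota>: "inj \<iota>" and L: "bmodule M P B L"
  shows "bmodule M P B (bm_transport \<iota> L)" "bm_iso L (bm_transport \<iota> L) (\<lambda>_. \<iota>)"
proof -
  let ?N = "bm_transport \<iota> L"
  note om = bm_om[OF L]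
  have [simp]: "inv_into UNIV \<iota> (\<iota> m) = m" for m using \<iota> by simp
  have [simp]: "\<iota> m = \<iota> m' \<longleftrightarrow> m = m'" for m m' using \<iota> by (simp add: inj_eq)
  have S: "carrier (sec ?N U) = \<iota> ` carrier (sec L U)" "\<zero>\<^bsub>sec ?N U\<^esub> = \<iota> \<zero>\<^bsub>sec L U\<^esub>"
    "\<iota> m \<oplus>\<^bsub>sec ?N U\<^esub> \<iota> m' = \<iota> (m \<oplus>\<^bsub>sec L U\<^esub> m')" "f \<odot>\<^bsub>sec ?N U\<^esub> \<iota> m = \<iota> (f \<odot>\<^bsub>sec L U\<^esub> m)"
    "res ?N U V (\<iota> m) = \<iota> (res L U V m)" "act ?N U b (\<iota> m) = \<iota> (act L U b m)" for U V b f m m'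
    by (simp_all add: bm_transport_def)
  have md: "module (OXP M P U) (sec ?N U)" if U: "op U" for U
  proof (rule moduleI)
    interpret G: abelian_group "sec L U" by (rule om_group[OF om U])
    show "cring (OXP M P U)" by (rule OX_cring[OF U])
    show "abelian_group (sec ?N U)"
    proof (rule abelian_groupI)
      fix x assume "x \<in> carrier (sec ?N U)"
      then obtain m where m: "m \<in> carrier (sec L U)" "x = \<iota> m" by (auto simp: S)
      then show "\<exists>y\<in>carrier (sec ?N U). y \<oplus>\<^bsub>sec ?N U\<^esub> x = \<zero>\<^bsub>sec ?N U\<^esub>"
        by (intro bexI[of _ "\<iota> (\<ominus>\<^bsub>sec L U\<^esub> m)"]) (auto simp: S G.l_neg)
    qed (auto simp: S G.a_ac)
  qed (auto simp: S om_smult[OF om U] om_smult_ldistr[OF om U] om_smult_rdistr[OF om U] om_smult_assoc[OF om U]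
        om_smult_one[OF om U] simp del: OXP_simps(1,2,3) simp: module.smult_l_distr[OF om_module[OF om U]]
        module.smult_assoc1[OF om_module[OF om U]] module.smult_one[OF om_module[OF om U]])
  have sh: "is_sheaf (mtop M) (\<lambda>U. carrier (sec ?N U)) (res ?N)"
    unfolding is_sheaf_def
  proof (intro conjI allI impI, goal_cases)
    case (1 U V)
    then show ?case using om_res[OF om] by (auto simp: S)
  next
    case (2 U s)
    then show ?case using om_res_id[OF om] by (auto simp: S)
  next
    case (3 U V W s)
    then show ?case using om_res_res[OF om] by (auto simp: S)
  next
    case (4 \<U> s)
    define t where "t V = inv_into UNIV \<iota> (s V)" for V
    have t: "t V \<in> carrier (sec L V)" "s V = \<iota> (t V)" if "V \<in> \<U>" for V using 4 that by (force simp: t_def S)+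
    have "\<exists>!x. x \<in> carrier (sec L (\<Union>\<U>)) \<and> (\<forall>V\<in>\<U>. res L (\<Union>\<U>) V x = t V)"
    proof (rule om_glue1[OF om])
      show "op V" if "V \<in> \<U>" for V using 4 that by blast
      show "t V \<in> carrier (sec L V)" if "V \<in> \<U>" for V using t that by blast
      show "res L V (V \<inter> W) (t V) = res L W (V \<inter> W) (t W)" if "V \<in> \<U>" "W \<in> \<U>" for V W
      proof -
        have "res ?N V (V \<inter> W) (s V) = res ?N W (V \<inter> W) (s W)" using 4 that by blast
        then show ?thesis by (simp add: t that S)
      qed
    qed
    then obtain x where x: "x \<in> carrier (sec L (\<Union>\<U>))" "\<forall>V\<in>\<U>. res L (\<Union>\<U>) V x = t V"
      and u: "\<forall>y. y \<in> carrier (sec L (\<Union>\<U>)) \<and> (\<forall>V\<in>\<U>. res L (\<Union>\<U>) V y = t V) \<longrightarrow> y = x"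
      unfolding Ex1_def by (elim exE conjE)
    show ?case
    proof (rule ex1I[of _ "\<iota> x"])
      show "\<iota> x \<in> carrier (sec ?N (\<Union>\<U>)) \<and> (\<forall>V\<in>\<U>. res ?N (\<Union>\<U>) V (\<iota> x) = s V)"
        using x by (auto simp: S t)
      fix z assume z: "z \<in> carrier (sec ?N (\<Union>\<U>)) \<and> (\<forall>V\<in>\<U>. res ?N (\<Union>\<U>) V z = s V)"
      then obtain y where y: "y \<in> carrier (sec L (\<Union>\<U>))" "z = \<iota> y" by (auto simp: S)
      with z have "\<forall>V\<in>\<U>. res L (\<Union>\<U>) V y = t V" by (auto simp: S t)
      with u y show "z = \<iota> x" by blast
    qed
  qed
  have omN: "omodule M P ?N"
    unfolding omodule_def using sh md by (auto simp: S om_res_add[OF om] om_res_smult[OF om])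
  have mn: "\<iota> m \<ominus>\<^bsub>sec ?N U\<^esub> \<iota> m' = \<iota> (m \<ominus>\<^bsub>sec L U\<^esub> m')"
    if U: "op U" and m: "m \<in> carrier (sec L U)" "m' \<in> carrier (sec L U)" for U m m'
  proof -
    interpret G: abelian_group "sec L U" by (rule om_group[OF om U])
    have "\<ominus>\<^bsub>sec ?N U\<^esub> \<iota> m' = \<iota> (\<ominus>\<^bsub>sec L U\<^esub> m')"
      by (rule abelian_group.minus_equality[OF om_group[OF omN U]]) (use m in \<open>auto simp: S G.l_neg\<close>)
    then show ?thesis by (simp add: a_minus_def S)
  qed
  show "bmodule M P B ?N"
    unfolding bmodule_def using omN
  proof (intro conjI allI impI ballI, goal_cases)
    case (4 U b x z)
    then obtain m where m: "m \<in> carrier (sec L U)" "x = \<iota> m" by (auto simp: S)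
    show ?case
      by (rule bm_cscale[OF omN 4(2,3,4)]) (use 4 m in \<open>auto simp: S bm_act[OF L] bm_leibniz[OF L]\<close>)
  qed (auto simp: S bm_act[OF L] bm_add[OF L] bm_badd[OF L] bm_brk[OF L] bm_bsmult[OF L] bm_leibniz[OF L] bm_res[OF L] mn)
  show "bm_iso L ?N (\<lambda>_. \<iota>)"
    unfolding bm_iso_def by (auto simp: S bij_betw_def intro: inj_on_subset[OF \<iota>])
qed

end

subsection \<open>Comparison with the module of an atlas\<close>

context lie_algebroid_space
begin

lemma coef_add:
  assumes L: "omodule M P L" "op U" "generator L U e" and m: "m \<in> carrier (sec L U)" "m' \<in> carrier (sec L U)"
  shows "coef L U e (m \<oplus>\<^bsub>sec L U\<^esub> m') = (\<lambda>x. coef L U e m x + coef L U e m' x)"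
proof -
  note c = coef_closed[OF L m(1)] coef_closed[OF L m(2)]
  have "m \<oplus>\<^bsub>sec L U\<^esub> m' = (\<lambda>x. coef L U e m x + coef L U e m' x) \<odot>\<^bsub>sec L U\<^esub> e"
    using om_smult_ldistr[OF L(1,2) c generator_closed[OF L(3)]] coef_smult[OF L m(1)] coef_smult[OF L m(2)] by simp
  then show ?thesis using coef_eq[OF L OX_add[OF L(2) c]] by simp
qed

lemma coef_scale:
  assumes L: "omodule M P L" "op U" "generator L U e" and m: "m \<in> carrier (sec L U)" and f: "f \<in> OX U"
  shows "coef L U e (f \<odot>\<^bsub>sec L U\<^esub> m) = (\<lambda>x. f x * coef L U e m x)"
proof -
  note c = coef_closed[OF L m]
  have "f \<odot>\<^bsub>sec L U\<^esub> m = (\<lambda>x. f x * coef L U e m x) \<odot>\<^bsub>sec L U\<^esub> e"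
    using om_smult_assoc[OF L(1,2) f c generator_closed[OF L(3)]] coef_smult[OF L m] by simp
  then show ?thesis using coef_eq[OF L OX_mult[OF L(2) f c]] by simp
qed

text \<open>The Leibniz rule for \<open>m\<close> written as a multiple of the generator. The
  resulting formula is the one by which an atlas defines its action, with \<open>a\<close> as the
  value of the connection form.\<close>

lemma coef_act:
  assumes L: "bmodule M P B L" and U: "op U" and e: "generator L U e" and m: "m \<in> carrier (sec L U)" and b: "b \<in> BB U"
    and a: "a \<in> OX U" "act L U b e = a \<odot>\<^bsub>sec L U\<^esub> e"
  shows "coef L U e (act L U b m) = (\<lambda>x. DD U b (coef L U e m) x + a x * coef L U e m x)"
proof -
  note om = bm_om[OF L]
  note c = coef_closed[OF om U e m] and ec = generator_closed[OF e]
  have "act L U b m = act L U b (coef L U e m \<odot>\<^bsub>sec L U\<^esub> e)" using coef_smult[OF om U e m] by simp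
  also have "\<dots> = DD U b (coef L U e m) \<odot>\<^bsub>sec L U\<^esub> e \<oplus>\<^bsub>sec L U\<^esub> coef L U e m \<odot>\<^bsub>sec L U\<^esub> (a \<odot>\<^bsub>sec L U\<^esub> e)"
    unfolding a(2)[symmetric] by (rule bm_leibniz[OF L U b ec c])
  also have "\<dots> = (\<lambda>x. DD U b (coef L U e m) x + coef L U e m x * a x) \<odot>\<^bsub>sec L U\<^esub> e"
    unfolding om_smult_assoc[OF om U c a(1) ec]
    by (rule om_smult_ldistr[OF om U DD_closed[OF U b c] OX_mult[OF U c a(1)] ec, symmetric])
  finally show ?thesis
    using coef_eq[OF om U e OX_add[OF U DD_closed[OF U b c] OX_mult[OF U c a(1)]]] by (simp add: mult.commute)
qed

end

context atlas_space
begin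

text \<open>An atlas provides transition functions only near points. The ratio is the coordinate, in
  the first chart, of the generator of the second, hence a section on the whole overlap.\<close>

lemma chart_ratio:
  assumes "(V, \<gamma>, \<alpha>) \<in> A" "(V', \<gamma>', \<alpha>') \<in> A"
  shows "cut (V \<inter> V') (\<lambda>x. \<gamma> x / \<gamma>' x) \<in> OX (V \<inter> V')"
proof -
  have "cut (V \<inter> V') (\<lambda>x. \<gamma> x * chart_gen V' \<gamma>' x) \<in> OX (V \<inter> V')"
    by (rule L_sec_chart[OF chart_gen_mem[OF assms(2)] assms(1) chart_op[OF assms(2)]])
       (use chart_op assms in auto)
  moreover have "cut (V \<inter> V') (\<lambda>x. \<gamma> x * chart_gen V' \<gamma>' x) = cut (V \<inter> V') (\<lambda>x. \<gamma> x / \<gamma>' x)"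
    by (auto simp: chart_gen_def cut_def)
  ultimately show ?thesis by simp
qed

text \<open>The isomorphism sends the generator attached to a chart to \<open>1 / \<gamma>\<close>.
  By \<open>change\<close> the generators of \<open>K\<close> transform as these functions do, which
  makes the map independent of the chart, and by \<open>conn\<close> both sides have the same
  connection forms. Generators are attached to a covering set \<open>C\<close> of charts only, as an
  atlas may contain many more.\<close>

lemma atlas_iso:
  fixes K :: "('x, 'b, 'm) bmod"
  assumes K: "bmodule M P B K" and CA: "C \<subseteq> A"
    and cover: "\<And>p. p \<in> topspace (mtop M) \<Longrightarrow> \<exists>c\<in>C. p \<in> fst c"
    and gen: "\<And>V \<gamma> \<alpha>. (V, \<gamma>, \<alpha>) \<in> C \<Longrightarrow> generator K V (e (V, \<gamma>, \<alpha>))"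
    and conn: "\<And>V \<gamma> \<alpha> W b. \<lbrakk>(V, \<gamma>, \<alpha>) \<in> C; op W; W \<subseteq> V; b \<in> BB W\<rbrakk> \<Longrightarrow>
        act K W b (res K V W (e (V, \<gamma>, \<alpha>))) = \<alpha> W b \<odot>\<^bsub>sec K W\<^esub> res K V W (e (V, \<gamma>, \<alpha>))"
    and change: "\<And>V \<gamma> \<alpha> V' \<gamma>' \<alpha>'. \<lbrakk>(V, \<gamma>, \<alpha>) \<in> C; (V', \<gamma>', \<alpha>') \<in> C\<rbrakk> \<Longrightarrow>
        res K V' (V \<inter> V') (e (V', \<gamma>', \<alpha>')) = cut (V \<inter> V') (\<lambda>x. \<gamma> x / \<gamma>' x) \<odot>\<^bsub>sec K (V \<inter> V')\<^esub> res K V (V \<inter> V') (e (V, \<gamma>, \<alpha>))"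
  shows "bmodule_isomorphic M P B K (L_mod A)"
proof -
  note om = bm_om[OF K]
  define cf where "cf c U W m = coef K W (res K (fst c) W (e c)) (res K U W m)" for c U W m
  \<comment> \<open>The coefficient in some chart around \<open>x\<close>, divided by
    \<open>\<gamma>\<close>; by \<open>\<phi>_eq\<close> every chart gives the same number.\<close>
  define \<phi> where "\<phi> U m = (\<lambda>x. if x \<in> U then
    (let c = (SOME c. c \<in> C \<and> x \<in> fst c) in cf c U (U \<inter> fst c) m x / fst (snd c) x) else 0)" for U m
  have gW: "generator K W (res K V W (e (V, \<gamma>, \<alpha>)))" if c: "(V, \<gamma>, \<alpha>) \<in> C" and W: "op W" "W \<subseteq> V" for V \<gamma> \<alpha> W
    using generator_res[OF om _ W gen[OF c]] chart_op CA c by blast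
  have cf_res: "cf (V, \<gamma>, \<alpha>) U W' m = cut W' (cf (V, \<gamma>, \<alpha>) U W m)"
    if c: "(V, \<gamma>, \<alpha>) \<in> C" and U: "op U" and W: "op W" "W \<subseteq> U" "W \<subseteq> V" and W': "op W'" "W' \<subseteq> W"
      and m: "m \<in> carrier (sec K U)" for V \<gamma> \<alpha> U W W' m
  proof -
    have V: "op V" using chart_op CA c by blast
    show ?thesis
      unfolding cf_def fst_conv
      using coef_res[OF om W(1) W' gW[OF c W(1,3)] om_res[OF om U W(1,2) m]]
        om_res_res[OF om U W(1) W' W(2) m] om_res_res[OF om V W(1) W' W(3) generator_closed[OF gen[OF c]]] by simp
  qed
  have cf_closed: "cf (V, \<gamma>, \<alpha>) U W m \<in> OX W"
    if c: "(V, \<gamma>, \<alpha>) \<in> C" and U: "op U" and W: "op W" "W \<subseteq> U" "W \<subseteq> V" and m: "m \<in> carrier (sec K U)" for V \<gamma> \<alpha> U W m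
    unfolding cf_def fst_conv by (rule coef_closed[OF om W(1) gW[OF c W(1,3)] om_res[OF om U W(1,2) m]])
  have \<phi>_eq: "\<phi> U m x = cf (V, \<gamma>, \<alpha>) U W m x / \<gamma> x"
    if c: "(V, \<gamma>, \<alpha>) \<in> C" and U: "op U" and W: "op W" "W \<subseteq> U" "W \<subseteq> V" and m: "m \<in> carrier (sec K U)" and x: "x \<in> W"
    for V \<gamma> \<alpha> U W m x
  proof -
    define c' where "c' = (SOME c. c \<in> C \<and> x \<in> fst c)"
    have "c' \<in> C \<and> x \<in> fst c'" unfolding c'_def by (rule someI_ex) (use c x W in force)
    then obtain V' \<gamma>' \<alpha>' where c': "c' = (V', \<gamma>', \<alpha>')" "(V', \<gamma>', \<alpha>') \<in> C" "x \<in> V'" by (cases c') auto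
    have V: "op V" "op V'" using chart_op CA c c'(2) by blast+
    have UV': "op (U \<inter> V')" using U V by blast
    define W1 where "W1 = W \<inter> V'"
    have W1: "op W1" "W1 \<subseteq> W" "W1 \<subseteq> U \<inter> V'" "W1 \<subseteq> V \<inter> V'" "W1 \<subseteq> U" "W1 \<subseteq> V" "W1 \<subseteq> V'" "x \<in> W1"
      using W V x c' by (auto simp: W1_def)
    define r where "r = cut W1 (\<lambda>x. \<gamma> x / \<gamma>' x)"
    have VV: "op (V \<inter> V')" using V by blast
    have r': "r = cut W1 (cut (V \<inter> V') (\<lambda>x. \<gamma> x / \<gamma>' x))" unfolding r_def using W1 by (auto simp: cut_def fun_eq_iff)
    have ratio: "cut (V \<inter> V') (\<lambda>x. \<gamma> x / \<gamma>' x) \<in> OX (V \<inter> V')" using chart_ratio CA c c'(2) by blast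
    have r: "r \<in> OX W1" unfolding r' by (rule OX_cut[OF ratio W1(1,4)])
    define e1 where "e1 = res K V W1 (e (V, \<gamma>, \<alpha>))"
    have e1: "generator K W1 e1" unfolding e1_def by (rule gW[OF c W1(1,6)])
    note ec = generator_closed[OF gen[OF c]] and ec' = generator_closed[OF gen[OF c'(2)]]
    have e': "res K V' W1 (e (V', \<gamma>', \<alpha>')) = r \<odot>\<^bsub>sec K W1\<^esub> e1"
    proof -
      have "res K V' W1 (e (V', \<gamma>', \<alpha>')) = res K (V \<inter> V') W1 (res K V' (V \<inter> V') (e (V', \<gamma>', \<alpha>')))"
        by (rule om_res_res[OF om V(2) VV W1(1,4) _ ec', symmetric]) simp
      also have "\<dots> = r \<odot>\<^bsub>sec K W1\<^esub> res K (V \<inter> V') W1 (res K V (V \<inter> V') (e (V, \<gamma>, \<alpha>)))"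
        unfolding change[OF c c'(2)] r'
        by (rule om_res_smult[OF om VV W1(1,4) ratio om_res[OF om V(1) VV _ ec]]) simp
      also have "res K (V \<inter> V') W1 (res K V (V \<inter> V') (e (V, \<gamma>, \<alpha>))) = e1"
        unfolding e1_def by (rule om_res_res[OF om V(1) VV W1(1,4) _ ec]) simp
      finally show ?thesis .
    qed
    define m1 where "m1 = res K U W1 m"
    have m1: "m1 \<in> carrier (sec K W1)" unfolding m1_def by (rule om_res[OF om U W1(1,5) m])
    define f' where "f' = cf (V', \<gamma>', \<alpha>') U W1 m"
    have f': "f' \<in> OX W1" unfolding f'_def by (rule cf_closed[OF c'(2) U W1(1,5,7) m])
    have "m1 = f' \<odot>\<^bsub>sec K W1\<^esub> (r \<odot>\<^bsub>sec K W1\<^esub> e1)"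
      unfolding f'_def cf_def fst_conv m1_def[symmetric] e'[symmetric]
      by (rule coef_smult[OF om W1(1) gW[OF c'(2) W1(1,7)] m1, symmetric])
    then have "m1 = (\<lambda>x. f' x * r x) \<odot>\<^bsub>sec K W1\<^esub> e1"
      using om_smult_assoc[OF om W1(1) f' r generator_closed[OF e1]] by simp
    then have "cf (V, \<gamma>, \<alpha>) U W1 m = (\<lambda>x. f' x * r x)"
      unfolding cf_def fst_conv m1_def[symmetric] e1_def[symmetric]
      using coef_eq[OF om W1(1) e1 OX_mult[OF W1(1) f' r]] by simp
    then have "cf (V, \<gamma>, \<alpha>) U W m x = f' x * (\<gamma> x / \<gamma>' x)"
      using fun_cong[OF cf_res[OF c U W W1(1,2) m], of x] W1(8) by (simp add: cut_def r_def)
    moreover have "cf (V', \<gamma>', \<alpha>') U (U \<inter> V') m x = f' x"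
      using fun_cong[OF cf_res[OF c'(2) U UV' _ _ W1(1,3) m], of x] W1(8) by (simp add: cut_def f'_def)
    moreover have "\<phi> U m x = cf (V', \<gamma>', \<alpha>') U (U \<inter> V') m x / \<gamma>' x"
      unfolding \<phi>_def Let_def c'_def[symmetric] using x W by (auto simp: c'(1))
    moreover have "\<gamma> x \<noteq> 0" using chart_nz CA c x W by blast
    ultimately show ?thesis by simp
  qed
  have \<phi>_off: "\<phi> U m x = 0" if "x \<notin> U" for U m x using that by (simp add: \<phi>_def)
  have pick: "\<exists>V \<gamma> \<alpha>. (V, \<gamma>, \<alpha>) \<in> C \<and> p \<in> V" if "op U" "p \<in> U" for U p
  proof -
    have "p \<in> topspace (mtop M)" using that openin_subset by blast
    then obtain c where "c \<in> C" "p \<in> fst c" using cover by blast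
    then show ?thesis by (metis prod.collapse)
  qed
  have W: "op (U \<inter> V)" if "(V, \<gamma>, \<alpha>) \<in> C" "op U" for U V \<gamma> \<alpha> using that chart_op CA by blast
  have \<phi>_cut: "cut (U \<inter> V) (\<lambda>x. \<gamma> x * \<phi> U m x) = cf (V, \<gamma>, \<alpha>) U (U \<inter> V) m"
    if c: "(V, \<gamma>, \<alpha>) \<in> C" and U: "op U" and m: "m \<in> carrier (sec K U)" for V \<gamma> \<alpha> U m
  proof
    fix x show "cut (U \<inter> V) (\<lambda>x. \<gamma> x * \<phi> U m x) x = cf (V, \<gamma>, \<alpha>) U (U \<inter> V) m x"
    proof (cases "x \<in> U \<inter> V")
      case True
      then have "\<gamma> x \<noteq> 0" using chart_nz CA c by blast
      then show ?thesis using True \<phi>_eq[OF c U W[OF c U] _ _ m True] by (simp add: cut_def)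
    next
      case False
      then show ?thesis using OX_off[OF cf_closed[OF c U W[OF c U] _ _ m] False] by (auto simp: cut_def)
    qed
  qed
  have \<phi>_closed: "\<phi> U m \<in> L_sec A U" if U: "op U" and m: "m \<in> carrier (sec K U)" for U m
  proof (rule L_secI[OF U \<phi>_off])
    fix p assume p: "p \<in> U"
    obtain V \<gamma> \<alpha> where c: "(V, \<gamma>, \<alpha>) \<in> C" "p \<in> V" using pick[OF U p] by blast
    have "cut (U \<inter> V) (\<lambda>x. \<gamma> x * \<phi> U m x) \<in> OX (U \<inter> V)"
      unfolding \<phi>_cut[OF c(1) U m] by (rule cf_closed[OF c(1) U W[OF c(1) U] _ _ m]) auto
    then show "\<exists>V \<gamma> \<alpha> W. (V, \<gamma>, \<alpha>) \<in> A \<and> op W \<and> p \<in> W \<and> W \<subseteq> U \<inter> V \<and> cut W (\<lambda>x. \<gamma> x * \<phi> U m x) \<in> OX W"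
      using c CA W[OF c(1) U] p by (intro exI[of _ V] exI[of _ \<gamma>] exI[of _ \<alpha>] exI[of _ "U \<inter> V"]) auto
  qed
  have ext: "s = t"
    if U: "op U" and off: "\<And>x. x \<notin> U \<Longrightarrow> s x = t x"
      and eq: "\<And>V \<gamma> \<alpha>. \<lbrakk>(V, \<gamma>, \<alpha>) \<in> C; op (U \<inter> V)\<rbrakk> \<Longrightarrow> cut (U \<inter> V) (\<lambda>x. \<gamma> x * s x) = cut (U \<inter> V) (\<lambda>x. \<gamma> x * t x)"
    for U s t
  proof
    fix x show "s x = t x"
    proof (cases "x \<in> U")
      case True
      then obtain V \<gamma> \<alpha> where c: "(V, \<gamma>, \<alpha>) \<in> C" "x \<in> V" using pick[OF U] by blast
      have "\<gamma> x * s x = \<gamma> x * t x" using fun_cong[OF eq[OF c(1) W[OF c(1) U]], of x] True c(2) by (simp add: cut_def)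
      moreover have "\<gamma> x \<noteq> 0" using chart_nz CA c by blast
      ultimately show ?thesis by simp
    qed (rule off)
  qed
  have "bm_iso K (L_mod A) \<phi>"
    unfolding bm_iso_def L_mod_simps
  proof (intro allI impI conjI ballI, goal_cases)
    case (1 U)
    show ?case
      unfolding bij_betw_def
    proof (intro conjI inj_onI equalityI subsetI)
      fix m m' assume m: "m \<in> carrier (sec K U)" "m' \<in> carrier (sec K U)" and eq: "\<phi> U m = \<phi> U m'"
      show "m = m'"
      proof (rule om_sep[OF om 1 m])
        fix p assume p: "p \<in> U"
        obtain V \<gamma> \<alpha> where c: "(V, \<gamma>, \<alpha>) \<in> C" "p \<in> V" using pick[OF 1 p] by blast
        note Wc = W[OF c(1) 1] and g = gW[OF c(1) W[OF c(1) 1] Int_lower2]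
        have s: "cf (V, \<gamma>, \<alpha>) U (U \<inter> V) m \<odot>\<^bsub>sec K (U \<inter> V)\<^esub> res K V (U \<inter> V) (e (V, \<gamma>, \<alpha>)) = res K U (U \<inter> V) m"
          if "m \<in> carrier (sec K U)" for m
          unfolding cf_def fst_conv by (rule coef_smult[OF om Wc g om_res[OF om 1 Wc Int_lower1 that]])
        have "cf (V, \<gamma>, \<alpha>) U (U \<inter> V) m = cf (V, \<gamma>, \<alpha>) U (U \<inter> V) m'"
          using \<phi>_cut[OF c(1) 1 m(1)] \<phi>_cut[OF c(1) 1 m(2)] eq by simp
        then have "res K U (U \<inter> V) m = res K U (U \<inter> V) m'"
          using s[OF m(1)] s[OF m(2)] by simp
        then show "\<exists>V. op V \<and> p \<in> V \<and> V \<subseteq> U \<and> res K U V m = res K U V m'" using Wc p c by blast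
      qed
    next
      fix s assume "s \<in> \<phi> U ` carrier (sec K U)"
      then show "s \<in> L_sec A U" using \<phi>_closed[OF 1] by blast
    next
      fix s assume s: "s \<in> L_sec A U"
      \<comment> \<open>Surjectivity: over each chart the preimage of \<open>s\<close> is its
        coordinate times the generator. These pieces agree on overlaps by the change of generators
        and glue because \<open>K\<close> is a sheaf.\<close>
      define t where "t c = cut (U \<inter> fst c) (\<lambda>x. fst (snd c) x * s x) \<odot>\<^bsub>sec K (U \<inter> fst c)\<^esub> res K (fst c) (U \<inter> fst c) (e c)" for c
      have tf: "cut (U \<inter> V) (\<lambda>x. \<gamma> x * s x) \<in> OX (U \<inter> V)" if c: "(V, \<gamma>, \<alpha>) \<in> C" for V \<gamma> \<alpha>
        by (rule L_sec_chart[OF s _ 1 W[OF c 1]]) (use CA c in auto)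
      have tc: "t c \<in> carrier (sec K (U \<inter> fst c))" if c: "c \<in> C" for c
      proof -
        obtain V \<gamma> \<alpha> where c': "c = (V, \<gamma>, \<alpha>)" by (cases c)
        then show ?thesis
          unfolding t_def using om_smult[OF om W tf generator_closed[OF gW]] c 1 W by (simp add: c')
      qed
      have "\<exists>m\<in>carrier (sec K U). \<forall>c\<in>C. res K U (U \<inter> fst c) m = t c"
      proof (rule om_glue[OF om 1])
        show "op (U \<inter> fst c)" if "c \<in> C" for c using W[of "fst c"] that 1 by (metis prod.collapse)
        show "U \<subseteq> (\<Union>c\<in>C. U \<inter> fst c)" using pick[OF 1] by fastforce
        show "t c \<in> carrier (sec K (U \<inter> fst c))" if "c \<in> C" for c using tc[OF that] .
        fix c c' assume C: "c \<in> C" "c' \<in> C"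
        obtain V \<gamma> \<alpha> where c: "c = (V, \<gamma>, \<alpha>)" by (cases c)
        obtain V' \<gamma>' \<alpha>' where c': "c' = (V', \<gamma>', \<alpha>')" by (cases c')
        note C' = C[unfolded c c']
        have V: "op V" "op V'" using C' chart_op CA by blast+
        define W1 where "W1 = U \<inter> V \<inter> V'"
        have W1: "op W1" "W1 \<subseteq> U" "W1 \<subseteq> V" "W1 \<subseteq> V'" "W1 \<subseteq> V \<inter> V'" "W1 \<subseteq> U \<inter> V" "W1 \<subseteq> U \<inter> V'"
          "U \<inter> V \<inter> (U \<inter> V') = W1" using V 1 by (auto simp: W1_def)
        have VV: "op (V \<inter> V')" using V by blast
        note ec = generator_closed[OF gen[OF C'(1)]] and ec' = generator_closed[OF gen[OF C'(2)]]
        have ratio: "cut (V \<inter> V') (\<lambda>x. \<gamma> x / \<gamma>' x) \<in> OX (V \<inter> V')" using chart_ratio CA C' by blast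
        have e': "res K V' W1 (e c') = cut W1 (cut (V \<inter> V') (\<lambda>x. \<gamma> x / \<gamma>' x)) \<odot>\<^bsub>sec K W1\<^esub> res K V W1 (e c)"
        proof -
          have "res K V' W1 (e c') = res K (V \<inter> V') W1 (res K V' (V \<inter> V') (e c'))"
            unfolding c' by (rule om_res_res[OF om V(2) VV W1(1,5) _ ec', symmetric]) simp
          also have "\<dots> = cut W1 (cut (V \<inter> V') (\<lambda>x. \<gamma> x / \<gamma>' x)) \<odot>\<^bsub>sec K W1\<^esub> res K (V \<inter> V') W1 (res K V (V \<inter> V') (e c))"
            unfolding c c' change[OF C']
            by (rule om_res_smult[OF om VV W1(1,5) ratio om_res[OF om V(1) VV _ ec]]) simp
          also have "res K (V \<inter> V') W1 (res K V (V \<inter> V') (e c)) = res K V W1 (e c)"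
            unfolding c by (rule om_res_res[OF om V(1) VV W1(1,5) _ ec]) simp
          finally show ?thesis .
        qed
        have rt: "res K (U \<inter> V) W1 (t c) = cut W1 (cut (U \<inter> V) (\<lambda>x. \<gamma> x * s x)) \<odot>\<^bsub>sec K W1\<^esub> res K V W1 (e c)"
          unfolding t_def c fst_conv snd_conv
          using om_res_smult[OF om W[OF C'(1) 1] W1(1,6) tf[OF C'(1)] generator_closed[OF gW[OF C'(1) W[OF C'(1) 1] Int_lower2]]]
            om_res_res[OF om V(1) W[OF C'(1) 1] W1(1,6) Int_lower2 ec] by simp
        have rt': "res K (U \<inter> V') W1 (t c') = cut W1 (cut (U \<inter> V') (\<lambda>x. \<gamma>' x * s x)) \<odot>\<^bsub>sec K W1\<^esub> res K V' W1 (e c')"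
          unfolding t_def c' fst_conv snd_conv
          using om_res_smult[OF om W[OF C'(2) 1] W1(1,7) tf[OF C'(2)] generator_closed[OF gW[OF C'(2) W[OF C'(2) 1] Int_lower2]]]
            om_res_res[OF om V(2) W[OF C'(2) 1] W1(1,7) Int_lower2 ec'] by simp
        have g1: "res K V W1 (e c) \<in> carrier (sec K W1)" unfolding c by (rule om_res[OF om V(1) W1(1,3) ec])
        have "res K (U \<inter> V') W1 (t c') = (\<lambda>x. cut W1 (cut (U \<inter> V') (\<lambda>x. \<gamma>' x * s x)) x * cut W1 (cut (V \<inter> V') (\<lambda>x. \<gamma> x / \<gamma>' x)) x)
            \<odot>\<^bsub>sec K W1\<^esub> res K V W1 (e c)"
          unfolding rt' e' by (rule om_smult_assoc[OF om W1(1) OX_cut[OF tf[OF C'(2)] W1(1,7)] OX_cut[OF ratio W1(1,5)] g1])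
        also have "(\<lambda>x. cut W1 (cut (U \<inter> V') (\<lambda>x. \<gamma>' x * s x)) x * cut W1 (cut (V \<inter> V') (\<lambda>x. \<gamma> x / \<gamma>' x)) x) =
            cut W1 (cut (U \<inter> V) (\<lambda>x. \<gamma> x * s x))"
        proof
          fix x
          have "\<gamma>' x \<noteq> 0" if "x \<in> W1"
            by (rule chart_nz[OF subsetD[OF CA C'(2)]]) (use that W1(4) in blast)
          then show "cut W1 (cut (U \<inter> V') (\<lambda>x. \<gamma>' x * s x)) x * cut W1 (cut (V \<inter> V') (\<lambda>x. \<gamma> x / \<gamma>' x)) x =
              cut W1 (cut (U \<inter> V) (\<lambda>x. \<gamma> x * s x)) x" using W1 by (auto simp: cut_def)
        qed
        finally have "res K (U \<inter> V) W1 (t c) = res K (U \<inter> V') W1 (t c')" unfolding rt by simp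
        then show "res K (U \<inter> fst c) (U \<inter> fst c \<inter> (U \<inter> fst c')) (t c) = res K (U \<inter> fst c') (U \<inter> fst c \<inter> (U \<inter> fst c')) (t c')"
          by (simp add: c c' W1(8))
      qed auto
      then obtain m where m: "m \<in> carrier (sec K U)" "\<forall>c\<in>C. res K U (U \<inter> fst c) m = t c" by blast
      have "\<phi> U m = s"
      proof (rule ext[OF 1])
        fix V \<gamma> \<alpha> assume c: "(V, \<gamma>, \<alpha>) \<in> C" and Wc: "op (U \<inter> V)"
        have "res K U (U \<inter> V) m = cut (U \<inter> V) (\<lambda>x. \<gamma> x * s x) \<odot>\<^bsub>sec K (U \<inter> V)\<^esub> res K V (U \<inter> V) (e (V, \<gamma>, \<alpha>))"
          using bspec[OF m(2) c] by (simp add: t_def)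
        then show "cut (U \<inter> V) (\<lambda>x. \<gamma> x * \<phi> U m x) = cut (U \<inter> V) (\<lambda>x. \<gamma> x * s x)"
          unfolding \<phi>_cut[OF c 1 m(1)] cf_def fst_conv using coef_eq[OF om Wc gW[OF c Wc Int_lower2] tf[OF c]] by simp
      qed (simp add: \<phi>_off L_sec_off[OF s])
      then show "s \<in> \<phi> U ` carrier (sec K U)" using m by blast
    qed
  next
    case (2 U m m')
    show ?case
    proof (rule ext[OF 2(1)])
      fix V \<gamma> \<alpha> assume c: "(V, \<gamma>, \<alpha>) \<in> C" and Wc: "op (U \<inter> V)"
      have e: "cut (U \<inter> V) (\<lambda>x. \<gamma> x * (s x + t x)) = (\<lambda>x. cut (U \<inter> V) (\<lambda>x. \<gamma> x * s x) x + cut (U \<inter> V) (\<lambda>x. \<gamma> x * t x) x)"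
        for s t by (auto simp: cut_def algebra_simps)
      show "cut (U \<inter> V) (\<lambda>x. \<gamma> x * \<phi> U (m \<oplus>\<^bsub>sec K U\<^esub> m') x) = cut (U \<inter> V) (\<lambda>x. \<gamma> x * (\<phi> U m x + \<phi> U m' x))"
        unfolding e \<phi>_cut[OF c 2(1,2)] \<phi>_cut[OF c 2(1,3)] \<phi>_cut[OF c 2(1) om_add[OF om 2(1,2,3)]] cf_def fst_conv
          om_res_add[OF om 2(1) Wc Int_lower1 2(2,3)]
        by (rule coef_add[OF om Wc gW[OF c Wc Int_lower2]]) (intro om_res[OF om 2(1) Wc Int_lower1] 2)+
    qed (simp add: \<phi>_off)
  next
    case (3 U m f)
    show ?case
    proof (rule ext[OF 3(1)])
      fix V \<gamma> \<alpha> assume c: "(V, \<gamma>, \<alpha>) \<in> C" and Wc: "op (U \<inter> V)"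
      have e: "cut (U \<inter> V) (\<lambda>x. \<gamma> x * (f x * s x)) = (\<lambda>x. cut (U \<inter> V) f x * cut (U \<inter> V) (\<lambda>x. \<gamma> x * s x) x)"
        for s by (auto simp: cut_def algebra_simps)
      show "cut (U \<inter> V) (\<lambda>x. \<gamma> x * \<phi> U (f \<odot>\<^bsub>sec K U\<^esub> m) x) = cut (U \<inter> V) (\<lambda>x. \<gamma> x * (f x * \<phi> U m x))"
        unfolding e \<phi>_cut[OF c 3(1,2)] \<phi>_cut[OF c 3(1) om_smult[OF om 3(1,3,2)]] cf_def fst_conv
          om_res_smult[OF om 3(1) Wc Int_lower1 3(3,2)]
        by (rule coef_scale[OF om Wc gW[OF c Wc Int_lower2] om_res[OF om 3(1) Wc Int_lower1 3(2)] OX_cut[OF 3(3) Wc Int_lower1]])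
    qed (simp add: \<phi>_off OX_off[OF 3(3)])
  next
    case (4 U m V)
    then have V: "op V" "V \<subseteq> U" by auto
    show ?case
    proof
      fix x show "\<phi> V (res K U V m) x = cut V (\<phi> U m) x"
      proof (cases "x \<in> V")
        case True
        then obtain V' \<gamma> \<alpha> where c: "(V', \<gamma>, \<alpha>) \<in> C" "x \<in> V'" using pick[OF V(1)] by blast
        have VW: "op (V \<inter> V')" "V \<inter> V' \<subseteq> U" "x \<in> V \<inter> V'" using W[OF c(1) V(1)] V True c by auto
        show ?thesis
          using \<phi>_eq[OF c(1) V(1) VW(1) _ _ om_res[OF om 4(1) V 4(2)] VW(3)] \<phi>_eq[OF c(1) 4(1) VW(1,2) _ 4(2) VW(3)]
            om_res_res[OF om 4(1) V(1) VW(1) _ V(2) 4(2)] True by (simp add: cf_def cut_def)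
      qed (simp add: \<phi>_off cut_def)
    qed
  next
    case (5 U m b)
    show ?case
    proof (rule ext[OF 5(1)])
      fix V \<gamma> \<alpha> assume c: "(V, \<gamma>, \<alpha>) \<in> C" and Wc: "op (U \<inter> V)"
      have cA: "(V, \<gamma>, \<alpha>) \<in> A" using c CA by blast
      note b' = BB_res[OF 5(1) Wc Int_lower1 5(3)] and g = gW[OF c Wc Int_lower2]
      have "cf (V, \<gamma>, \<alpha>) U (U \<inter> V) (act K U b m) = (\<lambda>x. DD (U \<inter> V) (res B U (U \<inter> V) b) (cf (V, \<gamma>, \<alpha>) U (U \<inter> V) m) x +
         \<alpha> (U \<inter> V) (res B U (U \<inter> V) b) x * cf (V, \<gamma>, \<alpha>) U (U \<inter> V) m x)"
        unfolding cf_def fst_conv bm_res[OF K 5(1,3,2) Wc Int_lower1, symmetric]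
        by (rule coef_act[OF K Wc g om_res[OF om 5(1) Wc Int_lower1 5(2)] b'
              lin_form_closed[OF Gx_form[OF chart_form[OF cA]] Wc Int_lower2 b'] conn[OF c Wc Int_lower2 b']])
      then show "cut (U \<inter> V) (\<lambda>x. \<gamma> x * \<phi> U (act K U b m) x) = cut (U \<inter> V) (\<lambda>x. \<gamma> x * L_act A U b (\<phi> U m) x)"
        unfolding \<phi>_cut[OF c 5(1) bm_act[OF K 5(1,3,2)]]
          L_act_chart[OF cA 5(1) Wc Int_lower1 Int_lower2 5(3) \<phi>_closed[OF 5(1,2)]] \<phi>_cut[OF c 5(1,2)] .
    qed (simp add: \<phi>_off L_act_off)
  qed
  then show ?thesis by (auto simp: bmodule_isomorphic_iff)
qed

end

section \<open>Tensor products of invertible modules\<close>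

context lie_algebroid_space
begin

lemma
  assumes "omodule_bilinear M P K L N \<beta>" "op U" "k \<in> carrier (sec K U)" "l \<in> carrier (sec L U)"
  shows bil_closed: "\<beta> U k l \<in> carrier (sec N U)"
    and bil_ladd: "k' \<in> carrier (sec K U) \<Longrightarrow> \<beta> U (k \<oplus>\<^bsub>sec K U\<^esub> k') l = \<beta> U k l \<oplus>\<^bsub>sec N U\<^esub> \<beta> U k' l"
    and bil_radd: "l' \<in> carrier (sec L U) \<Longrightarrow> \<beta> U k (l \<oplus>\<^bsub>sec L U\<^esub> l') = \<beta> U k l \<oplus>\<^bsub>sec N U\<^esub> \<beta> U k l'"
    and bil_lsmult: "f \<in> OX U \<Longrightarrow> \<beta> U (f \<odot>\<^bsub>sec K U\<^esub> k) l = f \<odot>\<^bsub>sec N U\<^esub> \<beta> U k l"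
    and bil_rsmult: "f \<in> OX U \<Longrightarrow> \<beta> U k (f \<odot>\<^bsub>sec L U\<^esub> l) = f \<odot>\<^bsub>sec N U\<^esub> \<beta> U k l"
    and bil_res: "\<lbrakk>op V; V \<subseteq> U\<rbrakk> \<Longrightarrow> \<beta> V (res K U V k) (res L U V l) = res N U V (\<beta> U k l)"
  using assms by (simp_all add: omodule_bilinear_def)

lemma
  assumes "omodule_hom M P L N \<phi>" "op U" "m \<in> carrier (sec L U)"
  shows hom_closed: "\<phi> U m \<in> carrier (sec N U)"
    and hom_add: "m' \<in> carrier (sec L U) \<Longrightarrow> \<phi> U (m \<oplus>\<^bsub>sec L U\<^esub> m') = \<phi> U m \<oplus>\<^bsub>sec N U\<^esub> \<phi> U m'"
    and hom_smult: "f \<in> OX U \<Longrightarrow> \<phi> U (f \<odot>\<^bsub>sec L U\<^esub> m) = f \<odot>\<^bsub>sec N U\<^esub> \<phi> U m"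
    and hom_res: "\<lbrakk>op V; V \<subseteq> U\<rbrakk> \<Longrightarrow> \<phi> V (res L U V m) = res N U V (\<phi> U m)"
  using assms by (auto simp: omodule_hom_def Pi_iff)

lemma bil_smult2:
  assumes \<beta>: "omodule_bilinear M P K L N \<beta>" and om: "omodule M P K" "omodule M P L" "omodule M P N" and U: "op U"
    and k: "k \<in> carrier (sec K U)" and l: "l \<in> carrier (sec L U)" and f: "f \<in> OX U" and g: "g \<in> OX U"
  shows "\<beta> U (f \<odot>\<^bsub>sec K U\<^esub> k) (g \<odot>\<^bsub>sec L U\<^esub> l) = (\<lambda>x. f x * g x) \<odot>\<^bsub>sec N U\<^esub> \<beta> U k l"
  unfolding bil_lsmult[OF \<beta> U k om_smult[OF om(2) U g l] f] bil_rsmult[OF \<beta> U k l g]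
  by (rule om_smult_assoc[OF om(3) U f g bil_closed[OF \<beta> U k l]])

definition gen_pair where
  "gen_pair K L N \<tau> W k l \<longleftrightarrow> op W \<and> generator K W k \<and> generator L W l \<and> generator N W (\<tau> W k l)"

text \<open>The local criterion by which a bilinear map between rank one modules is recognised as a
  tensor product.\<close>

definition locally_gen where
  "locally_gen K L N \<tau> \<longleftrightarrow> (\<forall>p\<in>topspace (mtop M). \<exists>W k l. p \<in> W \<and> gen_pair K L N \<tau> W k l)"

lemma gen_pair_res:
  assumes om: "omodule M P K" "omodule M P L" "omodule M P N" and \<tau>: "omodule_bilinear M P K L N \<tau>"
    and g: "gen_pair K L N \<tau> W k l" and W': "op W'" "W' \<subseteq> W"
  shows "gen_pair K L N \<tau> W' (res K W W' k) (res L W W' l)"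
proof -
  have W: "op W" and k: "generator K W k" and l: "generator L W l" and t: "generator N W (\<tau> W k l)"
    using g by (auto simp: gen_pair_def)
  show ?thesis
    unfolding gen_pair_def bil_res[OF \<tau> W generator_closed[OF k] generator_closed[OF l] W']
    by (intro conjI W' generator_res[OF _ W W'] om k l t)
qed

lemma locally_gen_cover:
  assumes om: "omodule M P K" "omodule M P L" "omodule M P N" and \<tau>: "omodule_bilinear M P K L N \<tau>"
    and lg: "locally_gen K L N \<tau>" and U: "op U" and p: "p \<in> U"
  obtains W k l where "p \<in> W" "W \<subseteq> U" "gen_pair K L N \<tau> W k l"
proof -
  have "p \<in> topspace (mtop M)" using U p openin_subset by blast
  then obtain W k l where W: "p \<in> W" "gen_pair K L N \<tau> W k l" using lg unfolding locally_gen_def by blast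
  have "op (U \<inter> W)" using W U by (auto simp: gen_pair_def)
  then show thesis using gen_pair_res[OF om \<tau> W(2), of "U \<inter> W"] that[of "U \<inter> W"] W(1) p by auto
qed

text \<open>Where \<open>k\<close>, \<open>l\<close> and \<open>\<tau> W k l\<close> are generators,
  a linear map compatible with \<open>\<beta>\<close> has to send
  \<open>f \<odot> \<tau> W k l\<close> to \<open>f \<odot> \<beta> W k l\<close>. This determines
  it locally and makes the local maps agree, and the sheaf property of \<open>Q\<close> glues
  them.\<close>

lemma tensor_universal:
  fixes K :: "('x, 'k, 'y) osheaf_scheme" and L :: "('x, 'l, 'z) osheaf_scheme" and N :: "('x, 'n, 'w) osheaf_scheme"
    and Q :: "('x, 'q, 'v) osheaf_scheme"
  assumes om: "omodule M P K" "omodule M P L" "omodule M P N" and \<tau>: "omodule_bilinear M P K L N \<tau>"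
    and lg: "locally_gen K L N \<tau>" and Q: "omodule M P Q" and \<beta>: "omodule_bilinear M P K L Q \<beta>"
  shows "\<exists>h. omodule_hom M P N Q h \<and>
           (\<forall>U k l. op U \<and> k \<in> carrier (sec K U) \<and> l \<in> carrier (sec L U) \<longrightarrow> h U (\<tau> U k l) = \<beta> U k l) \<and>
           (\<forall>h'. omodule_hom M P N Q h' \<and>
              (\<forall>U k l. op U \<and> k \<in> carrier (sec K U) \<and> l \<in> carrier (sec L U) \<longrightarrow> h' U (\<tau> U k l) = \<beta> U k l) \<longrightarrow>
              (\<forall>U n. op U \<and> n \<in> carrier (sec N U) \<longrightarrow> h' U n = h U n))"
proof -
  let ?g = "gen_pair K L N \<tau>"
  define loc where "loc W k l n = coef N W (\<tau> W k l) n \<odot>\<^bsub>sec Q W\<^esub> \<beta> W k l" for W k l n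
  have gp: "op W" "generator K W k" "generator L W l" "generator N W (\<tau> W k l)"
    "k \<in> carrier (sec K W)" "l \<in> carrier (sec L W)" "\<tau> W k l \<in> carrier (sec N W)" "\<beta> W k l \<in> carrier (sec Q W)"
    if "?g W k l" for W k l
  proof -
    show *: "op W" "generator K W k" "generator L W l" "generator N W (\<tau> W k l)" using that by (auto simp: gen_pair_def)
    show k: "k \<in> carrier (sec K W)" by (rule generator_closed[OF *(2)])
    show l: "l \<in> carrier (sec L W)" by (rule generator_closed[OF *(3)])
    show "\<tau> W k l \<in> carrier (sec N W)" by (rule generator_closed[OF *(4)])
    from k l show "\<beta> W k l \<in> carrier (sec Q W)" using bil_closed[OF \<beta> *(1)] by blast
  qed
  have loc_closed: "loc W k l n \<in> carrier (sec Q W)" if g: "?g W k l" and n: "n \<in> carrier (sec N W)" for W k l n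
    unfolding loc_def by (rule om_smult[OF Q gp(1)[OF g] coef_closed[OF om(3) gp(1)[OF g] gp(4)[OF g] n] gp(8)[OF g]])
  have loc_smult: "loc W k l (f \<odot>\<^bsub>sec N W\<^esub> \<tau> W k l) = f \<odot>\<^bsub>sec Q W\<^esub> \<beta> W k l" if g: "?g W k l" and f: "f \<in> OX W" for W k l f
    unfolding loc_def coef_eq[OF om(3) gp(1)[OF g] gp(4)[OF g] f] ..
  \<comment> \<open>The local map is right on all pairs and not only on the chosen generators:
    expand both arguments in them and use bilinearity of \<open>\<tau>\<close> and
    \<open>\<beta>\<close>.\<close>
  have loc_tau: "loc W k l (\<tau> W k' l') = \<beta> W k' l'"
    if g: "?g W k l" and k': "k' \<in> carrier (sec K W)" and l': "l' \<in> carrier (sec L W)" for W k l k' l'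
  proof -
    note G = gp[OF g]
    define a b where "a = coef K W k k'" and "b = coef L W l l'"
    have a: "a \<in> OX W" "a \<odot>\<^bsub>sec K W\<^esub> k = k'"
      using coef_closed[OF om(1) G(1,2) k'] coef_smult[OF om(1) G(1,2) k'] by (auto simp: a_def)
    have b: "b \<in> OX W" "b \<odot>\<^bsub>sec L W\<^esub> l = l'"
      using coef_closed[OF om(2) G(1,3) l'] coef_smult[OF om(2) G(1,3) l'] by (auto simp: b_def)
    show ?thesis
      using bil_smult2[OF \<tau> om G(1,5,6) a(1) b(1)] bil_smult2[OF \<beta> om(1,2) Q G(1,5,6) a(1) b(1)]
        loc_smult[OF g OX_mult[OF G(1) a(1) b(1)]] by (simp add: a(2) b(2))
  qed
  \<comment> \<open>Two pairs of generators over one \<open>W\<close> are related by a factor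
    \<open>a\<close>, and \<open>loc_tau\<close> shows that this same factor relates the values of
    \<open>\<beta>\<close>.\<close>
  have loc_indep: "loc W k' l' n = loc W k l n"
    if g: "?g W k l" and g': "?g W k' l'" and n: "n \<in> carrier (sec N W)" for W k l k' l' n
  proof -
    note G = gp[OF g] and G' = gp[OF g']
    define c where "c = coef N W (\<tau> W k' l') n"
    have c: "c \<in> OX W" "c \<odot>\<^bsub>sec N W\<^esub> \<tau> W k' l' = n"
      using coef_closed[OF om(3) G'(1,4) n] coef_smult[OF om(3) G'(1,4) n] by (auto simp: c_def)
    define a where "a = coef N W (\<tau> W k l) (\<tau> W k' l')"
    have a: "a \<in> OX W" "a \<odot>\<^bsub>sec N W\<^esub> \<tau> W k l = \<tau> W k' l'"
      using coef_closed[OF om(3) G(1,4) G'(7)] coef_smult[OF om(3) G(1,4) G'(7)] by (auto simp: a_def)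
    have "a \<odot>\<^bsub>sec Q W\<^esub> \<beta> W k l = \<beta> W k' l'"
      using loc_smult[OF g a(1)] loc_tau[OF g G'(5,6)] by (simp add: a(2))
    moreover have "(\<lambda>x. c x * a x) \<odot>\<^bsub>sec N W\<^esub> \<tau> W k l = n"
      using om_smult_assoc[OF om(3) G(1) c(1) a(1) G(7)] by (simp add: a(2) c(2))
    ultimately show ?thesis
      using loc_smult[OF g OX_mult[OF G(1) c(1) a(1)]] om_smult_assoc[OF Q G(1) c(1) a(1) G(8)]
      by (simp add: loc_def c_def)
  qed
  have loc_res: "loc W' (res K W W' k) (res L W W' l) (res N W W' n) = res Q W W' (loc W k l n)"
    if g: "?g W k l" and n: "n \<in> carrier (sec N W)" and W': "op W'" "W' \<subseteq> W" for W k l n W'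
  proof -
    note G = gp[OF g]
    show ?thesis
      unfolding loc_def bil_res[OF \<tau> G(1,5,6) W'] bil_res[OF \<beta> G(1,5,6) W'] coef_res[OF om(3) G(1) W' G(4) n]
      by (rule om_res_smult[OF Q G(1) W' coef_closed[OF om(3) G(1,4) n] G(8), symmetric])
  qed
  have ex: "\<exists>t\<in>carrier (sec Q U). \<forall>W k l. ?g W k l \<and> W \<subseteq> U \<longrightarrow> res Q U W t = loc W k l (res N U W n)"
    if U: "op U" and n: "n \<in> carrier (sec N U)" for U n
  proof -
    define I where "I = {(W, k, l). ?g W k l \<and> W \<subseteq> U}"
    have "\<exists>t\<in>carrier (sec Q U). \<forall>i\<in>I. res Q U (fst i) t = loc (fst i) (fst (snd i)) (snd (snd i)) (res N U (fst i) n)"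
    proof (rule om_glue[OF Q U])
      show "U \<subseteq> (\<Union>i\<in>I. fst i)"
      proof
        fix p assume "p \<in> U"
        from locally_gen_cover[OF om \<tau> lg U this] obtain W k l where W: "p \<in> W" "W \<subseteq> U" "?g W k l" .
        then have "(W, k, l) \<in> I" by (simp add: I_def)
        with W(1) show "p \<in> (\<Union>i\<in>I. fst i)" by force
      qed
      fix i assume "i \<in> I"
      then obtain W k l where i: "i = (W, k, l)" and g: "?g W k l" and W: "W \<subseteq> U" unfolding I_def by blast
      show "op (fst i)" "fst i \<subseteq> U" using gp(1)[OF g] W by (auto simp: i)
      show "loc (fst i) (fst (snd i)) (snd (snd i)) (res N U (fst i) n) \<in> carrier (sec Q (fst i))"
        unfolding i fst_conv snd_conv by (rule loc_closed[OF g om_res[OF om(3) U gp(1)[OF g] W n]])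
      fix j assume "j \<in> I"
      then obtain W' k' l' where j: "j = (W', k', l')" and g': "?g W' k' l'" and W': "W' \<subseteq> U" unfolding I_def by blast
      have o: "op (W \<inter> W')" using gp(1)[OF g] gp(1)[OF g'] by blast
      note nW = om_res[OF om(3) U gp(1)[OF g] W n] and nW' = om_res[OF om(3) U gp(1)[OF g'] W' n]
      show "res Q (fst i) (fst i \<inter> fst j) (loc (fst i) (fst (snd i)) (snd (snd i)) (res N U (fst i) n)) =
          res Q (fst j) (fst i \<inter> fst j) (loc (fst j) (fst (snd j)) (snd (snd j)) (res N U (fst j) n))"
        unfolding i j fst_conv snd_conv loc_res[OF g nW o Int_lower1, symmetric] loc_res[OF g' nW' o Int_lower2, symmetric]
          om_res_res[OF om(3) U gp(1)[OF g] o Int_lower1 W n] om_res_res[OF om(3) U gp(1)[OF g'] o Int_lower2 W' n]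
        by (rule loc_indep[OF gen_pair_res[OF om \<tau> g' o Int_lower2] gen_pair_res[OF om \<tau> g o Int_lower1] om_res[OF om(3) U o _ n]])
           (use W in blast)
    qed
    then obtain t where t: "t \<in> carrier (sec Q U)"
      and t': "\<forall>i\<in>I. res Q U (fst i) t = loc (fst i) (fst (snd i)) (snd (snd i)) (res N U (fst i) n)" by blast
    have "res Q U W t = loc W k l (res N U W n)" if "?g W k l \<and> W \<subseteq> U" for W k l
      using bspec[OF t', of "(W, k, l)"] that by (simp add: I_def)
    with t show ?thesis by blast
  qed
  \<comment> \<open>The glued section is characterised by all its local values at once; linearity,
    compatibility with restriction and uniqueness then all follow from \<open>h_uniq\<close> by
    comparing local values.\<close>
  define h where "h U n = (SOME t. t \<in> carrier (sec Q U) \<and>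
     (\<forall>W k l. ?g W k l \<and> W \<subseteq> U \<longrightarrow> res Q U W t = loc W k l (res N U W n)))" for U n
  have h: "h U n \<in> carrier (sec Q U) \<and> (\<forall>W k l. ?g W k l \<and> W \<subseteq> U \<longrightarrow> res Q U W (h U n) = loc W k l (res N U W n))"
    if "op U" "n \<in> carrier (sec N U)" for U n
    unfolding h_def by (rule someI_ex) (use ex[OF that] in blast)
  have h_closed: "h U n \<in> carrier (sec Q U)" if "op U" "n \<in> carrier (sec N U)" for U n using h[OF that] by simp
  have h_uniq: "t = h U n" if U: "op U" and n: "n \<in> carrier (sec N U)" and t: "t \<in> carrier (sec Q U)"
    and eq: "\<And>W k l. \<lbrakk>?g W k l; W \<subseteq> U\<rbrakk> \<Longrightarrow> res Q U W t = loc W k l (res N U W n)" for U n t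
  proof (rule om_sep[OF Q U t h_closed[OF U n]])
    fix p assume "p \<in> U"
    then obtain W k l where W: "p \<in> W" "W \<subseteq> U" "?g W k l" using locally_gen_cover[OF om \<tau> lg U] by blast
    then have "res Q U W t = res Q U W (h U n)" using eq[OF W(3,2)] h[OF U n] by simp
    then show "\<exists>V. op V \<and> p \<in> V \<and> V \<subseteq> U \<and> res Q U V t = res Q U V (h U n)" using W gp(1)[OF W(3)] by blast
  qed
  have h_tau: "h U (\<tau> U k l) = \<beta> U k l" if U: "op U" and k: "k \<in> carrier (sec K U)" and l: "l \<in> carrier (sec L U)" for U k l
  proof (rule h_uniq[OF U bil_closed[OF \<tau> U k l] bil_closed[OF \<beta> U k l], symmetric])
    fix W e e' assume g: "?g W e e'" and W: "W \<subseteq> U"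
    note o = gp(1)[OF g]
    show "res Q U W (\<beta> U k l) = loc W e e' (res N U W (\<tau> U k l))"
      unfolding bil_res[OF \<tau> U k l o W, symmetric] bil_res[OF \<beta> U k l o W, symmetric]
      by (rule loc_tau[OF g om_res[OF om(1) U o W k] om_res[OF om(2) U o W l], symmetric])
  qed
  have h_hom: "omodule_hom M P N Q h"
    unfolding omodule_hom_def
  proof (intro allI impI conjI ballI funcsetI, goal_cases)
    case (1 U n)
    then show ?case by (rule h_closed)
  next
    case (2 U n n')
    show ?case
    proof (rule h_uniq[OF 2(1) om_add[OF om(3) 2] om_add[OF Q 2(1) h_closed[OF 2(1,2)] h_closed[OF 2(1,3)]], symmetric])
      fix W k l assume g: "?g W k l" and W: "W \<subseteq> U"
      note G = gp[OF g]
      note r = om_res[OF om(3) 2(1) G(1) W 2(2)] om_res[OF om(3) 2(1) G(1) W 2(3)]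
      have "res Q U W (h U n \<oplus>\<^bsub>sec Q U\<^esub> h U n') = loc W k l (res N U W n) \<oplus>\<^bsub>sec Q W\<^esub> loc W k l (res N U W n')"
        using om_res_add[OF Q 2(1) G(1) W h_closed[OF 2(1,2)] h_closed[OF 2(1,3)]] h[OF 2(1,2)] h[OF 2(1,3)] g W by simp
      also have "\<dots> = loc W k l (res N U W n \<oplus>\<^bsub>sec N W\<^esub> res N U W n')"
        unfolding loc_def coef_add[OF om(3) G(1,4) r]
        by (rule om_smult_ldistr[OF Q G(1) coef_closed[OF om(3) G(1,4) r(1)] coef_closed[OF om(3) G(1,4) r(2)] G(8), symmetric])
      finally show "res Q U W (h U n \<oplus>\<^bsub>sec Q U\<^esub> h U n') = loc W k l (res N U W (n \<oplus>\<^bsub>sec N U\<^esub> n'))"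
        unfolding om_res_add[OF om(3) 2(1) G(1) W 2(2,3)] .
    qed
  next
    case (3 U f n)
    show ?case
    proof (rule h_uniq[OF 3(1) om_smult[OF om(3) 3] om_smult[OF Q 3(1,2) h_closed[OF 3(1,3)]], symmetric])
      fix W k l assume g: "?g W k l" and W: "W \<subseteq> U"
      note G = gp[OF g]
      note r = om_res[OF om(3) 3(1) G(1) W 3(3)] and f' = OX_cut[OF 3(2) G(1) W]
      have "res Q U W (f \<odot>\<^bsub>sec Q U\<^esub> h U n) = cut W f \<odot>\<^bsub>sec Q W\<^esub> loc W k l (res N U W n)"
        using om_res_smult[OF Q 3(1) G(1) W 3(2) h_closed[OF 3(1,3)]] h[OF 3(1,3)] g W by simp
      also have "\<dots> = loc W k l (cut W f \<odot>\<^bsub>sec N W\<^esub> res N U W n)"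
        unfolding loc_def coef_scale[OF om(3) G(1,4) r f']
        by (rule om_smult_assoc[OF Q G(1) f' coef_closed[OF om(3) G(1,4) r] G(8)])
      finally show "res Q U W (f \<odot>\<^bsub>sec Q U\<^esub> h U n) = loc W k l (res N U W (f \<odot>\<^bsub>sec N U\<^esub> n))"
        unfolding om_res_smult[OF om(3) 3(1) G(1) W 3(2,3)] .
    qed
  next
    case (4 U V n)
    then have V: "op V" "V \<subseteq> U" by auto
    show ?case
    proof (rule h_uniq[OF V(1) om_res[OF om(3) 4(1) V 4(3)] om_res[OF Q 4(1) V h_closed[OF 4(1,3)]], symmetric])
      fix W k l assume g: "?g W k l" and W: "W \<subseteq> V"
      note o = gp(1)[OF g]
      have "W \<subseteq> U" using W V by blast
      then show "res Q V W (res Q U V (h U n)) = loc W k l (res N V W (res N U V n))"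
        using om_res_res[OF Q 4(1) V(1) o W V(2) h_closed[OF 4(1,3)]] om_res_res[OF om(3) 4(1) V(1) o W V(2) 4(3)] h[OF 4(1,3)] g
        by simp
    qed
  qed
  have uniq: "h' U n = h U n"
    if h': "omodule_hom M P N Q h'" "\<And>U k l. \<lbrakk>op U; k \<in> carrier (sec K U); l \<in> carrier (sec L U)\<rbrakk> \<Longrightarrow> h' U (\<tau> U k l) = \<beta> U k l"
      and U: "op U" and n: "n \<in> carrier (sec N U)" for h' U n
  proof (rule h_uniq[OF U n hom_closed[OF h'(1) U n]])
    fix W k l assume g: "?g W k l" and W: "W \<subseteq> U"
    note G = gp[OF g]
    note r = om_res[OF om(3) U G(1) W n]
    define c where "c = coef N W (\<tau> W k l) (res N U W n)"
    have c: "c \<in> OX W" "c \<odot>\<^bsub>sec N W\<^esub> \<tau> W k l = res N U W n"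
      using coef_closed[OF om(3) G(1,4) r] coef_smult[OF om(3) G(1,4) r] by (auto simp: c_def)
    have "res Q U W (h' U n) = h' W (c \<odot>\<^bsub>sec N W\<^esub> \<tau> W k l)"
      unfolding c(2) by (rule hom_res[OF h'(1) U n G(1) W, symmetric])
    also have "\<dots> = c \<odot>\<^bsub>sec Q W\<^esub> \<beta> W k l"
      using hom_smult[OF h'(1) G(1,7) c(1)] h'(2)[OF G(1,5,6)] by simp
    finally show "res Q U W (h' U n) = loc W k l (res N U W n)" by (simp add: loc_def c_def)
  qed
  show ?thesis
  proof (intro exI[of _ h] conjI allI impI, goal_cases)
    case 1
    show ?case by (rule h_hom)
  next
    case (2 U k l)
    then show ?case by (simp add: h_tau)
  next
    case (3 h' U n)
    then show ?case by (intro uniq) auto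
  qed
qed

lemma is_tensor_productI:
  fixes K L N :: "('x, 'b, 'm) bmod"
  assumes "omodule M P K" "omodule M P L" "omodule M P N" "omodule_bilinear M P K L N \<tau>" "locally_gen K L N \<tau>"
  shows "is_tensor_product M P K L N \<tau>"
  unfolding is_tensor_product_def using tensor_universal[OF assms] assms(4) by blast

text \<open>The universal property is stated for plain sheaves of modules, while the targets of
  interest also carry an action; forgetting it leaves these notions unchanged.\<close>

lemma osheaf_truncate:
  fixes N :: "('x, 'm, 'z) osheaf_scheme"
  shows "omodule M P (osheaf.truncate N) \<longleftrightarrow> omodule M P N"
    "omodule_bilinear M P K L (osheaf.truncate N) \<beta> \<longleftrightarrow> omodule_bilinear M P K L N \<beta>"
    "omodule_hom M P Q (osheaf.truncate N) h \<longleftrightarrow> omodule_hom M P Q N h"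
  by (simp_all add: omodule_def omodule_bilinear_def omodule_hom_def osheaf.truncate_def)

lemma tensor_factor:
  fixes K L N :: "('x, 'b, 'm) bmod" and N' :: "('x, 'b, 'm) bmod"
  assumes "is_tensor_product M P K L N \<tau>" "omodule M P N'" "omodule_bilinear M P K L N' \<beta>"
  obtains h where "omodule_hom M P N N' h" "\<forall>U k l. op U \<and> k \<in> carrier (sec K U) \<and> l \<in> carrier (sec L U) \<longrightarrow> h U (\<tau> U k l) = \<beta> U k l"
    "\<forall>h'. omodule_hom M P N N' h' \<and> (\<forall>U k l. op U \<and> k \<in> carrier (sec K U) \<and> l \<in> carrier (sec L U) \<longrightarrow> h' U (\<tau> U k l) = \<beta> U k l) \<longrightarrow>
      (\<forall>U n. op U \<and> n \<in> carrier (sec N U) \<longrightarrow> h' U n = h U n)"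
proof -
  have "\<forall>(Q :: ('x, 'm) osheaf) \<beta>. omodule M P Q \<and> omodule_bilinear M P K L Q \<beta> \<longrightarrow>
        (\<exists>h. omodule_hom M P N Q h \<and>
           (\<forall>U k l. op U \<and> k \<in> carrier (sec K U) \<and> l \<in> carrier (sec L U) \<longrightarrow> h U (\<tau> U k l) = \<beta> U k l) \<and>
           (\<forall>h'. omodule_hom M P N Q h' \<and>
              (\<forall>U k l. op U \<and> k \<in> carrier (sec K U) \<and> l \<in> carrier (sec L U) \<longrightarrow> h' U (\<tau> U k l) = \<beta> U k l) \<longrightarrow>
              (\<forall>U n. op U \<and> n \<in> carrier (sec N U) \<longrightarrow> h' U n = h U n)))"
    using assms(1) unfolding is_tensor_product_def by (elim conjE)
  from spec[OF spec[OF this, of "osheaf.truncate N'"], of \<beta>]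
  obtain h where h: "omodule_hom M P N N' h"
      "\<forall>U k l. op U \<and> k \<in> carrier (sec K U) \<and> l \<in> carrier (sec L U) \<longrightarrow> h U (\<tau> U k l) = \<beta> U k l"
      "\<forall>h'. omodule_hom M P N N' h' \<and>
              (\<forall>U k l. op U \<and> k \<in> carrier (sec K U) \<and> l \<in> carrier (sec L U) \<longrightarrow> h' U (\<tau> U k l) = \<beta> U k l) \<longrightarrow>
              (\<forall>U n. op U \<and> n \<in> carrier (sec N U) \<longrightarrow> h' U n = h U n)"
    unfolding osheaf_truncate using assms(2,3) by (elim impE exE conjE) simp_all
  show thesis by (rule that[OF h])
qed

lemma omodule_hom_comp:
  "\<lbrakk>omodule_hom M P L N \<phi>; omodule_hom M P N K \<psi>\<rbrakk> \<Longrightarrow> omodule_hom M P L K (\<lambda>U m. \<psi> U (\<phi> U m))"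
  by (auto simp: omodule_hom_def Pi_iff)

lemma omodule_hom_id: "omodule_hom M P L L (\<lambda>_ m. m)"
  by (auto simp: omodule_hom_def)

text \<open>Universality of both products gives mutually inverse maps, each composite being compared
  with an identity. They respect the actions because both actions obey the product rule on values of
  \<open>\<tau>\<close>, and locally every section is a multiple of such a value.\<close>

lemma tensor_unique:
  fixes K L N N' :: "('x, 'b, 'm) bmod"
  assumes bm: "bmodule M P B K" "bmodule M P B L" "bmodule M P B N"
    and \<tau>: "omodule_bilinear M P K L N \<tau>" and lg: "locally_gen K L N \<tau>"
    and act_\<tau>: "\<And>U b k l. \<lbrakk>op U; b \<in> BB U; k \<in> carrier (sec K U); l \<in> carrier (sec L U)\<rbrakk> \<Longrightarrow>
      act N U b (\<tau> U k l) = \<tau> U (act K U b k) l \<oplus>\<^bsub>sec N U\<^esub> \<tau> U k (act L U b l)"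
    and t': "bmodule_tensor M P B K L N'"
  shows "bmodule_isomorphic M P B N N'"
proof -
  note om = bm(1,2,3)[THEN bm_om]
  have bm': "bmodule M P B N'" using t' by (simp add: bmodule_tensor_def)
  note om' = bm_om[OF bm']
  obtain \<tau>' where tp': "is_tensor_product M P K L N' \<tau>'"
    and act_\<tau>'0: "\<forall>U. op U \<longrightarrow> (\<forall>b\<in>BB U. \<forall>k\<in>carrier (sec K U). \<forall>l\<in>carrier (sec L U).
         act N' U b (\<tau>' U k l) = \<tau>' U (act K U b k) l \<oplus>\<^bsub>sec N' U\<^esub> \<tau>' U k (act L U b l))"
    using t' unfolding bmodule_tensor_def by (elim exE conjE)
  note act_\<tau>' = act_\<tau>'0[rule_format]
  have \<tau>': "omodule_bilinear M P K L N' \<tau>'" using tp' by (simp add: is_tensor_product_def)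
  have tp: "is_tensor_product M P K L N \<tau>" by (rule is_tensor_productI[OF om \<tau> lg])
  obtain h where h: "omodule_hom M P N N' h" and h0: "\<forall>U k l. op U \<and> k \<in> carrier (sec K U) \<and> l \<in> carrier (sec L U) \<longrightarrow> h U (\<tau> U k l) = \<tau>' U k l"
    and "\<forall>h'. omodule_hom M P N N' h' \<and> (\<forall>U k l. op U \<and> k \<in> carrier (sec K U) \<and> l \<in> carrier (sec L U) \<longrightarrow> h' U (\<tau> U k l) = \<tau>' U k l) \<longrightarrow>
      (\<forall>U n. op U \<and> n \<in> carrier (sec N U) \<longrightarrow> h' U n = h U n)"
    by (rule tensor_factor[OF tp om' \<tau>'])
  note h\<tau> = h0[rule_format, OF conjI, OF _ conjI]
  obtain h' where h': "omodule_hom M P N' N h'" and h'0: "\<forall>U k l. op U \<and> k \<in> carrier (sec K U) \<and> l \<in> carrier (sec L U) \<longrightarrow> h' U (\<tau>' U k l) = \<tau> U k l"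
    and "\<forall>g. omodule_hom M P N' N g \<and> (\<forall>U k l. op U \<and> k \<in> carrier (sec K U) \<and> l \<in> carrier (sec L U) \<longrightarrow> g U (\<tau>' U k l) = \<tau> U k l) \<longrightarrow>
      (\<forall>U n. op U \<and> n \<in> carrier (sec N' U) \<longrightarrow> g U n = h' U n)"
    by (rule tensor_factor[OF tp' om(3) \<tau>])
  note h'\<tau> = h'0[rule_format, OF conjI, OF _ conjI]
  have left: "h' U (h U n) = n" if U: "op U" and n: "n \<in> carrier (sec N U)" for U n
  proof -
    obtain i where "omodule_hom M P N N i" "\<forall>U k l. op U \<and> k \<in> carrier (sec K U) \<and> l \<in> carrier (sec L U) \<longrightarrow> i U (\<tau> U k l) = \<tau> U k l"
      and i: "\<forall>g. omodule_hom M P N N g \<and> (\<forall>U k l. op U \<and> k \<in> carrier (sec K U) \<and> l \<in> carrier (sec L U) \<longrightarrow> g U (\<tau> U k l) = \<tau> U k l) \<longrightarrow>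
      (\<forall>U n. op U \<and> n \<in> carrier (sec N U) \<longrightarrow> g U n = i U n)"
      by (rule tensor_factor[OF tp om(3) \<tau>])
    have "h' U (h U n) = i U n"
      by (rule i[rule_format, OF conjI, OF omodule_hom_comp[OF h h'] _ conjI[OF U n]]) (simp add: h\<tau> h'\<tau>)
    moreover have "n = i U n"
      by (rule i[rule_format, OF conjI, OF omodule_hom_id _ conjI[OF U n]]) simp
    ultimately show ?thesis by simp
  qed
  have right: "h U (h' U n) = n" if U: "op U" and n: "n \<in> carrier (sec N' U)" for U n
  proof -
    obtain i where "omodule_hom M P N' N' i" "\<forall>U k l. op U \<and> k \<in> carrier (sec K U) \<and> l \<in> carrier (sec L U) \<longrightarrow> i U (\<tau>' U k l) = \<tau>' U k l"
      and i: "\<forall>g. omodule_hom M P N' N' g \<and> (\<forall>U k l. op U \<and> k \<in> carrier (sec K U) \<and> l \<in> carrier (sec L U) \<longrightarrow> g U (\<tau>' U k l) = \<tau>' U k l) \<longrightarrow>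
      (\<forall>U n. op U \<and> n \<in> carrier (sec N' U) \<longrightarrow> g U n = i U n)"
      by (rule tensor_factor[OF tp' om' \<tau>'])
    have "h U (h' U n) = i U n"
      by (rule i[rule_format, OF conjI, OF omodule_hom_comp[OF h' h] _ conjI[OF U n]]) (simp add: h\<tau> h'\<tau>)
    moreover have "n = i U n"
      by (rule i[rule_format, OF conjI, OF omodule_hom_id _ conjI[OF U n]]) simp
    ultimately show ?thesis by simp
  qed
  have act: "h U (act N U b n) = act N' U b (h U n)" if U: "op U" and b: "b \<in> BB U" and n: "n \<in> carrier (sec N U)" for U b n
  proof (rule om_sep[OF om' U])
    show "h U (act N U b n) \<in> carrier (sec N' U)" by (rule hom_closed[OF h U bm_act[OF bm(3) U b n]])
    show "act N' U b (h U n) \<in> carrier (sec N' U)" by (rule bm_act[OF bm' U b hom_closed[OF h U n]])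
    fix p assume p: "p \<in> U"
    obtain W k l where W: "p \<in> W" "W \<subseteq> U" and g: "gen_pair K L N \<tau> W k l" by (rule locally_gen_cover[OF om \<tau> lg U p])
    have o: "op W" and gk: "generator K W k" and gl: "generator L W l" and gt: "generator N W (\<tau> W k l)"
      using g by (auto simp: gen_pair_def)
    note k = generator_closed[OF gk] and l = generator_closed[OF gl] and t = generator_closed[OF gt]
    define b' where "b' = res B U W b"
    have b': "b' \<in> BB W" unfolding b'_def by (rule BB_res[OF U o W(2) b])
    define c where "c = coef N W (\<tau> W k l) (res N U W n)"
    have nW: "res N U W n \<in> carrier (sec N W)" by (rule om_res[OF om(3) U o W(2) n])
    have c: "c \<in> OX W" "res N U W n = c \<odot>\<^bsub>sec N W\<^esub> \<tau> W k l"
      using coef_closed[OF om(3) o gt nW] coef_smult[OF om(3) o gt nW] by (auto simp: c_def)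
    have ht: "h W (\<tau> W k l) = \<tau>' W k l" by (rule h\<tau>[OF o k l])
    have t': "\<tau>' W k l \<in> carrier (sec N' W)" by (rule bil_closed[OF \<tau>' o k l])
    note ak = bm_act[OF bm(1) o b' k] and al = bm_act[OF bm(2) o b' l]
    \<comment> \<open>Compatibility on the product of the two local generators; the Leibniz rule
      extends it to the multiple by \<open>c\<close>.\<close>
    have hact: "h W (act N W b' (\<tau> W k l)) = act N' W b' (\<tau>' W k l)"
      unfolding act_\<tau>[OF o b' k l] act_\<tau>'[OF o b' k l]
        hom_add[OF h o bil_closed[OF \<tau> o ak l] bil_closed[OF \<tau> o k al]] h\<tau>[OF o ak l] h\<tau>[OF o k al] ..
    note dt = om_smult[OF om(3) o DD_closed[OF o b' c(1)] t] and at = bm_act[OF bm(3) o b' t]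
    have "res N' U W (h U (act N U b n)) = h W (act N W b' (c \<odot>\<^bsub>sec N W\<^esub> \<tau> W k l))"
      unfolding hom_res[OF h U bm_act[OF bm(3) U b n] o W(2), symmetric] bm_res[OF bm(3) U b n o W(2), symmetric] c(2) b'_def ..
    also have "\<dots> = DD W b' c \<odot>\<^bsub>sec N' W\<^esub> \<tau>' W k l \<oplus>\<^bsub>sec N' W\<^esub> c \<odot>\<^bsub>sec N' W\<^esub> act N' W b' (\<tau>' W k l)"
      unfolding bm_leibniz[OF bm(3) o b' t c(1)] hom_add[OF h o dt om_smult[OF om(3) o c(1) at]]
        hom_smult[OF h o t DD_closed[OF o b' c(1)]] hom_smult[OF h o at c(1)] ht hact ..
    also have "\<dots> = act N' W b' (h W (res N U W n))"
      unfolding c(2) hom_smult[OF h o t c(1)] ht bm_leibniz[OF bm' o b' t' c(1)] ..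
    also have "\<dots> = res N' U W (act N' U b (h U n))"
      unfolding hom_res[OF h U n o W(2)] b'_def by (rule bm_res[OF bm' U b hom_closed[OF h U n] o W(2)])
    finally show "\<exists>V. op V \<and> p \<in> V \<and> V \<subseteq> U \<and> res N' U V (h U (act N U b n)) = res N' U V (act N' U b (h U n))"
      using o W by blast
  qed
  have "bm_iso N N' h"
    unfolding bm_iso_def
  proof (intro allI impI conjI ballI, goal_cases)
    case (1 U)
    show ?case
      by (rule bij_betw_byWitness[of _ "h' U"]) (auto simp: left[OF 1] right[OF 1] hom_closed[OF h 1] hom_closed[OF h' 1])
  qed (auto simp: hom_add[OF h] hom_smult[OF h] hom_res[OF h] act)
  then show ?thesis by (auto simp: bmodule_isomorphic_iff)
qed

subsection \<open>Products of atlases\<close>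

text \<open>Asks for the product charts among those of \<open>A''\<close>, with equalities confined
  to the overlap: outside it the representing functions and forms carry no information.\<close>

definition atlas_prod where
  "atlas_prod A A' A'' \<longleftrightarrow> (\<forall>(V, \<gamma>, \<alpha>)\<in>A. \<forall>(V', \<gamma>', \<alpha>')\<in>A'. \<exists>\<gamma>'' \<alpha>''. (V \<inter> V', \<gamma>'', \<alpha>'') \<in> A'' \<and>
     (\<forall>x\<in>V \<inter> V'. \<gamma>'' x = \<gamma> x * \<gamma>' x) \<and>
     (\<forall>W b. op W \<and> W \<subseteq> V \<inter> V' \<and> b \<in> BB W \<longrightarrow> \<alpha>'' W b = (\<lambda>x. \<alpha> W b x + \<alpha>' W b x)))"

text \<open>For modules of atlases the product is pointwise multiplication, as
  \<open>1 / \<gamma>\<close> times \<open>1 / \<gamma>'\<close> is the generator of the product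
  chart. \<open>K\<close>, \<open>L\<close> and \<open>N\<close> are merely isomorphic to such
  modules, so the multiplication is conjugated with the isomorphisms.\<close>

lemma atlas_tensor:
  fixes K L N :: "('x, 'b, 'm) bmod"
  assumes at: "atlas A" "atlas A'" "atlas A''" and pr: "atlas_prod A A' A''"
    and bm: "bmodule M P B K" "bmodule M P B L" "bmodule M P B N"
    and iso: "bmodule_isomorphic M P B (L_mod A) K" "bmodule_isomorphic M P B (L_mod A') L" "bmodule_isomorphic M P B (L_mod A'') N"
  obtains \<tau> where "omodule_bilinear M P K L N \<tau>" "locally_gen K L N \<tau>"
    "\<And>U b k l. \<lbrakk>op U; b \<in> BB U; k \<in> carrier (sec K U); l \<in> carrier (sec L U)\<rbrakk> \<Longrightarrow>
      act N U b (\<tau> U k l) = \<tau> U (act K U b k) l \<oplus>\<^bsub>sec N U\<^esub> \<tau> U k (act L U b l)"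
proof -
  interpret A: atlas_space M P B A by unfold_locales (rule at)
  interpret A': atlas_space M P B A' by unfold_locales (rule at)
  interpret A'': atlas_space M P B A'' by unfold_locales (rule at)
  have chart3: "\<exists>V \<gamma> \<alpha> V' \<gamma>' \<alpha>' \<gamma>'' \<alpha>''. (V, \<gamma>, \<alpha>) \<in> A \<and> (V', \<gamma>', \<alpha>') \<in> A' \<and> (V \<inter> V', \<gamma>'', \<alpha>'') \<in> A'' \<and> p \<in> V \<inter> V' \<and>
     (\<forall>x\<in>V \<inter> V'. \<gamma>'' x = \<gamma> x * \<gamma>' x) \<and>
     (\<forall>W b. op W \<and> W \<subseteq> V \<inter> V' \<and> b \<in> BB W \<longrightarrow> \<alpha>'' W b = (\<lambda>x. \<alpha> W b x + \<alpha>' W b x))"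
    if U: "op U" and p: "p \<in> U" for U p
  proof -
    obtain V \<gamma> \<alpha> where c: "(V, \<gamma>, \<alpha>) \<in> A" "p \<in> V" by (rule A.chart_ex[OF U p])
    obtain V' \<gamma>' \<alpha>' where c': "(V', \<gamma>', \<alpha>') \<in> A'" "p \<in> V'" by (rule A'.chart_ex[OF U p])
    from bspec[OF bspec[OF pr[unfolded atlas_prod_def] c(1), unfolded prod.case] c'(1), unfolded prod.case]
    obtain \<gamma>'' \<alpha>'' where "(V \<inter> V', \<gamma>'', \<alpha>'') \<in> A''" "\<forall>x\<in>V \<inter> V'. \<gamma>'' x = \<gamma> x * \<gamma>' x"
      "\<forall>W b. op W \<and> W \<subseteq> V \<inter> V' \<and> b \<in> BB W \<longrightarrow> \<alpha>'' W b = (\<lambda>x. \<alpha> W b x + \<alpha>' W b x)" by (elim exE conjE)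
    with c c' show ?thesis
      by (intro exI[of _ V] exI[of _ \<gamma>] exI[of _ \<alpha>] exI[of _ V'] exI[of _ \<gamma>'] exI[of _ \<alpha>'] exI[of _ \<gamma>''] exI[of _ \<alpha>''] conjI IntI)
  qed
  have prod_closed: "(\<lambda>x. s x * t x) \<in> L_sec A'' U" if U: "op U" and s: "s \<in> L_sec A U" and t: "t \<in> L_sec A' U" for U s t
  proof (rule A''.L_secI[OF U])
    fix p assume p: "p \<in> U"
    obtain V \<gamma> \<alpha> V' \<gamma>' \<alpha>' \<gamma>'' \<alpha>'' where c: "(V, \<gamma>, \<alpha>) \<in> A" "(V', \<gamma>', \<alpha>') \<in> A'" "(V \<inter> V', \<gamma>'', \<alpha>'') \<in> A''" "p \<in> V \<inter> V'"
      "\<forall>x\<in>V \<inter> V'. \<gamma>'' x = \<gamma> x * \<gamma>' x" using chart3[OF U p] by (elim exE conjE)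
    define W where "W = U \<inter> (V \<inter> V')"
    have W: "op W" "W \<subseteq> U" "W \<subseteq> V" "W \<subseteq> V'" "p \<in> W" "W \<subseteq> U \<inter> (V \<inter> V')" using U A''.chart_op[OF c(3)] p c(4) by (auto simp: W_def)
    have "cut W (\<lambda>x. \<gamma>'' x * (s x * t x)) = (\<lambda>x. cut W (\<lambda>x. \<gamma> x * s x) x * cut W (\<lambda>x. \<gamma>' x * t x) x)"
      using c(5) W by (auto simp: cut_def fun_eq_iff)
    then have "cut W (\<lambda>x. \<gamma>'' x * (s x * t x)) \<in> OX W"
      using OX_mult[OF W(1) A.L_sec_chart[OF s c(1) U W(1-3)] A'.L_sec_chart[OF t c(2) U W(1,2,4)]] by simp
    then show "\<exists>V \<gamma> \<alpha> W. (V, \<gamma>, \<alpha>) \<in> A'' \<and> op W \<and> p \<in> W \<and> W \<subseteq> U \<inter> V \<and> cut W (\<lambda>x. \<gamma> x * (s x * t x)) \<in> OX W"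
      using c(3) W by (intro exI[of _ "V \<inter> V'"] exI[of _ \<gamma>''] exI[of _ \<alpha>''] exI[of _ W]) auto
  qed (use A.L_sec_off[OF s] in simp)
  \<comment> \<open>The product rule for derivatives and the additivity of the connection forms
    combine to the rule for the action on a tensor product.\<close>
  have prod_act: "L_act A'' U b (\<lambda>x. s x * t x) = (\<lambda>x. L_act A U b s x * t x + s x * L_act A' U b t x)"
    if U: "op U" and b: "b \<in> BB U" and s: "s \<in> L_sec A U" and t: "t \<in> L_sec A' U" for U b s t
  proof
    fix x show "L_act A'' U b (\<lambda>x. s x * t x) x = L_act A U b s x * t x + s x * L_act A' U b t x"
    proof (cases "x \<in> U")
      case True
      obtain V \<gamma> \<alpha> V' \<gamma>' \<alpha>' \<gamma>'' \<alpha>'' where c: "(V, \<gamma>, \<alpha>) \<in> A" "(V', \<gamma>', \<alpha>') \<in> A'" "(V \<inter> V', \<gamma>'', \<alpha>'') \<in> A''" "x \<in> V \<inter> V'"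
        "\<forall>x\<in>V \<inter> V'. \<gamma>'' x = \<gamma> x * \<gamma>' x"
        "\<forall>W b. op W \<and> W \<subseteq> V \<inter> V' \<and> b \<in> BB W \<longrightarrow> \<alpha>'' W b = (\<lambda>x. \<alpha> W b x + \<alpha>' W b x)"
        using chart3[OF U True] by (elim exE conjE)
      define W where "W = U \<inter> (V \<inter> V')"
      have W: "op W" "W \<subseteq> U" "W \<subseteq> V" "W \<subseteq> V'" "x \<in> W" "W \<subseteq> V \<inter> V'" using U A''.chart_op[OF c(3)] True c(4) by (auto simp: W_def)
      define b' where "b' = res B U W b"
      have b': "b' \<in> BB W" unfolding b'_def by (rule BB_res[OF U W(1,2) b])
      define f g where "f = cut W (\<lambda>x. \<gamma> x * s x)" and "g = cut W (\<lambda>x. \<gamma>' x * t x)"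
      have f: "f \<in> OX W" unfolding f_def by (rule A.L_sec_chart[OF s c(1) U W(1-3)])
      have g: "g \<in> OX W" unfolding g_def by (rule A'.L_sec_chart[OF t c(2) U W(1,2,4)])
      have e: "cut W (\<lambda>x. \<gamma>'' x * (s x * t x)) = (\<lambda>x. f x * g x)"
        using c(5) W by (auto simp: cut_def fun_eq_iff f_def g_def)
      have v: "f x = \<gamma> x * s x" "g x = \<gamma>' x * t x" "\<gamma>'' x = \<gamma> x * \<gamma>' x" "\<gamma> x \<noteq> 0" "\<gamma>' x \<noteq> 0"
        using W c(5) A.chart_nz[OF c(1)] A'.chart_nz[OF c(2)] by (auto simp: f_def g_def cut_def)
      have a: "\<alpha>'' W b' x = \<alpha> W b' x + \<alpha>' W b' x" using c(6) W b' by simp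
      show ?thesis
        unfolding A''.L_act_eq[OF c(3) U W(1,2,6) b prod_closed[OF U s t] W(5)] A.L_act_eq[OF c(1) U W(1-3) b s W(5)]
          A'.L_act_eq[OF c(2) U W(1,2,4) b t W(5)] chart_act_def b'_def[symmetric] e f_def[symmetric] g_def[symmetric]
          DD_mult[OF W(1) b' f g] a v
        using v(4,5) by (simp add: field_simps)
    qed (simp add: A.L_act_off A'.L_act_off A''.L_act_off)
  qed
  obtain \<psi>K \<psi>L \<psi> where \<psi>K: "bm_iso (L_mod A) K \<psi>K" and \<psi>L: "bm_iso (L_mod A') L \<psi>L" and \<psi>: "bm_iso (L_mod A'') N \<psi>"
    using iso by (auto simp: bmodule_isomorphic_iff)
  define \<phi>K \<phi>L where "\<phi>K U = inv_into (L_sec A U) (\<psi>K U)" and "\<phi>L U = inv_into (L_sec A' U) (\<psi>L U)" for U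
  have \<phi>K: "bm_iso K (L_mod A) \<phi>K" using bm_iso_sym[OF A.L_bmodule \<psi>K] by (simp add: \<phi>K_def[abs_def])
  have \<phi>L: "bm_iso L (L_mod A') \<phi>L" using bm_iso_sym[OF A'.L_bmodule \<psi>L] by (simp add: \<phi>L_def[abs_def])
  note cl = bm_iso_closed[OF \<phi>K, simplified] bm_iso_closed[OF \<phi>L, simplified] prod_closed
  define \<tau> where "\<tau> U k l = \<psi> U (\<lambda>x. \<phi>K U k x * \<phi>L U l x)" for U k l
  have bil: "omodule_bilinear M P K L N \<tau>"
    unfolding omodule_bilinear_def \<tau>_def
  proof (intro allI impI ballI conjI, goal_cases)
    case (1 U k l)
    then show ?case using bm_iso_closed[OF \<psi>] cl by simp
  next
    case (2 U k l k')
    then show ?case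
      using bm_iso_add[OF \<psi> 2(1), of "\<lambda>x. \<phi>K U k x * \<phi>L U l x" "\<lambda>x. \<phi>K U k' x * \<phi>L U l x"] cl
      by (simp add: bm_iso_add[OF \<phi>K] algebra_simps)
  next
    case (3 U k l l')
    then show ?case
      using bm_iso_add[OF \<psi> 3(1), of "\<lambda>x. \<phi>K U k x * \<phi>L U l x" "\<lambda>x. \<phi>K U k x * \<phi>L U l' x"] cl
      by (simp add: bm_iso_add[OF \<phi>L] algebra_simps)
  next
    case (4 U k l f)
    then show ?case
      using bm_iso_smult[OF \<psi> 4(1), of "\<lambda>x. \<phi>K U k x * \<phi>L U l x" f] cl
      by (simp add: bm_iso_smult[OF \<phi>K] algebra_simps)
  next
    case (5 U k l f)
    then show ?case
      using bm_iso_smult[OF \<psi> 5(1), of "\<lambda>x. \<phi>K U k x * \<phi>L U l x" f] cl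
      by (simp add: bm_iso_smult[OF \<phi>L] algebra_simps)
  next
    case (6 U k l V)
    then have V: "op V" "V \<subseteq> U" by auto
    have "(\<lambda>x. cut V (\<phi>K U k) x * cut V (\<phi>L U l) x) = cut V (\<lambda>x. \<phi>K U k x * \<phi>L U l x)" by (auto simp: cut_def)
    then show ?case
      using bm_iso_res[OF \<psi> 6(1) _ V, of "\<lambda>x. \<phi>K U k x * \<phi>L U l x"] cl 6
      by (simp add: bm_iso_res[OF \<phi>K 6(1) 6(2) V] bm_iso_res[OF \<phi>L 6(1) 6(3) V])
  qed
  have lg: "locally_gen K L N \<tau>"
    unfolding locally_gen_def gen_pair_def
  proof
    fix p assume p: "p \<in> topspace (mtop M)"
    obtain V \<gamma> \<alpha> V' \<gamma>' \<alpha>' \<gamma>'' \<alpha>'' where c: "(V, \<gamma>, \<alpha>) \<in> A" "(V', \<gamma>', \<alpha>') \<in> A'" "(V \<inter> V', \<gamma>'', \<alpha>'') \<in> A''" "p \<in> V \<inter> V'"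
      "\<forall>x\<in>V \<inter> V'. \<gamma>'' x = \<gamma> x * \<gamma>' x" using chart3[OF openin_topspace p] by (elim exE conjE)
    define W where "W = V \<inter> V'"
    have W: "op W" "W \<subseteq> V" "W \<subseteq> V'" using A''.chart_op[OF c(3)] by (auto simp: W_def)
    define s t where "s = cut W (A.chart_gen V \<gamma>)" and "t = cut W (A'.chart_gen V' \<gamma>')"
    have s: "generator (L_mod A) W s"
      using generator_res[OF A.L_omodule A.chart_op[OF c(1)] W(1,2) A.chart_generator[OF c(1)]] by (simp add: s_def)
    have t: "generator (L_mod A') W t"
      using generator_res[OF A'.L_omodule A'.chart_op[OF c(2)] W(1,3) A'.chart_generator[OF c(2)]] by (simp add: t_def)
    have st: "(\<lambda>x. s x * t x) = A''.chart_gen W \<gamma>''"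
      using c(5) unfolding s_def t_def A.chart_gen_def A'.chart_gen_def A''.chart_gen_def by (auto simp: cut_def W_def fun_eq_iff)
    have i: "\<phi>K W (\<psi>K W s) = s" "\<phi>L W (\<psi>L W t) = t"
      unfolding \<phi>K_def \<phi>L_def
      using bm_iso_bij[OF \<psi>K W(1)] bm_iso_bij[OF \<psi>L W(1)] generator_closed[OF s] generator_closed[OF t]
      by (simp_all add: bij_betw_def)
    have "generator K W (\<psi>K W s)" "generator L W (\<psi>L W t)" "generator N W (\<tau> W (\<psi>K W s) (\<psi>L W t))"
      unfolding \<tau>_def i st
      by (rule generator_iso[OF A.L_bmodule \<psi>K W(1) s] generator_iso[OF A'.L_bmodule \<psi>L W(1) t]
          generator_iso[OF A''.L_bmodule \<psi> W(1) A''.chart_generator[OF c(3), folded W_def]])+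
    then show "\<exists>W k l. p \<in> W \<and> op W \<and> generator K W k \<and> generator L W l \<and> generator N W (\<tau> W k l)"
      using W(1) c(4) unfolding W_def[symmetric] by blast
  qed
  have act: "act N U b (\<tau> U k l) = \<tau> U (act K U b k) l \<oplus>\<^bsub>sec N U\<^esub> \<tau> U k (act L U b l)"
    if U: "op U" and b: "b \<in> BB U" and k: "k \<in> carrier (sec K U)" and l: "l \<in> carrier (sec L U)" for U b k l
  proof -
    have s: "\<phi>K U k \<in> L_sec A U" and t: "\<phi>L U l \<in> L_sec A' U" using cl U k l by auto
    have "act N U b (\<tau> U k l) = \<psi> U (L_act A'' U b (\<lambda>x. \<phi>K U k x * \<phi>L U l x))"
      using bm_iso_act[OF \<psi> U _ b, of "\<lambda>x. \<phi>K U k x * \<phi>L U l x"] prod_closed[OF U s t] by (simp add: \<tau>_def)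
    also have "\<dots> = \<psi> U (\<lambda>x. L_act A U b (\<phi>K U k) x * \<phi>L U l x) \<oplus>\<^bsub>sec N U\<^esub> \<psi> U (\<lambda>x. \<phi>K U k x * L_act A' U b (\<phi>L U l) x)"
      unfolding prod_act[OF U b s t]
      using bm_iso_add[OF \<psi> U, simplified, OF prod_closed[OF U A.L_act_closed[OF U b s] t] prod_closed[OF U s A'.L_act_closed[OF U b t]]] .
    finally show ?thesis
      unfolding \<tau>_def bm_iso_act[OF \<phi>K U k b] bm_iso_act[OF \<phi>L U l b] by simp
  qed
  show thesis by (rule that[OF bil lg act])
qed

end

section \<open>From hypercohomology to modules\<close>

context lie_algebroid_space
begin

section \<open>The atlas and the module of a cocycle\<close>

interpretation D: ab_presheaf_hom "mtop M" FF GG dlog by (rule dlog_hom)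

abbreviation "XX \<equiv> topspace (mtop M)"
abbreviation "stalkF p \<equiv> stalk (mtop M) FF p"
abbreviation "germF p \<equiv> germ (mtop M) FF p"
abbreviation "gd0F U \<equiv> carrier (sgrp (gd0 (mtop M) FF) U)"
abbreviation "triv \<equiv> local_trivialisation (mtop M) FF GG dlog"
abbreviation "ZZ \<equiv> hyper_Z (mtop M) FF GG dlog"

text \<open>The value at \<open>p\<close> of a germ of functions; any representative may be
  evaluated, see \<open>gval_germ\<close>.\<close>

definition gval :: "'x \<Rightarrow> ('x set \<times> 'x cfun) set \<Rightarrow> complex" where
  "gval p \<sigma> = snd (SOME c. c \<in> \<sigma>) p"

lemma gval_germ:
  assumes "op U" "p \<in> U" "s \<in> Fx U"
  shows "gval p (germF p U s) = s p"
proof -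
  have "(SOME c. c \<in> germF p U s) \<in> germF p U s"
    using D.F.germ_self[OF assms] by (rule someI)
  then obtain V t where c: "(SOME c. c \<in> germF p U s) = (V, t)" "(V, t) \<in> germF p U s" by (metis surj_pair)
  then obtain W where "p \<in> W" "cut W s = cut W t" by (auto simp: germ_def)
  then have "s p = t p" by (metis cut_def)
  then show ?thesis by (simp add: gval_def c(1))
qed

lemma gval_mult:
  assumes "\<sigma> \<in> carrier (stalkF p)" "\<tau> \<in> carrier (stalkF p)"
  shows "gval p (\<sigma> \<otimes>\<^bsub>stalkF p\<^esub> \<tau>) = gval p \<sigma> * gval p \<tau>"
proof -
  obtain U s t where U: "op U" "p \<in> U" and s: "s \<in> Fx U" and t: "t \<in> Fx U" and e: "\<sigma> = germF p U s" "\<tau> = germF p U t"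
    by (rule D.F.stalk_common[OF assms])
  show ?thesis
    using D.F.mult_closed[OF U(1) s t] unfolding e D.F.stalk_mult_same[OF U s t] by (simp add: gval_germ[OF U] s t)
qed

lemma gval_nz:
  assumes "\<sigma> \<in> carrier (stalkF p)" shows "gval p \<sigma> \<noteq> 0"
proof -
  obtain U s where "op U" "p \<in> U" "s \<in> Fx U" "\<sigma> = germF p U s" by (rule D.F.stalkE[OF assms])
  then show ?thesis by (simp add: gval_germ) (simp add: Fx_iff)
qed

definition zatlas where
  "zatlas z = {(V, \<lambda>x. gval x (u x), \<alpha>) | V u \<alpha>. triv z V u \<alpha>}"

lemma triv_op: "triv z V u \<alpha> \<Longrightarrow> op V"
  and triv_mem: "\<lbrakk>triv z V u \<alpha>; x \<in> V\<rbrakk> \<Longrightarrow> u x \<in> carrier (stalkF x)"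
  and triv_form: "triv z V u \<alpha> \<Longrightarrow> \<alpha> \<in> Gx V"
  by (auto simp: local_trivialisation_def D.F.godement_carrier)

text \<open>Two trivialisations differ near each point by a unit \<open>h\<close> and its
  logarithmic differential. Taking values of germs is multiplicative and turns the relation between
  the cochains into \<open>\<gamma>' = h * \<gamma>\<close>.\<close>

lemma atlas_zatlas:
  assumes z: "z \<in> ZZ"
  shows "atlas (zatlas z)"
  unfolding atlas_def
proof (intro conjI ballI)
  fix c assume "c \<in> zatlas z"
  then obtain V u \<alpha> where c: "c = (V, \<lambda>x. gval x (u x), \<alpha>)" "triv z V u \<alpha>" by (auto simp: zatlas_def)
  then show "case c of (V, \<gamma>, \<alpha>) \<Rightarrow> op V \<and> (\<forall>x\<in>V. \<gamma> x \<noteq> 0) \<and> \<alpha> \<in> Gx V"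
    using triv_op[OF c(2)] triv_form[OF c(2)] gval_nz[OF triv_mem[OF c(2)]] by simp
  have "case c' of (V', \<gamma>', \<alpha>') \<Rightarrow> \<forall>p\<in>V \<inter> V'. \<exists>W h. op W \<and> p \<in> W \<and> W \<subseteq> V \<inter> V' \<and> h \<in> Fx W \<and>
        (\<forall>x\<in>W. \<gamma>' x = h x * gval x (u x)) \<and>
        (\<forall>W' b. op W' \<and> W' \<subseteq> W \<and> b \<in> BB W' \<longrightarrow> \<alpha> W' b = (\<lambda>x. \<alpha>' W' b x + dlog W h W' b x))"
    if "c' \<in> zatlas z" for c'
  proof -
    from that obtain V' u' \<alpha>' where c': "c' = (V', \<lambda>x. gval x (u' x), \<alpha>')" "triv z V' u' \<alpha>'" by (auto simp: zatlas_def)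
    have ex: "\<exists>W h. op W \<and> p \<in> W \<and> W \<subseteq> V \<inter> V' \<and> h \<in> Fx W \<and> (\<forall>x\<in>W. gval x (u' x) = h x * gval x (u x)) \<and>
          (\<forall>W' b. op W' \<and> W' \<subseteq> W \<and> b \<in> BB W' \<longrightarrow> \<alpha> W' b = (\<lambda>x. \<alpha>' W' b x + dlog W h W' b x))" if p: "p \<in> V \<inter> V'" for p
    proof -
      have o: "op (V \<inter> V')" using triv_op[OF c(2)] triv_op[OF c'(2)] by blast
      obtain W h where W: "op W" "p \<in> W" "W \<subseteq> V \<inter> V'" and h: "h \<in> Fx W"
        and hu: "\<And>q. q \<in> W \<Longrightarrow> restrict u' (V \<inter> V') q = germF q W h \<otimes>\<^bsub>stalkF q\<^esub> restrict u (V \<inter> V') q"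
        and h\<alpha>: "sres GG (V \<inter> V') W (sres GG V (V \<inter> V') \<alpha>) = sres GG (V \<inter> V') W (sres GG V' (V \<inter> V') \<alpha>') \<otimes>\<^bsub>sgrp GG W\<^esub> dlog W h"
        by (rule D.local_trivialisation_compare[OF D.local_trivialisation_res[OF c(2) o Int_lower1]
              D.local_trivialisation_res[OF c'(2) o Int_lower2] p])
           (rule that, assumption, assumption, assumption, assumption, simp, assumption)
      have "gval x (u' x) = h x * gval x (u x)" if x: "x \<in> W" for x
      proof -
        have "x \<in> V \<inter> V'" using x W(3) by blast
        then have "u' x = germF x W h \<otimes>\<^bsub>stalkF x\<^esub> u x" using hu[OF x] by simp
        moreover have "u x \<in> carrier (stalkF x)" using triv_mem[OF c(2)] x W(3) by blast
        ultimately show ?thesis using gval_mult D.F.germ_closed[OF W(1) x h] gval_germ[OF W(1) x h] by simp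
      qed
      moreover have "\<alpha> W' b = (\<lambda>x. \<alpha>' W' b x + dlog W h W' b x)" if "W' \<subseteq> W" for W' b
      proof -
        have "W' \<subseteq> V \<inter> V'" using that W(3) by blast
        then show ?thesis using fun_cong[OF fun_cong[OF h\<alpha>, of W'], of b] that by simp
      qed
      ultimately show ?thesis using W h by blast
    qed
    then show ?thesis unfolding c'(1) prod.case by blast
  qed
  then show "case c of (V, \<gamma>, \<alpha>) \<Rightarrow> \<forall>(V', \<gamma>', \<alpha>')\<in>zatlas z. \<forall>p\<in>V \<inter> V'. \<exists>W h. op W \<and> p \<in> W \<and> W \<subseteq> V \<inter> V' \<and> h \<in> Fx W \<and>
        (\<forall>x\<in>W. \<gamma>' x = h x * \<gamma> x) \<and>
        (\<forall>W' b. op W' \<and> W' \<subseteq> W \<and> b \<in> BB W' \<longrightarrow> \<alpha> W' b = (\<lambda>x. \<alpha>' W' b x + dlog W h W' b x))"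
    unfolding c(1) prod.case by (rule ballI)
next
  fix p assume p: "p \<in> XX"
  obtain V u \<alpha> where "p \<in> V" "triv z V u \<alpha>"
    using z p D.hyper_Z_iff[of "fst z" "snd z"] by auto
  then show "\<exists>(V, \<gamma>, \<alpha>)\<in>zatlas z. p \<in> V" by (force simp: zatlas_def)
qed

lemma zatlas_prod:
  "atlas_prod (zatlas z) (zatlas z') (zatlas (z \<otimes>\<^bsub>hyper_T1 (mtop M) FF GG\<^esub> z'))"
  unfolding atlas_prod_def Ball_def split_paired_All prod.case
proof (intro allI impI)
  fix V \<gamma> \<alpha> V' \<gamma>' \<alpha>' assume "(V, \<gamma>, \<alpha>) \<in> zatlas z" "(V', \<gamma>', \<alpha>') \<in> zatlas z'"
  then obtain u u' where c: "\<gamma> = (\<lambda>x. gval x (u x))" "triv z V u \<alpha>"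
    and c': "\<gamma>' = (\<lambda>x. gval x (u' x))" "triv z' V' u' \<alpha>'" by (auto simp: zatlas_def)
  define W where "W = V \<inter> V'"
  have W: "op W" "W \<subseteq> V" "W \<subseteq> V'" using triv_op[OF c(2)] triv_op[OF c'(2)] by (auto simp: W_def)
  define u'' \<alpha>'' where "u'' = restrict u W \<otimes>\<^bsub>sgrp (gd0 (mtop M) FF) W\<^esub> restrict u' W"
    and "\<alpha>'' = sres GG V W \<alpha> \<otimes>\<^bsub>sgrp GG W\<^esub> sres GG V' W \<alpha>'"
  have t: "triv (z \<otimes>\<^bsub>hyper_T1 (mtop M) FF GG\<^esub> z') W u'' \<alpha>''"
    unfolding u''_def \<alpha>''_def
    by (rule D.local_trivialisation_mult[OF D.local_trivialisation_res[OF c(2) W(1,2)] D.local_trivialisation_res[OF c'(2) W(1,3)]])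
  have "gval x (u'' x) = gval x (u x) * gval x (u' x)" if x: "x \<in> W" for x
  proof -
    have "u'' x = u x \<otimes>\<^bsub>stalkF x\<^esub> u' x" using x by (simp add: u''_def godement_def)
    moreover have "u x \<in> carrier (stalkF x)" "u' x \<in> carrier (stalkF x)"
      using triv_mem[OF c(2)] triv_mem[OF c'(2)] x W by auto
    ultimately show ?thesis by (simp add: gval_mult)
  qed
  moreover have "\<alpha>'' W' b = (\<lambda>x. \<alpha> W' b x + \<alpha>' W' b x)" if "W' \<subseteq> W" for W' b
    using that by (simp add: \<alpha>''_def)
  moreover have "(W, \<lambda>x. gval x (u'' x), \<alpha>'') \<in> zatlas (z \<otimes>\<^bsub>hyper_T1 (mtop M) FF GG\<^esub> z')"
    using t by (auto simp: zatlas_def)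
  ultimately show "\<exists>\<gamma>'' \<alpha>''. (V \<inter> V', \<gamma>'', \<alpha>'') \<in> zatlas (z \<otimes>\<^bsub>hyper_T1 (mtop M) FF GG\<^esub> z') \<and>
     (\<forall>x. x \<in> V \<inter> V' \<longrightarrow> \<gamma>'' x = \<gamma> x * \<gamma>' x) \<and>
     (\<forall>W b. op W \<and> W \<subseteq> V \<inter> V' \<and> b \<in> BB W \<longrightarrow> \<alpha>'' W b = (\<lambda>x. \<alpha> W b x + \<alpha>' W b x))"
    unfolding c(1) c'(1) W_def[symmetric]
    by (intro exI[of _ "\<lambda>x. gval x (u'' x)"] exI[of _ \<alpha>'']) auto
qed

abbreviation "Lz z \<equiv> L_mod (zatlas z)"

lemma Lz:
  assumes "z \<in> ZZ" shows Lz_bmodule: "bmodule M P B (Lz z)" and Lz_invertible: "invertible_bmodule M P B (Lz z)"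
proof -
  interpret atlas_space M P B "zatlas z" by unfold_locales (rule atlas_zatlas[OF assms])
  show "bmodule M P B (Lz z)" by (rule L_bmodule)
  show "invertible_bmodule M P B (Lz z)" by (rule L_invertible)
qed

subsection \<open>Every invertible module comes from a cocycle\<close>

text \<open>The one-form by which \<open>B\<close> acts on the generator \<open>e\<close>,
  normalised to zero where it has no meaning so that it can be a section of the presheaf of closed
  forms.\<close>

definition conn :: "('x, 'b, 'm) bmod \<Rightarrow> 'x set \<Rightarrow> 'm \<Rightarrow> 'x set \<Rightarrow> 'b \<Rightarrow> 'x cfun" where
  "conn L U e V b = (if op V \<and> V \<subseteq> U \<and> b \<in> BB V then coef L V (res L U V e) (act L V b (res L U V e)) else (\<lambda>_. 0))"

lemma conn_eq:
  assumes L: "bmodule M P B L" and U: "op U" and e: "generator L U e" and V: "op V" "V \<subseteq> U" and b: "b \<in> BB V"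
  shows "conn L U e V b \<in> OX V" "act L V b (res L U V e) = conn L U e V b \<odot>\<^bsub>sec L V\<^esub> res L U V e"
proof -
  note g = generator_res[OF bm_om[OF L] U V e]
  note a = bm_act[OF L V(1) b generator_closed[OF g]]
  show "conn L U e V b \<in> OX V" "act L V b (res L U V e) = conn L U e V b \<odot>\<^bsub>sec L V\<^esub> res L U V e"
    using coef_closed[OF bm_om[OF L] V(1) g a] coef_smult[OF bm_om[OF L] V(1) g a] V b by (simp_all add: conn_def)
qed

text \<open>Everything follows by comparing coefficients of the generator. Closedness expresses that
  the action respects brackets: in the commutator of two actions the products of values of the form
  are symmetric and cancel.\<close>

lemma conn_closed:
  assumes L: "bmodule M P B L" and U: "op U" and e: "generator L U e"
  shows "conn L U e \<in> Gx U"
  unfolding Gx_iff lin_form_def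
proof (intro conjI allI impI ballI)
  fix V b assume "\<not> (op V \<and> V \<subseteq> U \<and> b \<in> BB V)"
  then show "conn L U e V b = (\<lambda>_. 0)" by (auto simp: conn_def)
next
  fix V b assume V': "op V \<and> V \<subseteq> U" and b: "b \<in> BB V"
  then have V: "op V" "V \<subseteq> U" by auto
  note om = bm_om[OF L]
  define f where "f = res L U V e"
  have g: "generator L V f" unfolding f_def by (rule generator_res[OF om U V e])
  note fc = generator_closed[OF g]
  note cl = conn_eq(1)[OF L U e V] and ac = conn_eq(2)[OF L U e V, folded f_def]
  have uniq: "conn L U e V b = a" if b: "b \<in> BB V" and a: "a \<in> OX V" and eq: "act L V b f = a \<odot>\<^bsub>sec L V\<^esub> f" for b a
    using coef_eq[OF om V(1) g a] V b eq by (simp add: conn_def f_def)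
  show "conn L U e V b \<in> OX V" by (rule cl[OF b])
  { fix b' assume b': "b' \<in> BB V"
    show "conn L U e V (b \<oplus>\<^bsub>sec B V\<^esub> b') = (\<lambda>x. conn L U e V b x + conn L U e V b' x)"
      by (rule uniq[OF BB_add[OF V(1) b b'] OX_add[OF V(1) cl[OF b] cl[OF b']]])
         (simp add: bm_badd[OF L V(1) b fc b'] ac[OF b] ac[OF b'] om_smult_ldistr[OF om V(1) cl[OF b] cl[OF b'] fc])
    have act2: "act L V c (act L V c' f) = (\<lambda>x. DD V c (conn L U e V c') x + conn L U e V c x * conn L U e V c' x) \<odot>\<^bsub>sec L V\<^esub> f"
      if c: "c \<in> BB V" and c': "c' \<in> BB V" for c c'
    proof -
      note a = bm_act[OF L V(1) c' fc]
      have co: "coef L V f (act L V c' f) = conn L U e V c'" using V c' by (simp add: conn_def f_def)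
      show ?thesis
        using coef_smult[OF om V(1) g bm_act[OF L V(1) c a]] coef_act[OF L V(1) g a c cl[OF c] ac[OF c]] by (simp add: co)
    qed
    interpret G: abelian_group "sec L V" by (rule om_group[OF om V(1)])
    define p q where "p = (\<lambda>x. DD V b (conn L U e V b') x + conn L U e V b x * conn L U e V b' x)"
      and "q = (\<lambda>x. DD V b' (conn L U e V b) x + conn L U e V b' x * conn L U e V b x)"
    have pq: "p \<in> OX V" "q \<in> OX V" "(\<lambda>x. - q x) \<in> OX V"
      unfolding p_def q_def by (intro OX_minus OX_add OX_mult DD_closed V(1) b b' cl)+
    have "act L V (brk B V b b') f = p \<odot>\<^bsub>sec L V\<^esub> f \<ominus>\<^bsub>sec L V\<^esub> q \<odot>\<^bsub>sec L V\<^esub> f"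
      unfolding bm_brk[OF L V(1) b fc b'] act2[OF b b'] act2[OF b' b] p_def q_def ..
    also have "\<dots> = (\<lambda>x. p x + - q x) \<odot>\<^bsub>sec L V\<^esub> f"
      unfolding a_minus_def om_smult_minus[OF om V(1) pq(2) fc, symmetric]
      by (rule om_smult_ldistr[OF om V(1) pq(1,3) fc, symmetric])
    finally have "conn L U e V (brk B V b b') = (\<lambda>x. p x + - q x)"
      by (rule uniq[OF brk_closed[OF V(1) b b'] OX_add[OF V(1) pq(1,3)]])
    then show "conn L U e V (brk B V b b') = (\<lambda>x. DD V b (conn L U e V b') x - DD V b' (conn L U e V b) x)"
      by (simp add: p_def q_def mult.commute) }
  { fix h assume h: "h \<in> OX V"
    show "conn L U e V (h \<odot>\<^bsub>sec B V\<^esub> b) = (\<lambda>x. h x * conn L U e V b x)"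
      by (rule uniq[OF BB_smult[OF V(1) h b] OX_mult[OF V(1) h cl[OF b]]])
         (simp add: bm_bsmult[OF L V(1) b fc h] ac[OF b] om_smult_assoc[OF om V(1) h cl[OF b] fc]) }
  { fix W assume W': "op W \<and> W \<subseteq> V"
    then have W: "op W" "W \<subseteq> V" "W \<subseteq> U" using V by auto
    have "res L V W (act L V b f) = act L W (res B V W b) (res L U W e)"
      unfolding bm_res[OF L V(1) b fc W(1,2), symmetric] unfolding f_def om_res_res[OF om U V(1) W(1,2) V(2) generator_closed[OF e]] ..
    then have "cut W (conn L U e V b) = coef L W (res L U W e) (act L W (res B V W b) (res L U W e))"
      using coef_res[OF om V(1) W(1,2) g bm_act[OF L V(1) b fc]] om_res_res[OF om U V(1) W(1,2) V(2) generator_closed[OF e]] V b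
      by (simp add: conn_def f_def)
    then show "conn L U e W (res B V W b) = cut W (conn L U e V b)"
      using W BB_res[OF V(1) W(1,2) b] by (simp add: conn_def) }
qed

text \<open>The coefficients of two generators with respect to each other multiply to one, by
  uniqueness of coefficients.\<close>

lemma ratio_unit:
  assumes L: "omodule M P L" and U: "op U" and e: "generator L U e" "generator L U e'"
  shows "coef L U e e' \<in> Fx U"
proof -
  let ?f = "coef L U e e'" and ?g = "coef L U e' e"
  note ec = e[THEN generator_closed]
  have f: "?f \<in> OX U" "?f \<odot>\<^bsub>sec L U\<^esub> e = e'" and g: "?g \<in> OX U" "?g \<odot>\<^bsub>sec L U\<^esub> e' = e"
    using coef[OF L U e(1) ec(2)] coef[OF L U e(2) ec(1)] by auto
  have "(\<lambda>x. ?g x * ?f x) \<odot>\<^bsub>sec L U\<^esub> e = cut U (\<lambda>_. 1) \<odot>\<^bsub>sec L U\<^esub> e"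
    using om_smult_assoc[OF L U g(1) f(1) ec(1)] om_smult_one[OF L U ec(1)] f(2) g(2) by simp
  then have gf: "(\<lambda>x. ?g x * ?f x) = cut U (\<lambda>_. 1)"
    by (rule generator_unique[OF L U e(1) OX_mult[OF U g(1) f(1)] OX_const[OF U]])
  have gf': "?g x * ?f x = (if x \<in> U then 1 else 0)" for x using fun_cong[OF gf, of x] by (simp add: cut_def)
  have nz: "?f x \<noteq> 0" if "x \<in> U" for x using gf'[of x] that by (metis mult_zero_right zero_neq_one)
  have "inverse (?f x) = ?g x" for x
  proof (cases "x \<in> U")
    case True
    then show ?thesis using gf'[of x] nz[OF True] by (simp add: field_simps)
  qed (use OX_off[OF f(1)] OX_off[OF g(1)] in simp)
  then have "(\<lambda>x. inverse (?f x)) = ?g" by blast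
  then show ?thesis using f g nz by (simp add: Fx_iff[OF U])
qed

text \<open>Apply the Leibniz rule to \<open>e'\<close> as a multiple of \<open>e\<close> and
  compare coefficients: the derivative of the factor, divided by the factor, is added to the
  form.\<close>

lemma conn_change:
  assumes L: "bmodule M P B L" and U: "op U" and e: "generator L U e" "generator L U e'" and V: "op V" "V \<subseteq> U" and b: "b \<in> BB V"
  shows "conn L U e' V b = (\<lambda>x. conn L U e V b x + dlog U (coef L U e e') V b x)"
proof -
  note om = bm_om[OF L]
  define h where "h = cut V (coef L U e e')"
  define f where "f = res L U V e"
  have hF: "h \<in> Fx V" unfolding h_def using D.F.res_closed[OF U V ratio_unit[OF om U e]] by simp
  then have h: "h \<in> OX V" "(\<lambda>x. inverse (h x)) \<in> OX V" "\<And>x. x \<in> V \<Longrightarrow> h x \<noteq> 0" by (auto simp: Fx_iff[OF V(1)])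
  have fg: "generator L V f" unfolding f_def by (rule generator_res[OF om U V e(1)])
  note fc = generator_closed[OF fg]
  have "h \<odot>\<^bsub>sec L V\<^esub> f = res L U V e'"
    using om_res_smult[OF om U V coef_closed[OF om U e(1) generator_closed[OF e(2)]] generator_closed[OF e(1)]]
      coef_smult[OF om U e(1) generator_closed[OF e(2)]] by (simp add: h_def f_def)
  then have hf: "res L U V e' = h \<odot>\<^bsub>sec L V\<^esub> f" ..
  note a = conn_eq[OF L U e(1) V b, folded f_def] and a' = conn_eq[OF L U e(2) V b, unfolded hf]
  have "(\<lambda>x. conn L U e' V b x * h x) \<odot>\<^bsub>sec L V\<^esub> f = (\<lambda>x. DD V b h x + h x * conn L U e V b x) \<odot>\<^bsub>sec L V\<^esub> f"
    using a'(2) unfolding bm_leibniz[OF L V(1) b fc h(1)] a(2) om_smult_assoc[OF om V(1) h(1) a(1) fc]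
      om_smult_assoc[OF om V(1) a'(1) h(1) fc] om_smult_ldistr[OF om V(1) DD_closed[OF V(1) b h(1)] OX_mult[OF V(1) h(1) a(1)] fc]
    by simp
  then have eq: "(\<lambda>x. conn L U e' V b x * h x) = (\<lambda>x. DD V b h x + h x * conn L U e V b x)"
    by (rule generator_unique[OF om V(1) fg OX_mult[OF V(1) a'(1) h(1)]
          OX_add[OF V(1) DD_closed[OF V(1) b h(1)] OX_mult[OF V(1) h(1) a(1)]]])
  show ?thesis
  proof
    fix x show "conn L U e' V b x = conn L U e V b x + dlog U (coef L U e e') V b x"
    proof (cases "x \<in> V")
      case True
      then show ?thesis
        using fun_cong[OF eq, of x] h(3)[OF True] dlog_eq[OF V b, of "coef L U e e'"]
        by (simp add: h_def[symmetric]) (simp add: field_simps)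
    next
      case False
      then show ?thesis using OX_off[OF a(1)] OX_off[OF a'(1)] dlog_eq[OF V b, of "coef L U e e'"] by (simp add: cut_def)
    qed
  qed
qed

text \<open>A generator \<open>e p\<close> is chosen near every point \<open>p\<close>. The cochain
  near \<open>p\<close> compares \<open>e p\<close>, at each \<open>q\<close>, with the generator
  chosen for \<open>q\<close> itself. This reference jumps with \<open>q\<close>, which
  discontinuous sections allow. In the resulting module \<open>e p\<close> corresponds to
  \<open>1 / \<gamma> p\<close>.\<close>

lemma Lz_surj:
  fixes L :: "('x, 'b, 'm) bmod"
  assumes L: "invertible_bmodule M P B L"
  obtains z where "z \<in> ZZ" "bmodule_isomorphic M P B (Lz z) L"
proof -
  have bm: "bmodule M P B L" and r1: "locally_free_rank_one M P L" using L by (auto simp: invertible_bmodule_def)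
  note om = bm_om[OF bm]
  have "\<forall>p\<in>XX. \<exists>Ue. op (fst Ue) \<and> p \<in> fst Ue \<and> generator L (fst Ue) (snd Ue)"
    using r1 unfolding rank_one_iff[OF om] by simp
  then obtain Ue where Ue: "\<forall>p\<in>XX. op (fst (Ue p)) \<and> p \<in> fst (Ue p) \<and> generator L (fst (Ue p)) (snd (Ue p))" by metis
  define U e where "U p = fst (Ue p)" and "e p = snd (Ue p)" for p
  have U: "op (U p)" "p \<in> U p" and e: "generator L (U p) (e p)" if "p \<in> XX" for p
    using Ue that by (auto simp: U_def e_def)
  have UX: "q \<in> XX" if "p \<in> XX" "q \<in> U p" for p q using U(1)[OF that(1)] that(2) openin_subset by blast
  text \<open>\<open>e p = r p q W \<odot> e q\<close> over \<open>W\<close>\<close>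
  define r where "r p q W = coef L W (res L (U q) W (e q)) (res L (U p) W (e p))" for p q W
  have eW: "generator L W (res L (U p) W (e p))" if "p \<in> XX" "op W" "W \<subseteq> U p" for p W
    by (rule generator_res[OF om U(1)[OF that(1)] that(2,3) e[OF that(1)]])
  have r_unit: "r p q W \<in> Fx W" if "p \<in> XX" "q \<in> XX" "op W" "W \<subseteq> U p" "W \<subseteq> U q" for p q W
    unfolding r_def by (rule ratio_unit[OF om that(3) eW eW]) (use that in auto)
  have r_res: "r p q W' = cut W' (r p q W)" if "p \<in> XX" "q \<in> XX" "op W" "W \<subseteq> U p" "W \<subseteq> U q" "op W'" "W' \<subseteq> W" for p q W W'
    unfolding r_def
    using coef_res[OF om that(3,6,7) eW[OF that(2,3,5)] generator_closed[OF eW[OF that(1,3,4)]]]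
      om_res_res[OF om U(1)[OF that(1)] that(3,6,7,4) generator_closed[OF e[OF that(1)]]]
      om_res_res[OF om U(1)[OF that(2)] that(3,6,7,5) generator_closed[OF e[OF that(2)]]] by simp
  have r_OX: "r p q W \<in> OX W" if "p \<in> XX" "q \<in> XX" "op W" "W \<subseteq> U p" "W \<subseteq> U q" for p q W
    using r_unit[OF that] by (simp add: Fx_iff[OF that(3)])
  have r_cocycle: "r p s W = (\<lambda>x. r p q W x * r q s W x)"
    if "p \<in> XX" "q \<in> XX" "s \<in> XX" "op W" "W \<subseteq> U p" "W \<subseteq> U q" "W \<subseteq> U s" for p q s W
  proof -
    note g = generator_closed[OF eW[OF that(1,4,5)]] generator_closed[OF eW[OF that(2,4,6)]] generator_closed[OF eW[OF that(3,4,7)]]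
    note rr = r_OX[OF that(1,2,4,5,6)] r_OX[OF that(2,3,4,6,7)]
    have "res L (U p) W (e p) = r p q W \<odot>\<^bsub>sec L W\<^esub> (r q s W \<odot>\<^bsub>sec L W\<^esub> res L (U s) W (e s))"
      unfolding r_def coef_smult[OF om that(4) eW[OF that(3,4,7)] g(2)] coef_smult[OF om that(4) eW[OF that(2,4,6)] g(1)] ..
    then have "res L (U p) W (e p) = (\<lambda>x. r p q W x * r q s W x) \<odot>\<^bsub>sec L W\<^esub> res L (U s) W (e s)"
      unfolding om_smult_assoc[OF om that(4) rr g(3)] .
    then show ?thesis
      using coef_eq[OF om that(4) eW[OF that(3,4,7)] OX_mult[OF that(4) rr]] by (simp add: r_def[of p s])
  qed
  have r_self: "r p p W = cut W (\<lambda>_. 1)" if "p \<in> XX" "op W" "W \<subseteq> U p" for p W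
    using coef_eq[OF om that(2) eW[OF that] OX_const[OF that(2), of 1]] om_smult_one[OF om that(2) generator_closed[OF eW[OF that]]]
    by (simp add: r_def)
  \<comment> \<open>The factor \<open>r q p\<close> expresses \<open>e q\<close> through
    \<open>e p\<close>. In this direction \<open>e p\<close> is the reference \<open>e q\<close>
    divided by the factor, in agreement with the generator \<open>1 / \<gamma> p\<close>.\<close>
  define u where "u p = (\<lambda>q\<in>U p. germF q (U p \<inter> U q) (r q p (U p \<inter> U q)))" for p
  define \<alpha> where "\<alpha> p = conn L (U p) (e p)" for p
  have u: "u p \<in> gd0F (U p)" if p: "p \<in> XX" for p
    unfolding D.F.godement_carrier u_def restrict_PiE_iff
  proof
    fix q assume q: "q \<in> U p"
    note qX = UX[OF p q]
    show "germF q (U p \<inter> U q) (r q p (U p \<inter> U q)) \<in> carrier (stalkF q)"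
      using U[OF p] U[OF qX] q by (intro D.F.germ_closed r_unit p qX) auto
  qed
  have uW: "u p x = germF x W (r x p W)" if p: "p \<in> XX" and W: "op W" "x \<in> W" "W \<subseteq> U p" "W \<subseteq> U x" for p x W
  proof -
    have x: "x \<in> U p" "x \<in> XX" using W UX[OF p] by auto
    have o: "op (U p \<inter> U x)" "W \<subseteq> U p \<inter> U x" using U[OF p] U[OF x(2)] W by auto
    show ?thesis
      using D.F.germ_res[OF o(1) W(1,2) o(2) r_unit[OF x(2) p o(1) Int_lower2 Int_lower1]]
        r_res[OF x(2) p o(1) Int_lower2 Int_lower1 W(1) o(2)] x by (simp add: u_def)
  qed
  obtain z where z: "z \<in> ZZ" and triv: "\<And>p. p \<in> XX \<Longrightarrow> triv z (U p) (u p) (\<alpha> p)"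
  proof (rule D.hyper_Z_family[of U u \<alpha>])
    show "op (U p) \<and> p \<in> U p \<and> u p \<in> gd0F (U p) \<and> \<alpha> p \<in> Gx (U p)" if "p \<in> XX" for p
      using U[OF that] u[OF that] conn_closed[OF bm U(1)[OF that] e[OF that]] by (simp add: \<alpha>_def)
    fix p q assume p: "p \<in> XX" and q: "q \<in> U p"
    note qX = UX[OF p q]
    define W where "W = U p \<inter> U q"
    have W: "op W" "W \<subseteq> U p" "W \<subseteq> U q" using U[OF p] U[OF qX] by (auto simp: W_def)
    \<comment> \<open>The cocycle relation for \<open>x\<close>, \<open>q\<close> and
      \<open>p\<close>: both cochains use the same reference generator at \<open>x\<close>, so they
      differ by \<open>r q p\<close> alone.\<close>
    have 1: "restrict (u p) W = godement_unit (mtop M) FF W (r q p W) \<otimes>\<^bsub>sgrp (gd0 (mtop M) FF) W\<^esub> restrict (u q) W"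
    proof
      fix x show "restrict (u p) W x = (godement_unit (mtop M) FF W (r q p W) \<otimes>\<^bsub>sgrp (gd0 (mtop M) FF) W\<^esub> restrict (u q) W) x"
      proof (cases "x \<in> W")
        case True
        then have xX: "x \<in> XX" using UX[OF p] W by blast
        define W' where "W' = W \<inter> U x"
        have W': "op W'" "x \<in> W'" "W' \<subseteq> W" "W' \<subseteq> U p" "W' \<subseteq> U q" "W' \<subseteq> U x" using W U[OF xX] True by (auto simp: W'_def)
        note rp = r_unit[OF xX p W'(1,6,4)] and rq = r_unit[OF xX qX W'(1,6,5)] and rqp = r_unit[OF qX p W'(1,5,4)]
        have "u p x = germF x W' (\<lambda>y. r x q W' y * r q p W' y)"
          unfolding uW[OF p W'(1,2,4,6)] r_cocycle[OF xX qX p W'(1,6,5,4)] ..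
        also have "\<dots> = germF x W' (r q p W') \<otimes>\<^bsub>stalkF x\<^esub> germF x W' (r x q W')"
          unfolding D.F.stalk_mult_same[OF W'(1,2) rqp rq] by (simp add: mult.commute)
        also have "germF x W' (r q p W') = germF x W (r q p W)"
          using D.F.germ_res[OF W(1) W'(1,2,3) r_unit[OF qX p W(1,3,2)]] r_res[OF qX p W(1,3,2) W'(1,3)] by simp
        finally have "u p x = germF x W (r q p W) \<otimes>\<^bsub>stalkF x\<^esub> u q x" unfolding uW[OF qX W'(1,2,5,6)] .
        then show ?thesis using True by (simp add: godement_def godement_unit_def)
      qed (simp add: godement_def)
    qed
    have 2: "sres GG (U q) W (\<alpha> q) = sres GG (U p) W (\<alpha> p) \<otimes>\<^bsub>sgrp GG W\<^esub> dlog W (r q p W)"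
    proof (intro ext)
      fix V b x
      show "sres GG (U q) W (\<alpha> q) V b x = (sres GG (U p) W (\<alpha> p) \<otimes>\<^bsub>sgrp GG W\<^esub> dlog W (r q p W)) V b x"
      proof (cases "op V \<and> V \<subseteq> W \<and> b \<in> BB V")
        case True
        then have V: "op V" "V \<subseteq> W" and b: "b \<in> BB V" by auto
        have cr: "conn L W (res L (U p) W (e p)) V b = conn L (U p) (e p) V b" if "p \<in> XX" "W \<subseteq> U p" for p
        proof -
          have "V \<subseteq> U p" using V that by blast
          then show ?thesis
            using om_res_res[OF om U(1)[OF that(1)] W(1) V that(2) generator_closed[OF e[OF that(1)]]] V b by (simp add: conn_def)
        qed
        show ?thesis
          using fun_cong[OF conn_change[OF bm W(1) eW[OF p W(1,2)] eW[OF qX W(1,3)] V b], of x] cr[OF p W(2)] cr[OF qX W(3)] V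
          by (simp add: \<alpha>_def r_def)
      next
        case False
        then show ?thesis by (auto simp: dB_log_def dB0_def \<alpha>_def conn_def)
      qed
    qed
    show "\<exists>r\<in>Fx (U p \<inter> U q). restrict (u p) (U p \<inter> U q) =
         godement_unit (mtop M) FF (U p \<inter> U q) r \<otimes>\<^bsub>sgrp (gd0 (mtop M) FF) (U p \<inter> U q)\<^esub> restrict (u q) (U p \<inter> U q) \<and>
        sres GG (U q) (U p \<inter> U q) (\<alpha> q) = sres GG (U p) (U p \<inter> U q) (\<alpha> p) \<otimes>\<^bsub>sgrp GG (U p \<inter> U q)\<^esub> dlog (U p \<inter> U q) r"
      unfolding W_def[symmetric] by (rule bexI[of _ "r q p W"]) (intro conjI 1 2, rule r_unit[OF qX p W(1,3,2)])
  qed (rule that)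
  interpret A: atlas_space M P B "zatlas z" by unfold_locales (rule atlas_zatlas[OF z])
  define \<gamma> where "\<gamma> p x = gval x (u p x)" for p x
  have \<gamma>: "\<gamma> p x = r x p W x" if "p \<in> XX" "op W" "x \<in> W" "W \<subseteq> U p" "W \<subseteq> U x" for p x W
    unfolding \<gamma>_def uW[OF that] by (rule gval_germ[OF that(2,3) r_unit[OF UX[OF that(1)] that(1,2,5,4)]]) (use that in blast)
  define ch where "ch p = (U p, \<gamma> p, \<alpha> p)" for p
  \<comment> \<open>\<open>atlas_iso\<close> attaches a generator to each chart; as different points
    might give the same chart, one point is fixed for each.\<close>
  define pt where "pt c = (SOME p. p \<in> XX \<and> c = ch p)" for c
  have pt: "pt c \<in> XX \<and> c = ch (pt c)" if "c \<in> ch ` XX" for c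
    unfolding pt_def by (rule someI_ex) (use that in blast)
  have "bmodule_isomorphic M P B L (Lz z)"
  proof (rule A.atlas_iso[OF bm, of "ch ` XX" "\<lambda>c. e (pt c)"])
    show "ch ` XX \<subseteq> zatlas z" using triv by (auto simp: ch_def zatlas_def \<gamma>_def[abs_def])
    show "\<exists>c\<in>ch ` XX. p \<in> fst c" if "p \<in> XX" for p using U(2)[OF that] that by (auto simp: ch_def)
  next
    fix V g a assume c: "(V, g, a) \<in> ch ` XX"
    define p where "p = pt (V, g, a)"
    have p: "p \<in> XX" "V = U p" "g = \<gamma> p" "a = \<alpha> p" using pt[OF c] by (auto simp: p_def[symmetric] ch_def)
    show "generator L V (e (pt (V, g, a)))" unfolding p_def[symmetric] unfolding p(2) by (rule e[OF p(1)])
    show "act L W b (res L V W (e (pt (V, g, a)))) = a W b \<odot>\<^bsub>sec L W\<^esub> res L V W (e (pt (V, g, a)))"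
      if "op W" "W \<subseteq> V" "b \<in> BB W" for W b
      unfolding p_def[symmetric] unfolding p(2,4) \<alpha>_def
      by (rule conn_eq(2)[OF bm U(1)[OF p(1)] e[OF p(1)] that(1) _ that(3)]) (use that(2) p(2) in simp)
    fix V' g' a' assume c': "(V', g', a') \<in> ch ` XX"
    define q where "q = pt (V', g', a')"
    have q: "q \<in> XX" "V' = U q" "g' = \<gamma> q" "a' = \<alpha> q" using pt[OF c'] by (auto simp: q_def[symmetric] ch_def)
    define W where "W = U p \<inter> U q"
    have W: "op W" "W \<subseteq> U p" "W \<subseteq> U q" using U[OF p(1)] U[OF q(1)] by (auto simp: W_def)
    \<comment> \<open>The factors belonging to the reference generator at \<open>x\<close> cancel in
      the ratio, so the generators change as \<open>atlas_iso\<close> requires.\<close>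
    have "cut W (\<lambda>x. \<gamma> p x / \<gamma> q x) = r q p W"
    proof
      fix x show "cut W (\<lambda>x. \<gamma> p x / \<gamma> q x) x = r q p W x"
      proof (cases "x \<in> W")
        case True
        then have xX: "x \<in> XX" using UX[OF p(1)] W by blast
        define W' where "W' = W \<inter> U x"
        have W': "op W'" "x \<in> W'" "W' \<subseteq> W" "W' \<subseteq> U p" "W' \<subseteq> U q" "W' \<subseteq> U x" using W U[OF xX] True by (auto simp: W'_def)
        have "\<gamma> p x = r x q W' x * r q p W' x"
          unfolding \<gamma>[OF p(1) W'(1,2,4,6)] r_cocycle[OF xX q(1) p(1) W'(1,6,5,4)] ..
        moreover have "\<gamma> q x = r x q W' x" by (rule \<gamma>[OF q(1) W'(1,2,5,6)])
        moreover have "r x q W' x \<noteq> 0" using r_unit[OF xX q(1) W'(1,6,5)] W' by (simp add: Fx_iff)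
        moreover have "r q p W' x = r q p W x" using fun_cong[OF r_res[OF q(1) p(1) W(1,3,2) W'(1,3)], of x] W'(2) by (simp add: cut_def)
        ultimately show ?thesis using True by (simp add: cut_def)
      qed (use OX_off[OF r_OX[OF q(1) p(1) W(1,3,2)]] in \<open>simp add: cut_def\<close>)
    qed
    then have "res L (U q) W (e q) = cut W (\<lambda>x. \<gamma> p x / \<gamma> q x) \<odot>\<^bsub>sec L W\<^esub> res L (U p) W (e p)"
      using coef_smult[OF om W(1) eW[OF p(1) W(1,2)] generator_closed[OF eW[OF q(1) W(1,3)]]] by (simp add: r_def)
    then show "res L V' (V \<inter> V') (e (pt (V', g', a'))) =
        cut (V \<inter> V') (\<lambda>x. g x / g' x) \<odot>\<^bsub>sec L (V \<inter> V')\<^esub> res L V (V \<inter> V') (e (pt (V, g, a)))"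
      unfolding p_def[symmetric] q_def[symmetric] unfolding p(2,3) q(2,3) W_def[symmetric] .
  qed
  then show thesis using that[OF z] iso_sym[OF bm] by blast
qed

subsection \<open>Trivial modules come from coboundaries\<close>

abbreviation "UB \<equiv> unit_bmodule M P B"

lemma UB_simps [simp]:
  "carrier (sec UB U) = OX U" "\<zero>\<^bsub>sec UB U\<^esub> = (\<lambda>_. 0)" "s \<oplus>\<^bsub>sec UB U\<^esub> t = (\<lambda>x. s x + t x)"
  "f \<odot>\<^bsub>sec UB U\<^esub> s = (\<lambda>x. f x * s x)" "res UB U V = cut V" "act UB U b = DD U b"
  by (simp_all add: unit_bmodule_def)

lemma UB_omodule: "omodule M P UB"
proof -
  have md: "module (OXP M P U) (sec UB U)" if U: "op U" for U
  proof (rule moduleI)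
    show "cring (OXP M P U)" by (rule OX_cring[OF U])
    show "abelian_group (sec UB U)"
    proof (rule abelian_groupI)
      fix s assume "s \<in> carrier (sec UB U)"
      then show "\<exists>t\<in>carrier (sec UB U). t \<oplus>\<^bsub>sec UB U\<^esub> s = \<zero>\<^bsub>sec UB U\<^esub>"
        using OX_minus[OF U] by (intro bexI[of _ "\<lambda>x. - s x"]) auto
    qed (auto simp: OX_add[OF U] OX_zero[OF U] algebra_simps)
  qed (auto simp: OX_mult[OF U] OX_off cut_def fun_eq_iff algebra_simps)
  have sh: "is_sheaf (mtop M) OX (\<lambda>U V. cut V)"
    unfolding is_sheaf_def
  proof (intro conjI allI impI, goal_cases)
    case (1 U V)
    then show ?case using OX_cut by blast
  next
    case (2 U s)
    then show ?case by (simp add: cut_OX_eq)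
  next
    case (3 U V W s)
    then show ?case by (simp add: Int_absorb1)
  next
    case (4 \<U> s)
    define t where "t = (\<lambda>x. if x \<in> \<Union>\<U> then s (SOME V. V \<in> \<U> \<and> x \<in> V) x else 0)"
    have t: "t x = s V x" if "V \<in> \<U>" "x \<in> V" for V x
    proof -
      define V' where "V' = (SOME V. V \<in> \<U> \<and> x \<in> V)"
      have V': "V' \<in> \<U> \<and> x \<in> V'" unfolding V'_def by (rule someI_ex) (use that in blast)
      have "cut (V \<inter> V') (s V) x = cut (V \<inter> V') (s V') x" using 4 that V' by metis
      then have "s V' x = s V x" using that V' by (simp add: cut_def)
      then show ?thesis using that unfolding t_def V'_def[symmetric] by auto
    qed
    have tc: "cut V t = s V" if "V \<in> \<U>" for V
    proof
      have "s V \<in> OX V" using 4 that by blast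
      then show "cut V t x = s V x" for x using t[OF that, of x] OX_off[of "s V" V x] by (simp add: cut_def)
    qed
    show ?case
    proof (rule ex1I[of _ t])
      have "t \<in> OX (\<Union>\<U>)"
      proof (rule OX_local)
        show "op (\<Union>\<U>)" using 4 by blast
        fix p assume "p \<in> \<Union>\<U>"
        then obtain V where V: "V \<in> \<U>" "p \<in> V" by blast
        then have "op V" "cut V t \<in> OX V" using 4 tc[OF V(1)] by auto
        then show "\<exists>V. op V \<and> p \<in> V \<and> V \<subseteq> \<Union>\<U> \<and> cut V t \<in> OX V" using V by blast
      qed (simp add: t_def)
      then show "t \<in> OX (\<Union>\<U>) \<and> (\<forall>V\<in>\<U>. cut V t = s V)" using tc by blast
      fix t' assume t': "t' \<in> OX (\<Union>\<U>) \<and> (\<forall>V\<in>\<U>. cut V t' = s V)"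
      show "t' = t"
      proof
        fix x show "t' x = t x"
        proof (cases "x \<in> \<Union>\<U>")
          case True
          then obtain V where V: "V \<in> \<U>" "x \<in> V" by blast
          then have "cut V t' x = s V x" using t' by metis
          then show ?thesis using t[OF V] V by (simp add: cut_def)
        next
          case False
          then show ?thesis using t' OX_off by (auto simp: t_def)
        qed
      qed
    qed
  qed
  have "res UB = (\<lambda>U V. cut V)" by (simp add: unit_bmodule_def)
  then show ?thesis
    unfolding omodule_def \<open>res UB = _\<close> using sh md by (auto simp: cut_def fun_eq_iff)
qed

lemma UB_bmodule: "bmodule M P B UB"
proof -
  have mn: "s \<ominus>\<^bsub>sec UB U\<^esub> t = (\<lambda>x. s x - t x)" if "op U" "s \<in> OX U" "t \<in> OX U" for U s t
  proof -
    have "\<ominus>\<^bsub>sec UB U\<^esub> t = (\<lambda>x. - t x)"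
      by (rule abelian_group.minus_equality[OF om_group[OF UB_omodule that(1)]]) (simp_all add: that OX_minus)
    then show ?thesis by (simp add: a_minus_def)
  qed
  have cs: "DD U b (\<lambda>x. cut U (\<lambda>_. z) x * s x) = (\<lambda>x. cut U (\<lambda>_. z) x * DD U b s x)" if "op U" "b \<in> BB U" "s \<in> OX U" for U b s z
    using DD_mult[OF that(1,2) OX_const[OF that(1)] that(3), of z] DD_const[OF that(1,2)] by simp
  have lb: "DD U b (\<lambda>x. f x * s x) = (\<lambda>x. DD U b f x * s x + f x * DD U b s x)" if "op U" "b \<in> BB U" "f \<in> OX U" "s \<in> OX U" for U b f s
    using DD_mult[OF that] by (simp add: algebra_simps)
  show ?thesis
    unfolding bmodule_def using UB_omodule
    by (auto simp: DD_closed DD_add cscale_def cs DD_badd DD_brk mn DD_bsmult lb DD_cut)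
qed

lemma UB_generator: "generator UB XX (cut XX (\<lambda>_. 1))"
  unfolding generator_def UB_simps
proof (intro conjI allI impI ballI)
  show "cut XX (\<lambda>_. 1) \<in> OX XX" by (rule OX_const) simp
  fix V f assume V: "op V \<and> V \<subseteq> XX" and f: "f \<in> OX V"
  have e: "(\<lambda>x. g x * cut V (cut XX (\<lambda>_. 1)) x) = g" if g: "g \<in> OX V" for g
    using V OX_off[OF g] by (auto simp: cut_def fun_eq_iff)
  show "\<exists>!g. g \<in> OX V \<and> f = (\<lambda>x. g x * cut V (cut XX (\<lambda>_. 1)) x)"
    by (rule ex1I[of _ f]) (use f e in auto)
qed

text \<open>A coboundary is trivialised over the whole space with zero form. This one chart is
  already a cover, and its generator is annihilated by the action, like the constant one in the unit
  module.\<close>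

lemma coboundary_trivial:
  assumes v: "v \<in> gd0F XX" and zv: "z = hyper_D0 (mtop M) FF GG dlog v"
  shows "bmodule_isomorphic M P B UB (Lz z)"
proof -
  have z: "z \<in> ZZ" unfolding zv by (rule D.hyper_D0_trivialisation(2)[OF v])
  interpret A: atlas_space M P B "zatlas z" by unfold_locales (rule atlas_zatlas[OF z])
  define \<gamma> where "\<gamma> = (\<lambda>x. gval x (v x))"
  have c: "(XX, \<gamma>, \<lambda>_ _ _. 0) \<in> zatlas z"
    using D.hyper_D0_trivialisation(1)[OF v] unfolding zatlas_def \<gamma>_def zv by auto
  show ?thesis
  proof (rule A.atlas_iso[OF UB_bmodule, of "{(XX, \<gamma>, \<lambda>_ _ _. 0)}" "\<lambda>_. cut XX (\<lambda>_. 1)"])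
    show "{(XX, \<gamma>, \<lambda>_ _ _. 0)} \<subseteq> zatlas z" using c by simp
    show "generator UB V (cut XX (\<lambda>_. 1))" if "(V, g, a) \<in> {(XX, \<gamma>, \<lambda>_ _ _. 0)}" for V g a
      using that UB_generator by simp
    show "act UB W b (res UB V W (cut XX (\<lambda>_. 1))) = a W b \<odot>\<^bsub>sec UB W\<^esub> res UB V W (cut XX (\<lambda>_. 1))"
      if "(V, g, a) \<in> {(XX, \<gamma>, \<lambda>_ _ _. 0)}" "op W" "W \<subseteq> V" "b \<in> BB W" for V g a W b
      using that DD_const[OF that(2,4), of 1] by (simp add: Int_absorb1)
    show "res UB V' (V \<inter> V') (cut XX (\<lambda>_. 1)) = cut (V \<inter> V') (\<lambda>x. g x / g' x) \<odot>\<^bsub>sec UB (V \<inter> V')\<^esub> res UB V (V \<inter> V') (cut XX (\<lambda>_. 1))"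
      if "(V, g, a) \<in> {(XX, \<gamma>, \<lambda>_ _ _. 0)}" "(V', g', a') \<in> {(XX, \<gamma>, \<lambda>_ _ _. 0)}" for V g a V' g' a'
      using that A.chart_nz[OF c] by (auto simp: cut_def fun_eq_iff)
  qed auto
qed

text \<open>The image \<open>s\<close> of the constant one is a global generator on which
  \<open>B\<close> acts by zero. In a chart \<open>\<gamma> * s\<close> is a unit whose logarithmic
  differential is the negative of \<alpha>; changing the trivialisation by its inverse removes the
  form and leaves the values \<open>1 / s\<close>. These no longer depend on the chart, so the local
  cochains fit together.\<close>

lemma trivial_coboundary:
  assumes z: "z \<in> ZZ" and iso: "bmodule_isomorphic M P B UB (Lz z)"
  shows "z \<in> hyper_D0 (mtop M) FF GG dlog ` gd0F XX"
proof -
  interpret A: atlas_space M P B "zatlas z" by unfold_locales (rule atlas_zatlas[OF z])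
  obtain \<phi> where \<phi>: "bm_iso UB (Lz z) \<phi>" using iso by (auto simp: bmodule_isomorphic_iff)
  have oX: "op XX" by simp
  define s where "s = \<phi> XX (cut XX (\<lambda>_. 1))"
  have gen: "generator (Lz z) XX s" unfolding s_def by (rule generator_iso[OF UB_bmodule \<phi> oX UB_generator])
  have sX: "s \<in> L_sec (zatlas z) XX" using generator_closed[OF gen] by simp
  have sV: "cut V s = \<phi> V (cut V (\<lambda>_. 1))" "cut V s \<in> L_sec (zatlas z) V" if V: "op V" for V
  proof -
    have VX: "V \<subseteq> XX" using V openin_subset by blast
    show "cut V s = \<phi> V (cut V (\<lambda>_. 1))"
      using bm_iso_res[OF \<phi> oX _ V VX, of "cut XX (\<lambda>_. 1)"] OX_const[OF oX, of 1] VX by (simp add: s_def Int_absorb1)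
    show "cut V s \<in> L_sec (zatlas z) V" by (rule A.L_sec_cut[OF oX V VX sX])
  qed
  have act0: "L_act (zatlas z) V b (cut V s) = (\<lambda>_. 0)" if V: "op V" and b: "b \<in> BB V" for V b
  proof -
    note one = OX_const[OF V, of 1]
    have "L_act (zatlas z) V b (cut V s) = \<phi> V (DD V b (cut V (\<lambda>_. 1)))"
      using bm_iso_act[OF \<phi> V _ b, of "cut V (\<lambda>_. 1)"] one sV(1)[OF V] by simp
    also have "DD V b (cut V (\<lambda>_. 1)) = (\<lambda>_. 0) \<odot>\<^bsub>sec UB V\<^esub> cut V (\<lambda>_. 1)" by (simp add: DD_const[OF V b])
    also have "\<phi> V \<dots> = (\<lambda>_. 0)"
      using bm_iso_smult[OF \<phi> V _ OX_zero[OF V], of "cut V (\<lambda>_. 1)"] one by simp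
    finally show ?thesis .
  qed
  \<comment> \<open>Normalised trivialisations. The condition on values leaves no freedom for
    \<open>w\<close>: a remaining factor \<open>h\<close> has to be the constant one, see
    \<open>nt_uniq\<close>.\<close>
  define nt where "nt V w \<longleftrightarrow> triv z V w \<one>\<^bsub>sgrp GG V\<^esub> \<and> (\<forall>x\<in>V. gval x (w x) = inverse (s x))" for V w
  have nt_ex: "\<exists>V w. p \<in> V \<and> nt V w" if p: "p \<in> XX" for p
  proof -
    obtain V u \<alpha> where pV: "p \<in> V" and t: "triv z V u \<alpha>" using z p D.hyper_Z_iff[of "fst z" "snd z"] by auto
    have V: "op V" by (rule triv_op[OF t])
    have VX: "V \<subseteq> XX" using V openin_subset by blast
    define \<gamma> where "\<gamma> = (\<lambda>x. gval x (u x))"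
    have c: "(V, \<gamma>, \<alpha>) \<in> zatlas z" using t by (auto simp: zatlas_def \<gamma>_def)
    define h where "h = cut V (\<lambda>x. \<gamma> x * s x)"
    have h: "h \<in> OX V" unfolding h_def by (rule A.L_sec_chart[OF sX c oX V VX subset_refl])
    have gV: "generator (Lz z) V (cut V s)" using generator_res[OF A.L_omodule oX V VX gen] by simp
    \<comment> \<open>The coefficient of the chart generator with respect to \<open>s\<close> is the
      inverse of \<open>h\<close>; this is how the inverse is known to lie in the structure
      sheaf.\<close>
    define g where "g = coef (Lz z) V (cut V s) (A.chart_gen V \<gamma>)"
    have g: "g \<in> OX V" "(\<lambda>x. g x * cut V s x) = A.chart_gen V \<gamma>"
      using coef[OF A.L_omodule V gV, of "A.chart_gen V \<gamma>"] A.chart_gen_mem[OF c] by (simp_all add: g_def)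
    have gh: "g x * h x = 1" if "x \<in> V" for x
      using fun_cong[OF g(2), of x] A.chart_nz[OF c that] that by (simp add: A.chart_gen_def cut_def h_def field_simps)
    have hnz: "h x \<noteq> 0" if "x \<in> V" for x using gh[OF that] by (metis mult_zero_right zero_neq_one)
    have "inverse (h x) = g x" for x
    proof (cases "x \<in> V")
      case True
      then show ?thesis using gh[OF True] hnz[OF True] by (simp add: field_simps)
    qed (use OX_off[OF h] OX_off[OF g(1)] in simp)
    then have ig: "(\<lambda>x. inverse (h x)) = g" by blast
    have hF: "h \<in> Fx V" using h g(1) hnz by (simp add: Fx_iff[OF V] ig)
    have gF: "g \<in> Fx V"
    proof -
      have "(\<lambda>x. inverse (g x)) = h" unfolding ig[symmetric] by simp
      moreover have "g x \<noteq> 0" if "x \<in> V" for x using gh[OF that] by (metis mult_zero_left zero_neq_one)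
      ultimately show ?thesis using h g(1) by (simp add: Fx_iff[OF V])
    qed
    have dl: "dlog V h W b x + dlog V g W b x = 0" for W b x
    proof -
      have "(\<lambda>x. h x * g x) = \<one>\<^bsub>sgrp FF V\<^esub>"
        using gh OX_off[OF h] by (auto simp: cut_def mult.commute fun_eq_iff)
      then have "dlog V (\<lambda>x. h x * g x) = \<one>\<^bsub>sgrp GG V\<^esub>" using D.map_one[OF V] by metis
      then show ?thesis using fun_cong[OF fun_cong[OF fun_cong[OF dlog_mult[OF V hF gF], of W], of b], of x] by simp
    qed
    \<comment> \<open>That \<open>B\<close> annihilates \<open>s\<close> reads in the chart: the
      derivative of \<open>h\<close> plus \<alpha> times \<open>h\<close> is zero. So \<alpha> is
      minus the logarithmic differential of \<open>h\<close>, which is that of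
      \<open>g\<close>.\<close>
    have \<alpha>: "\<alpha> = dlog V g"
    proof (intro ext)
      fix W b x
      show "\<alpha> W b x = dlog V g W b x"
      proof (cases "op W \<and> W \<subseteq> V \<and> b \<in> BB W \<and> x \<in> W")
        case True
        then have W: "op W" "W \<subseteq> V" and b: "b \<in> BB W" and x: "x \<in> W" by auto
        have e: "cut W (\<lambda>x. \<gamma> x * cut W s x) = cut W h" using W by (auto simp: h_def cut_def fun_eq_iff)
        have "(\<lambda>_. 0) = (\<lambda>x. DD W b (cut W h) x + \<alpha> W b x * cut W h x)"
          using A.L_act_chart[OF c W(1) W(1) subset_refl W(2) b sV(2)[OF W(1)]] act0[OF W(1) b] om_res_id[OF B_om W(1) b]
          by (simp add: e)
        from fun_cong[OF this, of x] have "DD W b (cut W h) x + \<alpha> W b x * h x = 0" using x by (simp add: cut_def)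
        moreover have "h x \<noteq> 0" using hnz W x by blast
        moreover have "dlog V h W b x = inverse (h x) * DD W b (cut W h) x" using dlog_eq[OF W b, of h] x by (simp add: cut_def)
        ultimately have "\<alpha> W b x = - dlog V h W b x" by (simp add: field_simps add_eq_0_iff)
        then show ?thesis using dl[of W b x] by (simp add: add_eq_0_iff)
      next
        case False
        have "\<alpha> W b x = 0" if "op W \<and> W \<subseteq> V \<and> b \<in> BB W" "x \<notin> W"
          using OX_off[OF lin_form_closed[OF Gx_form[OF triv_form[OF t]]]] that by blast
        moreover have "\<alpha> W b x = 0" if "\<not> (op W \<and> W \<subseteq> V \<and> b \<in> BB W)"
          using Gx_supp[OF triv_form[OF t] that] by simp
        ultimately show ?thesis using False by (auto simp: dB_log_def dB0_def DD_off)
      qed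
    qed
    define w where "w = godement_unit (mtop M) FF V g \<otimes>\<^bsub>sgrp (gd0 (mtop M) FF) V\<^esub> u"
    have "\<alpha> \<otimes>\<^bsub>sgrp GG V\<^esub> inv\<^bsub>sgrp GG V\<^esub> dlog V g = \<one>\<^bsub>sgrp GG V\<^esub>"
      unfolding \<alpha> by (rule group.r_inv[OF D.G.group[OF V] dlog_closed[OF V gF]])
    then have tw: "triv z V w \<one>\<^bsub>sgrp GG V\<^esub>"
      using D.local_trivialisation_change[OF t gF] by (simp add: w_def)
    have "gval x (w x) = inverse (s x)" if x: "x \<in> V" for x
    proof -
      have "w x = germF x V g \<otimes>\<^bsub>stalkF x\<^esub> u x" using x by (simp add: w_def godement_def godement_unit_def)
      then have "gval x (w x) = g x * \<gamma> x"
        using gval_mult[OF D.F.germ_closed[OF V x gF] triv_mem[OF t x]] gval_germ[OF V x gF] by (simp add: \<gamma>_def)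
      moreover have "g x * (\<gamma> x * s x) = 1" using gh[OF x] x by (simp add: h_def cut_def)
      ultimately show ?thesis by (metis inverse_unique mult.assoc mult.commute)
    qed
    then show ?thesis using tw pV by (auto simp: nt_def)
  qed
  have nt_uniq: "w q = w' q" if nt: "nt V w" "nt V' w'" and q: "q \<in> V" "q \<in> V'" for V w V' w' q
  proof -
    have t: "triv z V w \<one>\<^bsub>sgrp GG V\<^esub>" "triv z V' w' \<one>\<^bsub>sgrp GG V'\<^esub>" using nt by (auto simp: nt_def)
    have o: "op (V \<inter> V')" using triv_op[OF t(1)] triv_op[OF t(2)] by blast
    have qq: "q \<in> V \<inter> V'" using q by blast
    obtain W h where W: "op W" "q \<in> W" "W \<subseteq> V \<inter> V'" and h: "h \<in> Fx W"
      and hw: "\<forall>x\<in>W. restrict w' (V \<inter> V') x = germF x W h \<otimes>\<^bsub>stalkF x\<^esub> restrict w (V \<inter> V') x"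
      by (rule D.local_trivialisation_compare[OF D.local_trivialisation_res[OF t(1) o Int_lower1]
            D.local_trivialisation_res[OF t(2) o Int_lower2] qq]) (rule that, assumption, assumption, assumption, assumption, simp)
    have wh: "w' x = germF x W h \<otimes>\<^bsub>stalkF x\<^esub> w x" if x: "x \<in> W" for x
    proof -
      have "x \<in> V \<inter> V'" using x W(3) by blast
      then show ?thesis using bspec[OF hw x] by simp
    qed
    have "h x = 1" if x: "x \<in> W" for x
    proof -
      have xV: "x \<in> V" "x \<in> V'" using x W(3) by auto
      have "gval x (w' x) = h x * gval x (w x)"
        unfolding wh[OF x] gval_mult[OF D.F.germ_closed[OF W(1) x h] triv_mem[OF t(1) xV(1)]] gval_germ[OF W(1) x h] ..
      moreover have "gval x (w x) = gval x (w' x)" using nt xV by (simp add: nt_def)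
      moreover have "gval x (w x) \<noteq> 0" by (rule gval_nz[OF triv_mem[OF t(1) xV(1)]])
      ultimately show ?thesis by simp
    qed
    then have "h = \<one>\<^bsub>sgrp FF W\<^esub>" using h OX_off[of h W] by (auto simp: cut_def fun_eq_iff Fx_iff[OF W(1)])
    then have "germF q W h = \<one>\<^bsub>stalkF q\<^esub>" using D.F.stalk_one[OF W(1,2)] by simp
    moreover have "q \<in> XX" using W(1,2) openin_subset by blast
    ultimately show ?thesis
      using wh[OF W(2)] monoid.l_one[OF group.is_monoid[OF D.F.stalk_group] triv_mem[OF t(1) q(1)]] by simp
  qed
  \<comment> \<open>All normalised trivialisations around a point have the same germ there, so a
    global cochain is defined point by point.\<close>
  define v where "v = (\<lambda>q\<in>XX. (SOME x. \<exists>V w. q \<in> V \<and> nt V w \<and> x = w q))"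
  have v: "v q = w q" if "nt V w" "q \<in> V" for V w q
  proof -
    have "op V" using triv_op that(1)[unfolded nt_def, THEN conjunct1] by blast
    then have "q \<in> XX" using that(2) openin_subset by blast
    moreover have "(SOME x. \<exists>V w. q \<in> V \<and> nt V w \<and> x = w q) = w q"
    proof (rule some_equality)
      show "\<exists>V w'. q \<in> V \<and> nt V w' \<and> w q = w' q" using that by blast
      show "x = w q" if "\<exists>V w. q \<in> V \<and> nt V w \<and> x = w q" for x
        using that nt_uniq[OF _ \<open>nt V w\<close> _ \<open>q \<in> V\<close>] by blast
    qed
    ultimately show ?thesis by (simp add: v_def)
  qed
  have vr: "restrict v V = w" if "nt V w" for V w
  proof
    have "w \<in> extensional V" using that by (auto simp: nt_def local_trivialisation_def D.F.godement_carrier PiE_iff)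
    then show "restrict v V q = w q" for q using v[OF that, of q] by (cases "q \<in> V") (auto simp: extensional_def)
  qed
  have vX: "v \<in> gd0F XX"
    unfolding D.F.godement_carrier
  proof (rule PiE_I)
    fix q assume "q \<in> XX"
    then obtain V w where "q \<in> V" "nt V w" using nt_ex by blast
    moreover have "w q \<in> carrier (stalkF q)" using triv_mem[of z V w _ q] \<open>q \<in> V\<close> \<open>nt V w\<close> by (auto simp: nt_def)
    ultimately show "v q \<in> carrier (stalkF q)" using v by simp
  qed (simp add: v_def)
  have "z = hyper_D0 (mtop M) FF GG dlog v"
  proof (rule D.hyper_D0_eqI[OF z vX])
    fix p assume "p \<in> XX"
    then obtain V w where "p \<in> V" "nt V w" using nt_ex by blast
    then show "\<exists>V. p \<in> V \<and> triv z V (restrict v V) \<one>\<^bsub>sgrp GG V\<^esub>" using vr by (auto simp: nt_def)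
  qed
  then show ?thesis using vX by blast
qed

subsection \<open>The isomorphism\<close>

lemma iso_class_eq:
  assumes "bmodule M P B L" "bmodule_isomorphic M P B L N"
  shows "iso_class M P B L = iso_class M P B N"
  using iso_trans[OF iso_sym[OF assms]] iso_trans[OF assms(2)] by (auto simp: iso_class_def)

text \<open>\<open>\<Phi>\<close> sends a cocycle to the class of its module. It is onto by
  \<open>Lz_surj\<close>, multiplicative because atlases multiply, and its kernel consists of the
  coboundaries; the first isomorphism theorem then yields the hypercohomology group.\<close>

lemma pi0_Pic_iso:
  fixes \<iota> :: "('x \<Rightarrow> 'x \<Rightarrow> complex) \<Rightarrow> 'm"
  assumes \<iota>: "inj \<iota>"
  shows "group (pi0_Pic M P B :: ('x, 'b, 'm) bmod set monoid) \<and>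
    (pi0_Pic M P B :: ('x, 'b, 'm) bmod set monoid) \<cong> hyper_H1 (mtop M) FF GG dlog"
proof -
  let ?Pi = "pi0_Pic M P B :: ('x, 'b, 'm) bmod set monoid"
  let ?T1 = "hyper_T1 (mtop M) FF GG"
  let ?G = "?T1\<lparr>carrier := ZZ\<rparr>"
  define \<Phi> :: "_ \<Rightarrow> ('x, 'b, 'm) bmod set" where "\<Phi> z = iso_class M P B (Lz z)" for z
  interpret G: group ?G by (rule D.hyper_Z_group)
  have mult: "z \<otimes>\<^bsub>?T1\<^esub> z' \<in> ZZ" if "z \<in> ZZ" "z' \<in> ZZ" for z z'
    using G.m_closed[of z z'] that by simp
  \<comment> \<open>Functions on the space embed into \<open>'m\<close> as families that are
    constant in the first variable.\<close>
  have inj: "inj (\<lambda>s :: 'x cfun. \<iota> (\<lambda>_. s))"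
    using \<iota> by (auto simp: inj_def fun_eq_iff)
  \<comment> \<open>Each class contains a module with sections in \<open>'m\<close>. This excludes
    empty classes, for which the product of classes, defined through representatives, would break
    down.\<close>
  have model: "\<exists>N \<in> \<Phi> z. invertible_bmodule M P B N \<and> bmodule M P B N \<and> bmodule_isomorphic M P B (Lz z) N" if z: "z \<in> ZZ" for z
  proof -
    let ?N = "bm_transport (\<lambda>s :: 'x cfun. \<iota> (\<lambda>_. s)) (Lz z)"
    have N: "bmodule M P B ?N" "bmodule_isomorphic M P B (Lz z) ?N"
      using bm_transport[OF inj Lz_bmodule[OF z]] by (auto simp: bmodule_isomorphic_iff)
    then have "invertible_bmodule M P B ?N" using invertible_iso[OF Lz_invertible[OF z]] by blast
    then show ?thesis using N by (intro bexI[of _ ?N]) (auto simp: \<Phi>_def iso_class_def)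
  qed
  have memD: "bmodule M P B N" "bmodule_isomorphic M P B (Lz z) N" if "N \<in> \<Phi> z" for N z
    using that by (auto simp: \<Phi>_def iso_class_def invertible_bmodule_def)
  have cls: "\<Phi> z = iso_class M P B N" if "z \<in> ZZ" "bmodule_isomorphic M P B (Lz z) N" for z and N :: "('x, 'b, 'm) bmod"
    unfolding \<Phi>_def by (rule iso_class_eq[OF Lz_bmodule[OF that(1)] that(2)])
  have carr: "carrier ?Pi = \<Phi> ` ZZ"
  proof (intro equalityI subsetI)
    fix c assume "c \<in> carrier ?Pi"
    then obtain L :: "('x, 'b, 'm) bmod" where L: "invertible_bmodule M P B L" "c = iso_class M P B L" by (auto simp: pi0_Pic_def)
    obtain z where "z \<in> ZZ" "bmodule_isomorphic M P B (Lz z) L" by (rule Lz_surj[OF L(1)])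
    then show "c \<in> \<Phi> ` ZZ" using cls L(2) by blast
  next
    fix c assume "c \<in> \<Phi> ` ZZ"
    then obtain z where z: "z \<in> ZZ" "c = \<Phi> z" by blast
    obtain N :: "('x, 'b, 'm) bmod" where "invertible_bmodule M P B N" "bmodule_isomorphic M P B (Lz z) N" using model[OF z(1)] by blast
    then show "c \<in> carrier ?Pi" using cls[OF z(1)] z(2) by (auto simp: pi0_Pic_def)
  qed
  \<comment> \<open>The product of two classes collects all tensor products of representatives. That
    every triple of representatives is a tensor product gives one inclusion, uniqueness up to
    isomorphism the other.\<close>
  have hom: "\<Phi> z \<otimes>\<^bsub>?Pi\<^esub> \<Phi> z' = \<Phi> (z \<otimes>\<^bsub>?T1\<^esub> z')" if z: "z \<in> ZZ" and z': "z' \<in> ZZ" for z z'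
  proof -
    note zz = mult[OF z z']
    note at = atlas_zatlas[OF z] atlas_zatlas[OF z'] atlas_zatlas[OF zz]
    have tensor: "bmodule_tensor M P B K L N" if K: "K \<in> \<Phi> z" and L: "L \<in> \<Phi> z'" and N: "N \<in> \<Phi> (z \<otimes>\<^bsub>?T1\<^esub> z')" for K L N
    proof -
      note bm = memD(1)[OF K] memD(1)[OF L] memD(1)[OF N]
      obtain \<tau> where "omodule_bilinear M P K L N \<tau>" "locally_gen K L N \<tau>"
        and a: "\<And>U b k l. \<lbrakk>op U; b \<in> BB U; k \<in> carrier (sec K U); l \<in> carrier (sec L U)\<rbrakk> \<Longrightarrow>
          act N U b (\<tau> U k l) = \<tau> U (act K U b k) l \<oplus>\<^bsub>sec N U\<^esub> \<tau> U k (act L U b l)"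
        by (rule atlas_tensor[OF at zatlas_prod bm memD(2)[OF K] memD(2)[OF L] memD(2)[OF N]])
           (rule that, assumption, assumption, simp)
      then have "is_tensor_product M P K L N \<tau>"
        using is_tensor_productI bm[THEN bm_om] by blast
      then show ?thesis unfolding bmodule_tensor_def using bm(3) a by blast
    qed
    have iso: "N' \<in> \<Phi> (z \<otimes>\<^bsub>?T1\<^esub> z')"
      if K: "K \<in> \<Phi> z" and L: "L \<in> \<Phi> z'" and N': "invertible_bmodule M P B N'" "bmodule_tensor M P B K L N'" for K L N'
    proof -
      obtain N where N: "N \<in> \<Phi> (z \<otimes>\<^bsub>?T1\<^esub> z')" using model[OF zz] by blast
      note bm = memD(1)[OF K] memD(1)[OF L] memD(1)[OF N]
      obtain \<tau> where t: "omodule_bilinear M P K L N \<tau>" "locally_gen K L N \<tau>"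
        and a: "\<forall>U b k l. op U \<longrightarrow> b \<in> BB U \<longrightarrow> k \<in> carrier (sec K U) \<longrightarrow> l \<in> carrier (sec L U) \<longrightarrow>
          act N U b (\<tau> U k l) = \<tau> U (act K U b k) l \<oplus>\<^bsub>sec N U\<^esub> \<tau> U k (act L U b l)"
        by (rule atlas_tensor[OF at zatlas_prod bm memD(2)[OF K] memD(2)[OF L] memD(2)[OF N]])
           (rule that, assumption, assumption, simp)
      have "bmodule_isomorphic M P B N N'"
        by (rule tensor_unique[OF bm t a[rule_format] N'(2)])
      then show ?thesis using iso_trans[OF memD(2)[OF N]] N'(1) by (auto simp: \<Phi>_def iso_class_def)
    qed
    have "\<Phi> z \<otimes>\<^bsub>?Pi\<^esub> \<Phi> z' = {N. invertible_bmodule M P B N \<and> (\<exists>K\<in>\<Phi> z. \<exists>L\<in>\<Phi> z'. bmodule_tensor M P B K L N)}"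
      by (simp add: pi0_Pic_def)
    also have "\<dots> = \<Phi> (z \<otimes>\<^bsub>?T1\<^esub> z')"
    proof (intro equalityI subsetI)
      fix N assume "N \<in> {N. invertible_bmodule M P B N \<and> (\<exists>K\<in>\<Phi> z. \<exists>L\<in>\<Phi> z'. bmodule_tensor M P B K L N)}"
      then show "N \<in> \<Phi> (z \<otimes>\<^bsub>?T1\<^esub> z')" using iso by blast
    next
      fix N assume N: "N \<in> \<Phi> (z \<otimes>\<^bsub>?T1\<^esub> z')"
      obtain K L where "K \<in> \<Phi> z" "L \<in> \<Phi> z'" using model[OF z] model[OF z'] by blast
      moreover have "invertible_bmodule M P B N" using N by (auto simp: \<Phi>_def iso_class_def)
      ultimately show "N \<in> {N. invertible_bmodule M P B N \<and> (\<exists>K\<in>\<Phi> z. \<exists>L\<in>\<Phi> z'. bmodule_tensor M P B K L N)}"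
        using tensor N by blast
    qed
    finally show ?thesis .
  qed
  \<comment> \<open>The unit class is that of the structure sheaf, so this determines the kernel;
    nonemptiness of the class provides a module through which the two isomorphisms are
    composed.\<close>
  have triv_iff: "\<Phi> z = \<one>\<^bsub>?Pi\<^esub> \<longleftrightarrow> z \<in> hyper_D0 (mtop M) FF GG dlog ` gd0F XX" if z: "z \<in> ZZ" for z
  proof
    assume e: "\<Phi> z = \<one>\<^bsub>?Pi\<^esub>"
    obtain N where N: "N \<in> \<Phi> z" using model[OF z] by blast
    then have "bmodule_isomorphic M P B UB N" using e by (auto simp: pi0_Pic_def iso_class_def)
    then have "bmodule_isomorphic M P B UB (Lz z)"
      using iso_trans iso_sym[OF Lz_bmodule[OF z] memD(2)[OF N]] by blast
    then show "z \<in> hyper_D0 (mtop M) FF GG dlog ` gd0F XX" by (rule trivial_coboundary[OF z])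
  next
    assume "z \<in> hyper_D0 (mtop M) FF GG dlog ` gd0F XX"
    then have i: "bmodule_isomorphic M P B UB (Lz z)" using coboundary_trivial by blast
    show "\<Phi> z = \<one>\<^bsub>?Pi\<^esub>" by (simp add: \<Phi>_def pi0_Pic_def iso_class_eq[OF UB_bmodule i])
  qed
  have D0Z: "hyper_D0 (mtop M) FF GG dlog ` gd0F XX \<subseteq> ZZ" using D.hyper_D0_trivialisation(2) by blast
  have one: "\<Phi> \<one>\<^bsub>?T1\<^esub> = \<one>\<^bsub>?Pi\<^esub>" "\<one>\<^bsub>?T1\<^esub> \<in> ZZ"
  proof -
    have "\<one>\<^bsub>?T1\<^esub> \<in> hyper_D0 (mtop M) FF GG dlog ` gd0F XX"
      using D.hyper_D0_one ab_presheaf.one_closed[OF D.F.godement_presheaf openin_topspace] by (metis image_eqI)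
    then show "\<Phi> \<one>\<^bsub>?T1\<^esub> = \<one>\<^bsub>?Pi\<^esub>" "\<one>\<^bsub>?T1\<^esub> \<in> ZZ" using triv_iff D0Z by blast+
  qed
  \<comment> \<open>The laws are carried over from the group of cocycles along the surjection
    \<open>\<Phi>\<close>, so associativity and inverses of tensor products need no construction of
    their own.\<close>
  have grp: "group ?Pi"
  proof (rule groupI)
    show "\<one>\<^bsub>?Pi\<^esub> \<in> carrier ?Pi" using one unfolding carr by (metis image_eqI)
    fix x assume "x \<in> carrier ?Pi"
    then obtain a where a: "a \<in> ZZ" "x = \<Phi> a" unfolding carr by blast
    show "\<one>\<^bsub>?Pi\<^esub> \<otimes>\<^bsub>?Pi\<^esub> x = x" using hom[OF one(2) a(1)] G.l_one[of a] a one(1) by simp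
    show "\<exists>y\<in>carrier ?Pi. y \<otimes>\<^bsub>?Pi\<^esub> x = \<one>\<^bsub>?Pi\<^esub>"
    proof -
      obtain b where "b \<in> ZZ" "b \<otimes>\<^bsub>?T1\<^esub> a = \<one>\<^bsub>?T1\<^esub>" using G.l_inv_ex[of a] a by auto
      then show ?thesis unfolding carr using hom[of b a] a one(1) by auto
    qed
    fix y assume "y \<in> carrier ?Pi"
    then obtain b where b: "b \<in> ZZ" "y = \<Phi> b" unfolding carr by blast
    show "x \<otimes>\<^bsub>?Pi\<^esub> y \<in> carrier ?Pi" unfolding carr using hom[OF a(1) b(1)] mult[OF a(1) b(1)] a b by auto
    fix w assume "w \<in> carrier ?Pi"
    then obtain c where c: "c \<in> ZZ" "w = \<Phi> c" unfolding carr by blast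
    show "x \<otimes>\<^bsub>?Pi\<^esub> y \<otimes>\<^bsub>?Pi\<^esub> w = x \<otimes>\<^bsub>?Pi\<^esub> (y \<otimes>\<^bsub>?Pi\<^esub> w)"
      using hom a b c mult G.m_assoc[of a b c] by simp
  qed
  interpret H: group_hom ?G ?Pi \<Phi>
    unfolding group_hom_def group_hom_axioms_def using grp G.group_axioms hom by (auto simp: hom_def carr)
  have ker: "kernel ?G ?Pi \<Phi> = hyper_D0 (mtop M) FF GG dlog ` gd0F XX"
    using triv_iff D0Z by (auto simp: kernel_def)
  have "?G Mod kernel ?G ?Pi \<Phi> \<cong> ?Pi" by (rule H.FactGroup_iso) (simp add: carr)
  then have "hyper_H1 (mtop M) FF GG dlog \<cong> ?Pi" unfolding hyper_H1_eq ker .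
  moreover have "group (hyper_H1 (mtop M) FF GG dlog)"
    using normal.factorgroup_is_group[OF H.normal_kernel] unfolding ker hyper_H1_eq .
  ultimately show ?thesis using grp group.iso_sym by blast
qed

end

theorem corollary4p2:
  fixes M :: "'x mfd" and P :: "'x distrib" and B :: "('x, 'b) lie_algd"
  assumes "smooth_manifold M"
    and "integrable_distribution M P"
    and "acyclic_quotient M P"
    and "lie_algebroid M P B"
    and "locally_free_finite_rank M P B"
    and large_universe: "\<exists>\<iota> :: ('x \<Rightarrow> 'x \<Rightarrow> complex) \<Rightarrow> 'm. inj \<iota>"
  shows "group (pi0_Pic M P B :: ('x, 'b, 'm) bmod set monoid) \<and>
    (pi0_Pic M P B :: ('x, 'b, 'm) bmod set monoid) \<cong>
      hyper_H1 (mtop M) (OXP_units M P) (B_closed_forms1 M P B) (dB_log M B)"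
proof -
  interpret lie_algebroid_space M P B
    using assms by unfold_locales (auto simp: integrable_distribution_def)
  show ?thesis using large_universe pi0_Pic_iso by blast
qed

end
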